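(* Let $D$ be a division ring with center $F$ and let $G$ be a subnormal subgroup of $D^*$. If $M$ is a non-abelian metabelian maximal subgroup of $G$, then there exist a prime $p$ and a maximal subfield $K$ of $D$ such that the following conditions hold: (i) $K/F$ is a finite Galois extension with $\mathrm{Gal}(K/F)\cong M/(K^*\cap G)\cong \mathbb{Z}_p$, and $[D:F]=p^2$. (ii) The subgroup $K^*\cap G$ is the $FC$-center of $M$ and also the Fitting subgroup of $M$, and $M/M'Z(M)\cong\bigoplus_{i\in I}\mathbb{Z}_p$ for some index set $I$. Furthermore, for any $x\in M\setminus K$, we have $x^p\in F$ and $D=F[M]=\bigoplus_{i=1}^pKx^i$.
   Context: $D^*$ is the multiplicative group of $D$. A maximal subgroup of $G$ is a maximal proper subgroup. $F[M]$ denotes the subring of $D$ generated by $F\cup M$. $M'$ is the derived group and $Z(M)$ the center of $M$. An element $x$ of a group $M$ is an $FC$-element of $M$ if $x^M=\{mxm^{-1}: m\in M\}$ is finite; the $FC$-center of $M$ is the set of all its $FC$-elements. The Fitting subgroup of a group is the subgroup generated by all its nilpotent normal subgroups. $\mathbb{Z}_p$ is the cyclic group of order $p$. *)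

theory Defs
  imports "HOL-Algebra.Algebra"
begin

locale skew_field = ring +
  assumes one_neq_zero: "\<one> \<noteq> \<zero>"
    and units_nonzero: "Units R = carrier R - {\<zero>}"

text \<open>Serves both as the center of a group and, via the multiplicative structure, of a ring.\<close>

definition center :: "('a, 'b) monoid_scheme \<Rightarrow> 'a set" where
  "center G = {z \<in> carrier G. \<forall>x \<in> carrier G. z \<otimes>\<^bsub>G\<^esub> x = x \<otimes>\<^bsub>G\<^esub> z}"

definition subnormal_subgroup :: "'a set \<Rightarrow> ('a, 'b) monoid_scheme \<Rightarrow> bool" where
  "subnormal_subgroup H G \<longleftrightarrow>
     (\<exists>(n::nat) S. S 0 = H \<and> S n = carrier G \<and> (\<forall>i\<le>n. subgroup (S i) G) \<and>
        (\<forall>i<n. S i \<lhd> G\<lparr>carrier := S (Suc i)\<rparr>))"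

definition maximal_subgroup :: "'a set \<Rightarrow> ('a, 'b) monoid_scheme \<Rightarrow> bool" where
  "maximal_subgroup M G \<longleftrightarrow>
     subgroup M G \<and> M \<noteq> carrier G \<and>
     (\<forall>H. subgroup H G \<and> M \<subseteq> H \<longrightarrow> H = M \<or> H = carrier G)"

definition metabelian :: "('a, 'b) monoid_scheme \<Rightarrow> bool" where
  "metabelian G \<longleftrightarrow> group G \<and> comm_group (G\<lparr>carrier := derived G (carrier G)\<rparr>)"

definition FC_center :: "('a, 'b) monoid_scheme \<Rightarrow> 'a set" where
  "FC_center G =
     {x \<in> carrier G. finite ((\<lambda>m. m \<otimes>\<^bsub>G\<^esub> x \<otimes>\<^bsub>G\<^esub> inv\<^bsub>G\<^esub> m) ` carrier G)}"

fun lower_central :: "('a, 'b) monoid_scheme \<Rightarrow> nat \<Rightarrow> 'a set" where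
  "lower_central G 0 = carrier G"
| "lower_central G (Suc n) =
     generate G (\<Union>x \<in> lower_central G n. \<Union>y \<in> carrier G.
       {x \<otimes>\<^bsub>G\<^esub> y \<otimes>\<^bsub>G\<^esub> inv\<^bsub>G\<^esub> x \<otimes>\<^bsub>G\<^esub> inv\<^bsub>G\<^esub> y})"

definition nilpotent_group :: "('a, 'b) monoid_scheme \<Rightarrow> bool" where
  "nilpotent_group G \<longleftrightarrow> group G \<and> (\<exists>n. lower_central G n = {\<one>\<^bsub>G\<^esub>})"

definition fitting_subgroup :: "('a, 'b) monoid_scheme \<Rightarrow> 'a set" where
  "fitting_subgroup G = generate G (\<Union>{N. N \<lhd> G \<and> nilpotent_group (G\<lparr>carrier := N\<rparr>)})"

definition maximal_subfield :: "'a set \<Rightarrow> ('a, 'b) ring_scheme \<Rightarrow> bool" where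
  "maximal_subfield K R \<longleftrightarrow> subfield K R \<and> (\<forall>L. subfield L R \<and> K \<subseteq> L \<longrightarrow> L = K)"

text \<open>Field automorphisms are represented by extensional functions on \<open>K\<close>, as in \<^const>\<open>BijGroup\<close>.\<close>

definition galois_group :: "('a, 'b) ring_scheme \<Rightarrow> 'a set \<Rightarrow> 'a set \<Rightarrow> ('a \<Rightarrow> 'a) monoid" where
  "galois_group R K F = (BijGroup K)
     \<lparr>carrier := {\<sigma> \<in> Bij K. \<sigma> \<in> ring_hom (R\<lparr>carrier := K\<rparr>) (R\<lparr>carrier := K\<rparr>) \<and>
                        (\<forall>a \<in> F. \<sigma> a = a)}\<rparr>"

text \<open>An algebraic extension is Galois if the fixed field of its automorphism group is the
  base field.\<close>

definition finite_galois_extension :: "('a, 'b) ring_scheme \<Rightarrow> 'a set \<Rightarrow> 'a set \<Rightarrow> bool" where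
  "finite_galois_extension R K F \<longleftrightarrow>
     subfield F R \<and> subfield K R \<and> F \<subseteq> K \<and> ring.finite_dimension R F K \<and>
     {a \<in> K. \<forall>\<sigma> \<in> carrier (galois_group R K F). \<sigma> a = a} = F"

text \<open>The additive group of \<open>R\<close> is the internal direct sum of the subgroups \<open>A i\<close>, for finite \<open>I\<close>.\<close>

definition internal_direct_sum ::
    "('a, 'b) ring_scheme \<Rightarrow> 'i set \<Rightarrow> ('i \<Rightarrow> 'a set) \<Rightarrow> bool" where
  "internal_direct_sum R I A \<longleftrightarrow>
     finite I \<and> (\<forall>i \<in> I. additive_subgroup (A i) R) \<and>
     bij_betw (\<lambda>f. finsum R f I) (\<Pi>\<^sub>E i\<in>I. A i) (carrier R)"

end

theory Submission
  imports Defs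
begin

text \<open>Let \<open>N 0 = G\<close>, normal in \<open>N 1\<close>, ..., up to \<open>N r\<close>, the multiplicative group of the division ring,
be the subnormal chain. Choose a maximal set \<open>A\<close> of pairwise commuting elements of \<open>M\<close> that
contains all commutators. It is an abelian normal subgroup of \<open>M\<close> that equals its own centralizer
in \<open>M\<close>. Let \<open>K\<close> be the division subring generated by \<open>A\<close> and the center \<open>F\<close>; it is a field, \<open>M\<close>
normalizes it, and an element of \<open>M\<close> centralizes \<open>K\<close> exactly if it lies in \<open>A\<close>. The heart of the
proof is that \<open>M/A\<close> has prime order \<open>p\<close> and that the division ring is the direct sum of the
\<open>K x^i\<close>, \<open>i < p\<close>, for any \<open>x\<close> in \<open>M\<close> outside \<open>A\<close>. After that only computations with a cyclic
algebra of degree \<open>p\<close> remain.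

For \<open>y\<close> in \<open>G\<close> and any nonzero \<open>z\<close>, put \<open>f_0 = z\<close> and \<open>f_{j+1} = [f_j, y]\<close>. Each step descends one
step in the chain, so that \<open>f_r\<close> lies in \<open>G\<close> whatever \<open>z\<close> was. On the other hand, if \<open>M\<close> normalizes
a subset \<open>E\<close>, then by maximality the elements of \<open>G\<close> that normalize \<open>E\<close> are either \<open>M\<close> or all of
\<open>G\<close>. In the second case \<open>f_{r+1}\<close> lies in \<open>E\<close> for every \<open>z\<close> as soon as \<open>y\<close> is in \<open>E\<close>. Now take
\<open>z = 1 + w c\<close> with a scalar \<open>c\<close> that commutes with everything in sight. By the Ore condition for
polynomials, \<open>f_n\<close> is a left fraction of two polynomials in \<open>c\<close> with constant terms 1
(\<open>iter_com_fraction\<close>), and its derivative at \<open>c = 0\<close> is obtained by applying \<open>tau(v) = v - y v y^-1\<close>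
to \<open>w\<close> exactly \<open>n\<close> times. If the values lie in a division subring \<open>E\<close> for infinitely many
scalars \<open>c\<close>, then so does the derivative (\<open>rational_derivative\<close>); if \<open>w\<close> is
transcendental over \<open>E\<close>, then already \<open>c = 1\<close> forces the derivative to vanish
(\<open>tau_vanishes_transcendental\<close>). But for \<open>x\<close> in \<open>M\<close> and \<open>y\<close> in \<open>A\<close> with \<open>q = [y, x] \<noteq> 1\<close> one
has \<open>q\<close> in \<open>K\<close> and \<open>tau^n(x) = (1 - q)^n x\<close>, a nonzero multiple of \<open>x\<close> outside \<open>K\<close>.

With \<open>E = K\<close> this gives that \<open>M\<close> is the normalizer of \<open>K\<close> in \<open>G\<close>, and so \<open>A\<close> consists
of the nonzero elements of \<open>K\<close> in \<open>G\<close> (\<open>A_eq\<close>). With \<open>E\<close> the set of fractions of polynomials in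
\<open>x^2\<close> over \<open>K\<close>, which have no linear term in \<open>x\<close>, it excludes elements of infinite order modulo \<open>A\<close>
(\<open>no_infinite_order\<close>). With \<open>E\<close> the division subring generated by \<open>K\<close> and an \<open>x\<close> such that
\<open>x^p\<close> is in \<open>A\<close>, it shows that \<open>E\<close> is everything (\<open>prime_order_generates\<close>): otherwise the first
member \<open>N i\<close> of the chain not inside \<open>E\<close> contains an element \<open>g\<close> outside \<open>E\<close> that normalizes \<open>E\<close>,
and the derivative argument for the elements \<open>k g\<close> with \<open>k\<close> in \<open>E\<close> leads to a contradiction.
The required infinite supply of scalars is the fixed field of \<open>x\<close> in \<open>K\<close>; that it is infinite is
a version of Wedderburn's little theorem (\<open>no_finite_cyclic\<close>), proved by counting with
Hilbert's Theorem 90.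

Since the powers \<open>x^i\<close>, \<open>i < p\<close>, are a left basis over \<open>K\<close> and conjugation by \<open>x\<close> acts on \<open>K\<close> with
order \<open>p\<close>, comparing coefficients shows that \<open>K\<close> is a maximal subfield and that \<open>M\<close> is the union
of the cosets \<open>A x^i\<close>; the center is the fixed field, and the Galois group is \<open>M/A\<close>. That the
FC-center and the Fitting subgroup are not larger than \<open>A\<close> rests on \<open>no_engel\<close>: no \<open>m\<close> in \<open>M\<close>
outside \<open>A\<close> satisfies an Engel condition on the powers of \<open>K\<close>, because by descent a fixed power of
every element of \<open>K\<close> would be central, which is impossible over an infinite center.
Finally \<open>x^p\<close> is central for \<open>x\<close> outside \<open>A\<close>, and for \<open>a\<close> in \<open>A\<close> the norm of \<open>a\<close>, which is central,
agrees with \<open>a^p\<close> modulo \<open>M'\<close>; so \<open>M/M'Z(M)\<close> is elementary abelian.\<close>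

section \<open>Division rings: conjugation and division subrings\<close>

context skew_field
begin

lemma nonzero_Units: "\<lbrakk>a \<in> carrier R; a \<noteq> \<zero>\<rbrakk> \<Longrightarrow> a \<in> Units R"
  using units_nonzero by blast

lemma sf_inv_closed [simp, intro]: "\<lbrakk>a \<in> carrier R; a \<noteq> \<zero>\<rbrakk> \<Longrightarrow> inv a \<in> carrier R"
  by (simp add: nonzero_Units)

lemma sf_l_inv [simp]: "\<lbrakk>a \<in> carrier R; a \<noteq> \<zero>\<rbrakk> \<Longrightarrow> inv a \<otimes> a = \<one>"
  by (simp add: nonzero_Units)

lemma sf_r_inv [simp]: "\<lbrakk>a \<in> carrier R; a \<noteq> \<zero>\<rbrakk> \<Longrightarrow> a \<otimes> inv a = \<one>"
  by (simp add: nonzero_Units)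

lemma sf_inv_nonzero [simp]: "\<lbrakk>a \<in> carrier R; a \<noteq> \<zero>\<rbrakk> \<Longrightarrow> inv a \<noteq> \<zero>"
  using one_neq_zero sf_l_inv[of a] l_null[of a] by force

lemma sf_inv_inv [simp]: "\<lbrakk>a \<in> carrier R; a \<noteq> \<zero>\<rbrakk> \<Longrightarrow> inv (inv a) = a"
  by (simp add: nonzero_Units)

lemma sf_l_cancel [simp]: "\<lbrakk>a \<in> carrier R; a \<noteq> \<zero>; b \<in> carrier R\<rbrakk> \<Longrightarrow> inv a \<otimes> (a \<otimes> b) = b"
  by (simp flip: m_assoc)

lemma sf_l_cancel' [simp]: "\<lbrakk>a \<in> carrier R; a \<noteq> \<zero>; b \<in> carrier R\<rbrakk> \<Longrightarrow> a \<otimes> (inv a \<otimes> b) = b"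
  by (simp flip: m_assoc)

lemma mult_eq_zero_iff [simp]:
  "\<lbrakk>a \<in> carrier R; b \<in> carrier R\<rbrakk> \<Longrightarrow> a \<otimes> b = \<zero> \<longleftrightarrow> a = \<zero> \<or> b = \<zero>"
  by (metis l_null r_null sf_l_cancel sf_inv_closed)

lemma sf_inv_eqI: "\<lbrakk>a \<in> carrier R; b \<in> carrier R; a \<otimes> b = \<one>\<rbrakk> \<Longrightarrow> inv a = b"
  using one_neq_zero by (metis l_null r_one sf_l_cancel sf_inv_closed)

lemma sf_inv_mult:
  "\<lbrakk>a \<in> carrier R; a \<noteq> \<zero>; b \<in> carrier R; b \<noteq> \<zero>\<rbrakk> \<Longrightarrow> inv (a \<otimes> b) = inv b \<otimes> inv a"
  by (rule sf_inv_eqI) (simp_all add: m_assoc)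

lemma pow_nonzero [simp]: "\<lbrakk>a \<in> carrier R; a \<noteq> \<zero>\<rbrakk> \<Longrightarrow> a [^] (n::nat) \<noteq> \<zero>"
  using one_neq_zero by (induction n) auto

lemma mult_left_cancel: "\<lbrakk>a \<in> carrier R; a \<noteq> \<zero>; b \<in> carrier R; c \<in> carrier R\<rbrakk> \<Longrightarrow> a \<otimes> b = a \<otimes> c \<longleftrightarrow> b = c"
  by (metis sf_l_cancel)

lemma mult_right_cancel: "\<lbrakk>a \<in> carrier R; a \<noteq> \<zero>; b \<in> carrier R; c \<in> carrier R\<rbrakk> \<Longrightarrow> b \<otimes> a = c \<otimes> a \<longleftrightarrow> b = c"
  by (metis m_assoc r_one sf_r_inv sf_inv_closed)

definition cj :: "'a \<Rightarrow> 'a \<Rightarrow> 'a" where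
  "cj g z = g \<otimes> z \<otimes> inv g"

lemma cj_closed [simp, intro]: "\<lbrakk>g \<in> carrier R; g \<noteq> \<zero>; z \<in> carrier R\<rbrakk> \<Longrightarrow> cj g z \<in> carrier R"
  by (simp add: cj_def)

lemma cj_mult: "\<lbrakk>g \<in> carrier R; g \<noteq> \<zero>; a \<in> carrier R; b \<in> carrier R\<rbrakk> \<Longrightarrow> cj g (a \<otimes> b) = cj g a \<otimes> cj g b"
  by (simp add: cj_def m_assoc)

lemma cj_add: "\<lbrakk>g \<in> carrier R; g \<noteq> \<zero>; a \<in> carrier R; b \<in> carrier R\<rbrakk> \<Longrightarrow> cj g (a \<oplus> b) = cj g a \<oplus> cj g b"
  by (simp add: cj_def l_distr r_distr)

lemma cj_uminus: "\<lbrakk>g \<in> carrier R; g \<noteq> \<zero>; a \<in> carrier R\<rbrakk> \<Longrightarrow> cj g (\<ominus> a) = \<ominus> cj g a"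
  by (simp add: cj_def l_minus r_minus)

lemma cj_minus: "\<lbrakk>g \<in> carrier R; g \<noteq> \<zero>; a \<in> carrier R; b \<in> carrier R\<rbrakk> \<Longrightarrow> cj g (a \<ominus> b) = cj g a \<ominus> cj g b"
  by (simp add: a_minus_def cj_add cj_uminus)

lemma cj_zero [simp]: "\<lbrakk>g \<in> carrier R; g \<noteq> \<zero>\<rbrakk> \<Longrightarrow> cj g \<zero> = \<zero>"
  by (simp add: cj_def)

lemma cj_one [simp]: "\<lbrakk>g \<in> carrier R; g \<noteq> \<zero>\<rbrakk> \<Longrightarrow> cj g \<one> = \<one>"
  by (simp add: cj_def)

lemma cj_by_one [simp]: "z \<in> carrier R \<Longrightarrow> cj \<one> z = z"
  by (simp add: cj_def)

lemma cj_cj: "\<lbrakk>g \<in> carrier R; g \<noteq> \<zero>; h \<in> carrier R; h \<noteq> \<zero>; z \<in> carrier R\<rbrakk> \<Longrightarrow> cj g (cj h z) = cj (g \<otimes> h) z"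
  by (simp add: cj_def m_assoc sf_inv_mult)

lemma cj_inv_cj [simp]: "\<lbrakk>g \<in> carrier R; g \<noteq> \<zero>; z \<in> carrier R\<rbrakk> \<Longrightarrow> cj (inv g) (cj g z) = z"
  by (simp add: cj_cj)

lemma cj_cj_inv [simp]: "\<lbrakk>g \<in> carrier R; g \<noteq> \<zero>; z \<in> carrier R\<rbrakk> \<Longrightarrow> cj g (cj (inv g) z) = z"
  by (simp add: cj_cj)

lemma cj_eq_zero [simp]: "\<lbrakk>g \<in> carrier R; g \<noteq> \<zero>; z \<in> carrier R\<rbrakk> \<Longrightarrow> cj g z = \<zero> \<longleftrightarrow> z = \<zero>"
  by (simp add: cj_def)

lemma cj_inv: "\<lbrakk>g \<in> carrier R; g \<noteq> \<zero>; z \<in> carrier R; z \<noteq> \<zero>\<rbrakk> \<Longrightarrow> cj g (inv z) = inv (cj g z)"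
  by (rule sf_inv_eqI[symmetric]) (simp_all flip: cj_mult)

lemma cj_mult_left: "\<lbrakk>g \<in> carrier R; g \<noteq> \<zero>; z \<in> carrier R\<rbrakk> \<Longrightarrow> cj g z \<otimes> g = g \<otimes> z"
  by (simp add: cj_def m_assoc)

lemma cj_eq_self_iff: "\<lbrakk>g \<in> carrier R; g \<noteq> \<zero>; z \<in> carrier R\<rbrakk> \<Longrightarrow> cj g z = z \<longleftrightarrow> g \<otimes> z = z \<otimes> g"
  by (metis cj_closed cj_mult_left mult_right_cancel)

lemma cj_inj: "\<lbrakk>g \<in> carrier R; g \<noteq> \<zero>; a \<in> carrier R; b \<in> carrier R\<rbrakk> \<Longrightarrow> cj g a = cj g b \<longleftrightarrow> a = b"
  by (metis cj_inv_cj)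

lemma cj_pow: "\<lbrakk>g \<in> carrier R; g \<noteq> \<zero>; z \<in> carrier R\<rbrakk> \<Longrightarrow> cj g (z [^] (n::nat)) = cj g z [^] n"
  by (induction n) (simp_all add: cj_mult)

lemma cj_finsum: "\<lbrakk>g \<in> carrier R; g \<noteq> \<zero>; finite I; f \<in> I \<rightarrow> carrier R\<rbrakk> \<Longrightarrow>
    cj g (\<Oplus>i\<in>I. f i) = (\<Oplus>i\<in>I. cj g (f i))"
  by (simp add: cj_def finsum_rdistr finsum_ldistr Pi_def)

definition division_subring :: "'a set \<Rightarrow> bool" where
  "division_subring E \<longleftrightarrow> E \<subseteq> carrier R \<and> \<one> \<in> E \<and> (\<forall>a\<in>E. \<forall>b\<in>E. a \<ominus> b \<in> E) \<and>
     (\<forall>a\<in>E. \<forall>b\<in>E. a \<otimes> b \<in> E) \<and> (\<forall>a\<in>E. a \<noteq> \<zero> \<longrightarrow> inv a \<in> E)"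

lemma dsub_sub: "division_subring E \<Longrightarrow> E \<subseteq> carrier R"
  and dsub_carrier: "division_subring E \<Longrightarrow> a \<in> E \<Longrightarrow> a \<in> carrier R"
  and dsub_one: "division_subring E \<Longrightarrow> \<one> \<in> E"
  and dsub_minus: "division_subring E \<Longrightarrow> a \<in> E \<Longrightarrow> b \<in> E \<Longrightarrow> a \<ominus> b \<in> E"
  and dsub_mult: "division_subring E \<Longrightarrow> a \<in> E \<Longrightarrow> b \<in> E \<Longrightarrow> a \<otimes> b \<in> E"
  and dsub_inv: "division_subring E \<Longrightarrow> a \<in> E \<Longrightarrow> a \<noteq> \<zero> \<Longrightarrow> inv a \<in> E"
  by (auto simp: division_subring_def)

lemma dsub_zero: assumes "division_subring E" shows "\<zero> \<in> E"
proof -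
  have "\<one> \<ominus> \<one> = \<zero>" by (simp add: a_minus_def r_neg)
  then show ?thesis using dsub_minus[OF assms dsub_one dsub_one] assms by metis
qed

lemma dsub_uminus: assumes "division_subring E" "a \<in> E" shows "\<ominus> a \<in> E"
proof -
  have "\<zero> \<ominus> a = \<ominus> a" using dsub_carrier[OF assms] by (simp add: a_minus_def)
  then show ?thesis using dsub_minus[OF assms(1) dsub_zero assms(2)] assms by simp
qed

lemma dsub_add: assumes "division_subring E" "a \<in> E" "b \<in> E" shows "a \<oplus> b \<in> E"
proof -
  have "a \<ominus> (\<ominus> b) = a \<oplus> b" using dsub_carrier assms by (simp add: a_minus_def)
  then show ?thesis using dsub_minus[OF assms(1,2) dsub_uminus[OF assms(1,3)]] by simp
qed

lemma dsub_pow: "division_subring E \<Longrightarrow> a \<in> E \<Longrightarrow> a [^] (n::nat) \<in> E"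
  by (induction n) (auto simp: dsub_one dsub_mult)

lemma dsub_finsum:
  assumes "division_subring E" "finite I" "\<And>i. i \<in> I \<Longrightarrow> f i \<in> E"
  shows "(\<Oplus>i\<in>I. f i) \<in> E"
  using assms(2,3)
proof (induction I rule: finite_induct)
  case empty then show ?case by (simp add: dsub_zero assms(1))
next
  case (insert x I)
  have "f \<in> I \<rightarrow> carrier R" "f x \<in> carrier R" using insert dsub_carrier[OF assms(1)] by auto
  then show ?case using insert by (simp add: dsub_add assms(1))
qed

lemmas dsub_intros = dsub_one dsub_minus dsub_mult dsub_inv dsub_zero dsub_uminus dsub_add dsub_pow dsub_finsum

lemma dsub_carrier_ring: "division_subring (carrier R)"
  by (auto simp: division_subring_def)

lemma dsub_cancel_left: assumes "division_subring E" "a \<in> E" "a \<noteq> \<zero>" "b \<in> carrier R" "a \<otimes> b \<in> E" shows "b \<in> E"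
  using dsub_mult[OF assms(1) dsub_inv[OF assms(1-3)] assms(5)] assms dsub_carrier by auto

lemma dsub_cancel_right: assumes "division_subring E" "a \<in> E" "a \<noteq> \<zero>" "b \<in> carrier R" "b \<otimes> a \<in> E" shows "b \<in> E"
proof -
  have "b \<otimes> a \<otimes> inv a = b" using assms dsub_carrier by (simp add: m_assoc)
  then show ?thesis using dsub_mult[OF assms(1) assms(5) dsub_inv[OF assms(1-3)]] by simp
qed

definition gen :: "'a set \<Rightarrow> 'a set" where
  "gen S = \<Inter>{E. division_subring E \<and> S \<subseteq> E}"

lemma gen_incl: "S \<subseteq> gen S"
  by (auto simp: gen_def)

lemma gen_min: "division_subring E \<Longrightarrow> S \<subseteq> E \<Longrightarrow> gen S \<subseteq> E"
  by (auto simp: gen_def)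

lemma gen_dsub: assumes "S \<subseteq> carrier R" shows "division_subring (gen S)"
  unfolding division_subring_def
proof (intro conjI ballI impI)
  show "gen S \<subseteq> carrier R" using gen_min[OF dsub_carrier_ring assms] .
qed (auto simp: gen_def intro: dsub_intros)

lemma gen_mono: "S \<subseteq> T \<Longrightarrow> gen S \<subseteq> gen T"
  by (auto simp: gen_def)

lemma dsub_cj_image:
  assumes "division_subring E" "g \<in> carrier R" "g \<noteq> \<zero>"
  shows "division_subring (cj g ` E)"
proof -
  have E: "\<And>a. a \<in> E \<Longrightarrow> a \<in> carrier R" using assms dsub_carrier by blast
  show ?thesis unfolding division_subring_def
  proof (intro conjI ballI impI)
    show "cj g ` E \<subseteq> carrier R" using E assms by auto
    show "\<one> \<in> cj g ` E" using assms dsub_one[of E] by (metis cj_one imageI)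
    fix a b assume "a \<in> cj g ` E" "b \<in> cj g ` E"
    then obtain a' b' where ab: "a = cj g a'" "b = cj g b'" "a' \<in> E" "b' \<in> E" by auto
    have "a \<ominus> b = cj g (a' \<ominus> b')" "a \<otimes> b = cj g (a' \<otimes> b')"
      using ab E assms by (simp_all add: cj_minus cj_mult)
    then show "a \<ominus> b \<in> cj g ` E" "a \<otimes> b \<in> cj g ` E" 
      using ab dsub_minus[OF assms(1)] dsub_mult[OF assms(1)] by auto
  next
    fix a assume "a \<in> cj g ` E" "a \<noteq> \<zero>"
    then obtain a' where ab: "a = cj g a'" "a' \<in> E" by auto
    then have "a' \<noteq> \<zero>" using \<open>a \<noteq> \<zero>\<close> assms by auto
    then have "inv a = cj g (inv a')" using ab E assms by (simp add: cj_inv)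
    then show "inv a \<in> cj g ` E" using ab dsub_inv[OF assms(1) ab(2) \<open>a' \<noteq> \<zero>\<close>] by auto
  qed
qed

lemma dsub_centralizer:
  assumes "S \<subseteq> carrier R"
  shows "division_subring {c \<in> carrier R. \<forall>s\<in>S. c \<otimes> s = s \<otimes> c}"
  unfolding division_subring_def
proof (intro conjI ballI impI)
  show "\<one> \<in> {c \<in> carrier R. \<forall>s\<in>S. c \<otimes> s = s \<otimes> c}" using assms by auto
  fix a b assume "a \<in> {c \<in> carrier R. \<forall>s\<in>S. c \<otimes> s = s \<otimes> c}" "b \<in> {c \<in> carrier R. \<forall>s\<in>S. c \<otimes> s = s \<otimes> c}"
  then have ab: "a \<in> carrier R" "b \<in> carrier R" "\<And>s. s \<in> S \<Longrightarrow> a \<otimes> s = s \<otimes> a" "\<And>s. s \<in> S \<Longrightarrow> b \<otimes> s = s \<otimes> b" by auto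
  then show "a \<ominus> b \<in> {c \<in> carrier R. \<forall>s\<in>S. c \<otimes> s = s \<otimes> c}" using assms
    by (auto simp: a_minus_def l_distr r_distr l_minus r_minus)
  have "a \<otimes> b \<otimes> s = s \<otimes> (a \<otimes> b)" if "s \<in> S" for s
  proof -
    have s: "s \<in> carrier R" using that assms by auto
    have "a \<otimes> b \<otimes> s = a \<otimes> s \<otimes> b" using ab(1,2) ab(4)[OF that] s by (simp add: m_assoc)
    also have "\<dots> = s \<otimes> (a \<otimes> b)" using ab(1,2) s by (simp add: ab(3)[OF that] m_assoc)
    finally show ?thesis .
  qed
  then show "a \<otimes> b \<in> {c \<in> carrier R. \<forall>s\<in>S. c \<otimes> s = s \<otimes> c}" using ab by auto
next
  fix a assume a: "a \<in> {c \<in> carrier R. \<forall>s\<in>S. c \<otimes> s = s \<otimes> c}" "a \<noteq> \<zero>"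
  have "inv a \<otimes> s = s \<otimes> inv a" if "s \<in> S" for s
  proof -
    have s: "s \<in> carrier R" and as: "a \<otimes> s = s \<otimes> a" using that assms a by auto
    have "inv a \<otimes> s = inv a \<otimes> (s \<otimes> a) \<otimes> inv a" using s a by (simp add: m_assoc)
    also have "\<dots> = s \<otimes> inv a" using s a by (simp flip: as)
    finally show ?thesis .
  qed
  then show "inv a \<in> {c \<in> carrier R. \<forall>s\<in>S. c \<otimes> s = s \<otimes> c}" using a by auto
qed auto

definition normalizes :: "'a \<Rightarrow> 'a set \<Rightarrow> bool" where
  "normalizes g E \<longleftrightarrow> g \<in> carrier R \<and> g \<noteq> \<zero> \<and> cj g ` E = E"

lemma normalizesI:
  assumes "g \<in> carrier R" "g \<noteq> \<zero>" "E \<subseteq> carrier R" "\<And>a. a \<in> E \<Longrightarrow> cj g a \<in> E" "\<And>a. a \<in> E \<Longrightarrow> cj (inv g) a \<in> E"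
  shows "normalizes g E"
proof -
  have "E \<subseteq> cj g ` E"
  proof
    fix a assume a: "a \<in> E"
    then have "a = cj g (cj (inv g) a)" using assms by (metis cj_cj_inv subsetD)
    then show "a \<in> cj g ` E" using assms(5)[OF a] by blast
  qed
  then show ?thesis using assms by (auto simp: normalizes_def)
qed

lemma normalizes_cj: "normalizes g E \<Longrightarrow> a \<in> E \<Longrightarrow> cj g a \<in> E"
  by (auto simp: normalizes_def)

lemma normalizes_inv: assumes "normalizes g E" "E \<subseteq> carrier R" shows "normalizes (inv g) E"
proof -
  have "cj (inv g) ` (cj g ` E) = (\<lambda>a. a) ` E" unfolding image_image
    using assms by (intro image_cong) (auto simp: normalizes_def)
  then show ?thesis using assms by (simp add: normalizes_def)
qed

lemma normalizes_mult: assumes "normalizes g E" "normalizes h E" "E \<subseteq> carrier R" shows "normalizes (g \<otimes> h) E"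
proof -
  have "cj g ` (cj h ` E) = cj (g \<otimes> h) ` E" unfolding image_image
    using assms by (intro image_cong) (auto simp: normalizes_def cj_cj subset_eq)
  then show ?thesis using assms by (simp add: normalizes_def)
qed

lemma normalizes_one: "E \<subseteq> carrier R \<Longrightarrow> normalizes \<one> E"
  using one_neq_zero by (intro normalizesI) (auto simp: subset_eq)

lemma normalizes_pow: "normalizes g E \<Longrightarrow> E \<subseteq> carrier R \<Longrightarrow> normalizes (g [^] (n::nat)) E"
  by (induction n) (auto simp: normalizes_one normalizes_mult)

lemma normalizes_self: "division_subring E \<Longrightarrow> g \<in> E \<Longrightarrow> g \<noteq> \<zero> \<Longrightarrow> normalizes g E"
  by (rule normalizesI) (auto simp: cj_def dsub_carrier dsub_sub intro!: dsub_intros)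

text \<open>Both inclusions are needed to get equality, and both follow from one: the preimage of a division subring under conjugation is again a division subring, so that it contains \<open>gen S\<close> as soon as it contains \<open>S\<close>.\<close>

lemma normalizes_gen:
  assumes "S \<subseteq> carrier R" "g \<in> carrier R" "g \<noteq> \<zero>" "cj g ` S \<subseteq> gen S" "cj (inv g) ` S \<subseteq> gen S"
  shows "normalizes g (gen S)"
proof -
  note d = gen_dsub[OF assms(1)]
  have *: "cj (inv h) ` gen S \<subseteq> gen S" if h: "h \<in> carrier R" "h \<noteq> \<zero>" "cj (inv h) ` S \<subseteq> gen S" for h
  proof -
    have "S \<subseteq> cj h ` gen S"
    proof
      fix s assume s: "s \<in> S"
      then have "s = cj h (cj (inv h) s)" using h assms(1) by (metis cj_cj_inv subsetD)
      then show "s \<in> cj h ` gen S" using h(3) s by blast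
    qed
    then have "gen S \<subseteq> cj h ` gen S" using gen_min[OF dsub_cj_image[OF d h(1,2)]] by blast
    then have "cj (inv h) ` gen S \<subseteq> cj (inv h) ` (cj h ` gen S)" by blast
    also have "\<dots> = gen S" using h dsub_carrier[OF d] by (force simp: image_image cong: image_cong_simp)
    finally show ?thesis .
  qed
  show ?thesis
    using *[of g] *[of "inv g"] assms dsub_sub[OF d] by (intro normalizesI) auto
qed

end

section \<open>Polynomials with graded coefficients and the Ore condition\<close>

(* As destruction rules, mem_upD and bound.bound leave the index free, and proof search diverges. *)
declare mem_upD [rule del] mem_upI [rule del] bound.intro [rule del] bound.bound [rule del]

sublocale skew_field \<subseteq> UPR: UP_ring R "UP R"
  by (simp add: UP_ring_def ring_axioms)

context skew_field
begin

abbreviation P where "P \<equiv> UP R"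
abbreviation cf where "cf \<equiv> up_ring.coeff (UP R)"
abbreviation mon where "mon \<equiv> up_ring.monom (UP R)"

declare UPR.coeff_mult [simp del]
declare bound_upD [rule del]

text \<open>Coefficient conditions for which division with remainder works: \<open>H i\<close> is the set of admissible
coefficients in degree \<open>i\<close>, and quotients of admissible coefficients are admissible in the
difference of the degrees. The instances used below are \<open>H i = E g^i\<close> for an element \<open>g\<close> that
normalizes a division subring \<open>E\<close>, where the polynomial ring is a skew polynomial ring in disguise,
and \<open>H i = C\<close> for a fixed division subring \<open>C\<close>. The variable of a polynomial commutes with
all coefficients.\<close>

definition graded :: "(nat \<Rightarrow> 'a set) \<Rightarrow> bool" where
  "graded H \<longleftrightarrow> (\<forall>i. H i \<subseteq> carrier R \<and> \<zero> \<in> H i \<and> (\<forall>a\<in>H i. \<forall>b\<in>H i. a \<ominus> b \<in> H i)) \<and> \<one> \<in> H 0 \<and>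
    (\<forall>i j. \<forall>a\<in>H i. \<forall>b\<in>H j. a \<otimes> b \<in> H (i + j)) \<and>
    (\<forall>i j. \<forall>a\<in>H (i + j). \<forall>b\<in>H j. b \<noteq> \<zero> \<longrightarrow> a \<otimes> inv b \<in> H i \<and> inv b \<otimes> a \<in> H i)"

lemma gradedD:
  assumes "graded H"
  shows graded_carrier: "\<And>i a. a \<in> H i \<Longrightarrow> a \<in> carrier R"
    and graded_zero: "\<And>i. \<zero> \<in> H i"
    and graded_minus: "\<And>i a b. a \<in> H i \<Longrightarrow> b \<in> H i \<Longrightarrow> a \<ominus> b \<in> H i"
    and graded_one: "\<one> \<in> H 0"
    and graded_mult: "\<And>i j a b. a \<in> H i \<Longrightarrow> b \<in> H j \<Longrightarrow> a \<otimes> b \<in> H (i + j)"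
    and graded_rdiv: "\<And>i j a b. a \<in> H (i + j) \<Longrightarrow> b \<in> H j \<Longrightarrow> b \<noteq> \<zero> \<Longrightarrow> a \<otimes> inv b \<in> H i"
    and graded_ldiv: "\<And>i j a b. a \<in> H (i + j) \<Longrightarrow> b \<in> H j \<Longrightarrow> b \<noteq> \<zero> \<Longrightarrow> inv b \<otimes> a \<in> H i"
  using assms unfolding graded_def by blast+

lemma graded_add: assumes "graded H" "a \<in> H i" "b \<in> H i" shows "a \<oplus> b \<in> H i"
proof -
  have "a \<ominus> (\<zero> \<ominus> b) = a \<oplus> b" using graded_carrier[OF assms(1)] assms by (simp add: a_minus_def)
  then show ?thesis
    using graded_minus[OF assms(1,2) graded_minus[OF assms(1) graded_zero[OF assms(1)] assms(3)]] by simp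
qed

lemma graded_finsum:
  assumes "graded H" "finite I" "\<And>i. i \<in> I \<Longrightarrow> f i \<in> H n"
  shows "(\<Oplus>i\<in>I. f i) \<in> H n"
  using assms(2,3)
proof (induction I rule: finite_induct)
  case empty then show ?case by (simp add: graded_zero[OF assms(1)])
next
  case (insert x I)
  have "f \<in> I \<rightarrow> carrier R" "f x \<in> carrier R" using insert graded_carrier[OF assms(1)] by auto
  then show ?case using insert by (simp add: graded_add[OF assms(1)])
qed

definition Pol :: "(nat \<Rightarrow> 'a set) \<Rightarrow> (nat \<Rightarrow> 'a) set" where
  "Pol H = {p \<in> carrier P. \<forall>i. cf p i \<in> H i}"

lemma Pol_carrier: "p \<in> Pol H \<Longrightarrow> p \<in> carrier P" and Pol_cf: "p \<in> Pol H \<Longrightarrow> cf p i \<in> H i"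
  by (auto simp: Pol_def)

lemma Pol_mult: assumes "graded H" "p \<in> Pol H" "q \<in> Pol H" shows "p \<otimes>\<^bsub>P\<^esub> q \<in> Pol H"
proof -
  have "cf p i \<otimes> cf q (n - i) \<in> H n" if "i \<le> n" for i n
    using graded_mult[OF assms(1) Pol_cf[OF assms(2)] Pol_cf[OF assms(3)], of i "n - i"] that by simp
  then have "cf (p \<otimes>\<^bsub>P\<^esub> q) n \<in> H n" for n
    using Pol_carrier[OF assms(2)] Pol_carrier[OF assms(3)]
    by (simp add: UPR.coeff_mult) (rule graded_finsum[OF assms(1)], auto)
  then show ?thesis using Pol_carrier[OF assms(2)] Pol_carrier[OF assms(3)] by (simp add: Pol_def)
qed

lemma cf_minus: assumes "p \<in> carrier P" "q \<in> carrier P" shows "cf (p \<ominus>\<^bsub>P\<^esub> q) n = cf p n \<ominus> cf q n"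
proof -
  have "cf (\<ominus>\<^bsub>P\<^esub> q) n \<oplus> cf q n = \<zero>"
    using assms UPR.coeff_add[of "\<ominus>\<^bsub>P\<^esub> q" q n] by (simp add: UPR.P.l_neg)
  then have "cf (\<ominus>\<^bsub>P\<^esub> q) n = \<ominus> cf q n" using assms minus_equality[of "cf (\<ominus>\<^bsub>P\<^esub> q) n" "cf q n"] by simp
  then show ?thesis using assms by (simp add: UPR.P.minus_eq minus_eq)
qed

lemma Pol_minus: assumes "graded H" "p \<in> Pol H" "q \<in> Pol H" shows "p \<ominus>\<^bsub>P\<^esub> q \<in> Pol H"
  using assms(2,3) unfolding Pol_def by (simp add: cf_minus graded_minus[OF assms(1)])

lemma Pol_add: assumes "graded H" "p \<in> Pol H" "q \<in> Pol H" shows "p \<oplus>\<^bsub>P\<^esub> q \<in> Pol H"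
  using assms(2,3) unfolding Pol_def by (simp add: graded_add[OF assms(1)])

lemma Pol_one: assumes "graded H" shows "\<one>\<^bsub>P\<^esub> \<in> Pol H"
  unfolding Pol_def by (simp add: graded_one[OF assms] graded_zero[OF assms])

lemma Pol_zero: assumes "graded H" shows "\<zero>\<^bsub>P\<^esub> \<in> Pol H"
  unfolding Pol_def by (simp add: graded_zero[OF assms])

lemma Pol_monom: assumes "graded H" "a \<in> H n" shows "mon a n \<in> Pol H"
  using graded_carrier[OF assms] assms(2) unfolding Pol_def by (simp add: graded_zero[OF assms(1)])

lemma cf_eqI: "p \<in> carrier P \<Longrightarrow> q \<in> carrier P \<Longrightarrow> (\<And>n. cf p n = cf q n) \<Longrightarrow> p = q"
  by (rule UPR.up_eqI)

lemma cf_up: assumes p: "p \<in> up R" shows "cf p i = p i"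
  by (simp add: UP_def p)

lemma cf_bound: assumes "p \<in> carrier P" shows "\<exists>n. \<forall>i>n. cf p i = \<zero>"
proof -
  have p: "p \<in> up R" using assms by (simp add: UP_def)
  have "\<exists>n. bound \<zero> n p" by (rule bound_upD[OF p])
  then obtain n where "bound \<zero> n p" ..
  then have "\<forall>i>n. cf p i = \<zero>" by (simp add: bound_def cf_up p)
  then show ?thesis ..
qed

lemma PolI: assumes "\<And>i. f i \<in> carrier R" "\<And>i. i > n \<Longrightarrow> f i = \<zero>"
  shows "f \<in> carrier P" "cf f i = f i"
proof -
  have "bound \<zero> n f" using assms(2) by (intro bound.intro)
  then have "\<exists>n. bound \<zero> n f" ..
  with assms(1) have f: "f \<in> up R" by (rule mem_upI)
  show "f \<in> carrier P" "cf f i = f i" by (simp_all add: UP_def f)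
qed

lemma cf_monom_mult:
  assumes "c \<in> carrier R" "q \<in> carrier P"
  shows "cf (mon c k \<otimes>\<^bsub>P\<^esub> q) n = (if k \<le> n then c \<otimes> cf q (n - k) else \<zero>)"
proof -
  have "cf (mon c k \<otimes>\<^bsub>P\<^esub> q) n = (\<Oplus>i\<in>{..n}. (if i = k then c \<otimes> cf q (n - i) else \<zero>))"
    using assms by (auto intro!: finsum_cong simp: Pi_def simp_implies_def UPR.coeff_mult)
  also have "\<dots> = (if k \<le> n then c \<otimes> cf q (n - k) else \<zero>)"
  proof (cases "k \<le> n")
    case True
    then have "(\<Oplus>i\<in>{..n}. (if i = k then c \<otimes> cf q (n - i) else \<zero>)) = c \<otimes> cf q (n - k)"
      using finsum_singleton[of k "{..n}" "\<lambda>i. c \<otimes> cf q (n - i)"] assms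
      by (simp add: eq_commute[of k] cong: if_cong)
    then show ?thesis using True by simp
  next
    case False
    then have "(\<Oplus>i\<in>{..n}. (if i = k then c \<otimes> cf q (n - i) else \<zero>)) = (\<Oplus>i\<in>{..n}. \<zero>)"
      by (intro finsum_cong) (auto simp: simp_implies_def)
    then show ?thesis using False by simp
  qed
  finally show ?thesis .
qed

lemma cf_mult_0: "p \<in> carrier P \<Longrightarrow> q \<in> carrier P \<Longrightarrow> cf (p \<otimes>\<^bsub>P\<^esub> q) 0 = cf p 0 \<otimes> cf q 0"
  by (simp add: UPR.coeff_mult)

lemma cf_mult_1: "p \<in> carrier P \<Longrightarrow> q \<in> carrier P \<Longrightarrow> cf (p \<otimes>\<^bsub>P\<^esub> q) 1 = cf p 0 \<otimes> cf q 1 \<oplus> cf p 1 \<otimes> cf q 0"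
  by (simp add: UPR.coeff_mult a_comm)

lemma cf_mult_const: assumes "e \<in> carrier R" "p \<in> carrier P" shows "cf (p \<otimes>\<^bsub>P\<^esub> mon e 0) n = cf p n \<otimes> e"
proof -
  have "cf (p \<otimes>\<^bsub>P\<^esub> mon e 0) n = (\<Oplus>i\<in>{..n}. (if i = n then cf p i \<otimes> e else \<zero>))"
    using assms by (auto intro!: finsum_cong simp: Pi_def simp_implies_def UPR.coeff_mult)
  also have "\<dots> = cf p n \<otimes> e"
      using finsum_singleton[of n "{..n}" "\<lambda>i. cf p i \<otimes> e"] assms
      by (simp add: eq_commute[of n] cong: if_cong)
  finally show ?thesis .
qed

text \<open>Division on the left by the monomial of degree \<open>s\<close> of \<open>p\<close>. Its coefficient is admissible in degree \<open>s\<close>, so the quotient has admissible coefficients as well.\<close>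

lemma Pol_normalize:
  assumes H: "graded H" and p: "p \<in> Pol H" and s: "cf p s \<noteq> \<zero>"
    and q: "q \<in> Pol H" "\<And>i. i < s \<Longrightarrow> cf q i = \<zero>"
  shows "\<exists>q'\<in>Pol H. q = mon (cf p s) s \<otimes>\<^bsub>P\<^esub> q' \<and> (\<forall>i. cf q' i = inv (cf p s) \<otimes> cf q (i + s))"
proof -
  define f where "f i = inv (cf p s) \<otimes> cf q (i + s)" for i
  note c = Pol_carrier[OF p] Pol_carrier[OF q(1)]
  have f: "f i \<in> H i" for i unfolding f_def
    using graded_ldiv[OF H Pol_cf[OF q(1)] Pol_cf[OF p]] s by simp
  obtain n where n: "\<forall>i>n. cf q i = \<zero>" using cf_bound[OF c(2)] ..
  have n': "f i = \<zero>" if "i > n" for i unfolding f_def using n that c s by simp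
  have fP: "f \<in> carrier P" "\<And>i. cf f i = f i" using PolI[of f n] f n' graded_carrier[OF H] by blast+
  have 1: "f \<in> Pol H" using fP f by (simp add: Pol_def)
  have 2: "q = mon (cf p s) s \<otimes>\<^bsub>P\<^esub> f"
    by (rule cf_eqI) (use c fP q s in \<open>auto simp: cf_monom_mult f_def\<close>)
  have "cf f i = inv (cf p s) \<otimes> cf q (i + s)" for i by (simp add: fP(2) f_def)
  with 1 2 show ?thesis by blast
qed

lemma Pol_low:
  assumes "p \<in> carrier P" "p \<noteq> \<zero>\<^bsub>P\<^esub>"
  obtains s where "cf p s \<noteq> \<zero>" "\<And>i. i < s \<Longrightarrow> cf p i = \<zero>"
proof -
  have ex: "\<exists>s. cf p s \<noteq> \<zero>" using assms cf_eqI[of p "\<zero>\<^bsub>P\<^esub>"] by auto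
  show ?thesis
  proof (rule that[of "LEAST s. cf p s \<noteq> \<zero>"])
    show "cf p (LEAST s. cf p s \<noteq> \<zero>) \<noteq> \<zero>" by (rule LeastI_ex[OF ex])
    show "cf p i = \<zero>" if "i < (LEAST s. cf p s \<noteq> \<zero>)" for i using not_less_Least[OF that] by simp
  qed
qed

text \<open>The lowest two coefficients of a product. They are what survives of the fraction calculus when derivatives at 0 are compared.\<close>

lemma cf_mult_low:
  assumes "p \<in> carrier P" "q \<in> carrier P" "\<And>i. i < s \<Longrightarrow> cf p i = \<zero>" "\<And>i. i < t \<Longrightarrow> cf q i = \<zero>"
  shows "k < s + t \<Longrightarrow> cf (p \<otimes>\<^bsub>P\<^esub> q) k = \<zero>" 
    and "cf (p \<otimes>\<^bsub>P\<^esub> q) (s + t) = cf p s \<otimes> cf q t"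
    and "cf (p \<otimes>\<^bsub>P\<^esub> q) (Suc (s + t)) = cf p s \<otimes> cf q (Suc t) \<oplus> cf p (Suc s) \<otimes> cf q t"
proof -
  define f where "f i = cf p (i + s)" for i
  define g where "g i = cf q (i + t)" for i
  obtain n where n: "\<forall>i>n. cf p i = \<zero>" using cf_bound[OF assms(1)] ..
  obtain m where m: "\<forall>i>m. cf q i = \<zero>" using cf_bound[OF assms(2)] ..
  have f: "f \<in> carrier P" "\<And>i. cf f i = f i" using PolI[of f n] n assms f_def by auto
  have g: "g \<in> carrier P" "\<And>i. cf g i = g i" using PolI[of g m] m assms g_def by auto
  have pf: "p = mon \<one> s \<otimes>\<^bsub>P\<^esub> f" by (rule cf_eqI) (use f assms in \<open>auto simp: cf_monom_mult f_def\<close>)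
  have qg: "q = mon \<one> t \<otimes>\<^bsub>P\<^esub> g" by (rule cf_eqI) (use g assms in \<open>auto simp: cf_monom_mult g_def\<close>)
  have f': "f i \<in> carrier R" for i using f UPR.coeff_closed[OF f(1)] by simp
  have comm: "f \<otimes>\<^bsub>P\<^esub> mon \<one> t = mon \<one> t \<otimes>\<^bsub>P\<^esub> f"
  proof (rule cf_eqI)
    fix k
    have "cf (f \<otimes>\<^bsub>P\<^esub> mon \<one> t) k = (\<Oplus>i\<in>{..k}. if t \<le> k \<and> i = k - t then f i else \<zero>)"
      using f f' by (auto intro!: finsum_cong simp: Pi_def simp_implies_def UPR.coeff_mult)
    also have "\<dots> = (if t \<le> k then f (k - t) else \<zero>)"
    proof (cases "t \<le> k")
      case True
      then show ?thesis using finsum_singleton[of "k - t" "{..k}" f] f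
        by (simp add: eq_commute[of "k - t"] Pi_def f' cong: if_cong)
    next
      case False then show ?thesis by simp
    qed
    finally show "cf (f \<otimes>\<^bsub>P\<^esub> mon \<one> t) k = cf (mon \<one> t \<otimes>\<^bsub>P\<^esub> f) k"
      using f f' by (simp add: cf_monom_mult)
  qed (use f in auto)
  have "p \<otimes>\<^bsub>P\<^esub> q = mon \<one> s \<otimes>\<^bsub>P\<^esub> ((f \<otimes>\<^bsub>P\<^esub> mon \<one> t) \<otimes>\<^bsub>P\<^esub> g)"
    using f g by (simp add: pf qg UPR.P.m_assoc)
  also have "\<dots> = mon \<one> s \<otimes>\<^bsub>P\<^esub> (mon \<one> t \<otimes>\<^bsub>P\<^esub> (f \<otimes>\<^bsub>P\<^esub> g))"
    using f g by (simp add: comm UPR.P.m_assoc)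
  finally have pq: "cf (p \<otimes>\<^bsub>P\<^esub> q) k = (if s + t \<le> k then cf (f \<otimes>\<^bsub>P\<^esub> g) (k - s - t) else \<zero>)" for k
    using f g by (auto simp: cf_monom_mult)
  show "k < s + t \<Longrightarrow> cf (p \<otimes>\<^bsub>P\<^esub> q) k = \<zero>" using pq by simp
  show "cf (p \<otimes>\<^bsub>P\<^esub> q) (s + t) = cf p s \<otimes> cf q t" using f g pq[of "s+t"] cf_mult_0[OF f(1) g(1)]
    by (simp add: f_def g_def)
  show "cf (p \<otimes>\<^bsub>P\<^esub> q) (Suc (s + t)) = cf p s \<otimes> cf q (Suc t) \<oplus> cf p (Suc s) \<otimes> cf q t"
    using f g pq[of "Suc (s+t)"] cf_mult_1[OF f(1) g(1)] by (simp add: f_def g_def)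
qed

lemma P_integral:
  assumes "p \<in> carrier P" "q \<in> carrier P" "p \<otimes>\<^bsub>P\<^esub> q = \<zero>\<^bsub>P\<^esub>" "p \<noteq> \<zero>\<^bsub>P\<^esub>"
  shows "q = \<zero>\<^bsub>P\<^esub>"
proof (rule ccontr)
  assume "q \<noteq> \<zero>\<^bsub>P\<^esub>"
  with assms obtain s t where st: "cf p s \<noteq> \<zero>" "\<And>i. i < s \<Longrightarrow> cf p i = \<zero>"
      "cf q t \<noteq> \<zero>" "\<And>i. i < t \<Longrightarrow> cf q i = \<zero>"
    using Pol_low[OF assms(1,4)] Pol_low[OF assms(2)] by (metis (no_types))
  have "cf (p \<otimes>\<^bsub>P\<^esub> q) (s + t) = cf p s \<otimes> cf q t" by (rule cf_mult_low(2)) (use assms st in auto)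
  then have "cf p s \<otimes> cf q t = \<zero>" using assms(3) by simp
  then show False using st assms(1,2) by simp
qed

lemma P_left_cancel:
  assumes "p \<in> carrier P" "q \<in> carrier P" "r \<in> carrier P" "p \<otimes>\<^bsub>P\<^esub> q = p \<otimes>\<^bsub>P\<^esub> r" "p \<noteq> \<zero>\<^bsub>P\<^esub>"
  shows "q = r"
proof -
  have "p \<otimes>\<^bsub>P\<^esub> (q \<ominus>\<^bsub>P\<^esub> r) = \<zero>\<^bsub>P\<^esub>" using assms by (simp add: UPR.P.minus_eq UPR.P.r_distr UPR.P.r_minus UPR.P.r_neg)
  then have "q \<ominus>\<^bsub>P\<^esub> r = \<zero>\<^bsub>P\<^esub>" using P_integral[OF assms(1) _ _ assms(5)] assms(2,3) by blast
  then show ?thesis using assms by simp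
qed

lemma P_one_nonzero: "\<one>\<^bsub>P\<^esub> \<noteq> \<zero>\<^bsub>P\<^esub>"
proof
  assume "\<one>\<^bsub>P\<^esub> = \<zero>\<^bsub>P\<^esub>"
  then have "cf \<one>\<^bsub>P\<^esub> 0 = cf \<zero>\<^bsub>P\<^esub> 0" by (simp only:)
  then show False using one_neq_zero by simp
qed

text \<open>The Euclidean algorithm: the leading term of \<open>p\<close> is cancelled by a left multiple of \<open>q\<close>, and if the degree of \<open>p\<close> is smaller, the roles are exchanged.\<close>

lemma Pol_left_ore:
  assumes H: "graded H"
  shows "\<lbrakk>q \<in> Pol H; p \<in> Pol H; \<And>i. i \<ge> l \<Longrightarrow> cf q i = \<zero>; q \<noteq> \<zero>\<^bsub>P\<^esub>\<rbrakk>
     \<Longrightarrow> \<exists>u\<in>Pol H. \<exists>v\<in>Pol H. u \<noteq> \<zero>\<^bsub>P\<^esub> \<and> u \<otimes>\<^bsub>P\<^esub> p = v \<otimes>\<^bsub>P\<^esub> q"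
proof (induction l arbitrary: p q rule: less_induct)
  case (less l)
  note q = less.prems(1,3,4)
  have step: "\<lbrakk>p \<in> Pol H; \<And>i. i \<ge> m \<Longrightarrow> cf p i = \<zero>\<rbrakk>
     \<Longrightarrow> \<exists>u\<in>Pol H. \<exists>v\<in>Pol H. u \<noteq> \<zero>\<^bsub>P\<^esub> \<and> u \<otimes>\<^bsub>P\<^esub> p = v \<otimes>\<^bsub>P\<^esub> q" for m p
  proof (induction m arbitrary: p)
    case 0
    then have p: "p = \<zero>\<^bsub>P\<^esub>" by (intro cf_eqI) (auto simp: Pol_carrier)
    show ?case using p P_one_nonzero Pol_one[OF H] Pol_zero[OF H] q(1) Pol_carrier[OF q(1)]
      by (intro bexI[of _ "\<one>\<^bsub>P\<^esub>"] bexI[of _ "\<zero>\<^bsub>P\<^esub>"]) auto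
  next
    case (Suc m)
    show ?case
    proof (cases "l > Suc m")
      case True
      show ?thesis
      proof (cases "p = \<zero>\<^bsub>P\<^esub>")
        case True
        show ?thesis using True P_one_nonzero Pol_one[OF H] Pol_zero[OF H] q(1) Pol_carrier[OF q(1)]
          by (intro bexI[of _ "\<one>\<^bsub>P\<^esub>"] bexI[of _ "\<zero>\<^bsub>P\<^esub>"]) auto
      next
        case False
        from less.IH[OF True Suc.prems(1) q(1) Suc.prems(2) False]
        obtain u v where uv: "u \<in> Pol H" "v \<in> Pol H" "u \<noteq> \<zero>\<^bsub>P\<^esub>" "u \<otimes>\<^bsub>P\<^esub> q = v \<otimes>\<^bsub>P\<^esub> p" by blast
        have "v \<noteq> \<zero>\<^bsub>P\<^esub>"
        proof
          assume "v = \<zero>\<^bsub>P\<^esub>"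
          then have "u \<otimes>\<^bsub>P\<^esub> q = \<zero>\<^bsub>P\<^esub>" using uv Pol_carrier[OF Suc.prems(1)] by simp
          then show False using P_integral uv q Pol_carrier by blast
        qed
        then show ?thesis using uv by (intro bexI[of _ v] bexI[of _ u]) auto
      qed
    next
      case False
      show ?thesis
      proof (cases "l = 0 \<or> cf q (l - 1) = \<zero>")
        case True
        have "l \<noteq> 0" using q cf_eqI[of q "\<zero>\<^bsub>P\<^esub>"] Pol_carrier[OF q(1)] by fastforce
        then have "cf q i = \<zero>" if "i \<ge> l - 1" for i using True q(2)[of i] that by (cases "i = l - 1") auto
        then show ?thesis using less.IH[of "l - 1" q p] \<open>l \<noteq> 0\<close> q Suc.prems by simp
      next
        case nz: False
        define k where "k = l - 1"
        have k: "l = Suc k" "k \<le> m" "cf q k \<noteq> \<zero>" using nz False k_def by auto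
        \<comment> \<open>one division step: cancel the coefficient of degree \<open>m\<close> of \<open>p\<close>\<close>
        define c where "c = cf p m \<otimes> inv (cf q k)"
        note car = Pol_carrier[OF q(1)] Pol_carrier[OF Suc.prems(1)]
        have cH: "c \<in> H (m - k)" unfolding c_def
          using graded_rdiv[OF H, of "cf p m" "m - k" k "cf q k"] Pol_cf[OF Suc.prems(1)] Pol_cf[OF q(1)] k by simp
        then have c: "c \<in> carrier R" using graded_carrier[OF H] by blast
        define w where "w = mon c (m - k)"
        have wH: "w \<in> Pol H" using Pol_monom[OF H cH] w_def by simp
        define p' where "p' = p \<ominus>\<^bsub>P\<^esub> w \<otimes>\<^bsub>P\<^esub> q"
        have p'H: "p' \<in> Pol H" unfolding p'_def using Pol_minus[OF H Suc.prems(1) Pol_mult[OF H wH q(1)]] .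
        have "cf p' i = \<zero>" if "i \<ge> m" for i
        proof -
          have "cf p' i = cf p i \<ominus> (if m - k \<le> i then c \<otimes> cf q (i - (m - k)) else \<zero>)"
            unfolding p'_def w_def using car c by (simp add: cf_minus cf_monom_mult)
          also have "\<dots> = \<zero>"
          proof (cases "i = m")
            case True
            then show ?thesis using k car by (simp add: c_def m_assoc a_minus_def r_neg)
          next
            case False
            then have "cf p i = \<zero>" "i - (m - k) \<ge> l" using that Suc.prems(2) k by auto
            then show ?thesis using q(2) c by (simp add: a_minus_def)
          qed
          finally show ?thesis .
        qed
        from Suc.IH[OF p'H this] obtain u v where uv: "u \<in> Pol H" "v \<in> Pol H" "u \<noteq> \<zero>\<^bsub>P\<^esub>" "u \<otimes>\<^bsub>P\<^esub> p' = v \<otimes>\<^bsub>P\<^esub> q"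
          by blast
        note car' = Pol_carrier[OF uv(1)] Pol_carrier[OF uv(2)] Pol_carrier[OF wH] car
        have "p = p' \<oplus>\<^bsub>P\<^esub> w \<otimes>\<^bsub>P\<^esub> q" unfolding p'_def using car' by (simp add: UPR.P.minus_eq UPR.P.a_assoc UPR.P.l_neg)
        moreover have "u \<otimes>\<^bsub>P\<^esub> (p' \<oplus>\<^bsub>P\<^esub> w \<otimes>\<^bsub>P\<^esub> q) = u \<otimes>\<^bsub>P\<^esub> p' \<oplus>\<^bsub>P\<^esub> u \<otimes>\<^bsub>P\<^esub> (w \<otimes>\<^bsub>P\<^esub> q)" 
          using car' Pol_carrier[OF p'H] by (simp add: UPR.P.r_distr)
        ultimately have "u \<otimes>\<^bsub>P\<^esub> p = u \<otimes>\<^bsub>P\<^esub> p' \<oplus>\<^bsub>P\<^esub> u \<otimes>\<^bsub>P\<^esub> (w \<otimes>\<^bsub>P\<^esub> q)" by simp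
        also have "\<dots> = (v \<oplus>\<^bsub>P\<^esub> u \<otimes>\<^bsub>P\<^esub> w) \<otimes>\<^bsub>P\<^esub> q" 
          using car' uv by (simp add: UPR.P.l_distr UPR.P.m_assoc)
        finally show ?thesis using uv Pol_add[OF H uv(2) Pol_mult[OF H uv(1) wH]] by blast
      qed
    qed
  qed
  obtain m where m: "\<forall>i>m. cf p i = \<zero>" using cf_bound[OF Pol_carrier[OF less.prems(2)]] ..
  show ?case by (rule step[OF less.prems(2), of "Suc m"]) (simp add: m)
qed

lemma Pol_ore:
  assumes H: "graded H" "q \<in> Pol H" "p \<in> Pol H" "q \<noteq> \<zero>\<^bsub>P\<^esub>"
  obtains u v where "u \<in> Pol H" "v \<in> Pol H" "u \<noteq> \<zero>\<^bsub>P\<^esub>" "u \<otimes>\<^bsub>P\<^esub> p = v \<otimes>\<^bsub>P\<^esub> q"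
proof -
  obtain m where m: "\<forall>i>m. cf q i = \<zero>" using cf_bound[OF Pol_carrier[OF assms(2)]] ..
  have "\<exists>u\<in>Pol H. \<exists>v\<in>Pol H. u \<noteq> \<zero>\<^bsub>P\<^esub> \<and> u \<otimes>\<^bsub>P\<^esub> p = v \<otimes>\<^bsub>P\<^esub> q"
    by (rule Pol_left_ore[OF assms(1-3) _ assms(4), of "Suc m"]) (simp add: m)
  then show ?thesis using that by (elim bexE conjE)
qed

text \<open>If both polynomials have constant term 1, the cofactors can be chosen in the same way: their lowest terms agree, because the common multiple has one lowest term, and this monomial can be cancelled.\<close>

lemma Pol_ore_unital:
  assumes H: "graded H" "q \<in> Pol H" "p \<in> Pol H" "cf q 0 = \<one>" "cf p 0 = \<one>"
  obtains u v where "u \<in> Pol H" "v \<in> Pol H" "cf u 0 = \<one>" "cf v 0 = \<one>" "u \<otimes>\<^bsub>P\<^esub> p = v \<otimes>\<^bsub>P\<^esub> q"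
proof -
  note car = Pol_carrier[OF assms(2)] Pol_carrier[OF assms(3)]
  have "q \<noteq> \<zero>\<^bsub>P\<^esub>" using assms(4) one_neq_zero by auto
  from Pol_ore[OF assms(1-3) this] obtain u v where
    uv: "u \<in> Pol H" "v \<in> Pol H" "u \<noteq> \<zero>\<^bsub>P\<^esub>" "u \<otimes>\<^bsub>P\<^esub> p = v \<otimes>\<^bsub>P\<^esub> q" .
  note car' = car Pol_carrier[OF uv(1)] Pol_carrier[OF uv(2)]
  obtain s where s: "cf u s \<noteq> \<zero>" "\<And>i. i < s \<Longrightarrow> cf u i = \<zero>" using Pol_low[OF car'(3) uv(3)] by (metis (no_types))
  have v0: "cf v i = \<zero>" if "i < s" for i using that
  proof (induction i rule: less_induct)
    case (less i)
    have "cf (v \<otimes>\<^bsub>P\<^esub> q) (i + 0) = cf v i \<otimes> cf q 0" 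
      by (rule cf_mult_low(2)) (use less car' in auto)
    moreover have "cf (u \<otimes>\<^bsub>P\<^esub> p) i = \<zero>"
      by (rule cf_mult_low(1)[where s = s and t = 0]) (use less car' s in auto)
    ultimately show ?case using uv(4) assms car' by simp
  qed
  have "cf (v \<otimes>\<^bsub>P\<^esub> q) (s + 0) = cf v s \<otimes> cf q 0" by (rule cf_mult_low(2)) (use v0 car' in auto)
  moreover have "cf (u \<otimes>\<^bsub>P\<^esub> p) (s + 0) = cf u s \<otimes> cf p 0" by (rule cf_mult_low(2)) (use s car' in auto)
  ultimately have vs: "cf v s = cf u s" using uv(4) assms car' by simp
  obtain u' where u': "u' \<in> Pol H" "u = mon (cf u s) s \<otimes>\<^bsub>P\<^esub> u'" "\<And>i. cf u' i = inv (cf u s) \<otimes> cf u (i + s)"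
    using Pol_normalize[OF H(1) uv(1) s(1) uv(1) s(2)] by blast
  obtain v' where v': "v' \<in> Pol H" "v = mon (cf u s) s \<otimes>\<^bsub>P\<^esub> v'" "\<And>i. cf v' i = inv (cf u s) \<otimes> cf v (i + s)"
    using Pol_normalize[OF H(1) uv(1) s(1) uv(2) v0] by blast
  note car'' = car' Pol_carrier[OF u'(1)] Pol_carrier[OF v'(1)]
  let ?w = "mon (cf u s) s"
  have w: "?w \<in> carrier P" "?w \<noteq> \<zero>\<^bsub>P\<^esub>" using car' s by (auto dest: arg_cong[where f="\<lambda>x. cf x s"])
  have "?w \<otimes>\<^bsub>P\<^esub> (u' \<otimes>\<^bsub>P\<^esub> p) = (?w \<otimes>\<^bsub>P\<^esub> u') \<otimes>\<^bsub>P\<^esub> p" using w(1) car'' by (simp add: UPR.P.m_assoc)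
  also have "\<dots> = v \<otimes>\<^bsub>P\<^esub> q" using uv(4) by (simp only: u'(2)[symmetric])
  also have "\<dots> = (?w \<otimes>\<^bsub>P\<^esub> v') \<otimes>\<^bsub>P\<^esub> q" by (simp only: v'(2)[symmetric])
  also have "\<dots> = ?w \<otimes>\<^bsub>P\<^esub> (v' \<otimes>\<^bsub>P\<^esub> q)" using w(1) car'' by (simp add: UPR.P.m_assoc)
  finally have "?w \<otimes>\<^bsub>P\<^esub> (u' \<otimes>\<^bsub>P\<^esub> p) = ?w \<otimes>\<^bsub>P\<^esub> (v' \<otimes>\<^bsub>P\<^esub> q)" .
  then have "u' \<otimes>\<^bsub>P\<^esub> p = v' \<otimes>\<^bsub>P\<^esub> q" by (rule P_left_cancel[OF w(1) _ _ _ w(2), rotated 2]) (simp_all add: car'')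
  moreover have "cf u' 0 = \<one>" "cf v' 0 = \<one>" using s(1) car' by (simp_all add: u'(3) v'(3) vs)
  ultimately show ?thesis using that[OF u'(1) v'(1)] by simp
qed

end

section \<open>Evaluation, roots and interpolation\<close>

context skew_field
begin

lemma finsum_atMost_extend:
  assumes "f \<in> UNIV \<rightarrow> carrier R" "(m::nat) \<le> n" "\<And>i. i > m \<Longrightarrow> f i = \<zero>"
  shows "(\<Oplus>i\<in>{..n}. f i) = (\<Oplus>i\<in>{..m}. f i)"
  using assms(2)
proof (induction n rule: dec_induct)
  case (step n)
  have f: "f \<in> S \<rightarrow> carrier R" for S using assms(1) by auto
  have "(\<Oplus>i\<in>{..Suc n}. f i) = f (Suc n) \<oplus> (\<Oplus>i\<in>{..n}. f i)" by (rule finsum_Suc[OF f])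
  moreover have "f (Suc n) = \<zero>" using assms(3) step by auto
  ultimately show ?case using step by (simp add: finsum_closed[OF f])
qed simp

definition ev :: "'a \<Rightarrow> (nat \<Rightarrow> 'a) \<Rightarrow> 'a" where
  "ev lam p = (\<Oplus>i\<in>{..(LEAST n. \<forall>i>n. cf p i = \<zero>)}. cf p i \<otimes> lam [^] i)"

lemma ev_bound:
  assumes p: "p \<in> carrier P" and lam: "lam \<in> carrier R" and n: "\<forall>i>n. cf p i = \<zero>"
  shows "ev lam p = (\<Oplus>i\<in>{..n}. cf p i \<otimes> lam [^] i)"
proof -
  obtain m where m: "m = (LEAST n. \<forall>i>n. cf p i = \<zero>)" by simp
  have 1: "\<forall>i>m. cf p i = \<zero>" unfolding m by (rule LeastI[where P = "\<lambda>n. \<forall>i>n. cf p i = \<zero>"], rule n)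
  have 2: "m \<le> n" unfolding m by (rule Least_le[where P = "\<lambda>n. \<forall>i>n. cf p i = \<zero>"], rule n)
  show ?thesis unfolding ev_def m[symmetric]
    by (rule finsum_atMost_extend[symmetric, OF _ 2]) (use 1 p lam in auto)
qed

lemma ev_closed [simp]:
  assumes "p \<in> carrier P" "lam \<in> carrier R" shows "ev lam p \<in> carrier R"
  unfolding ev_def using assms by (intro finsum_closed) auto

lemma cf_mult_bound:
  assumes "p \<in> carrier P" "q \<in> carrier P" "\<forall>i>n. cf p i = \<zero>" "\<forall>i>m. cf q i = \<zero>" "k > n + m"
  shows "cf (p \<otimes>\<^bsub>P\<^esub> q) k = \<zero>"
proof -
  have "cf p i \<otimes> cf q (k - i) = \<zero>" for i
    using assms by (cases "i > n") auto
  then show ?thesis by (simp add: UPR.coeff_mult[OF assms(1,2)] del: mult_eq_zero_iff)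
qed

text \<open>The variable has to be moved past the coefficients of the right factor; this is where commutation with \<open>lam\<close> enters.\<close>

lemma ev_mult:
  assumes p: "p \<in> carrier P" and q: "q \<in> carrier P" and lam: "lam \<in> carrier R"
    and comm: "\<And>i. lam \<otimes> cf q i = cf q i \<otimes> lam"
  shows "ev lam (p \<otimes>\<^bsub>P\<^esub> q) = ev lam p \<otimes> ev lam q"
proof -
  obtain n where n: "\<forall>i>n. cf p i = \<zero>" using cf_bound[OF p] ..
  obtain m where m: "\<forall>i>m. cf q i = \<zero>" using cf_bound[OF q] ..
  have pc: "lam [^] i \<otimes> cf q j = cf q j \<otimes> lam [^] i" for i j :: nat
  proof (induction i)
    case (Suc i)
    have "lam [^] Suc i \<otimes> cf q j = lam [^] i \<otimes> cf q j \<otimes> lam" using lam q by (simp add: m_assoc comm)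
    then show ?case using lam q Suc by (simp add: m_assoc)
  qed (use q in simp)
  define f where "f i = cf p i \<otimes> lam [^] i" for i
  define g where "g i = cf q i \<otimes> lam [^] i" for i
  have f: "f \<in> UNIV \<rightarrow> carrier R" "f i \<in> carrier R" for i using p lam by (auto simp: f_def)
  have g: "g \<in> UNIV \<rightarrow> carrier R" "g i \<in> carrier R" for i using q lam by (auto simp: g_def)
  have "ev lam (p \<otimes>\<^bsub>P\<^esub> q) = (\<Oplus>k\<in>{..n + m}. cf (p \<otimes>\<^bsub>P\<^esub> q) k \<otimes> lam [^] k)"
    by (rule ev_bound) (use p q lam cf_mult_bound[OF p q n m] in auto)
  also have "\<dots> = (\<Oplus>k\<in>{..n + m}. \<Oplus>i\<in>{..k}. f i \<otimes> g (k - i))"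
  proof (rule finsum_cong', goal_cases)
    case 2 then show ?case using f g by auto
  next
    case (3 k)
    have "cf (p \<otimes>\<^bsub>P\<^esub> q) k \<otimes> lam [^] k = (\<Oplus>i\<in>{..k}. cf p i \<otimes> cf q (k - i) \<otimes> lam [^] k)"
      unfolding UPR.coeff_mult[OF p q] using p q lam by (intro finsum_ldistr) auto
    also have "\<dots> = (\<Oplus>i\<in>{..k}. f i \<otimes> g (k - i))"
    proof (rule finsum_cong', goal_cases)
      case 2 then show ?case using f g by auto
    next
      case (3 i)
      then have "f i \<otimes> g (k - i) = cf p i \<otimes> (lam [^] i \<otimes> cf q (k - i)) \<otimes> lam [^] (k - i)"
        using p q lam by (simp add: f_def g_def m_assoc)
      also have "\<dots> = cf p i \<otimes> cf q (k - i) \<otimes> (lam [^] i \<otimes> lam [^] (k - i))"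
        using p q lam by (simp add: pc m_assoc)
      finally show ?case using 3 lam by (simp add: nat_pow_mult)
    qed simp
    finally show ?case .
  qed simp
  also have "\<dots> = (\<Oplus>i\<in>{..n}. f i) \<otimes> (\<Oplus>i\<in>{..m}. g i)"
  proof (rule cauchy_product)
    show "bound \<zero> n f" unfolding bound_def f_def using n lam by simp
    show "bound \<zero> m g" unfolding bound_def g_def using m lam by simp
    show "f \<in> {..n} \<rightarrow> carrier R" "g \<in> {..m} \<rightarrow> carrier R" using f g by auto
  qed
  also have "\<dots> = ev lam p \<otimes> ev lam q"
    unfolding f_def g_def by (simp only: ev_bound[OF p lam n] ev_bound[OF q lam m])
  finally show ?thesis .
qed

lemma ev_add:
  assumes p: "p \<in> carrier P" and q: "q \<in> carrier P" and lam: "lam \<in> carrier R"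
  shows "ev lam (p \<oplus>\<^bsub>P\<^esub> q) = ev lam p \<oplus> ev lam q"
proof -
  obtain n where n: "\<forall>i>n. cf p i = \<zero>" using cf_bound[OF p] ..
  obtain m where m: "\<forall>i>m. cf q i = \<zero>" using cf_bound[OF q] ..
  have "ev lam (p \<oplus>\<^bsub>P\<^esub> q) = (\<Oplus>i\<in>{..n+m}. cf p i \<otimes> lam [^] i \<oplus> cf q i \<otimes> lam [^] i)"
    using p q lam n m by (subst ev_bound[where n = "n+m"]) (auto simp: l_distr cong: finsum_cong)
  also have "\<dots> = ev lam p \<oplus> ev lam q"
    using p q lam n m by (subst finsum_addf) (auto simp: ev_bound[where n = "n+m"])
  finally show ?thesis .
qed

lemma ev_minus:
  assumes p: "p \<in> carrier P" and q: "q \<in> carrier P" and lam: "lam \<in> carrier R"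
  shows "ev lam (p \<ominus>\<^bsub>P\<^esub> q) = ev lam p \<ominus> ev lam q"
proof -
  have "(p \<ominus>\<^bsub>P\<^esub> q) \<oplus>\<^bsub>P\<^esub> q = p" using p q by (simp add: UPR.P.minus_eq UPR.P.a_assoc UPR.P.l_neg)
  then have "ev lam p = ev lam (p \<ominus>\<^bsub>P\<^esub> q) \<oplus> ev lam q" using ev_add[of "p \<ominus>\<^bsub>P\<^esub> q" q lam] p q lam by simp
  then show ?thesis using p q lam by (simp add: a_minus_def a_assoc r_neg)
qed

lemma ev_mon:
  assumes "a \<in> carrier R" "lam \<in> carrier R"
  shows "ev lam (mon a n) = a \<otimes> lam [^] n"
proof -
  have "ev lam (mon a n) = (\<Oplus>i\<in>{..n}. cf (mon a n) i \<otimes> lam [^] i)" by (rule ev_bound) (use assms in auto)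
  also have "\<dots> = (\<Oplus>i\<in>{..n}. if n = i then a \<otimes> lam [^] i else \<zero>)"
    by (rule finsum_cong') (use assms in auto)
  also have "\<dots> = a \<otimes> lam [^] n" using assms finsum_singleton[of n "{..n}" "\<lambda>i. a \<otimes> lam [^] i"] by simp
  finally show ?thesis .
qed

lemma ev_one: "lam \<in> carrier R \<Longrightarrow> ev lam \<one>\<^bsub>P\<^esub> = \<one>"
  by (subst ev_bound[where n = 0]) auto

text \<open>Division by the linear polynomial with root \<open>mu\<close>, with remainder \<open>r\<close>, in terms of values: at points commuting with \<open>mu\<close> the values of quotient and divisor multiply.\<close>

lemma sum_div_linear:
  assumes "\<And>i. c i \<in> carrier R" "mu \<in> carrier R"
  shows "\<exists>q r. (\<forall>i. q i \<in> carrier R) \<and> r \<in> carrier R \<and> q n = c (Suc n) \<and>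
    (\<forall>lam\<in>carrier R. lam \<otimes> mu = mu \<otimes> lam \<longrightarrow>
      (\<Oplus>i\<in>{..Suc n}. c i \<otimes> lam [^] i) = (\<Oplus>i\<in>{..n}. q i \<otimes> lam [^] i) \<otimes> (lam \<ominus> mu) \<oplus> r)"
  using assms(1)
proof (induction n arbitrary: c)
  case 0
  have *: "(\<Oplus>i\<in>{..Suc 0}. c i \<otimes> lam [^] i) = (\<Oplus>i\<in>{..0::nat}. c 1 \<otimes> lam [^] i) \<otimes> (lam \<ominus> mu) \<oplus> (c 1 \<otimes> mu \<oplus> c 0)"
    if "lam \<in> carrier R" for lam
  proof -
    have "c 1 \<otimes> (lam \<ominus> mu) \<oplus> (c 1 \<otimes> mu \<oplus> c 0) = c 1 \<otimes> ((lam \<ominus> mu) \<oplus> mu) \<oplus> c 0"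
      using 0 that assms by (simp add: r_distr a_assoc)
    also have "(lam \<ominus> mu) \<oplus> mu = lam" using that assms by (simp add: a_minus_def a_assoc l_neg)
    finally show ?thesis using 0 that assms by (simp add: Pi_def)
  qed
  show ?case
  proof (intro exI conjI allI ballI impI)
    show "c 1 \<in> carrier R" "c 1 \<otimes> mu \<oplus> c 0 \<in> carrier R" using 0 assms by auto
    show "c 1 = c (Suc 0)" by simp
  qed (rule *)
next
  case (Suc n)
  obtain q r where qr: "\<And>i. q i \<in> carrier R" "r \<in> carrier R" "q n = c (Suc (Suc n))"
    "\<And>lam. lam\<in>carrier R \<Longrightarrow> lam \<otimes> mu = mu \<otimes> lam \<Longrightarrow>
      (\<Oplus>i\<in>{..Suc n}. c (Suc i) \<otimes> lam [^] i) = (\<Oplus>i\<in>{..n}. q i \<otimes> lam [^] i) \<otimes> (lam \<ominus> mu) \<oplus> r"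
    using Suc.IH[of "\<lambda>i. c (Suc i)"] Suc.prems by blast
  define q' where "q' i = (case i of 0 \<Rightarrow> r | Suc j \<Rightarrow> q j)" for i
  have q': "q' i \<in> carrier R" "q' 0 = r" "q' (Suc i) = q i" for i using qr by (auto simp: q'_def split: nat.split)
  have shift: "(\<Oplus>i\<in>{..Suc m}. d i \<otimes> lam [^] i) = (\<Oplus>i\<in>{..m}. d (Suc i) \<otimes> lam [^] i) \<otimes> lam \<oplus> d 0"
    if "\<And>i. d i \<in> carrier R" "lam \<in> carrier R" for d lam and m :: nat
  proof -
    have "(\<Oplus>i\<in>{..Suc m}. d i \<otimes> lam [^] i) = (\<Oplus>i\<in>{..m}. d (Suc i) \<otimes> lam [^] (Suc i)) \<oplus> d 0 \<otimes> lam [^] (0::nat)"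
      using that by (intro finsum_Suc2) auto
    also have "(\<Oplus>i\<in>{..m}. d (Suc i) \<otimes> lam [^] (Suc i)) = (\<Oplus>i\<in>{..m}. d (Suc i) \<otimes> lam [^] i \<otimes> lam)"
      using that by (intro finsum_cong') (auto simp: m_assoc)
    also have "\<dots> = (\<Oplus>i\<in>{..m}. d (Suc i) \<otimes> lam [^] i) \<otimes> lam"
      using that by (intro finsum_ldistr[symmetric]) auto
    finally show ?thesis using that by simp
  qed
  have "(\<Oplus>i\<in>{..Suc (Suc n)}. c i \<otimes> lam [^] i) = (\<Oplus>i\<in>{..Suc n}. q' i \<otimes> lam [^] i) \<otimes> (lam \<ominus> mu) \<oplus> (r \<otimes> mu \<oplus> c 0)"
    if lam: "lam \<in> carrier R" "lam \<otimes> mu = mu \<otimes> lam" for lam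
  proof -
    define S where "S = (\<Oplus>i\<in>{..n}. q i \<otimes> lam [^] i)"
    have S: "S \<in> carrier R" unfolding S_def using qr lam by auto
    have c: "(lam \<ominus> mu) \<otimes> lam = lam \<otimes> (lam \<ominus> mu)"
      using lam assms(2) by (simp add: a_minus_def l_distr r_distr l_minus r_minus)
    have "(\<Oplus>i\<in>{..Suc (Suc n)}. c i \<otimes> lam [^] i) = (S \<otimes> (lam \<ominus> mu) \<oplus> r) \<otimes> lam \<oplus> c 0"
      by (simp only: shift[of c lam "Suc n", OF Suc.prems lam(1)] qr(4)[OF lam] S_def)
    also have "\<dots> = S \<otimes> ((lam \<ominus> mu) \<otimes> lam) \<oplus> r \<otimes> lam \<oplus> c 0"
      using lam assms(2) S qr(2) Suc.prems by (simp add: l_distr m_assoc)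
    also have "\<dots> = S \<otimes> lam \<otimes> (lam \<ominus> mu) \<oplus> r \<otimes> lam \<oplus> c 0"
      using lam assms(2) S by (simp add: c m_assoc)
    also have "r \<otimes> lam = r \<otimes> (lam \<ominus> mu) \<oplus> r \<otimes> mu"
      using lam assms(2) qr(2) by (simp add: a_minus_def r_distr r_minus a_assoc l_neg)
    also have "S \<otimes> lam \<otimes> (lam \<ominus> mu) \<oplus> (r \<otimes> (lam \<ominus> mu) \<oplus> r \<otimes> mu) \<oplus> c 0 = (S \<otimes> lam \<oplus> r) \<otimes> (lam \<ominus> mu) \<oplus> (r \<otimes> mu \<oplus> c 0)"
      using lam assms(2) S qr(2) Suc.prems by (simp add: l_distr a_assoc)
    also have "S \<otimes> lam \<oplus> r = (\<Oplus>i\<in>{..Suc n}. q' i \<otimes> lam [^] i)"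
      unfolding S_def using shift[of q' lam n] q' lam by simp
    finally show ?thesis .
  qed
  note * = this
  show ?case
  proof (intro exI conjI allI ballI impI)
    show "q' i \<in> carrier R" for i by (rule q')
    show "r \<otimes> mu \<oplus> c 0 \<in> carrier R" using qr Suc.prems assms(2) by simp
    show "q' (Suc n) = c (Suc (Suc n))" using q' qr by simp
  qed (rule *)
qed

text \<open>Over a division ring a polynomial may have more roots than its degree, but not among pairwise commuting elements: linear factors can then be split off one after the other.\<close>

lemma sum_roots:
  assumes "\<And>i. c i \<in> carrier R" "finite L" "card L > n" "L \<subseteq> carrier R"
    "\<And>x y. x \<in> L \<Longrightarrow> y \<in> L \<Longrightarrow> x \<otimes> y = y \<otimes> x"
    "\<And>lam. lam \<in> L \<Longrightarrow> (\<Oplus>i\<in>{..n}. c i \<otimes> lam [^] i) = \<zero>"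
  shows "\<forall>i\<le>n. c i = \<zero>"
  using assms
proof (induction n arbitrary: c L)
  case 0
  then obtain lam where "lam \<in> L" by fastforce
  then have "c 0 \<otimes> \<one> = \<zero>" using 0(6)[of lam] 0 by (auto simp: Pi_def)
  then show ?case using 0(1)[of 0] by simp
next
  case (Suc n)
  then obtain mu where mu: "mu \<in> L" by fastforce
  then have muR: "mu \<in> carrier R" using Suc.prems by blast
  obtain q r where qr: "\<And>i. q i \<in> carrier R" "r \<in> carrier R" "q n = c (Suc n)"
    "\<And>lam. lam\<in>carrier R \<Longrightarrow> lam \<otimes> mu = mu \<otimes> lam \<Longrightarrow>
      (\<Oplus>i\<in>{..Suc n}. c i \<otimes> lam [^] i) = (\<Oplus>i\<in>{..n}. q i \<otimes> lam [^] i) \<otimes> (lam \<ominus> mu) \<oplus> r"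
    using sum_div_linear[of c mu n] Suc.prems(1) muR by blast
  have S: "(\<Oplus>i\<in>{..n}. q i \<otimes> lam [^] i) \<in> carrier R" if "lam \<in> carrier R" for lam using qr that by auto
  have mm: "mu \<ominus> mu = \<zero>" using muR by simp
  have "(\<Oplus>i\<in>{..n}. q i \<otimes> mu [^] i) \<otimes> (mu \<ominus> mu) \<oplus> r = \<zero>"
    by (rule trans[OF qr(4)[OF muR refl, symmetric] Suc.prems(6)[OF mu]])
  then have r: "r = \<zero>" unfolding mm using S[OF muR] qr(2) by simp
  have "(\<Oplus>i\<in>{..n}. q i \<otimes> lam [^] i) = \<zero>" if "lam \<in> L - {mu}" for lam
  proof -
    have lam: "lam \<in> carrier R" "lam \<otimes> mu = mu \<otimes> lam" "lam \<noteq> mu" "lam \<in> L" using that Suc.prems mu by auto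
    have "(\<Oplus>i\<in>{..n}. q i \<otimes> lam [^] i) \<otimes> (lam \<ominus> mu) \<oplus> r = \<zero>"
      by (rule trans[OF qr(4)[OF lam(1,2), symmetric] Suc.prems(6)[OF lam(4)]])
    then have "(\<Oplus>i\<in>{..n}. q i \<otimes> lam [^] i) \<otimes> (lam \<ominus> mu) = \<zero>"
      unfolding r using S[OF lam(1)] lam(1) muR by simp
    then show ?thesis using S[OF lam(1)] lam muR by simp
  qed
  then have "\<forall>i\<le>n. q i = \<zero>" using Suc.prems mu by (intro Suc.IH[of q "L - {mu}"]) (auto simp: qr(1))
  then have c: "c (Suc n) = \<zero>" using qr(3) by simp
  have "(\<Oplus>i\<in>{..n}. c i \<otimes> lam [^] i) = \<zero>" if "lam \<in> L" for lam
  proof -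
    have "lam \<in> carrier R" using that Suc.prems(4) by blast
    then have "(\<Oplus>i\<in>{..Suc n}. c i \<otimes> lam [^] i) = (\<Oplus>i\<in>{..n}. c i \<otimes> lam [^] i)"
      using Suc.prems(1) c by (subst finsum_Suc) auto
    then show ?thesis using Suc.prems(6)[OF that] by simp
  qed
  then have "\<forall>i\<le>n. c i = \<zero>" using Suc.prems by (intro Suc.IH[of c L]) auto
  then show ?case using c by (auto simp: le_Suc_eq)
qed

lemma ev_eq_imp_eq:
  assumes "p \<in> carrier P" "q \<in> carrier P" "infinite L" "L \<subseteq> carrier R"
    "\<And>x y. x \<in> L \<Longrightarrow> y \<in> L \<Longrightarrow> x \<otimes> y = y \<otimes> x" "\<And>lam. lam \<in> L \<Longrightarrow> ev lam p = ev lam q"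
  shows "p = q"
proof -
  let ?d = "p \<ominus>\<^bsub>P\<^esub> q"
  have d: "?d \<in> carrier P" using assms by simp
  obtain n where n: "\<forall>i>n. cf ?d i = \<zero>" using cf_bound[OF d] ..
  obtain L' where L': "L' \<subseteq> L" "finite L'" "card L' = Suc n" using infinite_arbitrarily_large[OF assms(3)] by blast
  have "\<forall>i\<le>n. cf ?d i = \<zero>"
  proof (rule sum_roots[of "cf ?d" L' n])
    fix lam assume "lam \<in> L'"
    then have lam: "lam \<in> L" "lam \<in> carrier R" using L' assms by auto
    have "ev lam ?d = \<zero>" using ev_minus[OF assms(1,2) lam(2)] assms(1,2) lam assms(6) by simp
    then show "(\<Oplus>i\<in>{..n}. cf ?d i \<otimes> lam [^] i) = \<zero>" using ev_bound[OF d lam(2) n] by simp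
    show "x \<otimes> y = y \<otimes> x" if "x \<in> L'" "y \<in> L'" for x y using assms(5) L'(1) that by blast
  qed (use d L' assms(4) in auto)
  then have "cf ?d i = \<zero>" for i using n by (cases "i \<le> n") auto
  then have "?d = \<zero>\<^bsub>P\<^esub>" using d by (intro cf_eqI) auto
  then show ?thesis using assms(1,2) by simp
qed

lemma graded_const: assumes "division_subring K" shows "graded (\<lambda>_. K)"
  unfolding graded_def using assms by (auto intro: dsub_intros simp: dsub_carrier)

text \<open>Lagrange interpolation inside the field \<open>K\<close>, one node at a time.\<close>

lemma interpolation_zero:
  assumes K: "division_subring K" "\<And>a b. a \<in> K \<Longrightarrow> b \<in> K \<Longrightarrow> a \<otimes> b = b \<otimes> a"
    and "finite Z" "Z \<subseteq> K" "z0 \<in> K" "z0 \<notin> Z" "v \<in> K"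
  shows "\<exists>p\<in>Pol (\<lambda>_. K). (\<forall>i>card Z. cf p i = \<zero>) \<and> (\<forall>z\<in>Z. ev z p = \<zero>) \<and> ev z0 p = v"
  using assms(3-7)
proof (induction Z arbitrary: v rule: finite_induct)
  case empty
  note car = dsub_carrier[OF K(1) empty(2)] dsub_carrier[OF K(1) empty(4)]
  show ?case using car Pol_monom[OF graded_const[OF K(1)] empty(4)]
    by (intro bexI[of _ "mon v 0"]) (auto simp: ev_mon)
next
  case (insert z1 Z)
  have z: "z1 \<in> K" "z0 \<in> K" "z0 \<noteq> z1" using insert by auto
  note car = dsub_carrier[OF K(1) z(1)] dsub_carrier[OF K(1) z(2)]
  have d: "z0 \<ominus> z1 \<in> K" "z0 \<ominus> z1 \<noteq> \<zero>" using z car dsub_minus[OF K(1)] by auto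
  let ?v = "v \<otimes> inv (z0 \<ominus> z1)"
  have vR: "v \<in> carrier R" using insert dsub_carrier[OF K(1)] by blast
  have v: "?v \<in> K" using insert d K(1) by (intro dsub_intros) auto
  obtain p where p: "p \<in> Pol (\<lambda>_. K)" "\<forall>i>card Z. cf p i = \<zero>" "\<forall>z\<in>Z. ev z p = \<zero>" "ev z0 p = ?v"
    using insert.IH[of ?v] insert.prems v by auto
  note pc = Pol_carrier[OF p(1)]
  let ?l = "mon \<one> 1 \<ominus>\<^bsub>P\<^esub> mon z1 0"
  have l: "?l \<in> Pol (\<lambda>_. K)" "?l \<in> carrier P"
    using graded_const[OF K(1)] Pol_minus Pol_monom dsub_one[OF K(1)] z car by auto
  have lb: "\<forall>i>1. cf ?l i = \<zero>" using car by (simp add: cf_minus)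
  have evl: "ev lam (p \<otimes>\<^bsub>P\<^esub> ?l) = ev lam p \<otimes> (lam \<ominus> z1)" if "lam \<in> K" for lam
  proof -
    have lamR: "lam \<in> carrier R" using that dsub_carrier[OF K(1)] by blast
    have "ev lam (p \<otimes>\<^bsub>P\<^esub> ?l) = ev lam p \<otimes> ev lam ?l"
      using K(2)[OF that Pol_cf[OF l(1)]] by (intro ev_mult[OF pc l(2) lamR]) auto
    then show ?thesis using car lamR by (simp add: ev_minus ev_mon)
  qed
  show ?case
  proof (intro bexI[of _ "p \<otimes>\<^bsub>P\<^esub> ?l"] conjI ballI allI impI)
    show "p \<otimes>\<^bsub>P\<^esub> ?l \<in> Pol (\<lambda>_. K)" by (rule Pol_mult[OF graded_const[OF K(1)] p(1) l(1)])
    show "cf (p \<otimes>\<^bsub>P\<^esub> ?l) i = \<zero>" if "i > card (insert z1 Z)" for i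
      using cf_mult_bound[OF pc l(2) p(2) lb, of i] that insert by simp
    show "ev z0 (p \<otimes>\<^bsub>P\<^esub> ?l) = v" using evl[OF z(2)] p d vR car by (simp add: m_assoc)
    show "ev z' (p \<otimes>\<^bsub>P\<^esub> ?l) = \<zero>" if "z' \<in> insert z1 Z" for z'
    proof -
      have "z' \<in> K" "z' \<in> carrier R" using that insert.prems dsub_carrier[OF K(1)] by auto
      then show ?thesis using evl[of z'] that p(3) car pc by auto
    qed
  qed
qed

lemma interpolation:
  assumes K: "division_subring K" "\<And>a b. a \<in> K \<Longrightarrow> b \<in> K \<Longrightarrow> a \<otimes> b = b \<otimes> a"
    and Z: "finite Z" "Z \<subseteq> K" "\<And>z. z \<in> Z \<Longrightarrow> v z \<in> K"
  shows "\<exists>p\<in>Pol (\<lambda>_. K). (\<forall>i\<ge>card Z. cf p i = \<zero>) \<and> (\<forall>z\<in>Z. ev z p = v z)"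
proof -
  have "\<exists>p\<in>Pol (\<lambda>_. K). (\<forall>i\<ge>card Z. cf p i = \<zero>) \<and> (\<forall>z\<in>S. ev z p = v z) \<and> (\<forall>z\<in>Z - S. ev z p = \<zero>)"
    if "finite S" "S \<subseteq> Z" for S
    using that
  proof (induction S rule: finite_induct)
    case empty
    have "ev z \<zero>\<^bsub>P\<^esub> = \<zero>" if "z \<in> Z" for z
      using that Z dsub_carrier[OF K(1)] by (subst ev_bound[where n = 0]) (auto simp: subset_eq)
    then show ?case using Pol_zero[OF graded_const[OF K(1)]] by (intro bexI[of _ "\<zero>\<^bsub>P\<^esub>"]) auto
  next
    case (insert s S)
    then obtain p where p: "p \<in> Pol (\<lambda>_. K)" "\<forall>i\<ge>card Z. cf p i = \<zero>" "\<forall>z\<in>S. ev z p = v z" "\<forall>z\<in>Z - S. ev z p = \<zero>"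
      by auto
    have "card (Z - {s}) = card Z - 1" "card Z > 0" using insert.prems Z(1) by (auto simp: card_gt_0_iff)
    then obtain q where q: "q \<in> Pol (\<lambda>_. K)" "\<forall>i>card Z - 1. cf q i = \<zero>" "\<forall>z\<in>Z - {s}. ev z q = \<zero>" "ev s q = v s"
      using interpolation_zero[OF K, of "Z - {s}" s "v s"] Z insert.prems by auto
    note c = Pol_carrier[OF p(1)] Pol_carrier[OF q(1)]
    have e: "ev z (p \<oplus>\<^bsub>P\<^esub> q) = ev z p \<oplus> ev z q" "ev z p \<in> carrier R" "ev z q \<in> carrier R" "v z \<in> carrier R" if "z \<in> Z" for z
      using that Z dsub_carrier[OF K(1)] ev_add[OF c] c ev_closed by (auto simp: subset_eq)
    show ?case
    proof (intro bexI[of _ "p \<oplus>\<^bsub>P\<^esub> q"] conjI ballI allI impI)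
      show "p \<oplus>\<^bsub>P\<^esub> q \<in> Pol (\<lambda>_. K)" by (rule Pol_add[OF graded_const[OF K(1)] p(1) q(1)])
      show "cf (p \<oplus>\<^bsub>P\<^esub> q) i = \<zero>" if "i \<ge> card Z" for i using that p(2) q(2) c \<open>card Z > 0\<close> by simp
      show "ev z (p \<oplus>\<^bsub>P\<^esub> q) = v z" if "z \<in> insert s S" for z
        using that insert e[of z] p q by (cases "z = s") auto
      show "ev z (p \<oplus>\<^bsub>P\<^esub> q) = \<zero>" if "z \<in> Z - insert s S" for z
        using that e[of z] p q by auto
    qed
  qed
  from this[OF Z(1) subset_refl] show ?thesis by auto
qed

section \<open>Iterated commutators as fractions of polynomials\<close>

fun iter_com :: "'a \<Rightarrow> nat \<Rightarrow> 'a \<Rightarrow> 'a" where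
  "iter_com y 0 z = z"
| "iter_com y (Suc n) z = iter_com y n z \<otimes> cj y (inv (iter_com y n z))"

text \<open>The linearization at 1 of the map that takes \<open>z\<close> to its commutator with \<open>y\<close>.\<close>

definition tau :: "'a \<Rightarrow> 'a \<Rightarrow> 'a" where
  "tau y z = z \<ominus> cj y z"

lemma iter_com_closed: "\<lbrakk>y \<in> carrier R; y \<noteq> \<zero>; z \<in> carrier R; z \<noteq> \<zero>\<rbrakk> \<Longrightarrow> iter_com y n z \<in> carrier R \<and> iter_com y n z \<noteq> \<zero>"
  by (induction n) auto

lemma tau_closed: "\<lbrakk>y \<in> carrier R; y \<noteq> \<zero>; z \<in> carrier R\<rbrakk> \<Longrightarrow> tau y z \<in> carrier R"
  by (simp add: tau_def)

lemma cj_poly: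
  assumes H: "graded H" and p: "p \<in> Pol H" and y: "y \<in> carrier R" "y \<noteq> \<zero>"
    and yH: "\<And>i a. a \<in> H i \<Longrightarrow> cj y a \<in> H i"
  shows "\<exists>q\<in>Pol H. (\<forall>i. cf q i = cj y (cf p i)) \<and>
     (\<forall>lam\<in>carrier R. y \<otimes> lam = lam \<otimes> y \<longrightarrow> ev lam q = cj y (ev lam p))"
proof -
  note pc = Pol_carrier[OF p]
  obtain n where n: "\<forall>i>n. cf p i = \<zero>" using cf_bound[OF pc] ..
  define q where "q i = cj y (cf p i)" for i
  have "q i \<in> carrier R" "i > n \<Longrightarrow> q i = \<zero>" for i using y pc n by (simp_all add: q_def)
  then have q: "q \<in> carrier P" "cf q i = q i" for i using PolI[of q n] by blast+
  have qH: "q \<in> Pol H" using q yH[OF Pol_cf[OF p]] by (auto simp: Pol_def q_def)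
  have "ev lam q = cj y (ev lam p)" if lam: "lam \<in> carrier R" "y \<otimes> lam = lam \<otimes> y" for lam
  proof -
    have cl: "cj y lam = lam" using cj_eq_self_iff y lam by simp
    have "ev lam q = (\<Oplus>i\<in>{..n}. cf q i \<otimes> lam [^] i)" by (rule ev_bound) (use q n y lam q_def in auto)
    also have "\<dots> = (\<Oplus>i\<in>{..n}. cj y (cf p i \<otimes> lam [^] i))"
      by (rule finsum_cong') (use q y lam pc cl in \<open>auto simp: q_def cj_mult cj_pow\<close>)
    also have "\<dots> = cj y (ev lam p)"
      unfolding ev_bound[OF pc lam(1) n] using y lam pc by (intro cj_finsum[symmetric]) auto
    finally show ?thesis .
  qed
  then show ?thesis using qH q(2) q_def by (intro bexI[of _ q]) auto
qed

text \<open>Inductively \<open>f_n = A^-1 B\<close>, hence \<open>f_{n+1} = A^-1 B (y B^-1 A y^-1)\<close>. With \<open>B'\<close> and \<open>A'\<close> denoting the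
conjugates by \<open>y\<close>, the Ore condition gives \<open>u B = v B'\<close>, so that \<open>f_{n+1} = (u A)^-1 (v A')\<close>.
The constant terms stay 1, and the linear terms show that the derivative at 0, which is
the difference of the linear coefficients of \<open>B\<close> and \<open>A\<close>, is hit by \<open>tau\<close> in each step.\<close>

lemma iter_com_fraction:
  assumes H: "graded H" and y: "y \<in> carrier R" "y \<noteq> \<zero>" and z: "z \<in> H 1"
    and yH: "\<And>i a. a \<in> H i \<Longrightarrow> cj y a \<in> H i"
  shows "\<exists>A\<in>Pol H. \<exists>B\<in>Pol H. cf A 0 = \<one> \<and> cf B 0 = \<one> \<and> cf B 1 \<ominus> cf A 1 = (tau y ^^ n) z \<and>
    (\<forall>lam\<in>carrier R. (\<forall>i. \<forall>h\<in>H i. lam \<otimes> h = h \<otimes> lam) \<longrightarrow> y \<otimes> lam = lam \<otimes> y \<longrightarrow> \<one> \<oplus> z \<otimes> lam \<noteq> \<zero> \<longrightarrow>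
       ev lam A \<otimes> iter_com y n (\<one> \<oplus> z \<otimes> lam) = ev lam B)"
proof (induction n)
  case 0
  have zR: "z \<in> carrier R" using graded_carrier[OF H z] .
  have "\<one>\<^bsub>P\<^esub> \<oplus>\<^bsub>P\<^esub> mon z 1 \<in> Pol H" using Pol_add[OF H Pol_one[OF H] Pol_monom[OF H z]] .
  then show ?case using zR Pol_one[OF H]
    by (intro bexI[of _ "\<one>\<^bsub>P\<^esub>"] bexI[of _ "\<one>\<^bsub>P\<^esub> \<oplus>\<^bsub>P\<^esub> mon z 1"]) (auto simp: ev_one ev_add ev_mon a_minus_def)
next
  case (Suc n)
  then obtain A B where AB: "A \<in> Pol H" "B \<in> Pol H" "cf A 0 = \<one>" "cf B 0 = \<one>"
    "cf B 1 \<ominus> cf A 1 = (tau y ^^ n) z"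
    "\<And>lam. lam\<in>carrier R \<Longrightarrow> (\<forall>i. \<forall>h\<in>H i. lam \<otimes> h = h \<otimes> lam) \<Longrightarrow> y \<otimes> lam = lam \<otimes> y \<Longrightarrow> \<one> \<oplus> z \<otimes> lam \<noteq> \<zero> \<Longrightarrow>
       ev lam A \<otimes> iter_com y n (\<one> \<oplus> z \<otimes> lam) = ev lam B" by blast
  obtain A' where A': "A' \<in> Pol H" "\<And>i. cf A' i = cj y (cf A i)"
     "\<And>lam. lam\<in>carrier R \<Longrightarrow> y \<otimes> lam = lam \<otimes> y \<Longrightarrow> ev lam A' = cj y (ev lam A)" 
    using cj_poly[OF H AB(1) y yH] by blast
  obtain B' where B': "B' \<in> Pol H" "\<And>i. cf B' i = cj y (cf B i)"
     "\<And>lam. lam\<in>carrier R \<Longrightarrow> y \<otimes> lam = lam \<otimes> y \<Longrightarrow> ev lam B' = cj y (ev lam B)" 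
    using cj_poly[OF H AB(2) y yH] by blast
  have "cf B' 0 = \<one>" using B' AB y by simp
  then obtain u v where uv: "u \<in> Pol H" "v \<in> Pol H" "cf u 0 = \<one>" "cf v 0 = \<one>" "u \<otimes>\<^bsub>P\<^esub> B = v \<otimes>\<^bsub>P\<^esub> B'"
    using Pol_ore_unital[OF H B'(1) AB(2)] AB(4) by blast
  note car = Pol_carrier[OF AB(1)] Pol_carrier[OF AB(2)] Pol_carrier[OF A'(1)] Pol_carrier[OF B'(1)]
    Pol_carrier[OF uv(1)] Pol_carrier[OF uv(2)]
  note cc = UPR.coeff_closed[OF car(1)] UPR.coeff_closed[OF car(2)] UPR.coeff_closed[OF car(5)] UPR.coeff_closed[OF car(6)]
  have zR: "z \<in> carrier R" using graded_carrier[OF H z] .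
  have uv1: "cf u 1 \<oplus> cf B 1 = cf v 1 \<oplus> cj y (cf B 1)"
  proof -
    have "cf (u \<otimes>\<^bsub>P\<^esub> B) 1 = cf (v \<otimes>\<^bsub>P\<^esub> B') 1" using uv(5) by simp
    then show ?thesis unfolding cf_mult_1[OF car(5,2)] cf_mult_1[OF car(6,4)]
      using cc y AB B' uv by (simp add: a_comm)
  qed
  show ?case
  proof (rule bexI[of _ "u \<otimes>\<^bsub>P\<^esub> A"], rule bexI[of _ "v \<otimes>\<^bsub>P\<^esub> A'"], intro conjI ballI impI)
    show "u \<otimes>\<^bsub>P\<^esub> A \<in> Pol H" "v \<otimes>\<^bsub>P\<^esub> A' \<in> Pol H" using Pol_mult[OF H] uv AB A' by auto
    show "cf (u \<otimes>\<^bsub>P\<^esub> A) 0 = \<one>" "cf (v \<otimes>\<^bsub>P\<^esub> A') 0 = \<one>" using cf_mult_0 car uv AB A' y by simp_all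
    have "cf (v \<otimes>\<^bsub>P\<^esub> A') 1 \<ominus> cf (u \<otimes>\<^bsub>P\<^esub> A) 1 = (cf v 1 \<oplus> cj y (cf A 1)) \<ominus> (cf u 1 \<oplus> cf A 1)"
      unfolding cf_mult_1[OF car(5,1)] cf_mult_1[OF car(6,3)] using cc y AB A' uv by (simp add: a_comm)
    also have "cf v 1 = (cf u 1 \<oplus> cf B 1) \<ominus> cj y (cf B 1)"
      unfolding uv1 using cc y by (simp add: a_minus_def a_assoc r_neg)
    also have "((cf u 1 \<oplus> cf B 1) \<ominus> cj y (cf B 1)) \<oplus> cj y (cf A 1) \<ominus> (cf u 1 \<oplus> cf A 1)
       = (cf B 1 \<ominus> cf A 1) \<ominus> (cj y (cf B 1) \<ominus> cj y (cf A 1))"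
    proof -
      have "((a \<oplus> b) \<ominus> b') \<oplus> a' \<ominus> (a \<oplus> c) = (b \<ominus> c) \<ominus> (b' \<ominus> a')"
        if "a \<in> carrier R" "b \<in> carrier R" "c \<in> carrier R" "a' \<in> carrier R" "b' \<in> carrier R" for a b c a' b'
      proof -
        have "((a \<oplus> b) \<ominus> b') \<oplus> a' \<ominus> (a \<oplus> c) = (a \<oplus> \<ominus> a) \<oplus> ((b \<oplus> \<ominus> c) \<oplus> (\<ominus> b' \<oplus> a'))"
          using that by (simp add: a_minus_def minus_add a_ac)
        also have "\<dots> = (b \<ominus> c) \<ominus> (b' \<ominus> a')" using that by (simp add: a_minus_def minus_add r_neg a_ac)
        finally show ?thesis .
      qed
      then show ?thesis using cc y by simp
    qed
    also have "\<dots> = tau y (cf B 1 \<ominus> cf A 1)" using cc y by (simp add: tau_def cj_minus)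
    finally show "cf (v \<otimes>\<^bsub>P\<^esub> A') 1 \<ominus> cf (u \<otimes>\<^bsub>P\<^esub> A) 1 = (tau y ^^ Suc n) z" using AB(5) by simp
    fix lam assume lam: "lam \<in> carrier R" "\<forall>i. \<forall>h\<in>H i. lam \<otimes> h = h \<otimes> lam" "y \<otimes> lam = lam \<otimes> y" "\<one> \<oplus> z \<otimes> lam \<noteq> \<zero>"
    define f where "f = iter_com y n (\<one> \<oplus> z \<otimes> lam)"
    have f: "f \<in> carrier R" "f \<noteq> \<zero>" using iter_com_closed[OF y _ lam(4)] zR lam(1) f_def by auto
    have Af: "ev lam A \<otimes> f = ev lam B" using AB(6)[OF lam] f_def by simp
    have m: "ev lam (p \<otimes>\<^bsub>P\<^esub> q) = ev lam p \<otimes> ev lam q" if "p \<in> carrier P" "q \<in> Pol H" for p q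
      by (rule ev_mult) (use that Pol_carrier[OF that(2)] Pol_cf[OF that(2)] lam in auto)
    note e = ev_closed[OF car(1) lam(1)] ev_closed[OF car(5) lam(1)] ev_closed[OF car(6) lam(1)]
       ev_closed[OF car(2) lam(1)]
    have "ev lam (u \<otimes>\<^bsub>P\<^esub> A) \<otimes> iter_com y (Suc n) (\<one> \<oplus> z \<otimes> lam) = ev lam u \<otimes> (ev lam A \<otimes> f) \<otimes> cj y (inv f)"
      using m[OF car(5) AB(1)] e f y by (simp add: f_def[symmetric] m_assoc)
    also have "\<dots> = ev lam (u \<otimes>\<^bsub>P\<^esub> B) \<otimes> cj y (inv f)" unfolding Af using m[OF car(5) AB(2)] by simp
    also have "\<dots> = ev lam v \<otimes> (cj y (ev lam B) \<otimes> cj y (inv f))"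
      unfolding uv(5) using m[OF car(6) B'(1)] B'(3)[OF lam(1,3)] e f y by (simp add: m_assoc)
    also have "cj y (ev lam B) \<otimes> cj y (inv f) = cj y (ev lam A)"
      using e f y by (simp add: m_assoc flip: cj_mult Af)
    also have "ev lam v \<otimes> cj y (ev lam A) = ev lam (v \<otimes>\<^bsub>P\<^esub> A')"
      using m[OF car(6) A'(1)] A'(3)[OF lam(1,3)] by simp
    finally show "ev lam (u \<otimes>\<^bsub>P\<^esub> A) \<otimes> iter_com y (Suc n) (\<one> \<oplus> z \<otimes> lam) = ev lam (v \<otimes>\<^bsub>P\<^esub> A')" .
  qed
qed

end

section \<open>Rational expressions whose values stay in a division subring\<close>

context skew_field
begin

lemma minus_self [simp]: "a \<in> carrier R \<Longrightarrow> a \<ominus> a = \<zero>"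
  by simp

lemma normalizesD: assumes "normalizes g E" shows "g \<in> carrier R" "g \<noteq> \<zero>" 
  using assms by (auto simp: normalizes_def)

text \<open>Homogeneous elements of degree \<open>i\<close> in the powers of \<open>g\<close>, with coefficients on the left.\<close>

definition Hp :: "'a set \<Rightarrow> 'a \<Rightarrow> nat \<Rightarrow> 'a set" where
  "Hp E g i = (\<lambda>e. e \<otimes> g [^] i) ` E"

lemma Hp_move:
  assumes "division_subring E" "normalizes g E" "e \<in> E"
  shows "\<exists>e'\<in>E. g [^] (i::nat) \<otimes> e = e' \<otimes> g [^] i" "\<exists>e'\<in>E. inv (g [^] i) \<otimes> e = e' \<otimes> inv (g [^] i)"
proof -
  note g = normalizesD[OF assms(2)] and E = dsub_sub[OF assms(1)] 
  have gi: "normalizes (g [^] i) E" "normalizes (inv (g [^] i)) E"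
    using normalizes_pow[OF assms(2) E] normalizes_inv[OF _ E] by blast+
  have e: "e \<in> carrier R" using E assms by blast
  have "g [^] i \<otimes> e = cj (g [^] i) e \<otimes> g [^] i" using cj_mult_left[of "g [^] i" e] g e by simp
  then show "\<exists>e'\<in>E. g [^] i \<otimes> e = e' \<otimes> g [^] i" using normalizes_cj[OF gi(1) assms(3)] by blast
  have "inv (g [^] i) \<otimes> e = cj (inv (g [^] i)) e \<otimes> inv (g [^] i)" using cj_mult_left[of "inv (g [^] i)" e] g e by simp
  then show "\<exists>e'\<in>E. inv (g [^] i) \<otimes> e = e' \<otimes> inv (g [^] i)" using normalizes_cj[OF gi(2) assms(3)] by blast
qed

lemma graded_Hp:
  assumes "division_subring E" "normalizes g E" shows "graded (Hp E g)"
proof -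
  note g = normalizesD[OF assms(2)] and E = dsub_carrier[OF assms(1)]
  have mult: "a \<otimes> b \<in> Hp E g (i + j)" if ab: "a \<in> Hp E g i" "b \<in> Hp E g j" for i j a b
  proof -
    obtain e f where ef: "a = e \<otimes> g [^] i" "b = f \<otimes> g [^] j" "e \<in> E" "f \<in> E" using ab by (auto simp: Hp_def)
    obtain f' where f': "f' \<in> E" "g [^] i \<otimes> f = f' \<otimes> g [^] i" using Hp_move(1)[OF assms ef(4)] by blast
    have "a \<otimes> b = e \<otimes> (g [^] i \<otimes> f) \<otimes> g [^] j" using ef E g by (simp add: m_assoc)
    also have "\<dots> = (e \<otimes> f') \<otimes> g [^] (i + j)" using ef f' E g by (simp add: m_assoc nat_pow_mult)
    finally show ?thesis using dsub_mult[OF assms(1) ef(3) f'(1)] by (auto simp: Hp_def)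
  qed
  have div: "a \<otimes> inv b \<in> Hp E g i \<and> inv b \<otimes> a \<in> Hp E g i"
    if ab: "a \<in> Hp E g (i + j)" "b \<in> Hp E g j" "b \<noteq> \<zero>" for i j a b
  proof
    obtain e f where ef: "a = e \<otimes> g [^] (i + j)" "b = f \<otimes> g [^] j" "e \<in> E" "f \<in> E" using ab by (auto simp: Hp_def)
    have f0: "f \<noteq> \<zero>" using ab(3) ef g E by auto
    have fi: "inv f \<in> E" "inv f \<in> carrier R" using dsub_inv[OF assms(1) ef(4) f0] E by auto
    have ib: "inv b = inv (g [^] j) \<otimes> inv f" using ef g E f0 by (simp add: sf_inv_mult)
    have gg: "g [^] (i + j) = g [^] i \<otimes> g [^] j" "g [^] (i + j) = g [^] j \<otimes> g [^] i"
      using g by (simp_all add: nat_pow_mult add.commute)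
    obtain f' where f': "f' \<in> E" "g [^] i \<otimes> inv f = f' \<otimes> g [^] i" using Hp_move(1)[OF assms fi(1)] by blast
    have "a \<otimes> inv b = e \<otimes> (g [^] i \<otimes> inv f)" unfolding ib ef(1) gg(1) using ef g E fi by (simp add: m_assoc)
    also have "\<dots> = (e \<otimes> f') \<otimes> g [^] i" using ef f' E g by (simp add: m_assoc)
    finally show "a \<otimes> inv b \<in> Hp E g i" using dsub_mult[OF assms(1) ef(3) f'(1)] by (auto simp: Hp_def)
    have fe: "inv f \<otimes> e \<in> E" using dsub_mult[OF assms(1) fi(1) ef(3)] .
    obtain h where h: "h \<in> E" "inv (g [^] j) \<otimes> (inv f \<otimes> e) = h \<otimes> inv (g [^] j)"
      using Hp_move(2)[OF assms fe] by blast
    have "inv b \<otimes> a = (inv (g [^] j) \<otimes> (inv f \<otimes> e)) \<otimes> (g [^] j \<otimes> g [^] i)"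
      unfolding ib ef(1) gg(2) using ef g E fi by (simp add: m_assoc)
    also have "\<dots> = h \<otimes> g [^] i" unfolding h(2) using E[OF h(1)] g by (simp add: m_assoc)
    finally show "inv b \<otimes> a \<in> Hp E g i" using h(1) by (auto simp: Hp_def)
  qed
  have minus: "a \<ominus> b \<in> Hp E g i" if ab: "a \<in> Hp E g i" "b \<in> Hp E g i" for i a b
  proof -
    obtain e f where ef: "a = e \<otimes> g [^] i" "b = f \<otimes> g [^] i" "e \<in> E" "f \<in> E" using ab by (auto simp: Hp_def)
    have "a \<ominus> b = (e \<ominus> f) \<otimes> g [^] i" using ef E g by (simp add: a_minus_def l_distr l_minus)
    then show ?thesis using dsub_minus[OF assms(1) ef(3,4)] by (auto simp: Hp_def)
  qed
  have "\<zero> \<in> Hp E g i" for i unfolding Hp_def using dsub_zero[OF assms(1)] g by (auto intro!: image_eqI[of _ _ \<zero>])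
  moreover have "\<one> \<in> Hp E g 0" unfolding Hp_def using dsub_one[OF assms(1)] by (auto intro!: image_eqI[of _ _ \<one>])
  moreover have "Hp E g i \<subseteq> carrier R" for i unfolding Hp_def using E g by auto
  ultimately show ?thesis unfolding graded_def using mult div minus by blast
qed

lemma Hp_cj:
  assumes "division_subring E" "normalizes g E" "y \<in> E" "y \<noteq> \<zero>" "a \<in> Hp E g i" shows "cj y a \<in> Hp E g i"
proof -
  have H: "graded (Hp E g)" by (rule graded_Hp[OF assms(1,2)])
  have y: "y \<in> Hp E g 0" "inv y \<in> Hp E g 0" 
    using assms dsub_inv[OF assms(1,3,4)] dsub_carrier[OF assms(1)] by (auto simp: Hp_def intro!: image_eqI)
  have "y \<otimes> a \<otimes> inv y \<in> Hp E g (0 + i + 0)"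
    by (intro graded_mult[OF H] y assms)
  then show ?thesis by (simp add: cj_def)
qed

text \<open>\<open>g^d\<close> acts nontrivially on the center of \<open>E\<close>. In this form the condition gives linear independence of powers by the argument for independence of characters.\<close>

definition moved :: "'a set \<Rightarrow> 'a \<Rightarrow> nat \<Rightarrow> bool" where
  "moved E g d \<longleftrightarrow> (\<exists>mu\<in>E. (\<forall>e\<in>E. mu \<otimes> e = e \<otimes> mu) \<and> g [^] d \<otimes> mu \<noteq> mu \<otimes> g [^] d)"

text \<open>As in Artin's proof of the independence of characters: for a shortest relation with nonzero
terms in degrees \<open>j < k\<close>, choose a central element \<open>mu\<close> of \<open>E\<close> moved by \<open>g^(k-j)\<close>, multiply the relation by
\<open>mu\<close> on the left and by its conjugate under \<open>g^-j\<close> on the right, and subtract. The term of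
degree \<open>j\<close> cancels and the term of degree \<open>k\<close> does not.\<close>

lemma powers_independent:
  assumes E: "division_subring E" "normalizes g E" and mv: "\<And>d. 0 < d \<Longrightarrow> d < n \<Longrightarrow> moved E g d"
    and c: "\<And>i. i < n \<Longrightarrow> c i \<in> Hp E g i" and s: "(\<Oplus>i\<in>{..<n}. c i) = \<zero>"
  shows "\<forall>i<n. c i = \<zero>"
  using c s
proof (induction "card {i. i < n \<and> c i \<noteq> \<zero>}" arbitrary: c rule: less_induct)
  case less
  note g = normalizesD[OF E(2)] and EC = dsub_carrier[OF E(1)] and H = graded_Hp[OF E]
  have cR: "c i \<in> carrier R" if "i < n" for i using less.prems(1)[OF that] graded_carrier[OF H] by blast
  show ?case
  proof (rule ccontr)
    assume "\<not> ?thesis"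
    then obtain i1 where i1: "i1 < n" "c i1 \<noteq> \<zero>" by blast
    have "\<exists>i2<n. i2 \<noteq> i1 \<and> c i2 \<noteq> \<zero>"
    proof (rule ccontr)
      assume "\<not> ?thesis"
      then have "(\<Oplus>i\<in>{..<n}. c i) = (\<Oplus>i\<in>{..<n}. if i1 = i then c i else \<zero>)"
        using cR by (intro finsum_cong') auto
      also have "\<dots> = c i1" using finsum_singleton[of i1 "{..<n}" c] i1 cR by auto
      finally show False using less.prems(2) i1 by simp
    qed
    then obtain i2 where i2: "i2 < n" "i2 \<noteq> i1" "c i2 \<noteq> \<zero>" by blast
    obtain j k where jk: "j < k" "k < n" "c j \<noteq> \<zero>" "c k \<noteq> \<zero>" 
      using i1 i2 by (metis nat_neq_iff)
    define d where "d = k - j"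
    have d: "0 < d" "d < n" "k = d + j" using jk by (auto simp: d_def)
    obtain mu where mu: "mu \<in> E" "\<And>e. e \<in> E \<Longrightarrow> mu \<otimes> e = e \<otimes> mu" "g [^] d \<otimes> mu \<noteq> mu \<otimes> g [^] d"
      using mv[OF d(1,2)] by (auto simp: moved_def)
    define nu where "nu = cj (inv (g [^] j)) mu"
    have gj: "g [^] j \<in> carrier R" "g [^] j \<noteq> \<zero>" using g by auto
    have nu: "nu \<in> E" unfolding nu_def
      using normalizes_cj[OF normalizes_inv[OF normalizes_pow[OF E(2) dsub_sub[OF E(1)]] dsub_sub[OF E(1)]] mu(1)] .
    have gjnu: "g [^] j \<otimes> nu = mu \<otimes> g [^] j"
      using cj_mult_left[OF gj, of nu] EC[OF nu] EC[OF mu(1)] gj by (simp add: nu_def)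
    define c' where "c' i = mu \<otimes> c i \<ominus> c i \<otimes> nu" for i
    have m0: "mu \<in> Hp E g 0" "nu \<in> Hp E g 0" using mu nu EC by (auto simp: Hp_def intro!: image_eqI)
    have c'H: "c' i \<in> Hp E g i" if "i < n" for i
      unfolding c'_def using graded_mult[OF H m0(1) less.prems(1)[OF that]] graded_mult[OF H less.prems(1)[OF that] m0(2)]
      by (intro graded_minus[OF H]) auto
    have muR: "mu \<in> carrier R" "nu \<in> carrier R" using EC mu nu by auto
    have cn: "(\<lambda>i. c i) \<in> {..<n} \<rightarrow> carrier R" using cR by auto
    have "(\<Oplus>i\<in>{..<n}. c' i) = (\<Oplus>i\<in>{..<n}. mu \<otimes> c i \<oplus> c i \<otimes> (\<ominus> nu))"
      by (rule finsum_cong') (use cR muR in \<open>auto simp: c'_def a_minus_def r_minus\<close>)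
    also have "\<dots> = (\<Oplus>i\<in>{..<n}. mu \<otimes> c i) \<oplus> (\<Oplus>i\<in>{..<n}. c i \<otimes> (\<ominus> nu))"
      using cR muR by (intro finsum_addf) auto
    also have "\<dots> = mu \<otimes> (\<Oplus>i\<in>{..<n}. c i) \<oplus> (\<Oplus>i\<in>{..<n}. c i) \<otimes> (\<ominus> nu)"
      using cn muR by (simp add: finsum_rdistr finsum_ldistr)
    also have "\<dots> = \<zero>" unfolding less.prems(2) using muR by simp
    finally have s': "(\<Oplus>i\<in>{..<n}. c' i) = \<zero>" .
    have mono: "c' i = \<zero>" if "c i = \<zero>" for i using that muR by (simp add: c'_def a_minus_def)
    obtain e where e: "e \<in> E" "c j = e \<otimes> g [^] j" using less.prems(1)[of j] jk by (auto simp: Hp_def)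
    have "c j \<otimes> nu = e \<otimes> (g [^] j \<otimes> nu)" using e EC muR gj by (simp add: m_assoc)
    also have "\<dots> = (e \<otimes> mu) \<otimes> g [^] j" unfolding gjnu using e EC muR gj by (simp add: m_assoc)
    also have "\<dots> = mu \<otimes> c j" unfolding mu(2)[OF e(1), symmetric] e(2) using e EC muR gj by (simp add: m_assoc)
    finally have c'j: "c' j = \<zero>" using cR muR jk by (simp add: c'_def)
    have "{i. i < n \<and> c' i \<noteq> \<zero>} \<subset> {i. i < n \<and> c i \<noteq> \<zero>}" using mono c'j jk by auto
    then have "card {i. i < n \<and> c' i \<noteq> \<zero>} < card {i. i < n \<and> c i \<noteq> \<zero>}" by (intro psubset_card_mono) auto
    from less.hyps[OF this c'H s'] have c'k: "c' k = \<zero>" using jk by blast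
    obtain f where f: "f \<in> E" "c k = f \<otimes> g [^] k" using less.prems(1)[of k] jk by (auto simp: Hp_def)
    have gk: "g [^] k = g [^] d \<otimes> g [^] j" using g by (simp add: d(3) nat_pow_mult)
    have "f \<noteq> \<zero>" using jk f g EC by auto
    have "mu \<otimes> c k = c k \<otimes> nu" using c'k cR[OF jk(2)] muR by (simp add: c'_def)
    then have "f \<otimes> (mu \<otimes> g [^] d \<otimes> g [^] j) = f \<otimes> (g [^] d \<otimes> (g [^] j \<otimes> nu))"
      unfolding f(2) gk using mu(2)[OF f(1)] EC[OF f(1)] muR g by (simp flip: m_assoc)
    then have "mu \<otimes> g [^] d \<otimes> g [^] j = (g [^] d \<otimes> mu) \<otimes> g [^] j"
      unfolding gjnu using mult_left_cancel[OF EC[OF f(1)] \<open>f \<noteq> \<zero>\<close>] muR g by (simp add: m_assoc)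
    then have "mu \<otimes> g [^] d = g [^] d \<otimes> mu" using mult_right_cancel[OF gj] muR g by simp
    then show False using mu(3) by simp
  qed
qed

text \<open>If no positive power of \<open>g\<close> centralizes the center of \<open>E\<close>, the powers of \<open>g\<close> are left independent over \<open>E\<close>: the elements of \<open>E g^i\<close> then add up like the homogeneous parts of a polynomial, and evaluation at 1 loses nothing.\<close>

lemma ev_one_inj:
  assumes E: "division_subring E" "normalizes g E" and mv: "\<And>d. 0 < d \<Longrightarrow> moved E g d"
    and p: "p \<in> Pol (Hp E g)" "q \<in> Pol (Hp E g)" "ev \<one> p = ev \<one> q"
  shows "p = q"
proof -
  let ?d = "p \<ominus>\<^bsub>P\<^esub> q"
  note H = graded_Hp[OF E] and pc = Pol_carrier[OF p(1)] Pol_carrier[OF p(2)]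
  have dP: "?d \<in> Pol (Hp E g)" by (rule Pol_minus[OF H p(1,2)])
  then have d: "?d \<in> carrier P" by (rule Pol_carrier)
  obtain n where n: "\<forall>i>n. cf ?d i = \<zero>" using cf_bound[OF d] ..
  have "ev \<one> ?d = \<zero>" using ev_minus[OF pc, of \<one>] p(3) pc by simp
  moreover have "ev \<one> ?d = (\<Oplus>i\<in>{..n}. cf ?d i \<otimes> \<one> [^] i)" by (rule ev_bound[OF d _ n]) simp
  moreover have "\<dots> = (\<Oplus>i\<in>{..n}. cf ?d i)" by (rule finsum_cong') (use UPR.coeff_closed[OF d] in auto)
  ultimately have s: "(\<Oplus>i\<in>{..<Suc n}. cf ?d i) = \<zero>" by (simp add: lessThan_Suc_atMost)
  have "\<forall>i<Suc n. cf ?d i = \<zero>"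
    by (rule powers_independent[OF E mv _ s]) (use Pol_cf[OF dP] in auto)
  then have "cf ?d i = \<zero>" for i using n by (cases "i \<le> n") auto
  then have "?d = \<zero>\<^bsub>P\<^esub>" using d by (intro cf_eqI) auto
  then show ?thesis using pc by simp
qed

lemma one_plus_nonzero:
  assumes E: "division_subring E" and g: "g \<in> carrier R" "g \<notin> E" and k: "k \<in> E"
  shows "\<one> \<oplus> k \<otimes> g \<noteq> \<zero>"
proof
  assume a: "\<one> \<oplus> k \<otimes> g = \<zero>"
  have kR: "k \<in> carrier R" using dsub_carrier[OF E k] .
  have "k \<otimes> g = \<ominus> \<one>" using a kR g by (metis minus_equality minus_minus m_closed one_closed)
  then have "k \<otimes> g \<in> E" "k \<noteq> \<zero>" using dsub_uminus[OF E dsub_one[OF E]] a g one_neq_zero by auto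
  then show False using dsub_cancel_left[OF E k _ g(1)] g(2) by blast
qed

text \<open>Write the commutator \<open>e\<close> as a fraction \<open>A^-1 B\<close> evaluated at 1. As evaluation is injective, \<open>B = A e\<close> holds for polynomials. The constant terms give \<open>e = 1\<close>, and the linear terms give that the derivative is 0.\<close>

lemma tau_vanishes_transcendental:
  assumes E: "division_subring E" "normalizes g E" and gE: "g \<notin> E" and mv: "\<And>d. 0 < d \<Longrightarrow> moved E g d"
    and y: "y \<in> E" "y \<noteq> \<zero>" and k: "k \<in> E" and e: "iter_com y n (\<one> \<oplus> k \<otimes> g) \<in> E"
  shows "(tau y ^^ n) (k \<otimes> g) = \<zero>"
proof -
  note g = normalizesD[OF E(2)] and EC = dsub_carrier[OF E(1)] and H = graded_Hp[OF E]
  have z: "k \<otimes> g \<in> Hp E g 1" using k g by (auto simp: Hp_def)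
  have nz: "\<one> \<oplus> k \<otimes> g \<otimes> \<one> \<noteq> \<zero>" using one_plus_nonzero[OF E(1) g(1) gE k] EC[OF k] g by simp
  obtain A B where AB: "A \<in> Pol (Hp E g)" "B \<in> Pol (Hp E g)" "cf A 0 = \<one>" "cf B 0 = \<one>"
    "cf B 1 \<ominus> cf A 1 = (tau y ^^ n) (k \<otimes> g)" and ab:
    "\<forall>lam\<in>carrier R. (\<forall>i. \<forall>h\<in>Hp E g i. lam \<otimes> h = h \<otimes> lam) \<longrightarrow> y \<otimes> lam = lam \<otimes> y \<longrightarrow> \<one> \<oplus> k \<otimes> g \<otimes> lam \<noteq> \<zero> \<longrightarrow>
       ev lam A \<otimes> iter_com y n (\<one> \<oplus> k \<otimes> g \<otimes> lam) = ev lam B"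
    using iter_com_fraction[OF H EC[OF y(1)] y(2) z Hp_cj[OF E y]] by blast
  let ?e = "iter_com y n (\<one> \<oplus> k \<otimes> g)"
  note pc = Pol_carrier[OF AB(1)] Pol_carrier[OF AB(2)]
  have "ev \<one> A \<otimes> iter_com y n (\<one> \<oplus> k \<otimes> g \<otimes> \<one>) = ev \<one> B"
    using ab nz graded_carrier[OF H] EC[OF y(1)] by (metis l_one one_closed r_one)
  then have eq: "ev \<one> A \<otimes> ?e = ev \<one> B" using EC[OF k] g by simp
  have e0: "?e \<in> Hp E g 0" using e EC by (auto simp: Hp_def intro!: image_eqI)
  have eP: "mon ?e 0 \<in> Pol (Hp E g)" by (rule Pol_monom[OF H e0])
  have "ev \<one> (A \<otimes>\<^bsub>P\<^esub> mon ?e 0) = ev \<one> A \<otimes> ev \<one> (mon ?e 0)"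
    by (rule ev_mult) (use pc EC[OF e] in auto)
  also have "\<dots> = ev \<one> B" using eq EC[OF e] by (simp add: ev_mon)
  finally have "A \<otimes>\<^bsub>P\<^esub> mon ?e 0 = B" by (intro ev_one_inj[OF E mv Pol_mult[OF H AB(1) eP] AB(2)])
  then have c: "cf B i = cf A i \<otimes> ?e" for i using cf_mult_const[OF EC[OF e] pc(1)] by metis
  have "?e = \<one>" using c[of 0] AB EC[OF e] by simp
  then have "cf B 1 = cf A 1" using c[of 1] pc by simp
  then show ?thesis using AB(5) pc by simp
qed

text \<open>A right \<open>E\<close>-linear functional that separates \<open>b\<close> from \<open>a E\<close>: choose by Zorn's lemma a right \<open>E\<close>-subspace maximal among those that contain \<open>a\<close> but not \<open>b\<close>. It is a complement of \<open>b E\<close>, and the functional is the coordinate along \<open>b\<close>.\<close>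

lemma functional_exists:
  assumes E: "division_subring E" and ab: "a \<in> carrier R" "b \<in> carrier R" "\<And>e. e \<in> E \<Longrightarrow> b \<noteq> a \<otimes> e"
  shows "\<exists>f. (\<forall>x\<in>carrier R. f x \<in> E) \<and> (\<forall>x\<in>carrier R. \<forall>z\<in>carrier R. f (x \<oplus> z) = f x \<oplus> f z) \<and>
    (\<forall>x\<in>carrier R. \<forall>e\<in>E. f (x \<otimes> e) = f x \<otimes> e) \<and> f b = \<one> \<and> f a = \<zero>"
proof -
  note EC = dsub_carrier[OF E]
  define Ws where "Ws = {W. W \<subseteq> carrier R \<and> a \<in> W \<and> b \<notin> W \<and> (\<forall>x\<in>W. \<forall>z\<in>W. x \<ominus> z \<in> W) \<and> (\<forall>x\<in>W. \<forall>e\<in>E. x \<otimes> e \<in> W)}"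
  have "(\<lambda>e. a \<otimes> e) ` E \<in> Ws"
  proof -
    have "a \<otimes> e \<ominus> a \<otimes> e' = a \<otimes> (e \<ominus> e')" if "e \<in> E" "e' \<in> E" for e e'
      using that EC ab by (simp add: a_minus_def r_distr r_minus)
    moreover have "a \<otimes> e \<otimes> e' = a \<otimes> (e \<otimes> e')" if "e \<in> E" "e' \<in> E" for e e'
      using that EC ab by (simp add: m_assoc)
    moreover have "a \<in> (\<lambda>e. a \<otimes> e) ` E" using dsub_one[OF E] ab by (intro image_eqI[of _ _ \<one>]) auto
    moreover have "b \<notin> (\<lambda>e. a \<otimes> e) ` E" using ab(3) by blast
    moreover have "((\<lambda>e. a \<otimes> e) ` E) \<subseteq> carrier R" using ab(1) EC by auto
    ultimately show ?thesis unfolding Ws_def mem_Collect_eq using dsub_minus[OF E] dsub_mult[OF E]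
      by (intro conjI ballI) (auto simp del: mult_eq_zero_iff)
  qed
  then have ne: "Ws \<noteq> {}" by blast
  have ch: "\<Union>Cs \<in> Ws" if C: "Cs \<noteq> {}" "subset.chain Ws Cs" for Cs
  proof -
    have sub: "Cs \<subseteq> Ws" and lin: "\<And>V U. V \<in> Cs \<Longrightarrow> U \<in> Cs \<Longrightarrow> (V \<subseteq> U) \<or> (U \<subseteq> V)"
      using C(2) by (auto simp: subset.chain_def subset_chain_def)
    have "x \<ominus> z \<in> \<Union>Cs" if xz: "x \<in> \<Union>Cs" "z \<in> \<Union>Cs" for x z
    proof -
      obtain V U where VU: "V \<in> Cs" "x \<in> V" "U \<in> Cs" "z \<in> U" using xz by blast
      then obtain Z where "Z \<in> Cs" "x \<in> Z" "z \<in> Z" using lin[OF VU(1,3)] by blast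
      then show ?thesis using sub unfolding Ws_def by blast
    qed
    moreover have "a \<in> \<Union>Cs" using C(1) sub unfolding Ws_def by blast
    ultimately show ?thesis using sub unfolding Ws_def by blast
  qed
  obtain W where W: "W \<in> Ws" "\<And>V. V \<in> Ws \<Longrightarrow> W \<subseteq> V \<Longrightarrow> V = W"
    using subset_Zorn_nonempty[OF ne ch] by blast
  have WC: "W \<subseteq> carrier R" "a \<in> W" "b \<notin> W" and Wm: "\<And>x z. x \<in> W \<Longrightarrow> z \<in> W \<Longrightarrow> x \<ominus> z \<in> W"
    and We: "\<And>x e. x \<in> W \<Longrightarrow> e \<in> E \<Longrightarrow> x \<otimes> e \<in> W" using W(1) unfolding Ws_def by blast+
  have W0: "\<zero> \<in> W" using We[OF WC(2) dsub_zero[OF E]] ab by simp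
  have Wu: "\<ominus> x \<in> W" if "x \<in> W" for x using Wm[OF W0 that] that WC by (auto simp: a_minus_def)
  have Wa: "x \<oplus> z \<in> W" if "x \<in> W" "z \<in> W" for x z
  proof -
    have "x \<in> carrier R" "z \<in> carrier R" using that WC by auto
    then show ?thesis using Wm[OF that(1) Wu[OF that(2)]] by (simp add: a_minus_def)
  qed
  have ex: "\<exists>e\<in>E. d \<ominus> b \<otimes> e \<in> W" if d: "d \<in> carrier R" for d
  proof (cases "d \<in> W")
    case True
    then show ?thesis using dsub_zero[OF E] d ab by (intro bexI[of _ \<zero>]) (auto simp: a_minus_def)
  next
    case False
    define V where "V = {w \<oplus> d \<otimes> e | w e. w \<in> W \<and> e \<in> E}"
    have "W \<subseteq> V"
    proof
      fix w assume "w \<in> W"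
      then have "w = w \<oplus> d \<otimes> \<zero>" using WC d by auto
      then show "w \<in> V" unfolding V_def using \<open>w \<in> W\<close> dsub_zero[OF E] by blast
    qed
    moreover have "d \<in> V"
    proof -
      have "d = \<zero> \<oplus> d \<otimes> \<one>" using d by simp
      then show ?thesis unfolding V_def using W0 dsub_one[OF E] by blast
    qed
    ultimately have "V \<notin> Ws" using W(2) False by blast
    moreover have "V \<subseteq> carrier R" unfolding V_def using WC d EC by auto
    moreover have "a \<in> V" using WC \<open>W \<subseteq> V\<close> by blast
    moreover have "x \<ominus> z \<in> V" if xz: "x \<in> V" "z \<in> V" for x z
    proof -
      obtain w e w' e' where we: "x = w \<oplus> d \<otimes> e" "z = w' \<oplus> d \<otimes> e'" "w \<in> W" "w' \<in> W" "e \<in> E" "e' \<in> E"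
        using xz unfolding V_def by blast
      have c: "w \<in> carrier R" "w' \<in> carrier R" "e \<in> carrier R" "e' \<in> carrier R" using we WC EC by auto
      have "x \<ominus> z = (w \<ominus> w') \<oplus> d \<otimes> (e \<ominus> e')" 
        using we c d by (simp add: a_minus_def r_distr r_minus minus_add a_ac)
      then show ?thesis unfolding V_def using Wm[OF we(3,4)] dsub_minus[OF E we(5,6)] by blast
    qed
    moreover have "x \<otimes> h \<in> V" if xh: "x \<in> V" "h \<in> E" for x h
    proof -
      obtain w e where we: "x = w \<oplus> d \<otimes> e" "w \<in> W" "e \<in> E" using xh unfolding V_def by blast
      have c: "w \<in> carrier R" "h \<in> carrier R" "e \<in> carrier R" using we xh WC EC by auto
      have "x \<otimes> h = w \<otimes> h \<oplus> d \<otimes> (e \<otimes> h)" using we c d by (simp add: l_distr m_assoc)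
      then show ?thesis unfolding V_def using We[OF we(2) xh(2)] dsub_mult[OF E we(3) xh(2)] by blast
    qed
    ultimately have "b \<in> V" unfolding Ws_def by blast
    then obtain w e where we: "b = w \<oplus> d \<otimes> e" "w \<in> W" "e \<in> E" unfolding V_def by blast
    have c: "w \<in> carrier R" "e \<in> carrier R" using we WC EC by auto
    have "e \<noteq> \<zero>" using we WC c d by auto
    then have ie: "inv e \<in> E" "inv e \<in> carrier R" using dsub_inv[OF E we(3)] EC by auto
    have "d \<ominus> b \<otimes> inv e = \<ominus> (w \<otimes> inv e)"
    proof -
      have t: "w \<otimes> inv e \<in> carrier R" using c ie by simp
      have "b \<otimes> inv e = w \<otimes> inv e \<oplus> d" unfolding we(1) using c d ie \<open>e \<noteq> \<zero>\<close> by (simp add: l_distr m_assoc)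
      then have "d \<ominus> b \<otimes> inv e = (d \<oplus> \<ominus> d) \<oplus> \<ominus> (w \<otimes> inv e)"
        using t d by (simp add: a_minus_def minus_add a_ac)
      then show ?thesis using t d by (simp add: r_neg)
    qed
    then show ?thesis using Wu[OF We[OF we(2) ie(1)]] ie(1) by (intro bexI[of _ "inv e"]) simp_all
  qed
  define f where "f d = (SOME e. e \<in> E \<and> d \<ominus> b \<otimes> e \<in> W)" for d
  have f: "f d \<in> E" "d \<ominus> b \<otimes> f d \<in> W" if "d \<in> carrier R" for d
    using someI_ex[of "\<lambda>e. e \<in> E \<and> d \<ominus> b \<otimes> e \<in> W"] ex[OF that] unfolding f_def by auto
  have uniq: "f d = e" if d: "d \<in> carrier R" "e \<in> E" "d \<ominus> b \<otimes> e \<in> W" for d e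
  proof (rule ccontr)
    assume ne: "f d \<noteq> e"
    have c: "f d \<in> carrier R" "e \<in> carrier R" using f(1)[OF d(1)] d EC by auto
    define h where "h = f d \<ominus> e"
    have h: "h \<in> E" "h \<noteq> \<zero>" "h \<in> carrier R" unfolding h_def using dsub_minus[OF E f(1)[OF d(1)] d(2)] ne c by auto
    have "(d \<ominus> b \<otimes> e) \<ominus> (d \<ominus> b \<otimes> f d) = b \<otimes> h"
    proof -
      have "(d \<ominus> b \<otimes> e) \<ominus> (d \<ominus> b \<otimes> f d) = (d \<oplus> \<ominus> d) \<oplus> (b \<otimes> f d \<oplus> \<ominus> (b \<otimes> e))"
        using c d ab by (simp add: a_minus_def minus_add a_ac)
      then show ?thesis using c d ab by (simp add: h_def a_minus_def r_neg r_distr r_minus)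
    qed
    then have "b \<otimes> h \<in> W" using Wm[OF d(3) f(2)[OF d(1)]] by simp
    then have "b \<otimes> h \<otimes> inv h \<in> W" using We dsub_inv[OF E h(1,2)] by blast
    then show False using WC(3) h ab by (simp add: m_assoc)
  qed
  have "f (x \<oplus> z) = f x \<oplus> f z" if xz: "x \<in> carrier R" "z \<in> carrier R" for x z
  proof (rule uniq)
    have c: "f x \<in> carrier R" "f z \<in> carrier R" using f(1) xz EC by auto
    have "x \<oplus> z \<ominus> b \<otimes> (f x \<oplus> f z) = (x \<ominus> b \<otimes> f x) \<oplus> (z \<ominus> b \<otimes> f z)"
      using c xz ab by (simp add: a_minus_def r_distr minus_add a_ac)
    then show "x \<oplus> z \<ominus> b \<otimes> (f x \<oplus> f z) \<in> W" using Wa[OF f(2)[OF xz(1)] f(2)[OF xz(2)]] by simp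
    show "f x \<oplus> f z \<in> E" using dsub_add[OF E] f(1) xz by blast
  qed (use xz in auto)
  moreover have "f (x \<otimes> e) = f x \<otimes> e" if xe: "x \<in> carrier R" "e \<in> E" for x e
  proof (rule uniq)
    have c: "f x \<in> carrier R" "e \<in> carrier R" using f(1) xe EC by auto
    have "x \<otimes> e \<ominus> b \<otimes> (f x \<otimes> e) = (x \<ominus> b \<otimes> f x) \<otimes> e"
      using c xe ab by (simp add: a_minus_def l_distr l_minus m_assoc)
    then show "x \<otimes> e \<ominus> b \<otimes> (f x \<otimes> e) \<in> W" using We[OF f(2)[OF xe(1)] xe(2)] by simp
    show "f x \<otimes> e \<in> E" using dsub_mult[OF E] f(1) xe by blast
  qed (use xe EC in auto)
  moreover have "f b = \<one>" by (rule uniq) (use ab W0 dsub_one[OF E] in auto)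
  moreover have "f a = \<zero>" by (rule uniq) (use ab WC dsub_zero[OF E] in \<open>auto simp: a_minus_def\<close>)
  ultimately show ?thesis using f(1) by (intro exI[of _ f]) auto
qed

lemma functional_poly:
  assumes E: "division_subring E" and f: "\<And>x. x\<in>carrier R \<Longrightarrow> f x \<in> E" "\<And>x z. x\<in>carrier R \<Longrightarrow> z\<in>carrier R \<Longrightarrow> f (x \<oplus> z) = f x \<oplus> f z"
    "\<And>x e. x\<in>carrier R \<Longrightarrow> e\<in>E \<Longrightarrow> f (x \<otimes> e) = f x \<otimes> e" and p: "p \<in> carrier P"
  shows "\<exists>q\<in>Pol (\<lambda>_. E). (\<forall>i. cf q i = f (cf p i)) \<and> (\<forall>lam\<in>E. ev lam q = f (ev lam p))"
proof -
  note EC = dsub_carrier[OF E]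
  have f0: "f \<zero> = \<zero>" using f(3)[of \<zero> \<zero>] dsub_zero[OF E] EC[OF f(1)[of \<zero>]] by simp
  obtain n where n: "\<forall>i>n. cf p i = \<zero>" using cf_bound[OF p] ..
  define q where "q i = f (cf p i)" for i
  have "q i \<in> carrier R" "i > n \<Longrightarrow> q i = \<zero>" for i using EC[OF f(1)] p n f0 by (simp_all add: q_def)
  then have q: "q \<in> carrier P" "cf q i = q i" for i using PolI[of q n] by blast+
  have "q \<in> Pol (\<lambda>_. E)" using q f(1) p by (auto simp: Pol_def q_def)
  moreover have "ev lam q = f (ev lam p)" if lam: "lam \<in> E" for lam
  proof -
    have lR: "lam \<in> carrier R" "\<And>i::nat. lam [^] i \<in> E" using EC[OF lam] dsub_pow[OF E lam] by auto
    have sum: "f (\<Oplus>i\<in>I. g i) = (\<Oplus>i\<in>I. f (g i))" if "finite I" "g \<in> I \<rightarrow> carrier R" for I :: "nat set" and g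
      using that
    proof (induction I rule: finite_induct)
      case (insert x I)
      then have "g \<in> I \<rightarrow> carrier R" "g x \<in> carrier R" "(\<lambda>i. f (g i)) \<in> I \<rightarrow> carrier R" "f (g x) \<in> carrier R"
        using EC[OF f(1)] by auto
      then show ?case using insert by (simp add: f(2))
    qed (simp add: f0)
    have "ev lam q = (\<Oplus>i\<in>{..n}. cf q i \<otimes> lam [^] i)" by (rule ev_bound) (use q n lR f0 q_def in auto)
    also have "\<dots> = (\<Oplus>i\<in>{..n}. f (cf p i \<otimes> lam [^] i))"
      by (rule finsum_cong') (use lR p q f EC in \<open>auto simp: q_def\<close>)
    also have "\<dots> = f (ev lam p)" unfolding ev_bound[OF p lR(1) n] using lR p by (intro sum[symmetric]) auto
    finally show ?thesis .
  qed
  ultimately show ?thesis using q q_def by (intro bexI[of _ q]) auto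
qed

lemma cf_mult_low_unital:
  assumes p: "p \<in> carrier P" "q \<in> carrier P" "cf q 0 = \<one>" and z: "\<And>i. i < s \<Longrightarrow> cf (p \<otimes>\<^bsub>P\<^esub> q) i = \<zero>"
  shows "i < s \<Longrightarrow> cf p i = \<zero>" and "cf (p \<otimes>\<^bsub>P\<^esub> q) s = cf p s"
proof -
  show *: "cf p i = \<zero>" if "i < s" for i using that
  proof (induction i rule: less_induct)
    case (less i)
    have "cf (p \<otimes>\<^bsub>P\<^esub> q) (i + 0) = cf p i \<otimes> cf q 0" by (rule cf_mult_low(2)) (use less p in auto)
    then show ?case using z[OF less.prems] p by simp
  qed
  have "cf (p \<otimes>\<^bsub>P\<^esub> q) (s + 0) = cf p s \<otimes> cf q 0" by (rule cf_mult_low(2)) (use * p in auto)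
  then show "cf (p \<otimes>\<^bsub>P\<^esub> q) s = cf p s" using p by simp
qed

text \<open>The rational function \<open>A^-1 B\<close> has values in \<open>E\<close> at infinitely many scalars. Suppose that
its derivative \<open>d\<close> at 0 is outside \<open>E\<close>. Apply two right \<open>E\<close>-linear functionals to the identity
\<open>A(lam) e = B(lam)\<close>: one, \<open>f\<close>, with \<open>f d = 1\<close> and \<open>f 1 = 0\<close>, and one, \<open>h\<close>, with \<open>h 1 = 1\<close>. The results are
polynomials \<open>a\<close>, \<open>b\<close>, \<open>a0\<close>, \<open>b0\<close> over \<open>E\<close> with \<open>a(lam) e = b(lam)\<close> and \<open>a0(lam) e = b0(lam)\<close>.
The Ore condition \<open>u a = v a0\<close> eliminates \<open>e\<close>, and \<open>u b = v b0\<close> follows because the two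
sides agree at infinitely many points. The lowest terms show that \<open>a\<close> and \<open>b\<close> have the same linear
coefficient, so that \<open>f d = 0\<close>.\<close>

lemma rational_derivative:
  assumes E: "division_subring E" and L: "infinite L" "L \<subseteq> E" "\<And>lam e. lam \<in> L \<Longrightarrow> e \<in> E \<Longrightarrow> lam \<otimes> e = e \<otimes> lam"
    and A: "A \<in> carrier P" "B \<in> carrier P" "cf A 0 = \<one>" "cf B 0 = \<one>"
    and e: "\<And>lam. lam \<in> L \<Longrightarrow> \<exists>e\<in>E. ev lam A \<otimes> e = ev lam B"
  shows "cf B 1 \<ominus> cf A 1 \<in> E"
proof (rule ccontr)
  let ?v = "cf B 1 \<ominus> cf A 1"
  assume v: "?v \<notin> E"
  note EC = dsub_carrier[OF E] and H = graded_const[OF E]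
  have vR: "?v \<in> carrier R" using A by simp
  have o1: "\<one> \<noteq> \<zero> \<otimes> e" if "e \<in> E" for e using EC[OF that] one_neq_zero by simp
  have v1: "?v \<noteq> \<one> \<otimes> e" if "e \<in> E" for e using v EC[OF that] that by auto
  obtain f where f: "\<And>x. x\<in>carrier R \<Longrightarrow> f x \<in> E" "\<And>x z. x\<in>carrier R \<Longrightarrow> z\<in>carrier R \<Longrightarrow> f (x \<oplus> z) = f x \<oplus> f z"
    "\<And>x e. x\<in>carrier R \<Longrightarrow> e\<in>E \<Longrightarrow> f (x \<otimes> e) = f x \<otimes> e" "f ?v = \<one>" "f \<one> = \<zero>"
    using functional_exists[OF E one_closed vR v1] by blast
  obtain h where h: "\<And>x. x\<in>carrier R \<Longrightarrow> h x \<in> E" "\<And>x z. x\<in>carrier R \<Longrightarrow> z\<in>carrier R \<Longrightarrow> h (x \<oplus> z) = h x \<oplus> h z"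
    "\<And>x e. x\<in>carrier R \<Longrightarrow> e\<in>E \<Longrightarrow> h (x \<otimes> e) = h x \<otimes> e" "h \<one> = \<one>"
    using functional_exists[OF E zero_closed one_closed o1] by blast
  obtain a where a: "a \<in> Pol (\<lambda>_. E)" "\<And>i. cf a i = f (cf A i)" "\<And>lam. lam\<in>E \<Longrightarrow> ev lam a = f (ev lam A)"
    using functional_poly[OF E f(1-3) A(1)] by auto
  obtain b where b: "b \<in> Pol (\<lambda>_. E)" "\<And>i. cf b i = f (cf B i)" "\<And>lam. lam\<in>E \<Longrightarrow> ev lam b = f (ev lam B)"
    using functional_poly[OF E f(1-3) A(2)] by auto
  obtain a0 where a0: "a0 \<in> Pol (\<lambda>_. E)" "\<And>i. cf a0 i = h (cf A i)" "\<And>lam. lam\<in>E \<Longrightarrow> ev lam a0 = h (ev lam A)"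
    using functional_poly[OF E h(1-3) A(1)] by auto
  obtain b0 where b0: "b0 \<in> Pol (\<lambda>_. E)" "\<And>i. cf b0 i = h (cf B i)" "\<And>lam. lam\<in>E \<Longrightarrow> ev lam b0 = h (ev lam B)"
    using functional_poly[OF E h(1-3) A(2)] by auto
  have z: "cf a 0 = \<zero>" "cf b 0 = \<zero>" "cf a0 0 = \<one>" "cf b0 0 = \<one>" using a(2) b(2) a0(2) b0(2) A f h by simp_all
  then have "a0 \<noteq> \<zero>\<^bsub>P\<^esub>" using one_neq_zero by auto
  from Pol_ore[OF H a0(1) a(1) this] obtain u v where
    uv: "u \<in> Pol (\<lambda>_. E)" "v \<in> Pol (\<lambda>_. E)" "u \<noteq> \<zero>\<^bsub>P\<^esub>" "u \<otimes>\<^bsub>P\<^esub> a = v \<otimes>\<^bsub>P\<^esub> a0" by blast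
  note car = Pol_carrier[OF a(1)] Pol_carrier[OF b(1)] Pol_carrier[OF a0(1)] Pol_carrier[OF b0(1)]
    Pol_carrier[OF uv(1)] Pol_carrier[OF uv(2)]
  have uvb: "u \<otimes>\<^bsub>P\<^esub> b = v \<otimes>\<^bsub>P\<^esub> b0"
  proof (rule ev_eq_imp_eq[OF _ _ L(1)])
    fix lam assume lam: "lam \<in> L"
    then have lE: "lam \<in> E" "lam \<in> carrier R" using L(2) EC by auto
    obtain e where e: "e \<in> E" "ev lam A \<otimes> e = ev lam B" using assms(9)[OF lam] by blast
    have m: "ev lam (p \<otimes>\<^bsub>P\<^esub> q) = ev lam p \<otimes> ev lam q" if "p \<in> carrier P" "q \<in> Pol (\<lambda>_. E)" for p q
      by (rule ev_mult) (use that Pol_carrier[OF that(2)] Pol_cf[OF that(2)] lE L(3)[OF lam] in auto)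
    have eb: "ev lam b = ev lam a \<otimes> e" using b(3)[OF lE(1)] a(3)[OF lE(1)] f(3)[OF _ e(1)] A lE(2) by (simp flip: e(2))
    have eb0: "ev lam b0 = ev lam a0 \<otimes> e" using b0(3)[OF lE(1)] a0(3)[OF lE(1)] h(3)[OF _ e(1)] A lE(2) by (simp flip: e(2))
    have "ev lam (u \<otimes>\<^bsub>P\<^esub> b) = ev lam (u \<otimes>\<^bsub>P\<^esub> a) \<otimes> e"
      using m[OF car(5) b(1)] m[OF car(5) a(1)] eb car lE EC[OF e(1)] by (simp add: m_assoc)
    also have "\<dots> = ev lam (v \<otimes>\<^bsub>P\<^esub> b0)"
      unfolding uv(4) using m[OF car(6) b0(1)] m[OF car(6) a0(1)] eb0 car lE EC[OF e(1)] by (simp add: m_assoc)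
    finally show "ev lam (u \<otimes>\<^bsub>P\<^esub> b) = ev lam (v \<otimes>\<^bsub>P\<^esub> b0)" .
  next
    show "x \<otimes> y = y \<otimes> x" if "x \<in> L" "y \<in> L" for x y using L(2) L(3)[OF that(1)] that by blast
  qed (use car L(2) EC in auto)
  obtain s where s: "cf u s \<noteq> \<zero>" "\<And>i. i < s \<Longrightarrow> cf u i = \<zero>" using Pol_low[OF car(5) uv(3)] by (metis (no_types))
  have one: "cf v (Suc s) = cf u s \<otimes> cf w 1"
    if w: "w \<in> carrier P" "cf w 0 = \<zero>" "w0 \<in> carrier P" "cf w0 0 = \<one>" "u \<otimes>\<^bsub>P\<^esub> w = v \<otimes>\<^bsub>P\<^esub> w0" for w w0
  proof -
    have low: "cf (v \<otimes>\<^bsub>P\<^esub> w0) i = \<zero>" if "i < Suc s" for i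
      unfolding w(5)[symmetric] by (rule cf_mult_low(1)[where s = s and t = 1]) (use that s w car in auto)
    have "cf (v \<otimes>\<^bsub>P\<^esub> w0) (Suc s) = cf v (Suc s)"
      by (rule cf_mult_low_unital(2)[OF car(6) w(3,4) low])
    moreover have "cf (u \<otimes>\<^bsub>P\<^esub> w) (s + 1) = cf u s \<otimes> cf w 1"
      by (rule cf_mult_low(2)) (use s w car in auto)
    ultimately show ?thesis using w(5) by simp
  qed
  have "cf u s \<otimes> cf a 1 = cf u s \<otimes> cf b 1"
    using one[OF car(1) z(1) car(3) z(3) uv(4)] one[OF car(2) z(2) car(4) z(4) uvb] by simp
  then have "cf a 1 = cf b 1" using mult_left_cancel[OF UPR.coeff_closed[OF car(5)] s(1)] car by simp
  then have fe: "f (cf A 1) = f (cf B 1)" using a(2) b(2) by simp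
  have "?v \<oplus> cf A 1 = cf B 1" using A by (simp add: a_minus_def a_assoc l_neg)
  then have "f ?v \<oplus> f (cf A 1) = f (cf B 1)" using f(2)[OF vR, of "cf A 1"] A by simp
  then have "\<one> \<oplus> f (cf B 1) = f (cf B 1)" using fe f(4) by simp
  then have "\<one> = \<zero>" using EC[OF f(1)[of "cf B 1"]] A by (metis add.r_cancel_one one_closed UPR.coeff_closed a_comm)
  then show False using one_neq_zero by simp
qed

text \<open>The polynomials are taken over the centralizer of the scalars \<open>L\<close>, because their values are formed at the points of \<open>L\<close>.\<close>

lemma tau_in_subring:
  assumes E: "division_subring E" and L: "infinite L" "L \<subseteq> E" "\<And>lam e. lam \<in> L \<Longrightarrow> e \<in> E \<Longrightarrow> lam \<otimes> e = e \<otimes> lam"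
    and z: "z \<in> carrier R" "\<And>lam. lam \<in> L \<Longrightarrow> lam \<otimes> z = z \<otimes> lam" and y: "y \<in> E" "y \<noteq> \<zero>"
    and nz: "\<And>lam. lam \<in> L \<Longrightarrow> \<one> \<oplus> z \<otimes> lam \<noteq> \<zero>"
    and e: "\<And>lam. lam \<in> L \<Longrightarrow> iter_com y n (\<one> \<oplus> z \<otimes> lam) \<in> E"
  shows "(tau y ^^ n) z \<in> E"
proof -
  note EC = dsub_carrier[OF E]
  have LR: "L \<subseteq> carrier R" using L EC by auto
  define C where "C = {c \<in> carrier R. \<forall>s\<in>L. c \<otimes> s = s \<otimes> c}"
  have C: "division_subring C" unfolding C_def by (rule dsub_centralizer[OF LR])
  have zC: "z \<in> C" "y \<in> C" unfolding C_def using z(1) z(2)[symmetric] L(3)[symmetric] y EC by auto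
  have yc: "cj y a \<in> C" if "a \<in> C" for a using normalizes_cj[OF normalizes_self[OF C zC(2) y(2)] that] .
  obtain A B where AB: "A \<in> Pol (\<lambda>_. C)" "B \<in> Pol (\<lambda>_. C)" "cf A 0 = \<one>" "cf B 0 = \<one>"
    "cf B 1 \<ominus> cf A 1 = (tau y ^^ n) z" and ab:
    "\<forall>lam\<in>carrier R. (\<forall>i. \<forall>h\<in>C. lam \<otimes> h = h \<otimes> lam) \<longrightarrow> y \<otimes> lam = lam \<otimes> y \<longrightarrow> \<one> \<oplus> z \<otimes> lam \<noteq> \<zero> \<longrightarrow>
       ev lam A \<otimes> iter_com y n (\<one> \<oplus> z \<otimes> lam) = ev lam B"
    using iter_com_fraction[OF graded_const[OF C] EC[OF y(1)] y(2) zC(1) yc, of n] by blast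
  have "cf B 1 \<ominus> cf A 1 \<in> E"
  proof (rule rational_derivative[OF E L Pol_carrier[OF AB(1)] Pol_carrier[OF AB(2)] AB(3,4)])
    fix lam assume lam: "lam \<in> L"
    have "ev lam A \<otimes> iter_com y n (\<one> \<oplus> z \<otimes> lam) = ev lam B"
      using ab nz[OF lam] lam LR zC(2) unfolding C_def by auto
    then show "\<exists>e\<in>E. ev lam A \<otimes> e = ev lam B" using e[OF lam] by blast
  qed
  then show ?thesis using AB(5) by simp
qed

end

section \<open>Cyclic automorphisms of a commutative subring induced by conjugation\<close>

context skew_field
begin

lemma dsub_Int: "division_subring E \<Longrightarrow> division_subring F \<Longrightarrow> division_subring (E \<inter> F)"
  unfolding division_subring_def by blast

definition fixed_by :: "'a set \<Rightarrow> 'a \<Rightarrow> 'a set" where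
  "fixed_by K x = {k \<in> K. x \<otimes> k = k \<otimes> x}"

lemma fixed_by_dsub: assumes "division_subring K" "x \<in> carrier R" shows "division_subring (fixed_by K x)"
proof -
  have "fixed_by K x = K \<inter> {c \<in> carrier R. \<forall>s\<in>{x}. c \<otimes> s = s \<otimes> c}"
    using dsub_sub[OF assms(1)] by (auto simp: fixed_by_def)
  then show ?thesis using dsub_Int[OF assms(1) dsub_centralizer[of "{x}"]] assms by simp
qed

lemma commutes_from_powers:
  assumes a: "a \<in> carrier R" "x \<in> carrier R" "x \<noteq> \<zero>" 
    and d: "x [^] (d::nat) \<otimes> a = a \<otimes> x [^] d" "x [^] (p::nat) \<otimes> a = a \<otimes> x [^] p" "coprime d p" "0 < d"
  shows "x \<otimes> a = a \<otimes> x"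
proof -
  define C where "C = {c \<in> carrier R. \<forall>s\<in>{a}. c \<otimes> s = s \<otimes> c}"
  have C: "division_subring C" unfolding C_def by (rule dsub_centralizer) (use a in auto)
  obtain u v where uv: "d * u = p * v + 1"
    using bezout_nat[of d p] d(3,4) by (auto simp: coprime_iff_gcd_eq_1)
  have "x [^] d \<in> C" "x [^] p \<in> C" unfolding C_def using a d by auto
  then have "(x [^] d) [^] u \<in> C" "(x [^] p) [^] v \<in> C" using dsub_pow[OF C] by auto
  then have 1: "x [^] (p * v) \<otimes> x \<in> C" "x [^] (p * v) \<in> C" 
    using uv a by (simp_all add: nat_pow_pow)
  have "x \<in> C" by (rule dsub_cancel_left[OF C 1(2) _ _ 1(1)]) (use a in auto)
  then show ?thesis unfolding C_def by simp
qed

lemma pow_comm: "x \<in> carrier R \<Longrightarrow> x \<otimes> x [^] (n::nat) = x [^] n \<otimes> x"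
  by (induction n) (simp_all add: m_assoc[symmetric])

lemma cj_pow_Suc: "\<lbrakk>x \<in> carrier R; x \<noteq> \<zero>; a \<in> carrier R\<rbrakk> \<Longrightarrow> cj x (cj (x [^] (i::nat)) a) = cj (x [^] Suc i) a"
  by (simp add: cj_cj pow_comm)

lemma ev_cj:
  assumes p: "p \<in> carrier P" and y: "y \<in> carrier R" "y \<noteq> \<zero>" and lam: "lam \<in> carrier R"
    and q: "q \<in> carrier P" "\<And>i. cf q i = cj y (cf p i)"
  shows "ev (cj y lam) q = cj y (ev lam p)"
proof -
  obtain n where n: "\<forall>i>n. cf p i = \<zero>" using cf_bound[OF p] ..
  have "ev (cj y lam) q = (\<Oplus>i\<in>{..n}. cf q i \<otimes> cj y lam [^] i)"
    by (rule ev_bound[OF q(1)]) (use n y lam in \<open>auto simp: q(2)\<close>)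
  also have "\<dots> = (\<Oplus>i\<in>{..n}. cj y (cf p i \<otimes> lam [^] i))"
    by (rule finsum_cong') (use y lam p in \<open>auto simp: q(2) cj_mult cj_pow\<close>)
  also have "\<dots> = cj y (ev lam p)"
    unfolding ev_bound[OF p lam n] using y lam p by (intro cj_finsum[symmetric]) auto
  finally show ?thesis .
qed

text \<open>Conjugation by \<open>x\<close> acts on the commutative division subring \<open>K\<close> with prime order \<open>p\<close>, and \<open>a\<close> is a point that is not fixed.\<close>

definition cyc :: "'a set \<Rightarrow> 'a \<Rightarrow> nat \<Rightarrow> 'a \<Rightarrow> bool" where
  "cyc K x p a \<longleftrightarrow> division_subring K \<and> (\<forall>a\<in>K. \<forall>b\<in>K. a \<otimes> b = b \<otimes> a) \<and> normalizes x K \<and> Factorial_Ring.prime p \<and>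
     (\<forall>k\<in>K. x [^] p \<otimes> k = k \<otimes> x [^] p) \<and> a \<in> K \<and> x \<otimes> a \<noteq> a \<otimes> x"

lemma cycD: assumes "cyc K x p a"
  shows "division_subring K" "\<And>a b. a \<in> K \<Longrightarrow> b \<in> K \<Longrightarrow> a \<otimes> b = b \<otimes> a" "normalizes x K" "Factorial_Ring.prime p"
     "\<And>k. k \<in> K \<Longrightarrow> x [^] p \<otimes> k = k \<otimes> x [^] p" "a \<in> K" "x \<otimes> a \<noteq> a \<otimes> x" "x \<in> carrier R" "x \<noteq> \<zero>"
    "0 < p" "1 < p"
  using assms normalizesD prime_gt_0_nat prime_gt_1_nat unfolding cyc_def by blast+

text \<open>A conjugate of \<open>a\<close> repeated among the first \<open>p\<close> ones would be fixed by a power of \<open>x\<close> prime to \<open>p\<close>, hence by \<open>x\<close>.\<close>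

lemma cyc_inj:
  assumes c: "cyc K x p a" shows "inj_on (\<lambda>i. cj (x [^] i) a) {..<p}"
proof -
  note D = cycD[OF c] and aR = dsub_carrier[OF cycD(1)[OF c] cycD(6)[OF c]]
  have *: False if ij: "i < j" "j < p" "cj (x [^] i) a = cj (x [^] j) a" for i j
  proof -
    define d where "d = j - i"
    have d: "0 < d" "d < p" "j = i + d" using ij by (auto simp: d_def)
    have "x [^] j = x [^] i \<otimes> x [^] d" using D by (simp add: d(3) nat_pow_mult)
    then have "cj (x [^] i) a = cj (x [^] i) (cj (x [^] d) a)" using ij(3) aR D by (simp add: cj_cj)
    then have "cj (x [^] d) a = a" using cj_inj aR D by (metis cj_closed pow_nonzero nat_pow_closed)
    then have 1: "x [^] d \<otimes> a = a \<otimes> x [^] d" using cj_eq_self_iff aR D by simp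
    have "coprime d p" using D(4) d by (metis coprime_commute nat_dvd_not_less prime_imp_coprime_nat)
    then show False using commutes_from_powers[OF aR D(8,9) 1 D(5)[OF D(6)]] d(1) D(7) by blast
  qed
  show ?thesis
  proof (rule inj_onI)
    fix i j assume "i \<in> {..<p}" "j \<in> {..<p}" "cj (x [^] i) a = cj (x [^] j) a"
    then show "i = j" using *[of i j] *[of j i] by (cases i j rule: linorder_cases) auto
  qed
qed

lemma cyc_cjK: assumes c: "cyc K x p a" "k \<in> K" shows "cj (x [^] (i::nat)) k \<in> K"
  using normalizes_cj[OF normalizes_pow[OF cycD(3)[OF c(1)] dsub_sub[OF cycD(1)[OF c(1)]]] c(2)] .

lemma cyc_cjp: assumes c: "cyc K x p a" "k \<in> K" shows "cj (x [^] p) k = k"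
  using cycD[OF c(1)] dsub_carrier[OF cycD(1)[OF c(1)] c(2)] c(2) by (subst cj_eq_self_iff) auto

lemma cyc_moved: assumes c: "cyc K x p a" "0 < d" "d < p" shows "moved K x d"
proof -
  note D = cycD[OF c(1)] and aR = dsub_carrier[OF cycD(1)[OF c(1)] cycD(6)[OF c(1)]]
  have "cj (x [^] d) a \<noteq> cj (x [^] (0::nat)) a"
    using inj_onD[OF cyc_inj[OF c(1)], of d 0] c by auto
  then have "x [^] d \<otimes> a \<noteq> a \<otimes> x [^] d" using aR D cj_eq_self_iff[of "x [^] d" a] by simp
  then show ?thesis unfolding moved_def using D(2,6) by blast
qed

text \<open>Interpolate the conjugates of \<open>b\<close> at the conjugates of \<open>a\<close> by a polynomial of degree below \<open>p\<close>. Conjugation by \<open>x\<close> permutes the interpolation data cyclically, and so the polynomial, being unique, has fixed coefficients.\<close>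

lemma cyc_span:
  assumes c: "cyc K x p a" and b: "b \<in> K"
  shows "\<exists>q\<in>Pol (\<lambda>_. fixed_by K x). (\<forall>i\<ge>p. cf q i = \<zero>) \<and> ev a q = b"
proof -
  note D = cycD[OF c] and KC = dsub_carrier[OF cycD(1)[OF c]]
  define z where "z i = cj (x [^] i) a" for i :: nat
  define Z where "Z = z ` {..<p}"
  have inj: "inj_on z {..<p}" using cyc_inj[OF c] unfolding z_def .
  have Z: "finite Z" "card Z = p" "Z \<subseteq> K" unfolding Z_def
    using card_image[OF inj] cyc_cjK[OF c D(6)] by (auto simp: z_def)
  define v where "v t = cj (x [^] (inv_into {..<p} z t)) b" for t
  have v: "v (z i) = cj (x [^] i) b" if "i < p" for i
    unfolding v_def using inv_into_f_f[OF inj] that by simp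
  obtain q where q: "q \<in> Pol (\<lambda>_. K)" "\<forall>i\<ge>p. cf q i = \<zero>" "\<forall>t\<in>Z. ev t q = v t"
    using interpolation[OF D(1,2) Z(1,3), of v] cyc_cjK[OF c b] Z(2) unfolding v_def by auto
  note qc = Pol_carrier[OF q(1)]
  have evq: "ev (z i) q = cj (x [^] i) b" if "i < p" for i using q(3) v that by (auto simp: Z_def)
  define q' where "q' i = cj x (cf q i)" for i
  have "q' i \<in> carrier R" "i > p \<Longrightarrow> q' i = \<zero>" for i using D qc q(2) by (simp_all add: q'_def)
  then have q': "q' \<in> carrier P" "cf q' i = q' i" for i using PolI[of q' p] by blast+
  have zR: "z i \<in> carrier R" for i unfolding z_def using D KC by simp
  have zS: "z (Suc i) = cj x (z i)" for i unfolding z_def using D KC[OF D(6)] by (simp add: cj_pow_Suc del: nat_pow_Suc)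
  have zp: "z p = z 0" unfolding z_def using cyc_cjp[OF c D(6)] KC[OF D(6)] by simp
  have evq': "ev (z (Suc i)) q' = cj (x [^] Suc i) b" if "i < p" for i
    unfolding zS using ev_cj[OF qc D(8,9) zR q'(1)] q'(2) evq[OF that] D KC[OF b]
    by (simp add: q'_def cj_pow_Suc del: nat_pow_Suc)
  have evq'': "ev (z i) q' = cj (x [^] i) b" if "i < p" for i
  proof (cases i)
    case 0
    have "ev (z (Suc (p - 1))) q' = cj (x [^] Suc (p - 1)) b" by (rule evq') (use D in simp)
    then show ?thesis using 0 D zp cyc_cjp[OF c b] KC[OF b] by simp
  next
    case (Suc j) then show ?thesis using evq'[of j] that by simp
  qed
  let ?d = "q \<ominus>\<^bsub>P\<^esub> q'"
  have d: "?d \<in> carrier P" using qc q' by simp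
  have dn: "\<forall>i>p - 1. cf ?d i = \<zero>" using q(2) qc q' D by (auto simp: cf_minus q'_def)
  have "\<forall>i\<le>p - 1. cf ?d i = \<zero>"
  proof (rule sum_roots[of "cf ?d" Z "p - 1"])
    fix t assume "t \<in> Z"
    then obtain i where i: "i < p" "t = z i" by (auto simp: Z_def)
    have "ev t ?d = \<zero>" using ev_minus[OF qc q'(1), of t] evq[OF i(1)] evq''[OF i(1)] zR D KC[OF b] i by simp
    then show "(\<Oplus>i\<in>{..p - 1}. cf ?d i \<otimes> t [^] i) = \<zero>" using ev_bound[OF d _ dn, of t] zR i by simp
  next
    show "u \<otimes> t = t \<otimes> u" if "u \<in> Z" "t \<in> Z" for u t using D(2) Z(3) that by blast
    show "p - 1 < card Z" using Z D by simp
    show "Z \<subseteq> carrier R" using Z KC by auto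
  qed (use d Z in auto)
  then have "cf ?d i = \<zero>" for i using dn by (cases "i \<le> p - 1") auto
  then have fixd: "cj x (cf q i) = cf q i" for i using qc q' D by (simp add: cf_minus q'_def)
  have "cf q i \<in> fixed_by K x" for i
    unfolding fixed_by_def using Pol_cf[OF q(1)] fixd[of i] cj_eq_self_iff[OF D(8,9)] qc by simp
  then have "q \<in> Pol (\<lambda>_. fixed_by K x)" using qc by (simp add: Pol_def)
  moreover have "ev a q = b" using evq[of 0] D KC[OF b] KC[OF D(6)] by (simp add: z_def)
  ultimately show ?thesis using q(2) by blast
qed

lemma cyc_span_sum:
  assumes c: "cyc K x p a" and b: "b \<in> K"
  shows "\<exists>f. (\<forall>i. f i \<in> fixed_by K x) \<and> b = (\<Oplus>i\<in>{..<p}. f i \<otimes> a [^] i)"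
proof -
  note D = cycD[OF c] and KC = dsub_carrier[OF cycD(1)[OF c]]
  obtain q where q: "q\<in>Pol (\<lambda>_. fixed_by K x)" "\<forall>i\<ge>p. cf q i = \<zero>" "ev a q = b" using cyc_span[OF c b] by blast
  have "ev a q = (\<Oplus>i\<in>{..p-1}. cf q i \<otimes> a [^] i)"
    by (rule ev_bound[OF Pol_carrier[OF q(1)] KC[OF D(6)]]) (use q(2) D in auto)
  moreover have "{..p-1} = {..<p}" using D by (auto simp: less_eq_Suc_le)
  ultimately show ?thesis using q Pol_cf[OF q(1)] by (intro exI[of _ "cf q"]) auto
qed

lemma cyc_independent:
  assumes c: "cyc K x p a" and f: "\<And>i. f i \<in> fixed_by K x" and s: "(\<Oplus>i\<in>{..<p}. f i \<otimes> a [^] i) = \<zero>"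
  shows "\<forall>i<p. f i = \<zero>"
proof -
  note D = cycD[OF c] and KC = dsub_carrier[OF cycD(1)[OF c]]
  have fR: "f i \<in> carrier R" "x \<otimes> f i = f i \<otimes> x" for i using f[of i] KC by (auto simp: fixed_by_def)
  have fx: "cj (x [^] j) (f i) = f i" for i j :: nat
  proof (induction j)
    case (Suc j)
    have "cj (x [^] Suc j) (f i) = cj x (cj (x [^] j) (f i))" using cj_pow_Suc D fR by metis
    then show ?case using Suc cj_eq_self_iff[OF D(8,9)] fR by simp
  qed (use fR in simp)
  have p1: "{..p-1} = {..<p}" using D by (auto simp: less_eq_Suc_le)
  have "\<forall>i\<le>p-1. f i = \<zero>"
  proof (rule sum_roots[of f "(\<lambda>i. cj (x [^] i) a) ` {..<p}"])
    fix t assume "t \<in> (\<lambda>i. cj (x [^] i) a) ` {..<p}"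
    then obtain j where j: "j < p" "t = cj (x [^] j) a" by auto
    have "(\<Oplus>i\<in>{..<p}. f i \<otimes> t [^] i) = (\<Oplus>i\<in>{..<p}. cj (x [^] j) (f i \<otimes> a [^] i))"
      by (rule finsum_cong') (use D KC fR fx in \<open>auto simp: j cj_mult cj_pow\<close>)
    also have "\<dots> = cj (x [^] j) (\<Oplus>i\<in>{..<p}. f i \<otimes> a [^] i)"
      by (rule cj_finsum[symmetric]) (use D KC fR in auto)
    finally show "(\<Oplus>i\<in>{..p-1}. f i \<otimes> t [^] i) = \<zero>" unfolding p1 s using D by simp
  next
    show "p - 1 < card ((\<lambda>i. cj (x [^] i) a) ` {..<p})" using card_image[OF cyc_inj[OF c]] D by simp
    show "(\<lambda>i. cj (x [^] i) a) ` {..<p} \<subseteq> carrier R" using cyc_cjK[OF c D(6)] KC by auto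
    show "u \<otimes> t = t \<otimes> u" if "u \<in> (\<lambda>i. cj (x [^] i) a) ` {..<p}" "t \<in> (\<lambda>i. cj (x [^] i) a) ` {..<p}" for u t 
      using D(2) cyc_cjK[OF c D(6)] that by blast
  qed (use fR in auto)
  then show ?thesis by auto
qed

lemma cyc_infinite_fix:
  assumes c: "cyc K x p a" and inf: "infinite K"
  shows "infinite (fixed_by K x)"
proof
  assume fin: "finite (fixed_by K x)"
  have "K \<subseteq> (\<lambda>f. \<Oplus>i\<in>{..<p}. f i \<otimes> a [^] i) ` ({..<p} \<rightarrow>\<^sub>E fixed_by K x)"
  proof
    fix b assume "b \<in> K"
    then obtain f where f: "\<And>i. f i \<in> fixed_by K x" "b = (\<Oplus>i\<in>{..<p}. f i \<otimes> a [^] i)" using cyc_span_sum[OF c] by blast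
    have R: "f i \<in> carrier R" "a \<in> carrier R" for i using f(1)[of i] dsub_carrier[OF cycD(1)[OF c]] cycD(6)[OF c] by (auto simp: fixed_by_def)
    have "b = (\<Oplus>i\<in>{..<p}. restrict f {..<p} i \<otimes> a [^] i)" unfolding f(2) 
      by (rule finsum_cong') (use R in auto)
    then show "b \<in> (\<lambda>f. \<Oplus>i\<in>{..<p}. f i \<otimes> a [^] i) ` ({..<p} \<rightarrow>\<^sub>E fixed_by K x)"
      using f(1) by (intro image_eqI[of _ _ "restrict f {..<p}"]) auto
  qed
  then show False using inf finite_subset finite_imageI[OF finite_PiE[of "{..<p}" "\<lambda>_. fixed_by K x"]] fin by blast
qed

text \<open>Induction on the order \<open>m\<close> of the action: factor out a prime \<open>p\<close>, pass to the fixed field of \<open>g^(m/p)\<close>, which is infinite because \<open>L\<close> is finite over it, and continue with \<open>g\<close> on that field.\<close>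

lemma infinite_fix:
  fixes m :: nat
  assumes "division_subring L" "\<And>a b. a \<in> L \<Longrightarrow> b \<in> L \<Longrightarrow> a \<otimes> b = b \<otimes> a" "infinite L" "normalizes g L"
    "0 < m" "\<And>k. k \<in> L \<Longrightarrow> g [^] m \<otimes> k = k \<otimes> g [^] m"
  shows "infinite (fixed_by L g)"
  using assms
proof (induction m arbitrary: L rule: less_induct)
  case (less m)
  note g = normalizesD[OF less.prems(4)] and LC = dsub_carrier[OF less.prems(1)]
  show ?case
  proof (cases "m = 1")
    case True
    then have "fixed_by L g = L" using less.prems(6) g by (auto simp: fixed_by_def)
    then show ?thesis using less.prems(3) by simp
  next
    case False
    then obtain p where p: "Factorial_Ring.prime p" "p dvd m" using prime_factor_nat by blast
    define d where "d = m div p"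
    have d: "m = d * p" "0 < d" "d < m" using p less.prems(5) prime_gt_1_nat[OF p(1)] by (auto simp: d_def dvd_div_mult_self)
    define h where "h = g [^] d"
    have h: "h \<in> carrier R" "h \<noteq> \<zero>" "h [^] p = g [^] m" "normalizes h L"
      unfolding h_def using g normalizes_pow[OF less.prems(4) dsub_sub[OF less.prems(1)]] by (auto simp: nat_pow_pow d(1))
    have inf: "infinite (fixed_by L h)"
    proof (cases "\<exists>a\<in>L. h \<otimes> a \<noteq> a \<otimes> h")
      case True
      then obtain a where "a \<in> L" "h \<otimes> a \<noteq> a \<otimes> h" by blast
      then have "cyc L h p a" unfolding cyc_def using less.prems p h by simp
      then show ?thesis using cyc_infinite_fix less.prems(3) by blast
    next
      case False
      then have "fixed_by L h = L" by (auto simp: fixed_by_def)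
      then show ?thesis using less.prems(3) by simp
    qed
    have gh: "g \<otimes> h = h \<otimes> g" unfolding h_def using g by (simp add: pow_comm)
    have hh: "h \<otimes> cj g' k = cj g' k \<otimes> h" if "k \<in> fixed_by L h" "g' \<in> carrier R" "g' \<noteq> \<zero>" "g' \<otimes> h = h \<otimes> g'" for g' k
    proof -
      have k: "k \<in> carrier R" "h \<otimes> k = k \<otimes> h" using that LC by (auto simp: fixed_by_def)
      have "cj h (cj g' k) = cj g' (cj h k)" using k h that by (simp add: cj_cj)
      also have "cj h k = k" using k h cj_eq_self_iff by simp
      finally show ?thesis using cj_eq_self_iff[of h "cj g' k"] h k that by simp
    qed
    have igh: "inv g \<otimes> h = h \<otimes> inv g"
    proof -
      have "inv g \<otimes> h = inv g \<otimes> (h \<otimes> g) \<otimes> inv g" using g h by (simp add: m_assoc)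
      also have "\<dots> = h \<otimes> inv g" using g h by (simp flip: gh)
      finally show ?thesis .
    qed
    have n: "normalizes g (fixed_by L h)"
    proof (rule normalizesI)
      fix k assume k: "k \<in> fixed_by L h"
      then have kL: "k \<in> L" by (simp add: fixed_by_def)
      show "cj g k \<in> fixed_by L h" using hh[OF k g gh] normalizes_cj[OF less.prems(4) kL] by (simp add: fixed_by_def)
      show "cj (inv g) k \<in> fixed_by L h" using hh[OF k _ _ igh] g normalizes_cj[OF normalizes_inv[OF less.prems(4) dsub_sub[OF less.prems(1)]] kL]
        by (simp add: fixed_by_def)
    qed (use g LC in \<open>auto simp: fixed_by_def\<close>)
    have "infinite (fixed_by (fixed_by L h) g)"
    proof (rule less.IH[OF d(3) fixed_by_dsub[OF less.prems(1) h(1)] _ inf n d(2)])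
      show "a \<otimes> b = b \<otimes> a" if "a \<in> fixed_by L h" "b \<in> fixed_by L h" for a b using that less.prems(2) by (auto simp: fixed_by_def)
      show "g [^] d \<otimes> k = k \<otimes> g [^] d" if "k \<in> fixed_by L h" for k using that by (simp add: fixed_by_def h_def)
    qed
    moreover have "fixed_by (fixed_by L h) g \<subseteq> fixed_by L g" by (auto simp: fixed_by_def)
    ultimately show ?thesis using infinite_super by blast
  qed
qed

section \<open>Cyclic division algebras over finite fields do not exist\<close>

text \<open>Partial norm products; for \<open>n = p\<close> this is the norm of \<open>k\<close> to the fixed field.\<close>

fun Nr :: "'a \<Rightarrow> 'a \<Rightarrow> nat \<Rightarrow> 'a" where
  "Nr x k 0 = \<one>"
| "Nr x k (Suc n) = Nr x k n \<otimes> cj (x [^] n) k"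

lemma Nr_K: assumes c: "cyc K x p a" "k \<in> K" shows "Nr x k n \<in> K"
  using cycD(1)[OF c(1)] cyc_cjK[OF c(1,2)] by (induction n) (auto intro: dsub_intros)

lemma Nr_pow: assumes c: "cyc K x p a" "k \<in> K" shows "(k \<otimes> x) [^] n = Nr x k n \<otimes> x [^] n"
proof (induction n)
  case (Suc n)
  note D = cycD[OF c(1)] and KC = dsub_carrier[OF cycD(1)[OF c(1)]]
  note R = KC[OF c(2)] KC[OF Nr_K[OF c]] KC[OF cyc_cjK[OF c]]
  have "(k \<otimes> x) [^] Suc n = Nr x k n \<otimes> (x [^] n \<otimes> k) \<otimes> x" using Suc R D by (simp add: m_assoc)
  also have "x [^] n \<otimes> k = cj (x [^] n) k \<otimes> x [^] n" using cj_mult_left R D by simp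
  finally show ?case using R D by (simp add: m_assoc)
qed simp

lemma Nr_nonzero: assumes c: "cyc K x p a" "k \<in> K" "k \<noteq> \<zero>" shows "Nr x k n \<noteq> \<zero>"
proof (induction n)
  case (Suc n)
  note D = cycD[OF c(1)] and KC = dsub_carrier[OF cycD(1)[OF c(1)]]
  note R = KC[OF c(2)] KC[OF Nr_K[OF c(1,2)]] KC[OF cyc_cjK[OF c(1,2)]]
  then show ?case using Suc c D by simp
qed (use one_neq_zero in simp)

text \<open>The cocycle property of the partial norm products, which drives both the invariance of the norm and the proof of Hilbert's Theorem 90.\<close>

lemma Nr_shift: assumes c: "cyc K x p a" "k \<in> K" shows "k \<otimes> cj x (Nr x k n) = Nr x k (Suc n)"
proof (induction n)
  case 0 then show ?case using cycD[OF c(1)] dsub_carrier[OF cycD(1)[OF c(1)] c(2)] by simp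
next
  case (Suc n)
  note D = cycD[OF c(1)] and KC = dsub_carrier[OF cycD(1)[OF c(1)]]
  note R = KC[OF c(2)] KC[OF Nr_K[OF c]] KC[OF cyc_cjK[OF c]]
  have "k \<otimes> cj x (Nr x k (Suc n)) = (k \<otimes> cj x (Nr x k n)) \<otimes> cj (x [^] Suc n) k"
    using R D cj_pow_Suc[of x k n] by (simp add: cj_mult m_assoc del: nat_pow_Suc)
  then show ?case using Suc by simp
qed

lemma Nr_fixed: assumes c: "cyc K x p a" "k \<in> K" shows "Nr x k p \<in> fixed_by K x"
proof (cases "k = \<zero>")
  note D = cycD[OF c(1)] and KC = dsub_carrier[OF cycD(1)[OF c(1)]]
  note R = KC[OF c(2)] KC[OF Nr_K[OF c]] KC[OF cyc_cjK[OF c]]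
  {
    case True
    obtain m where m: "p = Suc m" using D(10) by (cases p) auto
    have "Nr x k p = \<zero>" unfolding m using D(8,9) R(2)[of m] True by simp
    then show ?thesis using dsub_zero[OF D(1)] D by (simp add: fixed_by_def)
  next
    case False
    have "k \<otimes> cj x (Nr x k p) = Nr x k p \<otimes> k" using Nr_shift[OF c, of p] cyc_cjp[OF c] by simp
    also have "\<dots> = k \<otimes> Nr x k p" using D(2)[OF Nr_K[OF c] c(2)] .
    finally have "cj x (Nr x k p) = Nr x k p" using mult_left_cancel[OF R(1) False] R D by simp
    then show ?thesis using cj_eq_self_iff[OF D(8,9) R(2)] Nr_K[OF c] by (simp add: fixed_by_def)
  }
qed

lemma Nr_mult: assumes c: "cyc K x p a" "k \<in> K" "l \<in> K" shows "Nr x (k \<otimes> l) n = Nr x k n \<otimes> Nr x l n"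
proof (induction n)
  case (Suc n)
  note D = cycD[OF c(1)] and KC = dsub_carrier[OF cycD(1)[OF c(1)]]
  note R = KC[OF c(2)] KC[OF c(3)] KC[OF Nr_K[OF c(1,2)]] KC[OF Nr_K[OF c(1,3)]] KC[OF cyc_cjK[OF c(1,2)]] KC[OF cyc_cjK[OF c(1,3)]]
  have "Nr x (k \<otimes> l) (Suc n) = Nr x k n \<otimes> (Nr x l n \<otimes> cj (x [^] n) k) \<otimes> cj (x [^] n) l"
    using Suc R D by (simp add: cj_mult m_assoc)
  also have "Nr x l n \<otimes> cj (x [^] n) k = cj (x [^] n) k \<otimes> Nr x l n" using D(2) Nr_K[OF c(1,3)] cyc_cjK[OF c(1,2)] by blast
  finally show ?case using R by (simp add: m_assoc)
qed simp

text \<open>Dedekind's independence of the powers of the automorphism: replace \<open>b\<close> by \<open>a b\<close> and subtract a multiple of the original relation to eliminate the last term.\<close>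

lemma cyc_characters_independent:
  assumes c: "cyc K x p a" and n: "n \<le> p" and f: "\<And>i. f i \<in> K"
    and s: "\<And>b. b \<in> K \<Longrightarrow> (\<Oplus>i\<in>{..<n}. f i \<otimes> cj (x [^] i) b) = \<zero>"
  shows "\<forall>i<n. f i = \<zero>"
  using n f s
proof (induction n arbitrary: f)
  case (Suc n)
  note D = cycD[OF c] and KC = dsub_carrier[OF cycD(1)[OF c]]
  define z where "z i = cj (x [^] i) a" for i :: nat
  have zK: "z i \<in> K" "z i \<in> carrier R" for i using cyc_cjK[OF c D(6)] KC by (auto simp: z_def)
  have xR: "cj (x [^] i) b \<in> K" "cj (x [^] i) b \<in> carrier R" if "b \<in> K" for i :: nat and b 
    using cyc_cjK[OF c that] KC by auto
  have fR: "f i \<in> carrier R" for i using Suc.prems KC by blast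
  define f' where "f' i = f i \<otimes> (z i \<ominus> z n)" for i
  have f'K: "f' i \<in> K" for i unfolding f'_def by (intro dsub_mult[OF D(1)] dsub_minus[OF D(1)] Suc.prems(2) zK(1))
  have "\<forall>i<n. f' i = \<zero>"
  proof (rule Suc.IH[OF _ f'K])
    fix b assume b: "b \<in> K"
    note bR = KC[OF b] KC[OF D(6)]
    have ab: "a \<otimes> b \<in> K" using dsub_mult[OF D(1,6) b] .
    define S where "S h = (\<Oplus>i\<in>{..<Suc n}. h i)" for h :: "nat \<Rightarrow> 'a"
    have "S (\<lambda>i. f i \<otimes> cj (x [^] i) (a \<otimes> b)) \<oplus> S (\<lambda>i. f i \<otimes> cj (x [^] i) b) \<otimes> (\<ominus> z n)
        = S (\<lambda>i. f i \<otimes> cj (x [^] i) (a \<otimes> b)) \<oplus> S (\<lambda>i. f i \<otimes> cj (x [^] i) b \<otimes> (\<ominus> z n))"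
      unfolding S_def using fR xR[OF b] zK by (subst finsum_ldistr) auto
    also have "\<dots> = S (\<lambda>i. f i \<otimes> cj (x [^] i) (a \<otimes> b) \<oplus> f i \<otimes> cj (x [^] i) b \<otimes> (\<ominus> z n))"
      unfolding S_def using fR xR[OF b] xR[OF ab] zK by (subst finsum_addf) auto
    also have "\<dots> = S (\<lambda>i. f' i \<otimes> cj (x [^] i) b)" unfolding S_def
    proof (rule finsum_cong')
      fix i assume "i \<in> {..<Suc n}"
      have "f i \<otimes> cj (x [^] i) b \<otimes> (\<ominus> z n) = f i \<otimes> ((\<ominus> z n) \<otimes> cj (x [^] i) b)"
        using D(2)[OF xR(1)[OF b] dsub_uminus[OF D(1) zK(1)], of i n] fR xR(2)[OF b] zK by (simp add: m_assoc)
      moreover have "f i \<otimes> cj (x [^] i) (a \<otimes> b) = f i \<otimes> (z i \<otimes> cj (x [^] i) b)"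
        using bR D by (simp add: cj_mult z_def)
      ultimately show "f i \<otimes> cj (x [^] i) (a \<otimes> b) \<oplus> f i \<otimes> cj (x [^] i) b \<otimes> (\<ominus> z n) = f' i \<otimes> cj (x [^] i) b"
        unfolding f'_def a_minus_def using fR xR(2)[OF b] zK by (simp add: m_assoc l_distr r_distr)
    qed (use f'K KC xR[OF b] in auto)
    also have "\<dots> = (\<Oplus>i\<in>{..<n}. f' i \<otimes> cj (x [^] i) b)" unfolding S_def
      using f'K KC xR[OF b] zK by (subst finsum_insert[of "{..<n}" n, folded lessThan_Suc]) (auto simp: f'_def[of n] fR)
    finally show "(\<Oplus>i\<in>{..<n}. f' i \<otimes> cj (x [^] i) b) = \<zero>"
      unfolding S_def Suc.prems(3)[OF ab] Suc.prems(3)[OF b] using zK by simp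
  qed (use Suc.prems in simp)
  moreover have "z i \<noteq> z n" if "i < n" for i
    using inj_onD[OF cyc_inj[OF c], of i n] that Suc.prems(1) unfolding z_def by auto
  ultimately have f0: "f i = \<zero>" if "i < n" for i using that fR zK unfolding f'_def by simp
  have "\<zero> = (\<Oplus>i\<in>{..<Suc n}. f i \<otimes> cj (x [^] i) \<one>)" using Suc.prems(3)[OF dsub_one[OF D(1)]] by simp
  also have "\<dots> = f n \<oplus> (\<Oplus>i\<in>{..<n}. f i \<otimes> cj (x [^] i) \<one>)"
    using fR D by (subst finsum_insert[of "{..<n}" n, folded lessThan_Suc]) auto
  also have "(\<Oplus>i\<in>{..<n}. f i \<otimes> cj (x [^] i) \<one>) = (\<Oplus>i\<in>{..<n}. \<zero>)"
    by (rule finsum_cong') (use f0 D in auto)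
  finally have "f n = \<zero>" using fR by simp
  then show ?case using f0 less_Suc_eq by auto
qed simp

text \<open>The Lagrange resolvent of a suitable \<open>b\<close> is nonzero by the independence of the automorphisms.\<close>

lemma hilbert90:
  assumes c: "cyc K x p a" and k: "k \<in> K" "Nr x k p = \<one>"
  shows "\<exists>l\<in>K. l \<noteq> \<zero> \<and> k = l \<otimes> inv (cj x l)"
proof -
  note D = cycD[OF c] and KC = dsub_carrier[OF cycD(1)[OF c]]
  have "\<exists>b\<in>K. (\<Oplus>i\<in>{..<p}. Nr x k i \<otimes> cj (x [^] i) b) \<noteq> \<zero>"
  proof (rule ccontr)
    assume "\<not> ?thesis"
    then have "\<forall>i<p. Nr x k i = \<zero>" by (intro cyc_characters_independent[OF c order_refl]) (use Nr_K[OF c k(1)] in auto)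
    then show False using D(10) one_neq_zero by force
  qed
  then obtain b where b: "b \<in> K" "(\<Oplus>i\<in>{..<p}. Nr x k i \<otimes> cj (x [^] i) b) \<noteq> \<zero>" by blast
  define t where "t i = Nr x k i \<otimes> cj (x [^] i) b" for i
  have tK: "t i \<in> K" for i unfolding t_def by (intro dsub_mult[OF D(1)] Nr_K[OF c k(1)] cyc_cjK[OF c b(1)])
  note R = KC[OF k(1)] KC[OF b(1)] KC[OF tK] KC[OF Nr_K[OF c k(1)]]
  define l where "l = (\<Oplus>i\<in>{..<p}. t i)"
  have "l \<in> K" unfolding l_def by (rule dsub_finsum[OF D(1)]) (use tK in auto)
  moreover have "l \<noteq> \<zero>" using b(2) unfolding l_def t_def .
  ultimately have l: "l \<in> K" "l \<noteq> \<zero>" by auto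
  have tS: "k \<otimes> cj x (t i) = t (Suc i)" for i
  proof -
    have "k \<otimes> cj x (t i) = (k \<otimes> cj x (Nr x k i)) \<otimes> cj (x [^] Suc i) b"
      unfolding t_def using R D cj_pow_Suc[of x b i] by (simp add: cj_mult m_assoc del: nat_pow_Suc)
    then show ?thesis unfolding Nr_shift[OF c k(1)] t_def .
  qed
  have tp: "t p = t 0" unfolding t_def k(2) using cyc_cjp[OF c b(1)] R by simp
  have tS': "(\<Oplus>i\<in>{..<n}. t (Suc i)) \<oplus> t 0 = (\<Oplus>i\<in>{..<n}. t i) \<oplus> t n" for n
  proof (induction n)
    case (Suc n)
    have "(\<Oplus>i\<in>{..<Suc n}. t (Suc i)) \<oplus> t 0 = t (Suc n) \<oplus> ((\<Oplus>i\<in>{..<n}. t (Suc i)) \<oplus> t 0)"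
      using R by (subst finsum_insert[of "{..<n}" n, folded lessThan_Suc]) (auto simp: a_assoc)
    also have "\<dots> = (\<Oplus>i\<in>{..<Suc n}. t i) \<oplus> t (Suc n)"
      unfolding Suc using R by (subst finsum_insert[of "{..<n}" n, folded lessThan_Suc]) (auto simp: a_ac)
    finally show ?case .
  qed (use R in simp)
  have "k \<otimes> cj x l = (\<Oplus>i\<in>{..<p}. k \<otimes> cj x (t i))"
    unfolding l_def using R D by (subst cj_finsum) (auto simp: finsum_rdistr)
  also have "\<dots> = (\<Oplus>i\<in>{..<p}. t (Suc i))" unfolding tS ..
  also have "\<dots> = l"
  proof -
    have S: "(\<Oplus>i\<in>{..<p}. t (Suc i)) \<in> carrier R" using R by auto
    show ?thesis using tS'[of p] S R KC[OF l(1)] unfolding tp l_def[symmetric] by (metis add.r_cancel)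
  qed
  finally have kl: "k \<otimes> cj x l = l" .
  have "l \<otimes> inv (cj x l) = k \<otimes> cj x l \<otimes> inv (cj x l)" by (simp only: kl)
  also have "\<dots> = k" using KC[OF l(1)] l(2) R D by (simp add: m_assoc)
  finally show ?thesis using l by (intro bexI[of _ l]) auto
qed

lemma card_eq_fibres:
  assumes "finite S" shows "card S = (\<Sum>y\<in>f ` S. card {s \<in> S. f s = y})"
  using sum.image_gen[OF assms, of "\<lambda>_. 1::nat" f] by simp

text \<open>If \<open>K\<close> is finite, the norm from \<open>K\<close> to the fixed field is surjective on nonzero elements: the fibres
of \<open>k \<mapsto> k (x k x^-1)^-1\<close> have at least as many elements as the fixed field has nonzero ones,
and by Hilbert's Theorem 90 every fibre of the norm is at most as large as the image of this map. So there is
\<open>w = k x\<close> with \<open>w^p = 1\<close>. Then \<open>1 + w + ... + w^(p-1)\<close> is annihilated by \<open>w - 1\<close>, but it is nonzero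
because the powers of \<open>x\<close> are independent over \<open>K\<close>. Hence \<open>w = 1\<close>, and \<open>x\<close> lies in \<open>K\<close>.\<close>

lemma no_finite_cyclic:
  assumes c: "cyc K x p a" and fin: "finite K" and xp: "x [^] p \<in> K"
  shows False
proof -
  note D = cycD[OF c] and KC = dsub_carrier[OF cycD(1)[OF c]]
  have F1: "division_subring (fixed_by K x)" by (rule fixed_by_dsub[OF D(1,8)])
  define Ks where "Ks = K - {\<zero>}"
  define Fs where "Fs = fixed_by K x - {\<zero>}"
  define phi where "phi l = l \<otimes> inv (cj x l)" for l
  define N where "N k = Nr x k p" for k
  have fins: "finite Ks" "finite Fs" using fin by (auto simp: Ks_def Fs_def fixed_by_def)
  have cjx: "cj x l \<in> K" if "l \<in> K" for l using normalizes_cj[OF D(3) that] .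
  have fib1: "card {s \<in> Ks. phi s = y} \<ge> card Fs" if y: "y \<in> phi ` Ks" for y
  proof -
    obtain l where l: "l \<in> Ks" "y = phi l" using y by blast
    have lR: "l \<in> carrier R" "l \<noteq> \<zero>" using l KC by (auto simp: Ks_def)
    have "(\<lambda>f. l \<otimes> f) ` Fs \<subseteq> {s \<in> Ks. phi s = y}"
    proof
      fix s assume "s \<in> (\<lambda>f. l \<otimes> f) ` Fs"
      then obtain f where f: "f \<in> fixed_by K x" "f \<noteq> \<zero>" "s = l \<otimes> f" by (auto simp: Fs_def)
      have fR: "f \<in> K" "f \<in> carrier R" "x \<otimes> f = f \<otimes> x" using f KC by (auto simp: fixed_by_def)
      have cf: "cj x f = f" using fR cj_eq_self_iff D by simp
      have "phi s = l \<otimes> (f \<otimes> inv f) \<otimes> inv (cj x l)"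
      proof -
        have "phi s = l \<otimes> f \<otimes> inv (cj x l \<otimes> f)" unfolding phi_def f(3) using lR fR D cf by (simp add: cj_mult)
        also have "cj x l \<otimes> f = f \<otimes> cj x l" using D(2) cjx l(1) fR(1) by (auto simp: Ks_def)
        finally have "phi s = l \<otimes> f \<otimes> (inv (cj x l) \<otimes> inv f)" using lR fR D f(2) by (simp add: sf_inv_mult)
        also have "inv (cj x l) \<otimes> inv f = inv f \<otimes> inv (cj x l)"
          using D(2)[of "inv (cj x l)" "inv f"] dsub_inv[OF D(1)] cjx[of l] l(1) lR fR f(2) D by (auto simp: Ks_def)
        finally show ?thesis using lR fR D f(2) by (simp add: m_assoc)
      qed
      then have "phi s = y" using l(2) lR fR f(2) D by (simp add: phi_def)
      moreover have "s \<in> Ks" using l fR f lR dsub_mult[OF D(1)] by (auto simp: Ks_def)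
      ultimately show "s \<in> {s \<in> Ks. phi s = y}" by simp
    qed
    moreover have "inj_on (\<lambda>f. l \<otimes> f) Fs" 
      using mult_left_cancel[OF lR] KC by (intro inj_onI) (auto simp: Fs_def fixed_by_def)
    ultimately show ?thesis using card_inj_on_le[of "\<lambda>f. l \<otimes> f" Fs "{s \<in> Ks. phi s = y}"] fins by simp
  qed
  have fib2: "card {s \<in> Ks. N s = y} \<le> card (phi ` Ks)" if y: "y \<in> N ` Ks" for y
  proof -
    obtain k where k: "k \<in> Ks" "y = N k" using y by blast
    have kR: "k \<in> K" "k \<in> carrier R" "k \<noteq> \<zero>" using k KC by (auto simp: Ks_def)
    have ik: "inv k \<in> K" using dsub_inv[OF D(1) kR(1,3)] .
    have "(\<lambda>s. inv k \<otimes> s) ` {s \<in> Ks. N s = y} \<subseteq> phi ` Ks"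
    proof
      fix u assume "u \<in> (\<lambda>s. inv k \<otimes> s) ` {s \<in> Ks. N s = y}"
      then obtain s where s: "s \<in> K" "s \<noteq> \<zero>" "N s = N k" "u = inv k \<otimes> s" using k by (auto simp: Ks_def)
      have sR: "s \<in> carrier R" using s KC by blast
      have uK: "u \<in> K" using s ik dsub_mult[OF D(1)] by blast
      have "k \<otimes> u = s" using s sR kR by simp
      then have "Nr x k p \<otimes> Nr x u p = Nr x s p" using Nr_mult[OF c kR(1) uK] by simp
      then have "Nr x k p \<otimes> Nr x u p = Nr x k p \<otimes> \<one>" using s(3) KC[OF Nr_K[OF c kR(1)]] by (simp add: N_def)
      then have "Nr x u p = \<one>"
        using mult_left_cancel[OF KC[OF Nr_K[OF c kR(1)]] Nr_nonzero[OF c kR(1,3)] KC[OF Nr_K[OF c uK]] one_closed] by blast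
      from hilbert90[OF c uK this] show "u \<in> phi ` Ks" by (auto simp: phi_def Ks_def)
    qed
    moreover have "inj_on (\<lambda>s. inv k \<otimes> s) {s \<in> Ks. N s = y}"
      using mult_left_cancel[of "inv k"] kR KC by (intro inj_onI) (auto simp: Ks_def)
    ultimately show ?thesis using card_inj_on_le[of "\<lambda>s. inv k \<otimes> s" "{s \<in> Ks. N s = y}" "phi ` Ks"] fins by simp
  qed
  have NF: "N ` Ks \<subseteq> Fs" using Nr_fixed[OF c] Nr_nonzero[OF c] by (auto simp: N_def Ks_def Fs_def)
  have "card (phi ` Ks) * card Fs \<le> card Ks"
    unfolding card_eq_fibres[OF fins(1), of phi] using sum_mono[of "phi ` Ks" "\<lambda>_. card Fs"] fib1 by simp
  also have "\<dots> \<le> card (N ` Ks) * card (phi ` Ks)"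
    unfolding card_eq_fibres[OF fins(1), of N] using sum_mono[of "N ` Ks" _ "\<lambda>_. card (phi ` Ks)"] fib2 by simp
  finally have "card Fs * card (phi ` Ks) \<le> card (N ` Ks) * card (phi ` Ks)" by (simp add: mult.commute)
  moreover have "card (phi ` Ks) > 0" 
    using fins dsub_one[OF D(1)] one_neq_zero by (auto simp: card_gt_0_iff Ks_def)
  ultimately have "card Fs \<le> card (N ` Ks)" by simp
  then have surj: "N ` Ks = Fs" using NF fins by (metis card_seteq)
  have xpR: "x [^] p \<in> carrier R" "x [^] p \<noteq> \<zero>" using D by auto
  have "x \<otimes> x [^] p = x [^] p \<otimes> x" using D by (simp add: pow_comm)
  then have "x [^] p \<in> fixed_by K x" using xp by (simp add: fixed_by_def)
  then have "inv (x [^] p) \<in> Fs" using dsub_inv[OF F1] xpR by (simp add: Fs_def)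
  then have "inv (x [^] p) \<in> N ` Ks" using surj by simp
  then obtain k where "k \<in> Ks" "N k = inv (x [^] p)" by (metis imageE)
  then have k: "k \<in> K" "k \<noteq> \<zero>" "Nr x k p = inv (x [^] p)" by (auto simp: N_def Ks_def)
  define w where "w = k \<otimes> x"
  have wR: "w \<in> carrier R" using k KC D by (simp add: w_def)
  have wp: "w [^] p = \<one>" unfolding w_def Nr_pow[OF c k(1)] k(3) using xpR by simp
  define s where "s n = (\<Oplus>i\<in>{..<n}. w [^] i)" for n :: nat
  have sR: "s n \<in> carrier R" for n unfolding s_def using wR by auto
  have "s n \<otimes> w \<oplus> \<one> = s n \<oplus> w [^] n" for n
  proof (induction n)
    case (Suc n)
    have sS: "s (Suc n) = w [^] n \<oplus> s n" unfolding s_def 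
      using wR by (subst finsum_insert[of "{..<n}" n, folded lessThan_Suc]) auto
    have "s (Suc n) \<otimes> w \<oplus> \<one> = w [^] Suc n \<oplus> (s n \<otimes> w \<oplus> \<one>)" unfolding sS using sR wR by (simp add: l_distr a_assoc)
    also have "\<dots> = s (Suc n) \<oplus> w [^] Suc n" unfolding Suc sS using sR wR by (simp add: a_ac)
    finally show ?case .
  qed (use wR in \<open>simp add: s_def\<close>)
  from this[of p] have "s p \<otimes> w = s p" unfolding wp using sR wR by simp
  then have "s p \<otimes> w = s p \<otimes> \<one>" using sR by simp
  moreover have "s p \<noteq> \<zero>"
  proof
    assume "s p = \<zero>"
    then have "\<forall>i<p. w [^] i = \<zero>" unfolding s_def
    proof (intro powers_independent[OF D(1,3)])
      show "moved K x d" if "0 < d" "d < p" for d using cyc_moved[OF c that] .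
      show "w [^] i \<in> Hp K x i" for i unfolding w_def Nr_pow[OF c k(1)] Hp_def using Nr_K[OF c k(1)] by blast
    qed
    then show False using D(10) one_neq_zero by force
  qed
  ultimately have "w = \<one>" using mult_left_cancel[OF sR] wR by blast
  then have "k \<otimes> x \<in> K" using dsub_one[OF D(1)] by (simp add: w_def)
  then have "x \<in> K" using dsub_cancel_left[OF D(1) k(1,2) D(8)] by blast
  then show False using D(2,6,7) by blast
qed

end

section \<open>The abelian normal subgroup and its field\<close>

context skew_field
begin

definition Fc :: "'a set" where
  "Fc = {z \<in> carrier R. \<forall>x\<in>carrier R. z \<otimes> x = x \<otimes> z}"

lemma Fc_dsub: "division_subring Fc"
  unfolding Fc_def by (rule dsub_centralizer) simp

definition mult_subgroup :: "'a set \<Rightarrow> bool" where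
  "mult_subgroup H \<longleftrightarrow> H \<subseteq> carrier R - {\<zero>} \<and> \<one> \<in> H \<and> (\<forall>a\<in>H. \<forall>b\<in>H. a \<otimes> b \<in> H) \<and> (\<forall>a\<in>H. inv a \<in> H)"

lemma grpD: assumes "mult_subgroup H"
  shows "\<And>a. a \<in> H \<Longrightarrow> a \<in> carrier R" "\<And>a. a \<in> H \<Longrightarrow> a \<noteq> \<zero>" "\<one> \<in> H"
    "\<And>a b. a \<in> H \<Longrightarrow> b \<in> H \<Longrightarrow> a \<otimes> b \<in> H" "\<And>a. a \<in> H \<Longrightarrow> inv a \<in> H"
  using assms unfolding mult_subgroup_def by blast+

lemma grp_pow: "mult_subgroup H \<Longrightarrow> a \<in> H \<Longrightarrow> a [^] (n::nat) \<in> H"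
  by (induction n) (simp_all add: grpD(3,4))

lemma grp_normalizer: assumes "mult_subgroup H" "E \<subseteq> carrier R" shows "mult_subgroup {g \<in> H. normalizes g E}"
  unfolding mult_subgroup_def
proof (intro conjI ballI)
  show "{g \<in> H. normalizes g E} \<subseteq> carrier R - {\<zero>}" using grpD(1,2)[OF assms(1)] by auto
qed (auto simp: grpD(3-5)[OF assms(1)] normalizes_one normalizes_mult normalizes_inv assms(2))

definition com :: "'a \<Rightarrow> 'a \<Rightarrow> 'a" where
  "com a b = a \<otimes> b \<otimes> inv a \<otimes> inv b"

lemma com_cj: "\<lbrakk>a \<in> carrier R; a \<noteq> \<zero>; b \<in> carrier R; b \<noteq> \<zero>\<rbrakk> \<Longrightarrow> cj a b = com a b \<otimes> b"
  by (simp add: com_def cj_def m_assoc)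

end

text \<open>The situation of the theorem in elementary terms. The subnormal chain runs from the subnormal subgroup \<open>N 0\<close> up to the full multiplicative group \<open>N r\<close>, and \<open>M\<close> is a maximal subgroup of \<open>N 0\<close>.\<close>

locale maximal_metabelian = skew_field +
  fixes M :: "'a set" and r :: nat and N :: "nat \<Rightarrow> 'a set"
  assumes chain_top: "N r = carrier R - {\<zero>}"
    and N_grp: "\<And>i. i \<le> r \<Longrightarrow> mult_subgroup (N i)"
    and N_mono: "\<And>i. i < r \<Longrightarrow> N i \<subseteq> N (Suc i)"
    and N_norm: "\<And>i x y. i < r \<Longrightarrow> x \<in> N (Suc i) \<Longrightarrow> y \<in> N i \<Longrightarrow> cj x y \<in> N i"
    and M_grp: "mult_subgroup M" and M_sub: "M \<subseteq> N 0" and M_ne: "M \<noteq> N 0"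
    and M_max: "\<And>H. mult_subgroup H \<Longrightarrow> M \<subseteq> H \<Longrightarrow> H \<subseteq> N 0 \<Longrightarrow> H = M \<or> H = N 0"
    and metabel: "\<And>a b c d. a \<in> M \<Longrightarrow> b \<in> M \<Longrightarrow> c \<in> M \<Longrightarrow> d \<in> M \<Longrightarrow> com a b \<otimes> com c d = com c d \<otimes> com a b"
    and nonab: "\<exists>a\<in>M. \<exists>b\<in>M. a \<otimes> b \<noteq> b \<otimes> a"
begin

lemma N_le: "i \<le> r \<Longrightarrow> N 0 \<subseteq> N i"
proof (induction i)
  case (Suc i) then show ?case using N_mono[of i] by auto
qed simp

lemma MD: "\<And>a. a \<in> M \<Longrightarrow> a \<in> carrier R" "\<And>a. a \<in> M \<Longrightarrow> a \<noteq> \<zero>" "\<one> \<in> M"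
    "\<And>a b. a \<in> M \<Longrightarrow> b \<in> M \<Longrightarrow> a \<otimes> b \<in> M" "\<And>a. a \<in> M \<Longrightarrow> inv a \<in> M"
  using grpD[OF M_grp] by blast+

lemma com_M: "a \<in> M \<Longrightarrow> b \<in> M \<Longrightarrow> com a b \<in> M"
  unfolding com_def by (intro MD)

text \<open>By Zorn's lemma among the commuting subsets of \<open>M\<close> that contain all commutators; maximality makes such a set its own centralizer in \<open>M\<close>.\<close>

lemma A_exists: "\<exists>A. A \<subseteq> M \<and> (\<forall>a\<in>M. \<forall>b\<in>M. com a b \<in> A) \<and> (\<forall>a\<in>A. \<forall>b\<in>A. a \<otimes> b = b \<otimes> a) \<and>
   (\<forall>u\<in>M. (\<forall>a\<in>A. u \<otimes> a = a \<otimes> u) \<longrightarrow> u \<in> A)"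
proof -
  define Ws where "Ws = {B. B \<subseteq> M \<and> (\<forall>a\<in>M. \<forall>b\<in>M. com a b \<in> B) \<and> (\<forall>a\<in>B. \<forall>b\<in>B. a \<otimes> b = b \<otimes> a)}"
  have "{com a b | a b. a \<in> M \<and> b \<in> M} \<in> Ws" unfolding Ws_def using com_M metabel by (auto 0 4)
  then have ne: "Ws \<noteq> {}" by blast
  have ch: "\<Union>Cs \<in> Ws" if C: "Cs \<noteq> {}" "subset.chain Ws Cs" for Cs
  proof -
    have sub: "Cs \<subseteq> Ws" and lin: "\<And>V U. V \<in> Cs \<Longrightarrow> U \<in> Cs \<Longrightarrow> V \<subseteq> U \<or> U \<subseteq> V"
      using C(2) by (auto simp: subset.chain_def subset_chain_def)
    have "a \<otimes> b = b \<otimes> a" if ab: "a \<in> \<Union>Cs" "b \<in> \<Union>Cs" for a b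
    proof -
      obtain V U where VU: "V \<in> Cs" "a \<in> V" "U \<in> Cs" "b \<in> U" using ab by blast
      then obtain Z where "Z \<in> Cs" "a \<in> Z" "b \<in> Z" using lin[OF VU(1,3)] by blast
      then show ?thesis using sub unfolding Ws_def by blast
    qed
    then show ?thesis using sub C(1) unfolding Ws_def by blast
  qed
  obtain A where A: "A \<in> Ws" "\<And>B. B \<in> Ws \<Longrightarrow> A \<subseteq> B \<Longrightarrow> B = A"
    using subset_Zorn_nonempty[OF ne ch] by blast
  have "u \<in> A" if u: "u \<in> M" "\<forall>a\<in>A. u \<otimes> a = a \<otimes> u" for u
  proof -
    have "insert u A \<in> Ws" using A(1) u unfolding Ws_def by auto
    then show ?thesis using A(2)[of "insert u A"] by blast
  qed
  then show ?thesis using A(1) unfolding Ws_def by blast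
qed

definition A :: "'a set" where
  "A = (SOME A. A \<subseteq> M \<and> (\<forall>a\<in>M. \<forall>b\<in>M. com a b \<in> A) \<and> (\<forall>a\<in>A. \<forall>b\<in>A. a \<otimes> b = b \<otimes> a) \<and>
   (\<forall>u\<in>M. (\<forall>a\<in>A. u \<otimes> a = a \<otimes> u) \<longrightarrow> u \<in> A))"

lemma A_props: "\<And>a. a \<in> A \<Longrightarrow> a \<in> M" "\<And>a b. a \<in> M \<Longrightarrow> b \<in> M \<Longrightarrow> com a b \<in> A"
   "\<And>a b. a \<in> A \<Longrightarrow> b \<in> A \<Longrightarrow> a \<otimes> b = b \<otimes> a"
   "\<And>u. u \<in> M \<Longrightarrow> (\<And>a. a \<in> A \<Longrightarrow> u \<otimes> a = a \<otimes> u) \<Longrightarrow> u \<in> A"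
proof -
  have *: "A \<subseteq> M \<and> (\<forall>a\<in>M. \<forall>b\<in>M. com a b \<in> A) \<and> (\<forall>a\<in>A. \<forall>b\<in>A. a \<otimes> b = b \<otimes> a) \<and>
   (\<forall>u\<in>M. (\<forall>a\<in>A. u \<otimes> a = a \<otimes> u) \<longrightarrow> u \<in> A)"
    unfolding A_def by (rule someI_ex[OF A_exists])
  note c1 = conjunct1[OF *] and c2 = conjunct1[OF conjunct2[OF *]]
    and c3 = conjunct1[OF conjunct2[OF conjunct2[OF *]]] and c4 = conjunct2[OF conjunct2[OF conjunct2[OF *]]]
  show "a \<in> M" if "a \<in> A" for a by (rule subsetD[OF c1 that])
  show "com a b \<in> A" if "a \<in> M" "b \<in> M" for a b by (rule c2[rule_format, OF that])
  show "a \<otimes> b = b \<otimes> a" if "a \<in> A" "b \<in> A" for a b by (rule c3[rule_format, OF that])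
  show "u \<in> A" if "u \<in> M" "\<And>a. a \<in> A \<Longrightarrow> u \<otimes> a = a \<otimes> u" for u
    by (rule c4[rule_format, OF that])
qed

lemma AD: "a \<in> A \<Longrightarrow> a \<in> carrier R" "a \<in> A \<Longrightarrow> a \<noteq> \<zero>"
  using A_props(1) MD(1,2) by auto

lemma A_grp: "mult_subgroup A"
proof -
  define C where "C = {c \<in> carrier R. \<forall>a\<in>A. c \<otimes> a = a \<otimes> c}"
  have C: "division_subring C" unfolding C_def by (rule dsub_centralizer) (use AD in auto)
  have eq: "c \<in> A \<longleftrightarrow> c \<in> M \<and> c \<in> C" for c
    unfolding C_def using A_props(1,3) A_props(4)[of c] MD(1) by auto
  show ?thesis unfolding mult_subgroup_def
  proof (intro conjI ballI)
    show "A \<subseteq> carrier R - {\<zero>}" using AD by auto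
    show "\<one> \<in> A" unfolding eq using MD(3) dsub_one[OF C] by simp
    show "a \<otimes> b \<in> A" if "a \<in> A" "b \<in> A" for a b using that unfolding eq using MD(4) dsub_mult[OF C] by simp
    show "inv a \<in> A" if "a \<in> A" for a using that AD(2)[OF that] unfolding eq using MD(5) dsub_inv[OF C] by simp
  qed
qed

lemma A_normal: assumes "m \<in> M" "a \<in> A" shows "cj m a \<in> A"
proof -
  have "cj m a = com m a \<otimes> a" by (rule com_cj[OF MD(1,2)[OF assms(1)] AD[OF assms(2)]])
  then show ?thesis using A_props(2)[OF assms(1) A_props(1)[OF assms(2)]] assms(2) grpD[OF A_grp] by simp
qed

definition K :: "'a set" where "K = gen (Fc \<union> A)"

lemma FA_carrier: "Fc \<union> A \<subseteq> carrier R"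
  using AD dsub_sub[OF Fc_dsub] by blast

lemma K_dsub: "division_subring K"
  unfolding K_def by (rule gen_dsub[OF FA_carrier])

lemma KC: "k \<in> K \<Longrightarrow> k \<in> carrier R"
  using dsub_carrier[OF K_dsub] .

lemma A_K: "a \<in> A \<Longrightarrow> a \<in> K" and F_K: "a \<in> Fc \<Longrightarrow> a \<in> K"
  unfolding K_def using gen_incl[of "Fc \<union> A"] by auto

lemma K_commuting:
  assumes "c \<in> carrier R" "\<And>a. a \<in> A \<Longrightarrow> c \<otimes> a = a \<otimes> c" "k \<in> K" shows "c \<otimes> k = k \<otimes> c"
proof -
  have "K \<subseteq> {k \<in> carrier R. \<forall>s\<in>{c}. k \<otimes> s = s \<otimes> k}"
    unfolding K_def
  proof (rule gen_min[OF dsub_centralizer])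
    show "Fc \<union> A \<subseteq> {k \<in> carrier R. \<forall>s\<in>{c}. k \<otimes> s = s \<otimes> k}" using assms(1) assms(2)[symmetric] FA_carrier by (auto simp: Fc_def)
  qed (use assms in auto)
  then show ?thesis using assms(3) by auto
qed

lemma K_comm: "k \<in> K \<Longrightarrow> l \<in> K \<Longrightarrow> k \<otimes> l = l \<otimes> k"
  by (rule K_commuting[OF KC]) (auto intro: K_commuting[symmetric] AD(1) A_props(3))

lemma M_normalizes_K: assumes m: "m \<in> M" shows "normalizes m K"
proof -
  have "cj h ` (Fc \<union> A) \<subseteq> gen (Fc \<union> A)" if h: "h \<in> M" for h
  proof -
    have "cj h z = z" if "z \<in> Fc" for z using that h MD cj_eq_self_iff[of h z] by (auto simp: Fc_def)
    then show ?thesis using A_normal[OF h] gen_incl[of "Fc \<union> A"] by auto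
  qed
  then show ?thesis unfolding K_def using m MD by (intro normalizes_gen[OF FA_carrier]) auto
qed

lemma M_commutes_K_iff: assumes "m \<in> M" shows "(\<forall>k\<in>K. m \<otimes> k = k \<otimes> m) \<longleftrightarrow> m \<in> A"
  using A_props(4)[OF assms] A_K K_comm by blast

lemma noncommuting: assumes "x \<in> M" "x \<notin> A" shows "\<exists>y\<in>A. x \<otimes> y \<noteq> y \<otimes> x"
  using A_props(4) assms by blast

text \<open>Each commutator with \<open>y\<close> moves one step down the chain, since \<open>[f, y]\<close> is the product of \<open>f y f^-1\<close> and \<open>y^-1\<close>, both in \<open>N i\<close> if \<open>y\<close> is in \<open>N i\<close> and \<open>f\<close> in \<open>N (Suc i)\<close>.\<close>

lemma iter_com_chain: assumes "y \<in> N 0" "z \<in> carrier R" "z \<noteq> \<zero>" shows "j \<le> r \<Longrightarrow> iter_com y j z \<in> N (r - j)"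
proof (induction j)
  case 0 then show ?case using assms chain_top by simp
next
  case (Suc j)
  define f where "f = iter_com y j z"
  have y: "y \<in> N (r - Suc j)" using N_le[of "r - Suc j"] assms by auto
  have yc: "y \<in> carrier R" "y \<noteq> \<zero>" using grpD[OF N_grp[of "r - Suc j"]] y by auto
  have s: "Suc (r - Suc j) = r - j" using Suc.prems by simp
  have f: "f \<in> N (Suc (r - Suc j))" using Suc unfolding s f_def by simp
  have fc: "f \<in> carrier R" "f \<noteq> \<zero>" using iter_com_closed[OF yc assms(2,3)] by (auto simp: f_def)
  have "cj f y \<in> N (r - Suc j)" using N_norm[OF _ f y] Suc.prems by simp
  moreover have "inv y \<in> N (r - Suc j)" using grpD(5)[OF N_grp[of "r - Suc j"]] y by simp
  ultimately have "cj f y \<otimes> inv y \<in> N (r - Suc j)" using grpD(4)[OF N_grp[of "r - Suc j"]] by simp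
  moreover have "cj f y \<otimes> inv y = iter_com y (Suc j) z" using fc yc by (simp add: f_def[symmetric] cj_def m_assoc)
  ultimately show ?case by simp
qed

lemma iter_com_G: assumes "y \<in> N 0" "z \<in> carrier R" "z \<noteq> \<zero>" shows "iter_com y r z \<in> N 0"
  using iter_com_chain[OF assms, of r] by simp

lemma M_G: "a \<in> M \<Longrightarrow> a \<in> N 0" and A_G: "a \<in> A \<Longrightarrow> a \<in> N 0"
  using M_sub A_props(1) by auto

text \<open>If \<open>f\<close> normalizes \<open>E\<close> and \<open>y\<close> is in \<open>E\<close>, then \<open>[f, y] = (f y f^-1) y^-1\<close> is in \<open>E\<close>. This is why \<open>r + 1\<close> commutators are taken in the end.\<close>

lemma iter_com_Suc_in:
  assumes y: "y \<in> E" "y \<in> carrier R" "y \<noteq> \<zero>" and z: "z \<in> carrier R" "z \<noteq> \<zero>" and n: "normalizes (iter_com y n z) E"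
    and E: "\<And>a b. a \<in> E \<Longrightarrow> b \<in> E \<Longrightarrow> a \<otimes> b \<in> E" "\<And>a. a \<in> E \<Longrightarrow> a \<noteq> \<zero> \<Longrightarrow> inv a \<in> E"
  shows "iter_com y (Suc n) z \<in> E"
proof -
  define f where "f = iter_com y n z"
  have fc: "f \<in> carrier R" "f \<noteq> \<zero>" using iter_com_closed[OF y(2,3) z] by (auto simp: f_def)
  have "cj f y \<otimes> inv y = iter_com y (Suc n) z" using fc y by (simp add: f_def[symmetric] cj_def m_assoc)
  then show ?thesis using E normalizes_cj[OF n[folded f_def] y(1)] y by metis
qed

text \<open>The eigenvectors of conjugation by \<open>y\<close> are eigenvectors of \<open>tau\<close>; the eigenvalue \<open>q\<close> commutes with \<open>y\<close>.\<close>

lemma tau_pow_eigen: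
  assumes w: "w \<in> carrier R" "w \<noteq> \<zero>" and y: "y \<in> carrier R" "y \<noteq> \<zero>" and q: "q \<in> K" "y \<in> K" "cj y w = q \<otimes> w"
  shows "(tau y ^^ n) w = (\<one> \<ominus> q) [^] n \<otimes> w"
proof (induction n)
  case (Suc n)
  define c where "c = (\<one> \<ominus> q) [^] n"
  have c: "c \<in> K" unfolding c_def using q K_dsub by (intro dsub_pow dsub_minus dsub_one)
  note R = KC[OF c] KC[OF q(1)]
  have cjc: "cj y c = c" using K_comm[OF q(2) c] cj_eq_self_iff[OF y R(1)] by simp
  have "tau y (c \<otimes> w) = c \<otimes> w \<ominus> c \<otimes> q \<otimes> w" unfolding tau_def using R w y cjc q(3) by (simp add: cj_mult m_assoc)
  also have "\<dots> = c \<otimes> (\<one> \<ominus> q) \<otimes> w" using R w by (simp add: a_minus_def l_distr r_distr l_minus r_minus)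
  finally show ?case using Suc by (simp add: c_def)
qed (use w in simp)

text \<open>Elements of \<open>M\<close> outside \<open>A\<close> whose order modulo \<open>A\<close> is infinite or prime. The derivative argument covers both: in the first case the powers of \<open>x\<close> are independent over \<open>K\<close>, in the second there are infinitely many scalars.\<close>

definition special :: "'a \<Rightarrow> bool" where
  "special x \<longleftrightarrow> x \<in> M \<and> x \<notin> A \<and> ((\<forall>d::nat. 0 < d \<longrightarrow> x [^] d \<notin> A) \<or> (\<exists>p::nat. Factorial_Ring.prime p \<and> x [^] p \<in> A))"

lemma infinite_order_moved:
  assumes "x \<in> M" "\<forall>d::nat. 0 < d \<longrightarrow> x [^] d \<notin> A" "0 < d" shows "moved K x d"
proof -
  have "x [^] d \<in> M" by (rule grp_pow[OF M_grp assms(1)])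
  then obtain y where "y \<in> A" "x [^] d \<otimes> y \<noteq> y \<otimes> x [^] d" using noncommuting assms(2,3) by blast
  then show ?thesis unfolding moved_def using A_K K_comm by blast
qed

lemma prime_order_cyc:
  assumes "x \<in> M" "x \<notin> A" "Factorial_Ring.prime (p::nat)" "x [^] p \<in> A" "y \<in> A" "x \<otimes> y \<noteq> y \<otimes> x"
  shows "cyc K x p y"
  unfolding cyc_def using assms K_dsub K_comm M_normalizes_K A_K by blast

text \<open>Were the fixed field finite, \<open>K\<close> would be finite too, against \<open>no_finite_cyclic\<close>.\<close>

lemma prime_order_infinite:
  assumes "x \<in> M" "x \<notin> A" "Factorial_Ring.prime (p::nat)" "x [^] p \<in> A"
  shows "infinite (fixed_by K x)"
proof -
  obtain y where y: "y \<in> A" "x \<otimes> y \<noteq> y \<otimes> x" using noncommuting assms by blast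
  note c = prime_order_cyc[OF assms y]
  show ?thesis using cyc_infinite_fix[OF c] no_finite_cyclic[OF c _ A_K[OF assms(4)]] by blast
qed

text \<open>Conjugating \<open>x\<close> by \<open>y\<close> multiplies it by a commutator, which lies in \<open>A\<close> and so in \<open>K\<close>.\<close>

lemma eigen:
  assumes "x \<in> M" "y \<in> A" "x \<otimes> y \<noteq> y \<otimes> x"
  shows "com y x \<in> K" "cj y x = com y x \<otimes> x" "com y x \<noteq> \<one>"
proof -
  have R: "x \<in> carrier R" "x \<noteq> \<zero>" "y \<in> carrier R" "y \<noteq> \<zero>" using assms MD AD by auto
  show "com y x \<in> K" using A_props(2)[OF A_props(1)[OF assms(2)] assms(1)] A_K by blast
  show *: "cj y x = com y x \<otimes> x" using com_cj R by blast
  show "com y x \<noteq> \<one>" 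
  proof
    assume "com y x = \<one>"
    then have "cj y x = x" using * R by simp
    then show False using cj_eq_self_iff R assms(3) by simp
  qed
qed

lemma x_notin_K: assumes "x \<in> M" "x \<notin> A" shows "x \<notin> K"
  using noncommuting[OF assms] A_K K_comm by blast

text \<open>The key step. If all the iterated commutators normalized \<open>K\<close>, one further commutator
would lie in \<open>K\<close>, for all scalars in the fixed field of \<open>x\<close>. Then the derivative \<open>tau^(r+1)(x)\<close> is 0 if \<open>x\<close> has
infinite order modulo \<open>A\<close>, and lies in \<open>K\<close> if the order is prime. But it is a nonzero multiple of \<open>x\<close>.\<close>

lemma not_normalizing:
  assumes x: "special x"
  shows "\<exists>y\<in>A. \<exists>lam\<in>fixed_by K x. \<one> \<oplus> x \<otimes> lam \<noteq> \<zero> \<and> \<not> normalizes (iter_com y r (\<one> \<oplus> x \<otimes> lam)) K"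
proof (rule ccontr)
  assume a: "\<not> ?thesis"
  have xM: "x \<in> M" "x \<notin> A" using x by (auto simp: special_def)
  have xR: "x \<in> carrier R" "x \<noteq> \<zero>" using xM MD by auto
  obtain y where y: "y \<in> A" "x \<otimes> y \<noteq> y \<otimes> x" using noncommuting xM by blast
  have yR: "y \<in> carrier R" "y \<noteq> \<zero>" "y \<in> K" using y AD A_K by auto
  note q = eigen[OF xM(1) y]
  have qR: "com y x \<in> carrier R" "\<one> \<ominus> com y x \<noteq> \<zero>" using q KC[OF q(1)] by auto
  have fixC: "lam \<in> K" "lam \<in> carrier R" "x \<otimes> lam = lam \<otimes> x" if "lam \<in> fixed_by K x" for lam
    using that KC by (auto simp: fixed_by_def)
  have nz: "\<one> \<oplus> x \<otimes> lam \<noteq> \<zero>" if "lam \<in> fixed_by K x" for lam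
    using one_plus_nonzero[OF K_dsub xR(1) x_notin_K[OF xM] fixC(1)[OF that]] fixC(3)[OF that] by simp
  have inK: "iter_com y (Suc r) (\<one> \<oplus> x \<otimes> lam) \<in> K" if lam: "lam \<in> fixed_by K x" for lam
  proof (rule iter_com_Suc_in[OF yR(3,1,2)])
    show "normalizes (iter_com y r (\<one> \<oplus> x \<otimes> lam)) K" using a y(1) lam nz[OF lam] by blast
  qed (use xR fixC[OF lam] nz[OF lam] K_dsub dsub_mult dsub_inv in auto)
  define c where "c = (\<one> \<ominus> com y x) [^] Suc r"
  have tau: "(tau y ^^ Suc r) x = c \<otimes> x" unfolding c_def
    by (rule tau_pow_eigen[OF xR yR(1,2) q(1) yR(3) q(2)])
  have c1: "\<one> \<ominus> com y x \<in> K" by (rule dsub_minus[OF K_dsub dsub_one[OF K_dsub] q(1)])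
  have "c \<noteq> \<zero>" unfolding c_def by (rule pow_nonzero[OF KC[OF c1] qR(2)])
  moreover have "c \<in> K" unfolding c_def by (rule dsub_pow[OF K_dsub c1])
  ultimately have cne: "c \<noteq> \<zero>" "c \<in> K" by auto
  show False
  proof (cases "\<forall>d::nat. 0 < d \<longrightarrow> x [^] d \<notin> A")
    case True
    have "\<one> \<in> fixed_by K x" using dsub_one[OF K_dsub] xR by (simp add: fixed_by_def)
    from inK[OF this] have "iter_com y (Suc r) (\<one> \<oplus> \<one> \<otimes> x) \<in> K" using xR by simp
    then have "(tau y ^^ Suc r) (\<one> \<otimes> x) = \<zero>"
      by (intro tau_vanishes_transcendental[OF K_dsub M_normalizes_K[OF xM(1)] x_notin_K[OF xM]
            infinite_order_moved[OF xM(1) True] yR(3,2) dsub_one[OF K_dsub]])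
    then have "c \<otimes> x = \<zero>" unfolding l_one[OF xR(1)] tau .
    then show False using cne xR KC[OF cne(2)] by simp
  next
    case False
    then obtain p :: nat where p: "Factorial_Ring.prime p" "x [^] p \<in> A" using x by (auto simp: special_def)
    have "(tau y ^^ Suc r) x \<in> K"
    proof (rule tau_in_subring[OF K_dsub prime_order_infinite[OF xM p] _ _ xR(1) _ yR(3,2) nz inK])
      show "fixed_by K x \<subseteq> K" by (auto simp: fixed_by_def)
      show "lam \<otimes> e = e \<otimes> lam" if "lam \<in> fixed_by K x" "e \<in> K" for lam e using K_comm fixC that by blast
      show "lam \<otimes> x = x \<otimes> lam" if "lam \<in> fixed_by K x" for lam using fixC[OF that] by simp
    qed
    then have "c \<otimes> x \<in> K" unfolding tau .
    then show False using x_notin_K[OF xM] dsub_cancel_left[OF K_dsub cne(2,1) xR(1)] by simp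
  qed
qed

lemma special_exists: "\<exists>x. special x"
proof -
  have "\<exists>x\<in>M. x \<notin> A" using nonab A_props(3) by blast
  then obtain x where x: "x \<in> M" "x \<notin> A" by blast
  show ?thesis
  proof (cases "\<forall>d::nat. 0 < d \<longrightarrow> x [^] d \<notin> A")
    case True then show ?thesis using x by (auto simp: special_def)
  next
    case False
    define d where "d = (LEAST d::nat. 0 < d \<and> x [^] d \<in> A)"
    have d: "0 < d" "x [^] d \<in> A" 
      using LeastI_ex[of "\<lambda>d::nat. 0 < d \<and> x [^] d \<in> A"] False unfolding d_def by auto
    have min: "x [^] e \<notin> A" if "0 < e" "e < d" for e :: nat
      using not_less_Least[of e "\<lambda>d::nat. 0 < d \<and> x [^] d \<in> A"] that unfolding d_def by auto
    have "d \<noteq> 1" using d x MD by auto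
    then obtain p where p: "Factorial_Ring.prime p" "p dvd d" using prime_factor_nat by blast
    have e: "d = (d div p) * p" "0 < d div p" "d div p < d" using p d(1) prime_gt_1_nat[OF p(1)] by (auto simp: dvd_div_mult_self)
    have "(x [^] (d div p)) [^] p \<in> A" using d(2) e(1) x MD by (simp add: nat_pow_pow)
    moreover have "x [^] (d div p) \<notin> A" using min e by blast
    ultimately show ?thesis using grp_pow[OF M_grp x(1)] p(1) by (auto simp: special_def)
  qed
qed

lemma N0_grp: "mult_subgroup (N 0)" using N_grp by simp

text \<open>The normalizer of \<open>K\<close> in the subnormal subgroup contains \<open>M\<close> and is proper by \<open>not_normalizing\<close>.\<close>

lemma N_G_K: "{g \<in> N 0. normalizes g K} = M"
proof -
  obtain x where x: "special x" using special_exists by blast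
  then have xM: "x \<in> M" by (simp add: special_def)
  obtain y lam where yl: "y \<in> A" "lam \<in> fixed_by K x" "\<one> \<oplus> x \<otimes> lam \<noteq> \<zero>" "\<not> normalizes (iter_com y r (\<one> \<oplus> x \<otimes> lam)) K"
    using not_normalizing[OF x] by blast
  have "iter_com y r (\<one> \<oplus> x \<otimes> lam) \<in> N 0" 
    using yl xM MD KC A_G by (intro iter_com_G) (auto simp: fixed_by_def)
  then have "{g \<in> N 0. normalizes g K} \<noteq> N 0" using yl by blast
  then show ?thesis using M_max[OF grp_normalizer[OF N0_grp dsub_sub[OF K_dsub]]] M_sub M_normalizes_K by blast
qed

lemma A_eq: "A = (K - {\<zero>}) \<inter> N 0"
proof
  show "A \<subseteq> (K - {\<zero>}) \<inter> N 0" using A_K A_G AD by blast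
  show "(K - {\<zero>}) \<inter> N 0 \<subseteq> A"
  proof
    fix k assume k: "k \<in> (K - {\<zero>}) \<inter> N 0"
    then have "normalizes k K" using normalizes_self[OF K_dsub] by blast
    then have "k \<in> M" using k N_G_K by blast
    then show "k \<in> A" using M_commutes_K_iff k K_comm by blast
  qed
qed

text \<open>A set \<open>E\<close> closed under multiplication and inverses and normalized by \<open>M\<close> is normalized by the whole
subnormal subgroup as soon as it contains \<open>K\<close> and the elements \<open>1 + x lam\<close>: otherwise its normalizer
is \<open>M\<close> by maximality, but the iterated commutator that fails to normalize \<open>K\<close> is itself in \<open>E\<close>.\<close>

lemma G_normalizes:
  assumes x: "special x" and E: "E \<subseteq> carrier R" "\<And>a b. a \<in> E \<Longrightarrow> b \<in> E \<Longrightarrow> a \<otimes> b \<in> E" "\<And>a. a \<in> E \<Longrightarrow> a \<noteq> \<zero> \<Longrightarrow> inv a \<in> E"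
    and KE: "K \<subseteq> E" and xE: "\<And>lam. lam \<in> fixed_by K x \<Longrightarrow> \<one> \<oplus> x \<otimes> lam \<in> E"
    and ME: "\<And>m. m \<in> M \<Longrightarrow> normalizes m E" and g: "g \<in> N 0"
  shows "normalizes g E"
proof (rule ccontr)
  assume "\<not> normalizes g E"
  then have "{g \<in> N 0. normalizes g E} \<noteq> N 0" using g by blast
  then have NE: "{g \<in> N 0. normalizes g E} = M"
    using M_max[OF grp_normalizer[OF N0_grp E(1)]] M_sub ME by blast
  obtain y lam where yl: "y \<in> A" "lam \<in> fixed_by K x" "\<one> \<oplus> x \<otimes> lam \<noteq> \<zero>" "\<not> normalizes (iter_com y r (\<one> \<oplus> x \<otimes> lam)) K"
    using not_normalizing[OF x] by blast
  have R: "y \<in> carrier R" "y \<noteq> \<zero>" "\<one> \<oplus> x \<otimes> lam \<in> carrier R" "y \<in> E" using yl AD E(1) xE KE A_K by blast+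
  have yn: "inv y \<in> E" using E(3)[OF R(4,2)] .
  have "iter_com y n (\<one> \<oplus> x \<otimes> lam) \<in> E" for n
  proof (induction n)
    case 0 then show ?case using xE yl by simp
  next
    case (Suc n)
    have "iter_com y n (\<one> \<oplus> x \<otimes> lam) \<noteq> \<zero>" using iter_com_closed[OF R(1,2,3) yl(3)] by blast
    then have "inv (iter_com y n (\<one> \<oplus> x \<otimes> lam)) \<in> E" using E(3) Suc by blast
    then show ?case using Suc E(2) R(4) yn by (simp add: cj_def)
  qed
  then have f: "iter_com y r (\<one> \<oplus> x \<otimes> lam) \<in> E" "iter_com y r (\<one> \<oplus> x \<otimes> lam) \<noteq> \<zero>" using iter_com_closed[OF R(1,2,3) yl(3)] by auto
  define f where "f = iter_com y r (\<one> \<oplus> x \<otimes> lam)"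
  have fE: "f \<in> E" "f \<noteq> \<zero>" "f \<in> carrier R" "inv f \<in> E" using f E unfolding f_def by auto
  have "normalizes f E"
  proof (rule normalizesI[OF fE(3,2) E(1)])
    show "cj f a \<in> E" if "a \<in> E" for a unfolding cj_def using E(2) fE that by blast
    show "cj (inv f) a \<in> E" if "a \<in> E" for a unfolding cj_def using E(2) fE that by simp
  qed
  moreover have "f \<in> N 0" unfolding f_def using iter_com_G[OF A_G[OF yl(1)] R(3) yl(3)] .
  ultimately have "f \<in> M" using NE by blast
  then show False using M_normalizes_K yl(4) f_def by blast
qed

subsection \<open>No element has infinite order modulo the abelian normal subgroup\<close>

text \<open>Let \<open>E\<close> be the set of left fractions of even polynomials in \<open>x\<close> over \<open>K\<close>. It is normalized by \<open>M\<close>, because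
an element of \<open>M\<close> changes \<open>x\<close> only by a factor in \<open>K\<close>, and \<open>G_normalizes\<close>, applied to \<open>x^2\<close>, shows that the
subnormal subgroup normalizes it. Therefore the iterated commutator of \<open>1 + x\<close> lies in \<open>E\<close>.
It is also a fraction \<open>A^-1 B\<close> with derivative a nonzero multiple of \<open>x\<close>, whereas
an even fraction has no linear term.\<close>

lemma no_infinite_order:
  assumes x: "x \<in> M" "\<forall>d::nat. 0 < d \<longrightarrow> x [^] d \<notin> A"
  shows False
proof -
  have xR: "x \<in> carrier R" "x \<noteq> \<zero>" using x MD by auto
  have "x [^] (1::nat) \<notin> A" using x(2) zero_less_one by blast
  then have xA: "x \<notin> A" using xR by simp
  have n: "normalizes x K" by (rule M_normalizes_K[OF x(1)])
  note mv = infinite_order_moved[OF x]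
  define H where "H = Hp K x"
  have gH: "graded H" unfolding H_def by (rule graded_Hp[OF K_dsub n])
  have inj: "p = q" if "p \<in> Pol H" "q \<in> Pol H" "ev \<one> p = ev \<one> q" for p q
    by (rule ev_one_inj[OF K_dsub n _ that[unfolded H_def]]) (rule mv)
  \<comment> \<open>even polynomials: admissible coefficients only in even degrees\<close>
  define H2 where "H2 i = (if even i then H i else {\<zero>})" for i :: nat
  have H2H: "a \<in> H2 i \<Longrightarrow> a \<in> H i" for a i unfolding H2_def using graded_zero[OF gH] by (auto split: if_splits)
  have gH2: "graded H2"
    unfolding graded_def
  proof (intro conjI allI ballI impI)
    fix i j a b
    show "H2 i \<subseteq> carrier R" using H2H graded_carrier[OF gH] by blast
    show "\<zero> \<in> H2 i" using graded_zero[OF gH] by (simp add: H2_def)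
    show "\<one> \<in> H2 0" using graded_one[OF gH] by (simp add: H2_def)
    show "a \<ominus> b \<in> H2 i" if "a \<in> H2 i" "b \<in> H2 i" using that graded_minus[OF gH] by (auto simp: H2_def split: if_splits)
    show "a \<otimes> b \<in> H2 (i + j)" if "a \<in> H2 i" "b \<in> H2 j"
    proof (cases "a = \<zero> \<or> b = \<zero>")
      case True
      then show ?thesis using that H2H graded_carrier[OF gH] graded_zero[OF gH] by (auto simp: H2_def)
    next
      case False
      then have "even i" "even j" using that by (auto simp: H2_def split: if_splits)
      then show ?thesis using that graded_mult[OF gH] by (auto simp: H2_def)
    qed
    assume ab: "a \<in> H2 (i + j)" "b \<in> H2 j" "b \<noteq> \<zero>"
    have b: "even j" using ab by (auto simp: H2_def split: if_splits)
    have bR: "b \<in> carrier R" using ab H2H graded_carrier[OF gH] by blast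
    show "a \<otimes> inv b \<in> H2 i" "inv b \<otimes> a \<in> H2 i"
      using graded_rdiv[OF gH H2H[OF ab(1)] H2H[OF ab(2)] ab(3)] graded_ldiv[OF gH H2H[OF ab(1)] H2H[OF ab(2)] ab(3)] b ab bR
      by (auto simp: H2_def split: if_splits)
  qed
  have P2: "p \<in> Pol H" if "p \<in> Pol H2" for p using that H2H by (auto simp: Pol_def)
  have evnz: "ev \<one> p \<noteq> \<zero>" if p: "p \<in> Pol H" "p \<noteq> \<zero>\<^bsub>P\<^esub>" for p
  proof
    assume "ev \<one> p = \<zero>"
    moreover have "ev \<one> \<zero>\<^bsub>P\<^esub> = \<zero>" by (subst ev_bound[where n = 0]) auto
    ultimately show False using inj[OF p(1) Pol_zero[OF gH]] p(2) by simp
  qed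
  have evm: "ev \<one> (p \<otimes>\<^bsub>P\<^esub> q) = ev \<one> p \<otimes> ev \<one> q" if "p \<in> carrier P" "q \<in> carrier P" for p q
    by (rule ev_mult) (use that in auto)
  have evR: "ev \<one> p \<in> carrier R" if "p \<in> Pol H" for p using Pol_carrier[OF that] by simp
  define E where "E = {e \<in> carrier R. \<exists>p\<in>Pol H2. \<exists>q\<in>Pol H2. p \<noteq> \<zero>\<^bsub>P\<^esub> \<and> ev \<one> p \<otimes> e = ev \<one> q}"
  have EI: "ev \<one> q \<in> E" if "q \<in> Pol H2" for q
    unfolding E_def mem_Collect_eq
    by (rule conjI[OF evR[OF P2[OF that]]], rule bexI[OF _ Pol_one[OF gH2]], rule bexI[OF _ that])
      (simp add: P_one_nonzero ev_one evR[OF P2[OF that]])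
  have E_mult: "a \<otimes> b \<in> E" if ab: "a \<in> E" "b \<in> E" for a b
  proof -
    obtain p q where pq: "a \<in> carrier R" "p \<in> Pol H2" "q \<in> Pol H2" "p \<noteq> \<zero>\<^bsub>P\<^esub>" "ev \<one> p \<otimes> a = ev \<one> q"
      using ab(1) unfolding E_def by blast
    obtain p' q' where pq': "b \<in> carrier R" "p' \<in> Pol H2" "q' \<in> Pol H2" "p' \<noteq> \<zero>\<^bsub>P\<^esub>" "ev \<one> p' \<otimes> b = ev \<one> q'"
      using ab(2) unfolding E_def by blast
    obtain u v where uv: "u \<in> Pol H2" "v \<in> Pol H2" "u \<noteq> \<zero>\<^bsub>P\<^esub>" "u \<otimes>\<^bsub>P\<^esub> q = v \<otimes>\<^bsub>P\<^esub> p'"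
      using Pol_ore[OF gH2 pq'(2) pq(3) pq'(4)] by blast
    note car = Pol_carrier[OF pq(2)] Pol_carrier[OF pq(3)] Pol_carrier[OF pq'(2)] Pol_carrier[OF pq'(3)] Pol_carrier[OF uv(1)] Pol_carrier[OF uv(2)]
    have "ev \<one> (u \<otimes>\<^bsub>P\<^esub> p) \<otimes> (a \<otimes> b) = ev \<one> u \<otimes> (ev \<one> p \<otimes> a) \<otimes> b"
      using car pq(1) pq'(1) by (simp add: evm m_assoc)
    also have "\<dots> = ev \<one> (u \<otimes>\<^bsub>P\<^esub> q) \<otimes> b" unfolding pq(5) using car by (simp add: evm)
    also have "\<dots> = ev \<one> v \<otimes> (ev \<one> p' \<otimes> b)" unfolding uv(4) using car pq'(1) by (simp add: evm m_assoc)
    also have "\<dots> = ev \<one> (v \<otimes>\<^bsub>P\<^esub> q')" unfolding pq'(5) using car by (simp add: evm)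
    finally have "ev \<one> (u \<otimes>\<^bsub>P\<^esub> p) \<otimes> (a \<otimes> b) = ev \<one> (v \<otimes>\<^bsub>P\<^esub> q')" .
    moreover have "u \<otimes>\<^bsub>P\<^esub> p \<noteq> \<zero>\<^bsub>P\<^esub>" using P_integral[OF car(5,1)] uv(3) pq(4) by blast
    ultimately show ?thesis unfolding E_def using Pol_mult[OF gH2 uv(1) pq(2)] Pol_mult[OF gH2 uv(2) pq'(3)] pq(1) pq'(1) by blast
  qed
  have E_inv: "inv a \<in> E" if a: "a \<in> E" "a \<noteq> \<zero>" for a
  proof -
    obtain p q where pq: "a \<in> carrier R" "p \<in> Pol H2" "q \<in> Pol H2" "p \<noteq> \<zero>\<^bsub>P\<^esub>" "ev \<one> p \<otimes> a = ev \<one> q"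
      using a(1) unfolding E_def by blast
    have p0: "ev \<one> p \<noteq> \<zero>" using evnz[OF P2[OF pq(2)] pq(4)] .
    have "q \<noteq> \<zero>\<^bsub>P\<^esub>"
    proof
      assume "q = \<zero>\<^bsub>P\<^esub>"
      moreover have "ev \<one> \<zero>\<^bsub>P\<^esub> = \<zero>" by (subst ev_bound[where n = 0]) auto
      ultimately have "ev \<one> p \<otimes> a = \<zero>" using pq(5) by simp
      then show False using p0 pq(1) a(2) evR[OF P2[OF pq(2)]] by simp
    qed
    moreover have "ev \<one> q \<otimes> inv a = ev \<one> p" unfolding pq(5)[symmetric] using evR[OF P2[OF pq(2)]] pq(1) a(2) by (simp add: m_assoc)
    ultimately show ?thesis unfolding E_def using pq a by blast
  qed
  have ER: "E \<subseteq> carrier R" unfolding E_def by blast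
  have KE: "K \<subseteq> E"
  proof
    fix k assume k: "k \<in> K"
    then have "k \<in> H2 0" unfolding H2_def H_def Hp_def using KC by (auto intro!: image_eqI[of _ _ k])
    then have "mon k 0 \<in> Pol H2" by (rule Pol_monom[OF gH2])
    from EI[OF this] show "k \<in> E" using KC[OF k] by (simp add: ev_mon)
  qed
  have ME: "normalizes m E" if m: "m \<in> M" for m
  proof -
    have cjH: "cj h a \<in> H2 i" if h: "h \<in> M" "a \<in> H2 i" for h a i
    proof (cases "even i")
      case False
      then show ?thesis using h MD by (simp add: H2_def)
    next
      case True
      have hR: "h \<in> carrier R" "h \<noteq> \<zero>" using h MD by auto
      obtain k where k: "k \<in> K" "a = k \<otimes> x [^] i" using h(2) True by (auto simp: H2_def H_def Hp_def)
      have c: "com h x \<in> K" using A_K[OF A_props(2)[OF h(1) x(1)]] .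
      have cx: "cj h x \<in> H 1" unfolding H_def Hp_def com_cj[OF hR xR] using c xR by (auto intro!: image_eqI[of _ _ "com h x"])
      have "cj h x [^] i \<in> H i" for i :: nat
      proof (induction i)
        case 0 then show ?case using graded_one[OF gH] by simp
      next
        case (Suc i) then show ?case using graded_mult[OF gH Suc cx] by simp
      qed
      moreover have "cj h k \<in> H 0" unfolding H_def Hp_def using normalizes_cj[OF M_normalizes_K[OF h(1)] k(1)] KC
        by (auto intro!: image_eqI[of _ _ "cj h k"])
      ultimately have "cj h k \<otimes> cj h x [^] i \<in> H (0 + i)" using graded_mult[OF gH] by blast
      then show ?thesis using k KC hR xR True by (simp add: H2_def cj_mult cj_pow)
    qed
    have cjE: "cj h a \<in> E" if h: "h \<in> M" "a \<in> E" for h a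
    proof -
      have hR: "h \<in> carrier R" "h \<noteq> \<zero>" using h MD by auto
      obtain p q where pq: "a \<in> carrier R" "p \<in> Pol H2" "q \<in> Pol H2" "p \<noteq> \<zero>\<^bsub>P\<^esub>" "ev \<one> p \<otimes> a = ev \<one> q"
        using h(2) unfolding E_def by blast
      obtain p' where p': "p' \<in> Pol H2" "\<And>i. cf p' i = cj h (cf p i)" "ev \<one> p' = cj h (ev \<one> p)"
        using cj_poly[OF gH2 pq(2) hR cjH[OF h(1)]] hR by (metis l_one one_closed r_one)
      obtain q' where q': "q' \<in> Pol H2" "ev \<one> q' = cj h (ev \<one> q)"
        using cj_poly[OF gH2 pq(3) hR cjH[OF h(1)]] hR by (metis l_one one_closed r_one)
      have "p' \<noteq> \<zero>\<^bsub>P\<^esub>"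
      proof
        assume "p' = \<zero>\<^bsub>P\<^esub>"
        then have "cj h (cf p i) = \<zero>" for i using p'(2)[of i] by simp
        then have "cf p i = \<zero>" for i using hR Pol_carrier[OF pq(2)] by simp
        then show False using pq(4) cf_eqI[OF Pol_carrier[OF pq(2)], of "\<zero>\<^bsub>P\<^esub>"] by simp
      qed
      moreover have "ev \<one> p' \<otimes> cj h a = ev \<one> q'" unfolding p'(3) q'(2) pq(5)[symmetric]
        using cj_mult hR pq(1) evR[OF P2[OF pq(2)]] by simp
      ultimately show ?thesis unfolding E_def using p'(1) q'(1) pq(1) hR by blast
    qed
    show ?thesis using cjE[OF m] cjE[OF MD(5)[OF m]] MD m by (intro normalizesI[OF _ _ ER]) auto
  qed
  define x2 where "x2 = x [^] (2::nat)"
  have x2M: "x2 \<in> M" unfolding x2_def by (rule grp_pow[OF M_grp x(1)])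
  have x2d: "x2 [^] d \<notin> A" if "0 < d" for d :: nat
    using x(2) that xR by (simp add: x2_def nat_pow_pow)
  have sp: "special x2" unfolding special_def using x2M x2d x2d[of 1] MD(1)[OF x2M] by auto
  have Gn: "normalizes f E" if "f \<in> N 0" for f
  proof (rule G_normalizes[OF sp ER E_mult E_inv KE _ ME that])
    fix lam assume "lam \<in> fixed_by K x2"
    then have lam: "lam \<in> K" "x2 \<otimes> lam = lam \<otimes> x2" by (auto simp: fixed_by_def)
    have "x2 \<otimes> lam \<in> H2 2" unfolding lam(2) using lam(1) by (auto simp: H2_def H_def Hp_def x2_def)
    then have "\<one>\<^bsub>P\<^esub> \<oplus>\<^bsub>P\<^esub> mon (x2 \<otimes> lam) 2 \<in> Pol H2" using Pol_add[OF gH2 Pol_one[OF gH2] Pol_monom[OF gH2]] by blast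
    from EI[OF this] show "\<one> \<oplus> x2 \<otimes> lam \<in> E" using KC[OF lam(1)] MD(1)[OF x2M] by (simp add: ev_add ev_one ev_mon)
  qed auto
  obtain y where y: "y \<in> A" "x \<otimes> y \<noteq> y \<otimes> x" using noncommuting x(1) xA by blast
  have yR: "y \<in> carrier R" "y \<noteq> \<zero>" "y \<in> K" using y AD A_K by auto
  have xH: "x \<in> H 1" unfolding H_def Hp_def using dsub_one[OF K_dsub] xR by (auto intro!: image_eqI[of _ _ \<one>])
  have nz: "\<one> \<oplus> x \<noteq> \<zero>" using one_plus_nonzero[OF K_dsub xR(1) x_notin_K[OF x(1) xA] dsub_one[OF K_dsub]] xR by simp
  define e where "e = iter_com y (Suc r) (\<one> \<oplus> x)"
  have eE: "e \<in> E" unfolding e_def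
    by (rule iter_com_Suc_in[OF _ yR(1,2)]) (use yR KE xR nz Gn[OF iter_com_G[OF A_G[OF y(1)] _ nz]] E_mult E_inv in auto)
  have eR: "e \<in> carrier R" using eE ER by blast
  obtain p1 p2 where pp: "p1 \<in> Pol H" "p2 \<in> Pol H" "cf p1 0 = \<one>" "cf p2 0 = \<one>"
    "cf p2 1 \<ominus> cf p1 1 = (tau y ^^ Suc r) x" and ab:
    "\<forall>lam\<in>carrier R. (\<forall>i. \<forall>h\<in>H i. lam \<otimes> h = h \<otimes> lam) \<longrightarrow> y \<otimes> lam = lam \<otimes> y \<longrightarrow> \<one> \<oplus> x \<otimes> lam \<noteq> \<zero> \<longrightarrow>
       ev lam p1 \<otimes> iter_com y (Suc r) (\<one> \<oplus> x \<otimes> lam) = ev lam p2"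
    using iter_com_fraction[OF gH yR(1,2) xH Hp_cj[OF K_dsub n yR(3,2), folded H_def], of "Suc r"] by blast
  have "ev \<one> p1 \<otimes> iter_com y (Suc r) (\<one> \<oplus> x \<otimes> \<one>) = ev \<one> p2"
    by (rule ab[rule_format]) (use graded_carrier[OF gH] yR xR nz in auto)
  then have e1: "ev \<one> p1 \<otimes> e = ev \<one> p2" using xR by (simp add: e_def del: iter_com.simps)
  obtain p q where pq: "p \<in> Pol H2" "q \<in> Pol H2" "p \<noteq> \<zero>\<^bsub>P\<^esub>" "ev \<one> p \<otimes> e = ev \<one> q"
    using eE unfolding E_def by blast
  have p10: "p1 \<noteq> \<zero>\<^bsub>P\<^esub>" using pp(3) one_neq_zero by auto
  obtain u v where uv: "u \<in> Pol H" "v \<in> Pol H" "u \<noteq> \<zero>\<^bsub>P\<^esub>" "u \<otimes>\<^bsub>P\<^esub> p = v \<otimes>\<^bsub>P\<^esub> p1"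
    using Pol_ore[OF gH pp(1) P2[OF pq(1)] p10] by blast
  note car = Pol_carrier[OF pq(1)] Pol_carrier[OF pq(2)] Pol_carrier[OF pp(1)] Pol_carrier[OF pp(2)] Pol_carrier[OF uv(1)] Pol_carrier[OF uv(2)]
  have uv2: "u \<otimes>\<^bsub>P\<^esub> q = v \<otimes>\<^bsub>P\<^esub> p2"
  proof (rule inj)
    show "u \<otimes>\<^bsub>P\<^esub> q \<in> Pol H" "v \<otimes>\<^bsub>P\<^esub> p2 \<in> Pol H" using Pol_mult[OF gH] uv P2[OF pq(2)] pp(2) by auto
    have "ev \<one> (u \<otimes>\<^bsub>P\<^esub> q) = ev \<one> u \<otimes> ev \<one> p \<otimes> e" using car eR by (simp add: evm m_assoc pq(4))
    also have "\<dots> = ev \<one> (u \<otimes>\<^bsub>P\<^esub> p) \<otimes> e" using car by (simp add: evm)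
    also have "\<dots> = ev \<one> v \<otimes> (ev \<one> p1 \<otimes> e)" unfolding uv(4) using car eR by (simp add: evm m_assoc)
    also have "\<dots> = ev \<one> (v \<otimes>\<^bsub>P\<^esub> p2)" unfolding e1 using car by (simp add: evm)
    finally show "ev \<one> (u \<otimes>\<^bsub>P\<^esub> q) = ev \<one> (v \<otimes>\<^bsub>P\<^esub> p2)" .
  qed
  obtain a where a: "cf u a \<noteq> \<zero>" "\<And>i. i < a \<Longrightarrow> cf u i = \<zero>" using Pol_low[OF car(5) uv(3)] by (metis (no_types))
  obtain b where b: "cf p b \<noteq> \<zero>" "\<And>i. i < b \<Longrightarrow> cf p i = \<zero>" using Pol_low[OF car(1) pq(3)] by (metis (no_types))
  have "H2 b \<noteq> {\<zero>}" using Pol_cf[OF pq(1), of b] b(1) by auto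
  then have beven: "even b" by (auto simp: H2_def)
  \<comment> \<open>compare the lowest terms, in degree \<open>a + b\<close>, and the next ones in \<open>u p = v p1\<close> and \<open>u q = v p2\<close>; as \<open>p\<close> and \<open>q\<close> are even, the next terms on the left agree\<close>
  note lowp = cf_mult_low[OF car(5,1) a(2) b(2)]
  have vlow: "cf v i = \<zero>" if "i < a + b" for i
    by (rule cf_mult_low_unital(1)[OF car(6,3) pp(3) _ that]) (use lowp(1) uv(4) in simp)
  have q0: "cf q j = \<zero>" if "j < b" for j using that
  proof (induction j rule: less_induct)
    case (less j)
    have "cf (u \<otimes>\<^bsub>P\<^esub> q) (a + j) = cf u a \<otimes> cf q j" by (rule cf_mult_low(2)[OF car(5,2) a(2)]) (use less in auto)
    moreover have "cf (v \<otimes>\<^bsub>P\<^esub> p2) (a + j) = \<zero>"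
      by (rule cf_mult_low(1)[OF car(6,4), of "a + b" 0]) (use vlow less in auto)
    ultimately have "cf u a \<otimes> cf q j = \<zero>" using uv2 by metis
    then show ?case using a(1) car by simp
  qed
  note lowq = cf_mult_low[OF car(5,2) a(2) q0]
  have v1: "cf (v \<otimes>\<^bsub>P\<^esub> w) (a + b) = cf v (a + b)" "cf (v \<otimes>\<^bsub>P\<^esub> w) (Suc (a + b)) = cf v (a + b) \<otimes> cf w 1 \<oplus> cf v (Suc (a + b))"
    if w: "w \<in> carrier P" "cf w 0 = \<one>" for w
    using cf_mult_low(2,3)[OF car(6) w(1) vlow, where t = 0] w car by simp_all
  have "cf u a \<otimes> cf p b = cf u a \<otimes> cf q b" using lowp(2) lowq(2) uv(4) uv2 v1(1)[OF car(3) pp(3)] v1(1)[OF car(4) pp(4)] by simp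
  then have pqb: "cf p b = cf q b" using mult_left_cancel[OF _ a(1)] car by simp
  have odd0: "cf p (Suc b) = \<zero>" "cf q (Suc b) = \<zero>" using Pol_cf[OF pq(1), of "Suc b"] Pol_cf[OF pq(2), of "Suc b"] beven by (auto simp: H2_def)
  have "cf v (a + b) = cf u a \<otimes> cf p b" using lowp(2) uv(4) v1(1)[OF car(3) pp(3)] by simp
  moreover have "cf u a \<otimes> cf p b \<noteq> \<zero>" using a(1) b(1) car by simp
  ultimately have vs: "cf v (a + b) \<noteq> \<zero>" by metis
  have "cf (u \<otimes>\<^bsub>P\<^esub> p) (Suc (a + b)) = cf (u \<otimes>\<^bsub>P\<^esub> q) (Suc (a + b))" using lowp(3) lowq(3) odd0 pqb by simp
  then have "cf v (a + b) \<otimes> cf p1 1 \<oplus> cf v (Suc (a + b)) = cf v (a + b) \<otimes> cf p2 1 \<oplus> cf v (Suc (a + b))"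
    unfolding uv(4) uv2 v1(2)[OF car(3) pp(3)] v1(2)[OF car(4) pp(4)] .
  then have "cf v (a + b) \<otimes> cf p1 1 = cf v (a + b) \<otimes> cf p2 1" using car by simp
  then have "cf p1 1 = cf p2 1" using mult_left_cancel[OF _ vs] car by simp
  then have t0: "(tau y ^^ Suc r) x = \<zero>" unfolding pp(5)[symmetric] using car by simp
  note qq = eigen[OF x(1) y]
  have "(\<one> \<ominus> com y x) [^] Suc r \<otimes> x = \<zero>" using t0 tau_pow_eigen[OF xR yR(1,2) qq(1) yR(3) qq(2), of "Suc r"] by simp
  moreover have "com y x \<in> carrier R" "\<one> \<ominus> com y x \<noteq> \<zero>" using qq KC[OF qq(1)] by auto
  ultimately show False using xR by (simp del: nat_pow_Suc)
qed

end

section \<open>Bases and finite dimension\<close>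

context skew_field
begin

lemma dsub_subfield:
  assumes E: "division_subring E" and comm: "\<And>a b. a \<in> E \<Longrightarrow> b \<in> E \<Longrightarrow> a \<otimes> b = b \<otimes> a"
  shows "subfield E R"
proof (rule subfieldI)
  show "subcring E R"
    by (rule subcringI[OF subringI comm]) (auto intro: dsub_intros E simp: dsub_carrier[OF E])
  show "Units (R\<lparr>carrier := E\<rparr>) = E - {\<zero>}"
  proof
    show "Units (R\<lparr>carrier := E\<rparr>) \<subseteq> E - {\<zero>}"
      using one_neq_zero dsub_carrier[OF E] by (auto simp: Units_def)
    show "E - {\<zero>} \<subseteq> Units (R\<lparr>carrier := E\<rparr>)"
    proof
      fix a assume a: "a \<in> E - {\<zero>}"
      then have "inv a \<in> E" "a \<in> carrier R" using dsub_inv[OF E] dsub_carrier[OF E] by auto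
      then show "a \<in> Units (R\<lparr>carrier := E\<rparr>)" using a by (auto simp: Units_def intro!: bexI[of _ "inv a"])
    qed
  qed
qed

definition comb :: "'a set \<Rightarrow> (nat \<Rightarrow> 'a) \<Rightarrow> nat \<Rightarrow> 'a set" where
  "comb E v n = {s. \<exists>c. (\<forall>i. c i \<in> E) \<and> s = (\<Oplus>i\<in>{..<n}. c i \<otimes> v i)}"

lemma finsum_lessThan_Suc:
  assumes "\<And>i. i \<le> n \<Longrightarrow> f i \<in> carrier R"
  shows "(\<Oplus>i\<in>{..<Suc n}. f i) = f n \<oplus> (\<Oplus>i\<in>{..<n}. f i)"
  using assms by (subst finsum_insert[of "{..<n}" n, folded lessThan_Suc]) auto

lemma comb_dimension:
  assumes E: "division_subring E" and v: "\<And>i. v i \<in> carrier R"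
    and ind: "\<And>c. (\<And>i. c i \<in> E) \<Longrightarrow> (\<Oplus>i\<in>{..<m}. c i \<otimes> v i) = \<zero> \<Longrightarrow> \<forall>i<m. c i = \<zero>"
  shows "n \<le> m \<Longrightarrow> dimension n E (comb E v n)"
proof (induction n)
  case 0
  have "comb E v 0 = {\<zero>}" unfolding comb_def using dsub_zero[OF E] by auto
  then show ?case by simp
next
  case (Suc n)
  note EC = dsub_carrier[OF E]
  have eq: "comb E v (Suc n) = line_extension E (v n) (comb E v n)"
  proof (intro equalityI subsetI)
    fix s assume "s \<in> comb E v (Suc n)"
    then obtain c where c: "\<And>i. c i \<in> E" "s = (\<Oplus>i\<in>{..<Suc n}. c i \<otimes> v i)" unfolding comb_def by blast
    have "s = c n \<otimes> v n \<oplus> (\<Oplus>i\<in>{..<n}. c i \<otimes> v i)" unfolding c(2) by (rule finsum_lessThan_Suc) (use c EC v in auto)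
    then show "s \<in> line_extension E (v n) (comb E v n)" unfolding line_extension_mem_iff comb_def using c(1) by blast
  next
    fix s assume "s \<in> line_extension E (v n) (comb E v n)"
    then obtain k c where kc: "k \<in> E" "\<And>i. c i \<in> E" "s = k \<otimes> v n \<oplus> (\<Oplus>i\<in>{..<n}. c i \<otimes> v i)"
      unfolding line_extension_mem_iff comb_def by blast
    define c' where "c' i = (if i = n then k else c i)" for i
    have c': "c' i \<in> E" for i using kc by (auto simp: c'_def)
    have "(\<Oplus>i\<in>{..<Suc n}. c' i \<otimes> v i) = c' n \<otimes> v n \<oplus> (\<Oplus>i\<in>{..<n}. c' i \<otimes> v i)"
      by (rule finsum_lessThan_Suc) (use c' EC v in auto)
    also have "(\<Oplus>i\<in>{..<n}. c' i \<otimes> v i) = (\<Oplus>i\<in>{..<n}. c i \<otimes> v i)"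
      by (rule finsum_cong') (use kc EC v in \<open>auto simp: c'_def\<close>)
    finally have "s = (\<Oplus>i\<in>{..<Suc n}. c' i \<otimes> v i)" using kc(3) by (simp add: c'_def)
    then show "s \<in> comb E v (Suc n)" unfolding comb_def using c' by blast
  qed
  have "v n \<notin> comb E v n"
  proof
    assume "v n \<in> comb E v n"
    then obtain c where c: "\<And>i. c i \<in> E" "v n = (\<Oplus>i\<in>{..<n}. c i \<otimes> v i)" unfolding comb_def by blast
    define c' where "c' i = (if i < n then c i else if i = n then \<ominus> \<one> else \<zero>)" for i
    have c': "c' i \<in> E" for i using c E by (auto simp: c'_def intro: dsub_intros)
    have c'R: "c' i \<otimes> v i \<in> carrier R" for i using EC[OF c'] v by simp
    have "(\<Oplus>i\<in>{..<Suc n}. c' i \<otimes> v i) = c' n \<otimes> v n \<oplus> (\<Oplus>i\<in>{..<n}. c' i \<otimes> v i)"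
      by (rule finsum_lessThan_Suc) (use c'R in auto)
    also have "(\<Oplus>i\<in>{..<n}. c' i \<otimes> v i) = (\<Oplus>i\<in>{..<n}. c i \<otimes> v i)"
      by (rule finsum_cong') (use c EC v in \<open>auto simp: c'_def\<close>)
    also have "c' n \<otimes> v n \<oplus> (\<Oplus>i\<in>{..<n}. c i \<otimes> v i) = \<zero>"
      unfolding c(2)[symmetric] using v by (simp add: c'_def l_minus l_neg)
    finally have z: "(\<Oplus>i\<in>{..<Suc n}. c' i \<otimes> v i) = \<zero>" .
    have "(\<Oplus>i\<in>{..<Suc k}. c' i \<otimes> v i) = \<zero>" if "n \<le> k" for k
      using that
    proof (induction k rule: dec_induct)
      case (step k)
      have "(\<Oplus>i\<in>{..<Suc (Suc k)}. c' i \<otimes> v i) = c' (Suc k) \<otimes> v (Suc k) \<oplus> (\<Oplus>i\<in>{..<Suc k}. c' i \<otimes> v i)"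
        by (rule finsum_lessThan_Suc) (use c'R in auto)
      then show ?case unfolding step.IH using step.hyps v by (simp add: c'_def)
    qed (rule z)
    moreover have "n \<le> m - 1" "Suc (m - 1) = m" using Suc.prems by auto
    ultimately have "(\<Oplus>i\<in>{..<m}. c' i \<otimes> v i) = \<zero>" by metis
    from ind[of c', OF c' this] have "c' n = \<zero>" using Suc.prems by (meson Suc_le_eq)
    then show False using one_neq_zero by (simp add: c'_def)
  qed
  then show ?case unfolding eq using Suc v by (intro Suc_dim) auto
qed

lemma combine_right_mult:
  assumes "t \<in> carrier R" "set Ks \<subseteq> carrier R" "set Vs \<subseteq> carrier R"
  shows "combine Ks (map (\<lambda>v. v \<otimes> t) Vs) = combine Ks Vs \<otimes> t"
  using assms
proof (induction Ks Vs rule: combine.induct)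
  case (1 k Ks u Us)
  then show ?case using combine_in_carrier[of Ks Us] by (simp add: l_distr m_assoc)
qed auto

text \<open>Right multiplication by \<open>t\<close> is \<open>K\<close>-linear and injective on \<open>T\<close>, so it maps a basis to a basis, and 1 is in its image.\<close>

lemma finite_dimension_inverse:
  assumes K: "subfield K R" and dim: "dimension n K T" and T: "\<one> \<in> T" "\<And>a b. a \<in> T \<Longrightarrow> b \<in> T \<Longrightarrow> a \<otimes> b \<in> T"
    and t: "t \<in> T" "t \<noteq> \<zero>"
  shows "inv t \<in> T"
proof -
  have KC: "K \<subseteq> carrier R" using subfieldE(3)[OF K] .
  obtain Vs where Vs: "set Vs \<subseteq> carrier R" "independent K Vs" "length Vs = n" "Span K Vs = T"
    using exists_base[OF K dim] by blast
  have TC: "T \<subseteq> carrier R" using space_subgroup_props(1)[OF K dim] .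
  then have tR: "t \<in> carrier R" using t by blast
  define Us where "Us = map (\<lambda>v. v \<otimes> t) Vs"
  have VT: "set Vs \<subseteq> T" using Span_base_incl[OF K Vs(1)] Vs(4) by simp
  have UT: "set Us \<subseteq> T" "set Us \<subseteq> carrier R" using VT T(2) t(1) TC unfolding Us_def by auto
  have comb: "combine Ks Us = combine Ks Vs \<otimes> t" if "set Ks \<subseteq> K" for Ks
    unfolding Us_def using combine_right_mult[OF tR _ Vs(1)] that KC by blast
  have "independent K Us"
  proof (rule trivial_combine_imp_independent[OF K UT(2)])
    fix Ks assume Ks: "set Ks \<subseteq> K" "combine Ks Us = \<zero>"
    have "combine Ks Vs \<in> carrier R" using combine_in_carrier Ks(1) KC Vs(1) by blast
    then have "combine Ks Vs = \<zero>" using Ks(2) comb[OF Ks(1)] t tR by simp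
    then show "set (take (length Us) Ks) \<subseteq> {\<zero>}"
      using independent_imp_trivial_combine[OF K Vs(2) Ks(1)] by (simp add: Us_def)
  qed
  moreover have "length Us = n" using Vs(3) by (simp add: Us_def)
  ultimately have "Span K Us = T" using independent_length_eq_dimension[OF K dim _ UT(1)] by simp
  then obtain Ks where Ks: "set Ks \<subseteq> K" "\<one> = combine Ks Us"
    using T(1) Span_eq_combine_set[OF K UT(2)] by auto
  have s: "combine Ks Vs \<in> T" using Span_eq_combine_set[OF K Vs(1)] Vs(4) Ks(1) by blast
  then have sR: "combine Ks Vs \<in> carrier R" using TC by blast
  have st: "combine Ks Vs \<otimes> t = \<one>" using Ks comb by simp
  have "inv t = combine Ks Vs \<otimes> t \<otimes> inv t" using st tR t by simp
  also have "\<dots> = combine Ks Vs" using sR tR t by (simp add: m_assoc)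
  finally show ?thesis using s by simp
qed

lemma gen_commute:
  assumes S: "S \<subseteq> carrier R" and c: "c \<in> carrier R" "\<And>s. s \<in> S \<Longrightarrow> c \<otimes> s = s \<otimes> c" and e: "e \<in> gen S"
  shows "c \<otimes> e = e \<otimes> c"
proof -
  have "gen S \<subseteq> {k \<in> carrier R. \<forall>s\<in>{c}. k \<otimes> s = s \<otimes> k}"
    by (rule gen_min[OF dsub_centralizer]) (use S c in auto)
  then show ?thesis using e by auto
qed

end

section \<open>The division ring is a cyclic algebra of prime degree\<close>

context maximal_metabelian
begin

text \<open>Suppose that the division subring \<open>E\<close> generated by \<open>K\<close> and \<open>x\<close> is proper. The subnormal subgroup normalizes \<open>E\<close>, so there is a first member \<open>N i\<close>
of the chain not contained in \<open>E\<close>, and any \<open>g\<close> in \<open>N i\<close> outside \<open>E\<close> normalizes \<open>E\<close>, because for \<open>i > 0\<close> the ring \<open>E\<close> is generated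
by the center and \<open>N (i - 1)\<close>. For \<open>k\<close> in \<open>E\<close>, the \<open>(r+1)\<close>-fold commutator of \<open>1 + k g\<close> with \<open>y\<close> lies in \<open>E\<close>. If no power of
\<open>g\<close> centralizes the center \<open>Z\<close> of \<open>E\<close>, the transcendental case gives \<open>tau^(r+1)(k g) = 0\<close>. Otherwise
\<open>g\<close> acts on \<open>Z\<close> with finite order, \<open>Z\<close> is infinite as it contains the fixed field of \<open>x\<close>, and so are
the scalars in \<open>Z\<close> fixed by \<open>g\<close>; then \<open>tau^(r+1)(k g)\<close> lies in both \<open>E\<close> and \<open>E g\<close> and so is 0 as well.
Choose \<open>w = k g\<close> nonzero with \<open>tau(w) = 0\<close>, that is, commuting with \<open>y\<close>. Then \<open>x w\<close> is an eigenvector, and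
\<open>tau^(r+1)(x w) = (1 - q)^(r+1) x w\<close> is not 0, although \<open>x w\<close> is again of the form \<open>k g\<close>.\<close>

lemma prime_order_generates:
  fixes p :: nat
  assumes x: "x \<in> M" "x \<notin> A" "Factorial_Ring.prime p" "x [^] p \<in> A"
  shows "gen (Fc \<union> A \<union> {x}) = carrier R"
proof (rule ccontr)
  define S where "S = Fc \<union> A \<union> {x}"
  define E where "E = gen S"
  assume "gen (Fc \<union> A \<union> {x}) \<noteq> carrier R"
  then have neq: "E \<noteq> carrier R" by (simp add: E_def S_def)
  have xR: "x \<in> carrier R" "x \<noteq> \<zero>" using x MD by auto
  have SR: "S \<subseteq> carrier R" using FA_carrier xR by (auto simp: S_def)
  have E: "division_subring E" unfolding E_def by (rule gen_dsub[OF SR])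
  note EC = dsub_carrier[OF E]
  have SE: "S \<subseteq> E" unfolding E_def by (rule gen_incl)
  have KE: "K \<subseteq> E" unfolding K_def by (rule gen_min[OF E]) (use SE S_def in auto)
  have xE: "x \<in> E" using SE by (auto simp: S_def)
  have sp: "special x" using x by (auto simp: special_def)
  have fixF: "cj h z = z" if "z \<in> Fc" "h \<in> carrier R" "h \<noteq> \<zero>" for z h
    using that cj_eq_self_iff[of h z] by (auto simp: Fc_def)
  have ME: "normalizes m E" if m: "m \<in> M" for m
  proof -
    have "cj h ` S \<subseteq> E" if h: "h \<in> M" for h
    proof -
      have "cj h x = com h x \<otimes> x" using com_cj[OF MD(1,2)[OF h] xR] .
      moreover have "com h x \<in> E" using KE A_K[OF A_props(2)[OF h x(1)]] by blast
      ultimately have "cj h x \<in> E" using dsub_mult[OF E] xE by simp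
      then show ?thesis using fixF[OF _ MD(1,2)[OF h]] A_normal[OF h] SE by (auto simp: S_def)
    qed
    then show ?thesis unfolding E_def using m MD(1,2,5) by (intro normalizes_gen[OF SR]) auto
  qed
  have GE: "normalizes g E" if "g \<in> N 0" for g
  proof (rule G_normalizes[OF sp dsub_sub[OF E] dsub_mult[OF E] dsub_inv[OF E] KE _ ME that])
    fix lam assume "lam \<in> fixed_by K x"
    then have "lam \<in> E" using KE by (auto simp: fixed_by_def)
    then show "\<one> \<oplus> x \<otimes> lam \<in> E" using xE by (intro dsub_add[OF E] dsub_mult[OF E] dsub_one[OF E])
  qed
  have nr: "\<not> N r \<subseteq> E"
  proof
    assume "N r \<subseteq> E"
    then have "carrier R \<subseteq> E" using chain_top dsub_zero[OF E] by auto
    then show False using neq dsub_sub[OF E] by blast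
  qed
  \<comment> \<open>the first member of the chain that sticks out of \<open>E\<close>\<close>
  define i where "i = (LEAST i. \<not> N i \<subseteq> E)"
  have i: "\<not> N i \<subseteq> E" unfolding i_def using LeastI[of "\<lambda>i. \<not> N i \<subseteq> E" r] nr by blast
  have ir: "i \<le> r" unfolding i_def by (rule Least_le) (rule nr)
  have imin: "N j \<subseteq> E" if "j < i" for j using not_less_Least[of j "\<lambda>i. \<not> N i \<subseteq> E"] that unfolding i_def by blast
  obtain g where g: "g \<in> N i" "g \<notin> E" using i by blast
  have gR: "g \<in> carrier R" "g \<noteq> \<zero>" using grpD(1,2)[OF N_grp[OF ir]] g by auto
  have ng: "normalizes g E"
  proof (cases i)
    case 0 then show ?thesis using GE g by simp
  next
    case (Suc j)
    have NjR: "N j \<subseteq> carrier R" using grpD(1)[OF N_grp[of j]] ir Suc by auto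
    have S2R: "Fc \<union> N j \<subseteq> carrier R" using NjR FA_carrier by blast
    have "S \<subseteq> Fc \<union> N j" using A_G M_G[OF x(1)] N_le[of j] ir Suc by (auto simp: S_def)
    then have "E \<subseteq> gen (Fc \<union> N j)" unfolding E_def by (rule gen_mono)
    moreover have "gen (Fc \<union> N j) \<subseteq> E" by (rule gen_min[OF E]) (use SE imin Suc S_def in auto)
    ultimately have Eeq: "E = gen (Fc \<union> N j)" by blast
    have "cj h ` (Fc \<union> N j) \<subseteq> gen (Fc \<union> N j)" if h: "h \<in> N i" for h
    proof -
      have "h \<in> carrier R" "h \<noteq> \<zero>" using grpD(1,2)[OF N_grp[OF ir] h] by auto
      then have "cj h ` (Fc \<union> N j) \<subseteq> Fc \<union> N j" using fixF[of _ h] N_norm[of j h] h Suc ir by auto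
      then show ?thesis using gen_incl by blast
    qed
    then show ?thesis unfolding Eeq using g grpD(5)[OF N_grp[OF ir]] gR by (intro normalizes_gen[OF S2R]) auto
  qed
  obtain y where y: "y \<in> A" "x \<otimes> y \<noteq> y \<otimes> x" using noncommuting x by blast
  have yR: "y \<in> carrier R" "y \<noteq> \<zero>" "y \<in> K" "y \<in> E" using y AD A_K KE by auto
  have HpT: "tau y w \<in> Hp E g 1" if "w \<in> Hp E g 1" for w
    unfolding tau_def using graded_minus[OF graded_Hp[OF E ng] that Hp_cj[OF E ng yR(4,2) that]] .
  have HpTn: "(tau y ^^ n) w \<in> Hp E g 1" if "w \<in> Hp E g 1" for w n
    using that HpT by (induction n) auto
  have HpI: "k \<otimes> g \<in> Hp E g 1" if "k \<in> E" for k using that gR by (auto simp: Hp_def)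
  have inE: "iter_com y (Suc r) (\<one> \<oplus> w) \<in> E" if w: "w \<in> carrier R" "\<one> \<oplus> w \<noteq> \<zero>" for w
    by (rule iter_com_Suc_in[OF yR(4,1,2)]) (use w GE[OF iter_com_G[OF A_G[OF y(1)] _ w(2)]] dsub_mult[OF E] dsub_inv[OF E] in auto)
  have tz: "(tau y ^^ Suc r) (k \<otimes> g) = \<zero>" if k: "k \<in> E" for k
  proof (cases "\<forall>d>0. moved E g d")
    case True
    have kR: "k \<otimes> g \<in> carrier R" "\<one> \<oplus> k \<otimes> g \<noteq> \<zero>" using EC[OF k] gR one_plus_nonzero[OF E gR(1) g(2) k] by auto
    show ?thesis
      by (rule tau_vanishes_transcendental[OF E ng g(2) _ yR(4,2) k inE[OF kR]]) (use True in blast)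
  next
    case False
    then obtain m :: nat where m: "0 < m" "\<not> moved E g m" by blast
    define Z where "Z = E \<inter> {c \<in> carrier R. \<forall>s\<in>E. c \<otimes> s = s \<otimes> c}"
    have Zd: "division_subring Z" unfolding Z_def by (rule dsub_Int[OF E dsub_centralizer[OF dsub_sub[OF E]]])
    have Zc: "a \<otimes> b = b \<otimes> a" if "a \<in> Z" "b \<in> E" for a b using that by (auto simp: Z_def)
    have ZE: "Z \<subseteq> E" by (auto simp: Z_def)
    have "fixed_by K x \<subseteq> Z"
    proof
      fix k assume k: "k \<in> fixed_by K x"
      have kK: "k \<in> K" "x \<otimes> k = k \<otimes> x" "k \<in> carrier R" using k KC by (auto simp: fixed_by_def)
      have "k \<otimes> s = s \<otimes> k" if "s \<in> S" for s
        using that kK K_comm[OF kK(1)] A_K F_K by (auto simp: S_def)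
      then have "k \<otimes> e = e \<otimes> k" if "e \<in> E" for e using gen_commute[OF SR kK(3)] that unfolding E_def by blast
      then show "k \<in> Z" using kK KE by (auto simp: Z_def)
    qed
    then have Zinf: "infinite Z" using prime_order_infinite[OF x] infinite_super by blast
    have Zcj: "cj h a \<in> Z" if h: "normalizes h E" and a: "a \<in> Z" for h a
    proof -
      note hR = normalizesD[OF h]
      have aE: "a \<in> E" using a ZE by blast
      have "cj h a \<otimes> e = e \<otimes> cj h a" if e: "e \<in> E" for e
      proof -
        obtain e' where e': "e' \<in> E" "e = cj h e'" using h e unfolding normalizes_def by blast
        have "cj h (a \<otimes> e') = cj h (e' \<otimes> a)" using Zc[OF a e'(1)] by simp
        then show ?thesis using e' hR EC aE by (simp add: cj_mult)
      qed
      then show ?thesis using normalizes_cj[OF h aE] EC by (auto simp: Z_def)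
    qed
    have Zn: "normalizes g Z"
      by (rule normalizesI[OF gR dsub_sub[OF Zd]]) (use Zcj[OF ng] Zcj[OF normalizes_inv[OF ng dsub_sub[OF E]]] in auto)
    have gm: "g [^] m \<otimes> a = a \<otimes> g [^] m" if "a \<in> Z" for a using m(2) that ZE Zc unfolding moved_def by blast
    have Linf: "infinite (fixed_by Z g)"
      by (rule infinite_fix[OF Zd _ Zinf Zn m(1) gm]) (use Zc ZE in auto)
    have L: "lam \<in> Z" "lam \<in> E" "lam \<in> carrier R" "g \<otimes> lam = lam \<otimes> g" if "lam \<in> fixed_by Z g" for lam
      using that ZE EC by (auto simp: fixed_by_def)
    have kR: "k \<in> carrier R" using EC[OF k] .
    have mv: "k \<otimes> g \<otimes> lam = k \<otimes> lam \<otimes> g" if "lam \<in> fixed_by Z g" for lam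
      using L[OF that] kR gR by (simp add: m_assoc)
    have nz: "\<one> \<oplus> k \<otimes> g \<otimes> lam \<noteq> \<zero>" if "lam \<in> fixed_by Z g" for lam
      unfolding mv[OF that] by (rule one_plus_nonzero[OF E gR(1) g(2) dsub_mult[OF E k L(2)[OF that]]])
    have "(tau y ^^ Suc r) (k \<otimes> g) \<in> E"
    proof (rule tau_in_subring[OF E Linf _ _ _ _ yR(4,2) nz])
      show "fixed_by Z g \<subseteq> E" using L by blast
      show "lam \<otimes> e = e \<otimes> lam" if "lam \<in> fixed_by Z g" "e \<in> E" for lam e using Zc[OF L(1)[OF that(1)] that(2)] .
      show "k \<otimes> g \<in> carrier R" using kR gR by simp
      show "lam \<otimes> (k \<otimes> g) = k \<otimes> g \<otimes> lam" if lam: "lam \<in> fixed_by Z g" for lam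
        unfolding mv[OF lam] Zc[OF L(1)[OF lam] k, symmetric] using L[OF lam] kR gR by (simp add: m_assoc)
      show "iter_com y (Suc r) (\<one> \<oplus> k \<otimes> g \<otimes> lam) \<in> E" if lam: "lam \<in> fixed_by Z g" for lam
        by (rule inE[OF _ nz[OF lam]]) (use L[OF lam] kR gR in auto)
    qed
    moreover obtain e where e: "e \<in> E" "(tau y ^^ Suc r) (k \<otimes> g) = e \<otimes> g" 
      using HpTn[OF HpI[OF k], of "Suc r"] gR by (auto simp: Hp_def)
    ultimately have "e = \<zero>" using dsub_cancel_left[OF E e(1) _ gR(1)] g(2) by auto
    then show ?thesis using e(2) gR by simp
  qed
  \<comment> \<open>\<open>tau\<close> is nilpotent on \<open>g\<close>; its last nonzero iterate commutes with \<open>y\<close>\<close>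
  define j where "j = (LEAST j. (tau y ^^ j) g = \<zero>)"
  have "(tau y ^^ Suc r) g = \<zero>" using tz[OF dsub_one[OF E]] unfolding l_one[OF gR(1)] .
  then have j: "(tau y ^^ j) g = \<zero>" unfolding j_def by (rule LeastI[of "\<lambda>j. (tau y ^^ j) g = \<zero>"])
  then have "j \<noteq> 0" using gR by (cases j) auto
  then obtain j' where j': "j = Suc j'" by (cases j) auto
  define w where "w = (tau y ^^ j') g"
  have w0: "w \<noteq> \<zero>" unfolding w_def using not_less_Least[of j' "\<lambda>j. (tau y ^^ j) g = \<zero>"] j' unfolding j_def by auto
  have wH: "w \<in> Hp E g 1" unfolding w_def using HpTn[OF HpI[OF dsub_one[OF E]]] unfolding l_one[OF gR(1)] .
  obtain k0 where k0: "k0 \<in> E" "w = k0 \<otimes> g" using wH gR by (auto simp: Hp_def)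
  have wR: "w \<in> carrier R" using k0 EC gR by simp
  have "tau y w = \<zero>" using j unfolding j' w_def by simp
  then have cw: "cj y w = w" using wR yR by (simp add: tau_def)
  note q = eigen[OF x(1) y]
  note qR = KC[OF q(1)]
  have xw: "x \<otimes> w \<in> carrier R" "x \<otimes> w \<noteq> \<zero>" using xR wR w0 by auto
  have "cj y (x \<otimes> w) = com y x \<otimes> (x \<otimes> w)" using xR wR yR cw q(2) qR by (simp add: cj_mult m_assoc)
  then have "(tau y ^^ Suc r) (x \<otimes> w) = (\<one> \<ominus> com y x) [^] Suc r \<otimes> (x \<otimes> w)"
    by (rule tau_pow_eigen[OF xw yR(1,2) q(1) yR(3)])
  moreover have "(tau y ^^ Suc r) (x \<otimes> w) = \<zero>"
  proof -
    have "x \<otimes> w = (x \<otimes> k0) \<otimes> g" unfolding k0(2) using xR EC[OF k0(1)] gR by (simp add: m_assoc)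
    then show ?thesis using tz[OF dsub_mult[OF E xE k0(1)]] by simp
  qed
  ultimately have "(\<one> \<ominus> com y x) [^] Suc r \<otimes> (x \<otimes> w) = \<zero>" by metis
  moreover have "(\<one> \<ominus> com y x) [^] Suc r \<noteq> \<zero>" "(\<one> \<ominus> com y x) [^] Suc r \<in> carrier R"
    by (rule pow_nonzero, use qR q(3) in auto)
  ultimately show False using xw by (metis mult_eq_zero_iff)
qed

lemma M_mod_A_prime: "\<exists>x p. x \<in> M \<and> x \<notin> A \<and> Factorial_Ring.prime (p::nat) \<and> x [^] p \<in> A"
  using special_exists no_infinite_order unfolding special_def by blast

definition pow_span :: "'a \<Rightarrow> nat \<Rightarrow> 'a set" where
  "pow_span x p = comb K (\<lambda>i. x [^] i) p"

text \<open>The span of the first \<open>p\<close> powers of \<open>x\<close> is closed under multiplication because \<open>x^p\<close> lies in \<open>K\<close>. As it is finite-dimensional, it is a division subring, hence everything.\<close>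

lemma powers_basis:
  fixes p :: nat
  assumes x: "x \<in> M" "x \<notin> A" "Factorial_Ring.prime p" "x [^] p \<in> A"
  shows "pow_span x p = carrier R" "dimension p K (carrier R)"
    "\<And>c. (\<And>i. c i \<in> K) \<Longrightarrow> (\<Oplus>i\<in>{..<p}. c i \<otimes> x [^] i) = \<zero> \<Longrightarrow> \<forall>i<p. c i = \<zero>"
proof -
  have xR: "x \<in> carrier R" "x \<noteq> \<zero>" using x MD by auto
  obtain y where y: "y \<in> A" "x \<otimes> y \<noteq> y \<otimes> x" using noncommuting x by blast
  have c: "cyc K x p y" by (rule prime_order_cyc[OF x y])
  note D = cycD[OF c]
  have p1: "1 < p" using D by simp
  show ind: "\<forall>i<p. c i = \<zero>" if c0: "\<And>i. c i \<in> K" "(\<Oplus>i\<in>{..<p}. c i \<otimes> x [^] i) = \<zero>" for c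
  proof -
    have "\<forall>i<p. c i \<otimes> x [^] i = \<zero>"
      by (rule powers_independent[OF K_dsub D(3) _ _ c0(2)]) (use cyc_moved[OF c] c0(1) in \<open>auto simp: Hp_def\<close>)
    then show ?thesis using xR KC[OF c0(1)] by simp
  qed
  have dim: "dimension p K (pow_span x p)" unfolding pow_span_def
    by (rule comb_dimension[OF K_dsub _ ind order_refl]) (use xR in auto)
  have TC: "s \<in> carrier R" if "s \<in> pow_span x p" for s
    using that KC xR unfolding pow_span_def comb_def by auto
  have TI: "(\<Oplus>i\<in>{..<p}. c i \<otimes> x [^] i) \<in> pow_span x p" if "\<And>i. c i \<in> K" for c
    using that unfolding pow_span_def comb_def by blast
  have Tadd: "s \<oplus> t \<in> pow_span x p" if st: "s \<in> pow_span x p" "t \<in> pow_span x p" for s t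
  proof -
    obtain c d where cd: "\<And>i. c i \<in> K" "\<And>i. d i \<in> K" "s = (\<Oplus>i\<in>{..<p}. c i \<otimes> x [^] i)" "t = (\<Oplus>i\<in>{..<p}. d i \<otimes> x [^] i)"
      using st unfolding pow_span_def comb_def by blast
    have "s \<oplus> t = (\<Oplus>i\<in>{..<p}. c i \<otimes> x [^] i \<oplus> d i \<otimes> x [^] i)"
      unfolding cd using KC[OF cd(1)] KC[OF cd(2)] xR by (intro finsum_addf[symmetric]) auto
    also have "\<dots> = (\<Oplus>i\<in>{..<p}. (c i \<oplus> d i) \<otimes> x [^] i)"
      by (rule finsum_cong') (use KC[OF cd(1)] KC[OF cd(2)] xR in \<open>auto simp: l_distr\<close>)
    finally show ?thesis using TI[of "\<lambda>i. c i \<oplus> d i"] dsub_add[OF K_dsub cd(1,2)] by simp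
  qed
  have Tsum: "(\<Oplus>i\<in>I. f i) \<in> pow_span x p" if "finite I" "\<And>i. i \<in> I \<Longrightarrow> f i \<in> pow_span x p" for I and f :: "nat \<Rightarrow> 'a"
    using that
  proof (induction I rule: finite_induct)
    case empty
    show ?case using space_subgroup_props(2)[OF dsub_subfield[OF K_dsub K_comm] dim] by simp
  next
    case (insert i I)
    have "f \<in> I \<rightarrow> carrier R" "f i \<in> carrier R" using insert TC by auto
    then show ?case using insert Tadd by simp
  qed
  have KT: "k \<otimes> x [^] i \<in> pow_span x p" if k: "k \<in> K" "i < p" for k i
  proof -
    define c where "c j = (if i = j then k else \<zero>)" for j
    have cK: "c j \<in> K" for j using k dsub_zero[OF K_dsub] by (simp add: c_def)
    have "(\<Oplus>j\<in>{..<p}. c j \<otimes> x [^] j) = (\<Oplus>j\<in>{..<p}. if i = j then k \<otimes> x [^] j else \<zero>)"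
      by (rule finsum_cong') (use KC[OF k(1)] xR in \<open>auto simp: c_def\<close>)
    also have "\<dots> = k \<otimes> x [^] i" using finsum_singleton[of i "{..<p}" "\<lambda>j. k \<otimes> x [^] j"] k KC[OF k(1)] xR by simp
    finally show ?thesis using TI[of c, OF cK] by simp
  qed
  have KTn: "k \<otimes> x [^] n \<in> pow_span x p" if k: "k \<in> K" for k and n :: nat
  proof -
    have "x [^] n = (x [^] p) [^] (n div p) \<otimes> x [^] (n mod p)" using xR by (simp add: nat_pow_pow nat_pow_mult)
    then have "k \<otimes> x [^] n = (k \<otimes> (x [^] p) [^] (n div p)) \<otimes> x [^] (n mod p)" using KC[OF k] xR by (simp add: m_assoc)
    moreover have "k \<otimes> (x [^] p) [^] (n div p) \<in> K" by (rule dsub_mult[OF K_dsub k dsub_pow[OF K_dsub A_K[OF x(4)]]])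
    ultimately show ?thesis using KT[of _ "n mod p"] D by simp
  qed
  have Tmult: "s \<otimes> t \<in> pow_span x p" if st: "s \<in> pow_span x p" "t \<in> pow_span x p" for s t
  proof -
    obtain c d where cd: "\<And>i. c i \<in> K" "\<And>i. d i \<in> K" "s = (\<Oplus>i\<in>{..<p}. c i \<otimes> x [^] i)" "t = (\<Oplus>i\<in>{..<p}. d i \<otimes> x [^] i)"
      using st unfolding pow_span_def comb_def by blast
    note R = KC[OF cd(1)] KC[OF cd(2)] xR(1)
    have "(c i \<otimes> x [^] i) \<otimes> t \<in> pow_span x p" for i
    proof -
      have "(c i \<otimes> x [^] i) \<otimes> t = (\<Oplus>j\<in>{..<p}. (c i \<otimes> x [^] i) \<otimes> (d j \<otimes> x [^] j))"
        unfolding cd(4) using R by (intro finsum_rdistr) auto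
      also have "\<dots> \<in> pow_span x p"
      proof (rule Tsum)
        fix j
        have "(c i \<otimes> x [^] i) \<otimes> (d j \<otimes> x [^] j) \<in> Hp K x (i + j)"
          by (rule graded_mult[OF graded_Hp[OF K_dsub D(3)]]) (use cd in \<open>auto simp: Hp_def\<close>)
        then show "(c i \<otimes> x [^] i) \<otimes> (d j \<otimes> x [^] j) \<in> pow_span x p" using KTn by (auto simp: Hp_def)
      qed simp
      finally show ?thesis .
    qed
    moreover have "s \<otimes> t = (\<Oplus>i\<in>{..<p}. (c i \<otimes> x [^] i) \<otimes> t)"
      using cd(3) R TC[OF st(2)] by (simp add: finsum_ldistr)
    ultimately show ?thesis using Tsum by simp
  qed
  have KT0: "k \<in> pow_span x p" if "k \<in> K" for k using KTn[OF that, of 0] KC[OF that] by simp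
  have T: "division_subring (pow_span x p)" unfolding division_subring_def
  proof (intro conjI ballI impI)
    show "pow_span x p \<subseteq> carrier R" using TC by blast
    show "\<one> \<in> pow_span x p" using KT0 dsub_one[OF K_dsub] by blast
    then show "inv a \<in> pow_span x p" if "a \<in> pow_span x p" "a \<noteq> \<zero>" for a
      using finite_dimension_inverse[OF dsub_subfield[OF K_dsub K_comm] dim _ Tmult that] by blast
    show "a \<ominus> b \<in> pow_span x p" if "a \<in> pow_span x p" "b \<in> pow_span x p" for a b
      using space_subgroup_props(4)[OF dsub_subfield[OF K_dsub K_comm] dim that(2)] Tadd that by (simp add: a_minus_def)
  qed (rule Tmult)
  have "\<one> \<otimes> x [^] (1::nat) \<in> pow_span x p" by (rule KTn[OF dsub_one[OF K_dsub]])
  then have "x \<in> pow_span x p" using xR by simp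
  then have "Fc \<union> A \<union> {x} \<subseteq> pow_span x p" using KT0 A_K F_K by auto
  then have "carrier R \<subseteq> pow_span x p" using gen_min[OF T] prime_order_generates[OF x] by blast
  then show "pow_span x p = carrier R" using TC by blast
  then show "dimension p K (carrier R)" using dim by simp
qed

text \<open>Moving powers of \<open>m\<close> past elements of \<open>A\<close> only conjugates the latter.\<close>

lemma coset_power:
  assumes "a \<in> A" "m \<in> M" shows "\<exists>a'\<in>A. (a \<otimes> m) [^] (n::nat) = a' \<otimes> m [^] n"
proof (induction n)
  case 0 then show ?case using grpD(3)[OF A_grp] by (intro bexI[of _ \<one>]) auto
next
  case (Suc n)
  then obtain a' where a': "a' \<in> A" "(a \<otimes> m) [^] n = a' \<otimes> m [^] n" by blast
  have R: "a \<in> carrier R" "a' \<in> carrier R" "m \<in> carrier R" "m \<noteq> \<zero>" using AD a' assms MD by auto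
  have c: "cj (m [^] n) a \<in> A" using A_normal[OF grp_pow[OF M_grp assms(2)] assms(1)] .
  have "(a \<otimes> m) [^] Suc n = a' \<otimes> (m [^] n \<otimes> a) \<otimes> m" using a' R by (simp add: m_assoc)
  also have "m [^] n \<otimes> a = cj (m [^] n) a \<otimes> m [^] n" using cj_mult_left R by simp
  finally have "(a \<otimes> m) [^] Suc n = (a' \<otimes> cj (m [^] n) a) \<otimes> m [^] Suc n" using R AD[OF c] by (simp add: m_assoc)
  then show ?case using grpD(4)[OF A_grp a'(1) c] by blast
qed

text \<open>Comparison of coefficients in \<open>b m = m a\<close> with respect to the basis of powers of \<open>x\<close>.\<close>

lemma coefficient_twist:
  fixes p :: nat
  assumes x: "x \<in> M" "x \<notin> A" "Factorial_Ring.prime p" "x [^] p \<in> A"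
    and c: "\<And>i. c i \<in> K" "m = (\<Oplus>i\<in>{..<p}. c i \<otimes> x [^] i)" and ab: "a \<in> K" "b \<in> K" "b \<otimes> m = m \<otimes> a" and i: "i < p"
  shows "c i \<otimes> b = c i \<otimes> cj (x [^] i) a"
proof -
  have xR: "x \<in> carrier R" "x \<noteq> \<zero>" using x MD by auto
  note cR = KC[OF c(1)]
  have R: "a \<in> carrier R" "b \<in> carrier R" using KC ab by auto
  have mR: "m \<in> carrier R" unfolding c(2) using cR xR by auto
  have xa: "cj (x [^] j) a \<in> K" for j :: nat
    using normalizes_cj[OF M_normalizes_K[OF grp_pow[OF M_grp x(1)]] ab(1)] .
  define d where "d j = b \<otimes> c j \<ominus> c j \<otimes> cj (x [^] j) a" for j
  have dK: "d j \<in> K" for j unfolding d_def using ab(2) c(1) xa by (intro dsub_minus[OF K_dsub] dsub_mult[OF K_dsub])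
  have "(\<Oplus>j\<in>{..<p}. d j \<otimes> x [^] j) = (\<Oplus>j\<in>{..<p}. b \<otimes> (c j \<otimes> x [^] j) \<oplus> (c j \<otimes> x [^] j) \<otimes> (\<ominus> a))"
  proof (rule finsum_cong')
    fix j assume "j \<in> {..<p}"
    have "c j \<otimes> cj (x [^] j) a \<otimes> x [^] j = c j \<otimes> (x [^] j \<otimes> a)"
      using cj_mult_left[of "x [^] j" a] cR R xR KC[OF xa] by (simp add: m_assoc)
    then show "d j \<otimes> x [^] j = b \<otimes> (c j \<otimes> x [^] j) \<oplus> (c j \<otimes> x [^] j) \<otimes> (\<ominus> a)"
      unfolding d_def a_minus_def using cR R xR KC[OF xa] by (simp add: l_distr l_minus r_minus m_assoc)
  qed (use cR R xR in auto)
  also have "\<dots> = (\<Oplus>j\<in>{..<p}. b \<otimes> (c j \<otimes> x [^] j)) \<oplus> (\<Oplus>j\<in>{..<p}. (c j \<otimes> x [^] j) \<otimes> (\<ominus> a))"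
    using cR R xR by (intro finsum_addf) auto
  also have "(\<Oplus>j\<in>{..<p}. b \<otimes> (c j \<otimes> x [^] j)) = b \<otimes> m"
    unfolding c(2) using cR R xR by (intro finsum_rdistr[symmetric]) auto
  also have "(\<Oplus>j\<in>{..<p}. (c j \<otimes> x [^] j) \<otimes> (\<ominus> a)) = m \<otimes> (\<ominus> a)"
    unfolding c(2) using cR R xR by (intro finsum_ldistr[symmetric]) auto
  also have "b \<otimes> m \<oplus> m \<otimes> (\<ominus> a) = \<zero>" unfolding ab(3) using mR R by (simp add: r_minus r_neg)
  finally have "d i = \<zero>" using powers_basis(3)[OF x, of d] dK i by blast
  then have "b \<otimes> c i = c i \<otimes> cj (x [^] i) a" unfolding d_def using R cR KC[OF xa] by simp
  then show ?thesis using K_comm[OF ab(2) c(1)] by simp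
qed

text \<open>If the coefficient of \<open>m\<close> at \<open>x^i\<close> is nonzero, comparing coefficients in \<open>(m a m^-1) m = m a\<close> shows that \<open>m\<close> and \<open>x^i\<close> conjugate \<open>A\<close> in the same way. So they differ by an element of \<open>M\<close> that centralizes \<open>A\<close>.\<close>

lemma M_coset:
  fixes p :: nat
  assumes x: "x \<in> M" "x \<notin> A" "Factorial_Ring.prime p" "x [^] p \<in> A" and m: "m \<in> M"
  shows "\<exists>i<p. \<exists>a\<in>A. m = a \<otimes> x [^] i"
proof -
  have xR: "x \<in> carrier R" "x \<noteq> \<zero>" using x MD by auto
  have mR: "m \<in> carrier R" "m \<noteq> \<zero>" using m MD by auto
  have n: "normalizes x K" by (rule M_normalizes_K[OF x(1)])
  have "m \<in> pow_span x p" using powers_basis(1)[OF x] mR by simp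
  then obtain c where c: "\<And>i. c i \<in> K" "m = (\<Oplus>i\<in>{..<p}. c i \<otimes> x [^] i)" unfolding pow_span_def comb_def by blast
  note cR = KC[OF c(1)]
  have "\<exists>i<p. c i \<noteq> \<zero>"
  proof (rule ccontr)
    assume a: "\<not> ?thesis"
    have "m = (\<Oplus>i\<in>{..<p}. \<zero>)" unfolding c(2) by (rule finsum_cong') (use a xR in auto)
    then show False using mR by simp
  qed
  then obtain i where i: "i < p" "c i \<noteq> \<zero>" by blast
  have xi: "x [^] i \<in> M" by (rule grp_pow[OF M_grp x(1)])
  have key: "cj m a = cj (x [^] i) a" if a: "a \<in> A" for a
  proof -
    define b where "b = cj m a"
    have b: "b \<in> A" unfolding b_def by (rule A_normal[OF m a])
    have R: "a \<in> carrier R" "b \<in> carrier R" using AD a b by auto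
    have bm: "b \<otimes> m = m \<otimes> a" unfolding b_def using cj_mult_left mR R by simp
    have xa: "cj (x [^] i) a \<in> carrier R" using R xR by simp
    have "c i \<otimes> b = c i \<otimes> cj (x [^] i) a" by (rule coefficient_twist[OF x c A_K[OF a] A_K[OF b] bm i(1)])
    then have "b = cj (x [^] i) a" using mult_left_cancel[OF cR i(2) R(2) xa] by simp
    then show ?thesis unfolding b_def .
  qed
  define u where "u = m \<otimes> inv (x [^] i)"
  have uM: "u \<in> M" unfolding u_def using m xi MD(4,5) by blast
  have xiR: "x [^] i \<in> carrier R" "x [^] i \<noteq> \<zero>" using xR by auto
  have "u \<in> A"
  proof (rule A_props(4)[OF uM])
    fix a assume a: "a \<in> A"
    have aR: "a \<in> carrier R" using AD a by auto
    have "cj u a = cj m (cj (inv (x [^] i)) a)" unfolding u_def using cj_cj mR xiR aR by simp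
    also have "\<dots> = a" using key[OF A_normal[OF MD(5)[OF xi] a]] xiR aR by simp
    finally show "u \<otimes> a = a \<otimes> u" using cj_eq_self_iff MD(1,2)[OF uM] aR by blast
  qed
  moreover have "m = u \<otimes> x [^] i" unfolding u_def using mR xiR by (simp add: m_assoc)
  ultimately show ?thesis using i(1) by blast
qed

lemma prime_for_all:
  fixes p :: nat
  assumes x: "x \<in> M" "x \<notin> A" "Factorial_Ring.prime p" "x [^] p \<in> A" and m: "m \<in> M"
  shows "m [^] p \<in> A"
proof -
  obtain i :: nat and a where ia: "a \<in> A" "m = a \<otimes> x [^] i" using M_coset[OF x m] by blast
  have xi: "x [^] i \<in> M" by (rule grp_pow[OF M_grp x(1)])
  obtain a' where a': "a' \<in> A" "m [^] p = a' \<otimes> (x [^] i) [^] p" using coset_power[OF ia(1) xi] ia(2) by blast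
  have "(x [^] i) [^] p = (x [^] p) [^] i" using x MD(1) by (simp add: nat_pow_pow mult.commute)
  then show ?thesis using a' grp_pow[OF A_grp x(4)] grpD(4)[OF A_grp] by simp
qed

text \<open>An element of \<open>K\<close> that commutes with \<open>x\<close> commutes with generators of the division ring.\<close>

lemma Fc_eq:
  fixes p :: nat
  assumes x: "x \<in> M" "x \<notin> A" "Factorial_Ring.prime p" "x [^] p \<in> A"
  shows "Fc = fixed_by K x"
proof
  have xR: "x \<in> carrier R" using x MD by auto
  show "Fc \<subseteq> fixed_by K x" using F_K xR by (auto simp: fixed_by_def Fc_def)
  show "fixed_by K x \<subseteq> Fc"
  proof
    fix k assume k: "k \<in> fixed_by K x"
    have kK: "k \<in> K" "x \<otimes> k = k \<otimes> x" "k \<in> carrier R" using k KC by (auto simp: fixed_by_def)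
    have "k \<otimes> e = e \<otimes> k" if "e \<in> carrier R" for e
    proof (rule gen_commute[of "Fc \<union> A \<union> {x}"])
      show "k \<otimes> s = s \<otimes> k" if "s \<in> Fc \<union> A \<union> {x}" for s using that kK K_comm[OF kK(1)] A_K F_K by auto
    qed (use FA_carrier xR kK prime_order_generates[OF x] that in auto)
    then show "k \<in> Fc" using kK by (simp add: Fc_def)
  qed
qed

lemma power_central:
  fixes p :: nat
  assumes x: "x \<in> M" "x \<notin> A" "Factorial_Ring.prime p" "x [^] p \<in> A"
  shows "x [^] p \<in> Fc"
  unfolding Fc_eq[OF x] fixed_by_def using A_K[OF x(4)] pow_comm[of x p] MD(1)[OF x(1)] by simp

lemma Fc_infinite: "infinite Fc"
  using M_mod_A_prime Fc_eq prime_order_infinite by metis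

end

section \<open>Cyclic and elementary abelian groups\<close>

lemma (in group) iso_integer_mod_group:
  fixes p :: nat
  assumes q: "q \<in> carrier G" "q [^] p = \<one>" and p: "0 < p"
    and ord: "\<And>d::nat. 0 < d \<Longrightarrow> d < p \<Longrightarrow> q [^] d \<noteq> \<one>"
    and gen: "\<And>g. g \<in> carrier G \<Longrightarrow> \<exists>i<p. g = q [^] (i::nat)"
  shows "G \<cong> integer_mod_group p"
proof -
  have md: "q [^] (n mod p) = q [^] n" for n :: nat
  proof -
    have "q [^] n = q [^] (p * (n div p) + n mod p)" by simp
    also have "\<dots> = (q [^] p) [^] (n div p) \<otimes> q [^] (n mod p)"
      using q(1) by (simp add: nat_pow_pow nat_pow_mult)
    finally show ?thesis using q by simp
  qed
  define f where "f i = q [^] nat i" for i :: int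
  have inj: "i = j" if ij: "i \<le> j" "j < p" "q [^] i = q [^] j" for i j :: nat
  proof (rule ccontr)
    assume "i \<noteq> j"
    then have d: "0 < j - i" "j - i < p" using ij by auto
    have "q [^] i \<otimes> q [^] (j - i) = q [^] i \<otimes> \<one>" using nat_pow_mult[OF q(1), of i "j - i"] ij q(1) by simp
    then have "q [^] (j - i) = \<one>" using q by (subst (asm) l_cancel) auto
    then show False using ord[OF d] by simp
  qed
  have C: "carrier (integer_mod_group p) = {0..<int p}" using p by (simp add: carrier_integer_mod_group)
  have "f \<in> iso (integer_mod_group p) G"
    unfolding iso_def
  proof (intro CollectI conjI)
    show "f \<in> hom (integer_mod_group p) G"
    proof (rule homI)
      fix i j assume ij: "i \<in> carrier (integer_mod_group p)" "j \<in> carrier (integer_mod_group p)"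
      then obtain a b :: nat where ab: "i = int a" "j = int b" using C by (metis atLeastLessThan_iff nonneg_int_cases)
      have "nat ((int a + int b) mod int p) = (a + b) mod p" by (metis of_nat_add nat_int zmod_int)
      then show "f (i \<otimes>\<^bsub>integer_mod_group p\<^esub> j) = f i \<otimes> f j" using ab md q by (simp add: f_def nat_pow_mult)
    qed (use q in \<open>simp add: f_def\<close>)
    show "bij_betw f (carrier (integer_mod_group p)) (carrier G)"
      unfolding bij_betw_def
    proof
      show "inj_on f (carrier (integer_mod_group p))"
      proof (rule inj_onI)
        fix i j assume ij: "i \<in> carrier (integer_mod_group p)" "j \<in> carrier (integer_mod_group p)" "f i = f j"
        then have "nat i < p" "nat j < p" "0 \<le> i" "0 \<le> j" using C by auto
        then show "i = j" using inj[of "nat i" "nat j"] inj[of "nat j" "nat i"] ij(3)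
          unfolding f_def by (metis nat_eq_iff2 int_nat_eq nle_le)
      qed
      show "f ` carrier (integer_mod_group p) = carrier G"
      proof
        show "carrier G \<subseteq> f ` carrier (integer_mod_group p)"
        proof
          fix g assume "g \<in> carrier G"
          then obtain i where "i < p" "g = q [^] i" using gen by blast
          then show "g \<in> f ` carrier (integer_mod_group p)" using C by (intro image_eqI[of _ _ "int i"]) (auto simp: f_def)
        qed
      qed (use q in \<open>auto simp: f_def\<close>)
    qed
  qed
  then have "integer_mod_group p \<cong> G" by (rule is_isoI)
  then show ?thesis by (rule group.iso_sym[OF group_integer_mod_group])
qed

context comm_group
begin

lemma subgroup_finprod_closed:
  assumes H: "subgroup H G" and J: "finite J" "\<And>i. i \<in> J \<Longrightarrow> f i \<in> H"
  shows "finprod G f J \<in> H"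
  using J
proof (induction J rule: finite_induct)
  case empty then show ?case using subgroup.one_closed[OF H] by simp
next
  case (insert i J)
  have "f \<in> J \<rightarrow> carrier G" "f i \<in> carrier G" using insert subgroup.mem_carrier[OF H] by auto
  then show ?case using insert subgroup.m_closed[OF H] by simp
qed

text \<open>Linear independence over the field with \<open>p\<close> elements, with integer representatives of the coefficients.\<close>

definition zp_independent :: "nat \<Rightarrow> 'a set \<Rightarrow> bool" where
  "zp_independent p I \<longleftrightarrow> I \<subseteq> carrier G \<and>
    (\<forall>J c. finite J \<longrightarrow> J \<subseteq> I \<longrightarrow> finprod G (\<lambda>i. i [^] (c i :: int)) J = \<one> \<longrightarrow> (\<forall>i\<in>J. int p dvd c i))"

lemma maximal_zp_independent:
  "\<exists>I. zp_independent p I \<and> (\<forall>I'. zp_independent p I' \<longrightarrow> I \<subseteq> I' \<longrightarrow> I' = I)"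
proof -
  have ne: "{I. zp_independent p I} \<noteq> {}" by (auto simp: zp_independent_def intro!: exI[of _ "{}"])
  have ch: "\<Union>Cs \<in> {I. zp_independent p I}" if C: "Cs \<noteq> {}" "subset.chain {I. zp_independent p I} Cs" for Cs
  proof -
    have ind: "\<And>I. I \<in> Cs \<Longrightarrow> zp_independent p I" using C(2) by (auto simp: subset.chain_def)
    have lin: "\<And>V U. V \<in> Cs \<Longrightarrow> U \<in> Cs \<Longrightarrow> V \<subseteq> U \<or> U \<subseteq> V"
      using C(2) by (auto simp: subset.chain_def subset_chain_def)
    have cover: "\<exists>I\<in>Cs. J \<subseteq> I" if "finite J" "J \<subseteq> \<Union>Cs" for J
      using that
    proof (induction J rule: finite_induct)
      case empty then show ?case using C(1) by blast
    next
      case (insert j J)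
      then obtain I I' where "I \<in> Cs" "J \<subseteq> I" "I' \<in> Cs" "j \<in> I'" by blast
      then show ?case using lin[of I I'] by blast
    qed
    have "\<forall>i\<in>J. int p dvd c i"
      if J: "finite J" "J \<subseteq> \<Union>Cs" "finprod G (\<lambda>i. i [^] (c i :: int)) J = \<one>" for J c
    proof -
      obtain I where I: "I \<in> Cs" "J \<subseteq> I" using cover[OF J(1,2)] by blast
      show ?thesis using ind[OF I(1)] I(2) J(1,3) unfolding zp_independent_def by blast
    qed
    moreover have "\<Union>Cs \<subseteq> carrier G" using ind unfolding zp_independent_def by blast
    ultimately show ?thesis unfolding zp_independent_def mem_Collect_eq by blast
  qed
  obtain I where "I \<in> {I. zp_independent p I}" "\<And>I'. I' \<in> {I. zp_independent p I} \<Longrightarrow> I \<subseteq> I' \<Longrightarrow> I' = I"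
    using subset_Zorn_nonempty[OF ne ch] by blast
  then show ?thesis by blast
qed

text \<open>A maximal independent set is a basis: if \<open>g\<close> does not belong to it, there is a relation in which the exponent of \<open>g\<close> is prime to \<open>p\<close>, and by Bezout \<open>g\<close> is a product of powers of elements of the set.\<close>

lemma elementary_abelian_iso_sum_group:
  fixes p :: nat
  assumes p: "Factorial_Ring.prime p" and exp: "\<And>a. a \<in> carrier G \<Longrightarrow> a [^] p = \<one>"
  shows "\<exists>I :: 'a set. G \<cong> sum_group I (\<lambda>_. integer_mod_group p)"
proof -
  obtain I where I: "zp_independent p I" "\<And>I'. zp_independent p I' \<Longrightarrow> I \<subseteq> I' \<Longrightarrow> I' = I"
    using maximal_zp_independent by blast
  have IC: "I \<subseteq> carrier G" using I(1) by (simp add: zp_independent_def)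
  have p0: "1 < p" using prime_gt_1_nat[OF p] .
  let ?S = "sum_group I (\<lambda>_. integer_mod_group p)"
  have C: "carrier (integer_mod_group p) = {0..<int p}" using p0 by (simp add: carrier_integer_mod_group)
  have SC: "carrier ?S = {x \<in> \<Pi>\<^sub>E i\<in>I. {0..<int p}. finite {i \<in> I. x i \<noteq> 0}}"
    by (subst carrier_sum_group) (auto simp: C)
  have multp: "a [^] (int p * k) = \<one>" if "a \<in> carrier G" for a and k :: int
  proof -
    have "a [^] (int p * k) = (a [^] int p) [^] k" using that by (simp add: int_pow_pow)
    then show ?thesis using exp[OF that] by (simp add: int_pow_int)
  qed
  have md: "a [^] (k mod int p) = a [^] k" if a: "a \<in> carrier G" for a and k :: int
  proof -
    have "a [^] k = a [^] (int p * (k div int p) + k mod int p)" by simp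
    also have "\<dots> = a [^] (k mod int p)" unfolding int_pow_mult[OF a] multp[OF a] using a by simp
    finally show ?thesis by simp
  qed
  define \<phi> where "\<phi> x = gfinprod G (\<lambda>i. i [^] (x i :: int)) I" for x
  have hom: "\<phi> \<in> hom ?S G"
    unfolding \<phi>_def
  proof (rule hom_group_sum)
    fix i assume "i \<in> I"
    then have i: "i \<in> carrier G" using IC by blast
    show "(\<lambda>k::int. i [^] k) \<in> hom (integer_mod_group p) G"
      by (rule homI) (use i md[OF i] in \<open>auto simp: int_pow_mult\<close>)
  qed simp
  interpret S: group ?S by (rule sum_group) simp
  interpret \<phi>: group_hom ?S G \<phi> by unfold_locales (rule hom)
  have inj: "inj_on \<phi> (carrier ?S)"
    unfolding \<phi>.inj_on_one_iff
  proof (intro allI impI)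
    fix x assume x: "x \<in> carrier ?S" "\<phi> x = \<one>"
    define J where "J = {i \<in> I. i [^] x i \<noteq> \<one>}"
    have xr: "0 \<le> x i" "x i < int p" if "i \<in> I" for i using x that unfolding SC by auto
    have "J \<subseteq> {i \<in> I. x i \<noteq> 0}" unfolding J_def by auto
    then have fin: "finite J" using x unfolding SC by (auto elim: finite_subset)
    have "\<phi> x = finprod G (\<lambda>i. i [^] x i) J" unfolding \<phi>_def gfinprod_def J_def[symmetric] using fin by simp
    then have dv: "\<forall>i\<in>J. int p dvd x i" using I(1) fin x unfolding zp_independent_def J_def by auto
    have one: "i [^] x i = \<one>" if i: "i \<in> I" for i
    proof (rule ccontr)
      assume n: "i [^] x i \<noteq> \<one>"
      then have "int p dvd x i" using dv i by (simp add: J_def)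
      then show False using multp[of i] n i IC by (auto elim!: dvdE)
    qed
    have "x i = 0" if i: "i \<in> I" for i
    proof -
      have "finprod G (\<lambda>i. i [^] x i) {i} = \<one>" using one[OF i] i IC by (subst finprod_insert) auto
      then have "int p dvd x i" using I(1) i unfolding zp_independent_def by (metis empty_subsetI finite.intros insert_subset insertI1)
      then show ?thesis using xr[OF i] by (metis zdvd_not_zless order_le_less)
    qed
    moreover have "x \<in> extensional I" using x unfolding SC by (auto simp: PiE_def)
    ultimately have "x = (\<lambda>i\<in>I. 0)" by (intro extensionalityI[of _ I]) auto
    then show "x = \<one>\<^bsub>?S\<^esub>" by simp
  qed
  define H where "H = \<phi> ` carrier ?S"
  have H: "subgroup H G" unfolding H_def by (rule \<phi>.img_is_subgroup)
  have IH: "g \<in> H" if g: "g \<in> I" for g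
  proof -
    define x where "x = (\<lambda>i\<in>I. if i = g then 1 else 0 :: int)"
    have "{i \<in> I. x i \<noteq> 0} = {g}" using g by (auto simp: x_def)
    then have xS: "x \<in> carrier ?S" unfolding SC using p0 by (auto simp: x_def)
    have "\<phi> x = (if g = \<one> then \<one> else g)"
    proof -
      have "{i \<in> I. i [^] x i \<noteq> \<one>} = (if g = \<one> then {} else {g})" using g IC by (auto simp: x_def split: if_splits)
      then show ?thesis unfolding \<phi>_def gfinprod_def using g IC by (auto simp: x_def)
    qed
    then show ?thesis unfolding H_def using xS by (metis image_eqI)
  qed
  have "g \<in> H" if gC: "g \<in> carrier G" for g
  proof (cases "g \<in> I")
    case False
    have "\<not> zp_independent p (insert g I)" using I(2)[of "insert g I"] False by blast
    then obtain J c i where J: "finite J" "J \<subseteq> insert g I" "finprod G (\<lambda>i. i [^] (c i :: int)) J = \<one>" "i \<in> J" "\<not> int p dvd c i"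
      unfolding zp_independent_def using IC gC by auto
    define J' where "J' = J - {g}"
    have J': "finite J'" "J' \<subseteq> I" "g \<notin> J'" using J by (auto simp: J'_def)
    have "g \<in> J" using I(1) J unfolding zp_independent_def by blast
    then have JJ: "J = insert g J'" by (auto simp: J'_def)
    define h where "h = finprod G (\<lambda>i. i [^] (c i :: int)) J'"
    have hH: "h \<in> H" unfolding h_def
    proof (rule subgroup_finprod_closed[OF H J'(1)])
      fix i assume "i \<in> J'"
      then have "i \<in> H" using IH J' by blast
      then show "i [^] c i \<in> H" by (rule subgroup_int_pow_closed[OF H])
    qed
    have fC: "(\<lambda>i. i [^] c i) \<in> J' \<rightarrow> carrier G" using J' IC by auto
    then have hC: "h \<in> carrier G" unfolding h_def by simp
    have gh: "g [^] c g \<otimes> h = \<one>"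
      using J(3) unfolding JJ h_def using finprod_insert[OF J'(1,3) fC] gC by simp
    have "\<not> int p dvd c g"
    proof
      assume d: "int p dvd c g"
      then have "g [^] c g = \<one>" using multp[OF gC] by (auto elim!: dvdE)
      then have "h = \<one>" using gh hC by simp
      then have "\<forall>i\<in>J'. int p dvd c i" using I(1) J' unfolding zp_independent_def h_def by blast
      then show False using J(4,5) d unfolding JJ by auto
    qed
    then have "coprime (int p) (c g)" using p by (simp add: prime_imp_coprime)
    then obtain u v where uv: "u * int p + v * c g = 1" using bezout_int[of "int p" "c g"] by auto
    have "g = g [^] (int p * u + c g * v)" using uv gC by (simp add: mult.commute)
    also have "\<dots> = g [^] (int p * u) \<otimes> (g [^] c g) [^] v"
      using gC by (simp add: int_pow_mult int_pow_pow)
    also have "g [^] (int p * u) = \<one>" by (rule multp[OF gC])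
    finally have g: "g = (g [^] c g) [^] v" using gC by simp
    have "g [^] c g = inv h" using gh hC gC by (metis int_pow_closed inv_equality)
    then have "g [^] c g \<in> H" using subgroup.m_inv_closed[OF H hH] by simp
    then have "(g [^] c g) [^] v \<in> H" by (rule subgroup_int_pow_closed[OF H])
    then show ?thesis using g by simp
  qed (rule IH)
  then have "\<phi> ` carrier ?S = carrier G" using subgroup.subset[OF H] unfolding H_def by blast
  then have "\<phi> \<in> iso ?S G" unfolding iso_def using hom inj by (simp add: bij_betw_def)
  then have "?S \<cong> G" by (rule is_isoI)
  then have "G \<cong> ?S" by (rule S.iso_sym)
  then show ?thesis ..
qed

end

section \<open>Engel conditions and maximality of the subfield\<close>

text \<open>One prime serves as exponent of all elements of \<open>M\<close> modulo \<open>A\<close>.\<close>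

locale maximal_metabelian_prime = maximal_metabelian +
  fixes p :: nat
  assumes p: "Factorial_Ring.prime p" and pow_A: "\<And>m. m \<in> M \<Longrightarrow> m [^] p \<in> A"
begin

lemma outside: "\<exists>x\<in>M. x \<notin> A"
  using M_mod_A_prime by blast

lemmas generates' = prime_order_generates[OF _ _ p pow_A]
lemmas powers_basis' = powers_basis[OF _ _ p pow_A]
lemmas coefficient_twist' = coefficient_twist[OF _ _ p pow_A]
lemmas M_coset' = M_coset[OF _ _ p pow_A]
lemmas Fc_eq' = Fc_eq[OF _ _ p pow_A]
lemmas power_central' = power_central[OF _ _ p pow_A]

lemma cyc_ex: assumes "x \<in> M" "x \<notin> A" shows "\<exists>y\<in>A. cyc K x p y"
  using noncommuting[OF assms] prime_order_cyc[OF assms p pow_A[OF assms(1)]] by blast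

text \<open>On the field \<open>K\<close>, taking the commutator with \<open>m\<close> is the homomorphism \<open>u \<mapsto> u / (m u m^-1)\<close>, and \<open>iter_com\<close> iterates it.\<close>

lemma iter_com_K:
  assumes m: "m \<in> M" and k: "k \<in> K" "k \<noteq> \<zero>"
  shows "iter_com m n k \<in> K \<and> iter_com m n k \<noteq> \<zero>"
proof (induction n)
  case (Suc n)
  have mR: "m \<in> carrier R" "m \<noteq> \<zero>" using m MD by auto
  have i: "inv (iter_com m n k) \<in> K" using dsub_inv[OF K_dsub] Suc by blast
  have "cj m (inv (iter_com m n k)) \<in> K" by (rule normalizes_cj[OF M_normalizes_K[OF m] i])
  then have "iter_com m (Suc n) k \<in> K" unfolding iter_com.simps by (rule dsub_mult[OF K_dsub conjunct1[OF Suc]])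
  then show ?case using iter_com_closed[OF mR KC[OF k(1)] k(2)] by blast
qed (use k in simp)

lemma K_mult_swap:
  assumes "a \<in> K" "b \<in> K" "c \<in> K" "d \<in> K" shows "(a \<otimes> b) \<otimes> (c \<otimes> d) = (a \<otimes> c) \<otimes> (b \<otimes> d)"
  using K_comm[OF assms(2,3)] KC[OF assms(1)] KC[OF assms(2)] KC[OF assms(3)] KC[OF assms(4)]
  by (metis m_assoc m_closed)

lemma iter_com_mult:
  assumes m: "m \<in> M" and k: "k \<in> K" "k \<noteq> \<zero>" and l: "l \<in> K" "l \<noteq> \<zero>"
  shows "iter_com m n (k \<otimes> l) = iter_com m n k \<otimes> iter_com m n l"
proof (induction n)
  case (Suc n)
  define u v where "u = iter_com m n k" and "v = iter_com m n l"
  have mR: "m \<in> carrier R" "m \<noteq> \<zero>" using m MD by auto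
  have uv: "u \<in> K" "u \<noteq> \<zero>" "v \<in> K" "v \<noteq> \<zero>" using iter_com_K[OF m k] iter_com_K[OF m l] by (auto simp: u_def v_def)
  have R: "u \<in> carrier R" "v \<in> carrier R" using KC uv by auto
  have i: "inv u \<in> K" "inv v \<in> K" using dsub_inv[OF K_dsub] uv by auto
  have c: "cj m (inv u) \<in> K" "cj m (inv v) \<in> K" using normalizes_cj[OF M_normalizes_K[OF m]] i by auto
  have "inv (u \<otimes> v) = inv u \<otimes> inv v" using sf_inv_mult[OF R(1) uv(2) R(2) uv(4)] K_comm[OF i] by simp
  then have "cj m (inv (u \<otimes> v)) = cj m (inv u) \<otimes> cj m (inv v)" using cj_mult mR R uv by simp
  then have "iter_com m (Suc n) (k \<otimes> l) = (u \<otimes> v) \<otimes> (cj m (inv u) \<otimes> cj m (inv v))" using Suc by (simp add: u_def v_def)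
  also have "\<dots> = (u \<otimes> cj m (inv u)) \<otimes> (v \<otimes> cj m (inv v))" by (rule K_mult_swap[OF uv(1,3) c])
  finally show ?case by (simp add: u_def v_def)
qed simp

lemma iter_com_pow:
  assumes m: "m \<in> M" and k: "k \<in> K" "k \<noteq> \<zero>"
  shows "iter_com m n (k [^] (e::nat)) = iter_com m n k [^] e"
proof (induction e)
  case 0
  have mR: "m \<in> carrier R" "m \<noteq> \<zero>" using m MD by auto
  have "iter_com m n \<one> = \<one>" using mR by (induction n) (auto simp: sf_inv_eqI)
  then show ?case by simp
next
  case (Suc e)
  have "k [^] e \<in> K" "k [^] e \<noteq> \<zero>" using dsub_pow[OF K_dsub k(1)] KC[OF k(1)] k(2) by auto
  then show ?case using iter_com_mult[OF m _ _ k] Suc by simp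
qed

lemma roots_of_unity_finite: assumes e: "0 < (e::nat)" shows "finite {k \<in> K. k [^] e = \<one>}"
proof (rule ccontr)
  assume "infinite {k \<in> K. k [^] e = \<one>}"
  then obtain L where L: "L \<subseteq> {k \<in> K. k [^] e = \<one>}" "finite L" "card L = Suc e"
    using infinite_arbitrarily_large by blast
  define c where "c i = (if i = e then \<one> else if i = 0 then \<ominus> \<one> else \<zero>)" for i :: nat
  have "\<forall>i\<le>e. c i = \<zero>"
  proof (rule sum_roots[of c L])
    show "x \<otimes> y = y \<otimes> x" if "x \<in> L" "y \<in> L" for x y using that L K_comm by blast
    fix lam assume "lam \<in> L"
    then have lam: "lam \<in> K" "lam [^] e = \<one>" using L by auto
    have lR: "lam \<in> carrier R" using KC lam by simp
    obtain n where n: "e = Suc n" using e by (cases e) auto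
    have "(\<Oplus>i\<in>{..e}. c i \<otimes> lam [^] i) = (\<Oplus>i\<in>{0, e}. c i \<otimes> lam [^] i)"
      by (rule add.finprod_mono_neutral_cong_right) (use lR in \<open>auto simp: c_def\<close>)
    also have "\<dots> = c 0 \<otimes> lam [^] (0::nat) \<oplus> c e \<otimes> lam [^] e"
      using e lR by (subst finsum_insert) (auto simp: c_def)
    also have "\<dots> = \<zero>" using e lam by (simp add: c_def l_neg)
    finally show "(\<Oplus>i\<in>{..e}. c i \<otimes> lam [^] i) = \<zero>" .
  qed (use L KC in \<open>auto simp: c_def\<close>)
  then have "c e = \<zero>" by blast
  then show False using one_neq_zero by (simp add: c_def)
qed

lemma add_diff_cancel_left:
  assumes "a \<in> carrier R" "b \<in> carrier R" "z \<in> carrier R" shows "(z \<oplus> a) \<ominus> (z \<oplus> b) = a \<ominus> b"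
  using assms by (simp add: a_minus_def minus_add a_comm[of z a] a_assoc r_neg2)

text \<open>Let \<open>z\<close> be the conjugate of \<open>y\<close> by \<open>m\<close>, with \<open>y\<close> in \<open>A\<close> not fixed. If all \<open>e\<close>-th powers in \<open>K\<close> were central,
then \<open>(y + c)^e = (z + c)^e\<close> for every central \<open>c\<close>, so \<open>(y + c)/(z + c)\<close> would be a root of
unity. These are finitely many, whereas the fraction determines \<open>c\<close> and the center is infinite.\<close>

lemma power_not_all_fixed:
  assumes m: "m \<in> M" "m \<notin> A" and e: "0 < (e::nat)"
  shows "\<exists>l\<in>K. l \<noteq> \<zero> \<and> l [^] e \<notin> Fc"
proof (rule ccontr)
  assume "\<not> ?thesis"
  then have all: "\<And>l. l \<in> K \<Longrightarrow> l \<noteq> \<zero> \<Longrightarrow> l [^] e \<in> Fc" by blast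
  obtain y where y: "y \<in> A" "m \<otimes> y \<noteq> y \<otimes> m" using noncommuting m by blast
  have mR: "m \<in> carrier R" "m \<noteq> \<zero>" using m MD by auto
  have yR: "y \<in> carrier R" "y \<in> K" using AD y A_K by auto
  define z where "z = cj m y"
  have zK: "z \<in> K" unfolding z_def by (rule normalizes_cj[OF M_normalizes_K[OF m(1)] yR(2)])
  have zR: "z \<in> carrier R" using KC zK by simp
  have zy: "z \<noteq> y" unfolding z_def using cj_eq_self_iff[OF mR yR(1)] y(2) by simp
  define L where "L = Fc - {\<ominus> y}"
  have Linf: "infinite L" unfolding L_def using Fc_infinite by simp
  have FR: "a \<in> carrier R" if "a \<in> L" for a using that dsub_carrier[OF Fc_dsub] by (auto simp: L_def)
  have cF: "cj m a = a" if "a \<in> Fc" for a using that mR cj_eq_self_iff[OF mR, of a] by (auto simp: Fc_def)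
  have nz: "y \<oplus> a \<noteq> \<zero>" "z \<oplus> a \<noteq> \<zero>" and pw: "cj m (y \<oplus> a) = z \<oplus> a" if a: "a \<in> L" for a
  proof -
    have aR: "a \<in> carrier R" by (rule FR[OF a])
    show pw: "cj m (y \<oplus> a) = z \<oplus> a" using cj_add[OF mR yR(1) aR] cF[of a] a by (simp add: z_def L_def)
    show 1: "y \<oplus> a \<noteq> \<zero>"
    proof
      assume "y \<oplus> a = \<zero>"
      then have "a = \<ominus> y" using minus_equality[of a y] aR yR a_comm[of y a] by simp
      then show False using a by (simp add: L_def)
    qed
    then show "z \<oplus> a \<noteq> \<zero>" using pw mR yR aR by (metis a_closed cj_eq_zero)
  qed
  define w where "w a = (y \<oplus> a) \<otimes> inv (z \<oplus> a)" for a
  have aK: "y \<oplus> a \<in> K" "z \<oplus> a \<in> K" if "a \<in> L" for a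
    using dsub_add[OF K_dsub yR(2)] dsub_add[OF K_dsub zK] F_K that by (auto simp: L_def)
  have "w ` L \<subseteq> {k \<in> K. k [^] e = \<one>}"
  proof
    fix b assume "b \<in> w ` L"
    then obtain a where a: "a \<in> L" "b = w a" by blast
    define s t where "s = y \<oplus> a" and "t = z \<oplus> a"
    have st: "s \<in> K" "s \<noteq> \<zero>" "t \<in> K" "t \<noteq> \<zero>" unfolding s_def t_def using aK[OF a(1)] nz[OF a(1)] by auto
    have R: "s \<in> carrier R" "t \<in> carrier R" using KC st by auto
    have iK: "inv t \<in> K" using dsub_inv[OF K_dsub] st by blast
    have bb: "b = s \<otimes> inv t" by (simp add: a w_def s_def t_def)
    have "cj m s = t" using pw[OF a(1)] by (simp add: s_def t_def)
    then have "t [^] e = s [^] e" using cF[OF all[OF st(1,2)]] cj_pow[OF mR R(1), of e] by simp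
    moreover have "b [^] e \<otimes> t [^] e = s [^] e"
    proof -
      have bK: "b \<in> K" unfolding bb by (rule dsub_mult[OF K_dsub st(1) iK])
      have "b [^] e \<otimes> t [^] e = (b \<otimes> t) [^] e"
        by (rule pow_mult_distrib[symmetric, OF K_comm[OF bK st(3)] KC[OF bK] R(2)])
      also have "b \<otimes> t = s" unfolding bb using R st by (simp add: m_assoc)
      finally show ?thesis .
    qed
    moreover have bK: "b \<in> K" unfolding bb by (rule dsub_mult[OF K_dsub st(1) iK])
    ultimately have "b [^] e \<otimes> t [^] e = \<one> \<otimes> t [^] e" using R by simp
    then have "b [^] e = \<one>" using mult_right_cancel[of "t [^] e" "b [^] e" \<one>] R st KC[OF bK] by simp
    then show "b \<in> {k \<in> K. k [^] e = \<one>}" using bK by simp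
  qed
  moreover have "inj_on w L"
  proof (rule inj_onI)
    fix a b assume ab: "a \<in> L" "b \<in> L" "w a = w b"
    define v where "v = w a"
    have R: "a \<in> carrier R" "b \<in> carrier R" using FR ab by auto
    have vR: "v \<in> carrier R" unfolding v_def w_def using R yR zR nz[OF ab(1)] by simp
    have va: "v \<otimes> (z \<oplus> a) = y \<oplus> a" unfolding v_def w_def using R yR zR nz[OF ab(1)] by (simp add: m_assoc)
    have vb: "v \<otimes> (z \<oplus> b) = y \<oplus> b" unfolding v_def[unfolded ab(3)] w_def using R yR zR nz[OF ab(2)] by (simp add: m_assoc)
    show "a = b"
    proof (rule ccontr)
      assume ne: "a \<noteq> b"
      have d: "a \<ominus> b \<noteq> \<zero>" using ne R by simp
      have "v \<otimes> (a \<ominus> b) = v \<otimes> ((z \<oplus> a) \<ominus> (z \<oplus> b))"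
        using add_diff_cancel_left[OF R zR] by simp
      also have "\<dots> = (y \<oplus> a) \<ominus> (y \<oplus> b)" using va vb vR R zR by (simp add: a_minus_def r_distr[of "z \<oplus> a" "\<ominus> (z \<oplus> b)" v] r_minus)
      also have "\<dots> = \<one> \<otimes> (a \<ominus> b)" using add_diff_cancel_left[OF R yR(1)] R by simp
      finally have "v = \<one>" using mult_right_cancel[of "a \<ominus> b" v \<one>] d R vR by simp
      then have "z \<oplus> a = y \<oplus> a" using va R zR by simp
      then show False using zy R zR yR by simp
    qed
  qed
  ultimately have "finite L" using roots_of_unity_finite[OF e] by (meson finite_imageD finite_subset)
  then show False using Linf by simp
qed

text \<open>Descent on \<open>n\<close>. Let \<open>u\<close> be the \<open>n\<close>-fold commutator of \<open>l^e\<close> and \<open>v = u / (m u m^-1)\<close> the next one. If \<open>v\<close> is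
central, then conjugation by \<open>m^i\<close> divides \<open>u\<close> by \<open>v^i\<close>. As \<open>m^p\<close> centralizes \<open>K\<close>, this gives
\<open>v^p = 1\<close>; hence \<open>u^p\<close> is fixed by \<open>m\<close> and so central. It is the \<open>n\<close>-fold commutator of \<open>l^(e p)\<close>, which
contradicts the case \<open>n\<close> with exponent \<open>e p\<close>.\<close>

lemma no_engel:
  assumes m: "m \<in> M" "m \<notin> A" and e: "0 < (e::nat)"
  shows "\<exists>l\<in>K. l \<noteq> \<zero> \<and> iter_com m n (l [^] e) \<notin> Fc"
  using e
proof (induction n arbitrary: e)
  case 0
  then show ?case using power_not_all_fixed[OF m] by simp
next
  case (Suc n)
  obtain y where c: "cyc K m p y" using cyc_ex[OF m] by blast
  note D = cycD[OF c]
  obtain l where l: "l \<in> K" "l \<noteq> \<zero>" "iter_com m n (l [^] (e * p)) \<notin> Fc" using Suc.IH[of "e * p"] Suc.prems D(10) by auto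
  have lN: "l [^] e \<in> K" "l [^] e \<noteq> \<zero>" using dsub_pow[OF K_dsub l(1)] KC[OF l(1)] l(2) by auto
  define u where "u = iter_com m n (l [^] e)"
  define v where "v = iter_com m (Suc n) (l [^] e)"
  have u: "u \<in> K" "u \<noteq> \<zero>" using iter_com_K[OF m(1) lN] by (auto simp: u_def)
  have v: "v \<in> K" "v \<noteq> \<zero>" using iter_com_K[OF m(1) lN, of "Suc n"] by (auto simp only: v_def)
  have R: "u \<in> carrier R" "v \<in> carrier R" using KC u v by auto
  have vu: "v = u \<otimes> cj m (inv u)" by (simp add: v_def u_def)
  have iu: "inv u \<in> K" "inv u \<in> carrier R" "inv u \<noteq> \<zero>" using dsub_inv[OF K_dsub] u R by auto
  have "v \<notin> Fc"
  proof
    assume vF: "v \<in> Fc"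
    have cv: "cj m v = v" using vF D(8,9) cj_eq_self_iff[OF D(8,9), of v] by (auto simp: Fc_def)
    have c1: "cj m (inv u) = inv u \<otimes> v" unfolding vu using R u D(8,9) iu by simp
    have ci: "cj (m [^] i) (inv u) = inv u \<otimes> v [^] i" for i :: nat
    proof (induction i)
      case (Suc i)
      have "cj (m [^] Suc i) (inv u) = cj m (cj (m [^] i) (inv u))" using cj_pow_Suc D(8,9) iu by simp
      also have "\<dots> = (inv u \<otimes> v) \<otimes> v [^] i" unfolding Suc using c1 cv D(8,9) iu R by (simp add: cj_mult cj_pow)
      also have "\<dots> = inv u \<otimes> v [^] Suc i" using R iu pow_comm[OF R(2)] by (simp add: m_assoc)
      finally show ?case .
    qed (use iu in simp)
    have "inv u \<otimes> v [^] p = inv u \<otimes> \<one>" using ci[of p] cyc_cjp[OF c iu(1)] iu by simp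
    then have vp: "v [^] p = \<one>" using mult_left_cancel[OF iu(2,3)] R by simp
    have "v \<otimes> cj m u = u"
    proof -
      have "cj m (inv u) \<otimes> cj m u = \<one>" using cj_mult[OF D(8,9) iu(2) R(1)] R u D(8,9) by simp
      then show ?thesis unfolding vu using R iu D(8,9) by (simp add: m_assoc)
    qed
    then have "v [^] p \<otimes> cj m u [^] p = u [^] p"
      using pow_mult_distrib[OF K_comm[OF v(1) normalizes_cj[OF D(3) u(1)]] R(2), of p] D(8,9) R by simp
    then have "cj m (u [^] p) = u [^] p" using vp cj_pow D(8,9) R by simp
    then have "m \<otimes> u [^] p = u [^] p \<otimes> m" using cj_eq_self_iff[OF D(8,9)] R by simp
    then have "u [^] p \<in> Fc" unfolding Fc_eq'[OF m m(1)] fixed_by_def using dsub_pow[OF K_dsub u(1)] by simp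
    moreover have "u [^] p = iter_com m n (l [^] (e * p))"
      using iter_com_pow[OF m(1) lN, of n p] nat_pow_pow[OF KC[OF l(1)]] by (simp add: u_def)
    ultimately show False using l(3) by simp
  qed
  then show ?case using l(1,2) unfolding v_def by blast
qed

lemma iter_com_r_A: assumes "m \<in> M" "k \<in> K" "k \<noteq> \<zero>" shows "iter_com m r k \<in> A"
  using iter_com_G[OF M_G[OF assms(1)] KC[OF assms(2)] assms(3)] iter_com_K[OF assms] A_eq by blast

lemma iter_com_add: "iter_com m (i + j) z = iter_com m i (iter_com m j z)"
  by (induction i) simp_all

text \<open>For \<open>l\<close> in \<open>K\<close> the \<open>r\<close>-fold commutator lies in \<open>A\<close>, so that an Engel condition on \<open>A\<close> yields one on all of \<open>K\<close>.\<close>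

lemma no_engel_A:
  assumes m: "m \<in> M" "m \<notin> A"
  shows "\<exists>a\<in>A. iter_com m n a \<noteq> \<one>"
proof (rule ccontr)
  assume a: "\<not> ?thesis"
  obtain l where l: "l \<in> K" "l \<noteq> \<zero>" "iter_com m (n + r) (l [^] (1::nat)) \<notin> Fc" using no_engel[OF m, of 1 "n + r"] by auto
  have "iter_com m (n + r) l = \<one>" using a iter_com_r_A[OF m(1) l(1,2)] by (simp add: iter_com_add)
  then show False using l KC[OF l(1)] dsub_one[OF Fc_dsub] by simp
qed

lemma power_not_commuting:
  assumes m: "m \<in> M" "m \<notin> A" and e: "0 < (e::nat)"
  shows "\<exists>a\<in>A. m \<otimes> a [^] e \<noteq> a [^] e \<otimes> m"
proof (rule ccontr)
  assume a: "\<not> ?thesis"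
  obtain l where l: "l \<in> K" "l \<noteq> \<zero>" "iter_com m r (l [^] e) \<notin> Fc" using no_engel[OF m e] by blast
  have ia: "iter_com m r l \<in> A" by (rule iter_com_r_A[OF m(1) l(1,2)])
  have "iter_com m r l [^] e \<in> K" by (rule dsub_pow[OF K_dsub A_K[OF ia]])
  moreover have "m \<otimes> iter_com m r l [^] e = iter_com m r l [^] e \<otimes> m" using a ia by blast
  ultimately have "iter_com m r l [^] e \<in> Fc" unfolding Fc_eq'[OF m m(1)] fixed_by_def by simp
  then show False using iter_com_pow[OF m(1) l(1,2)] l(3) by simp
qed

text \<open>An element of \<open>A\<close> has at most \<open>p\<close> conjugates, as \<open>A\<close> centralizes it. Conversely, if \<open>m\<close> has at most \<open>c\<close>
conjugates, then among the conjugates by \<open>a^i\<close>, \<open>i \<le> c\<close>, two agree, so some \<open>a^d\<close> with \<open>0 < d \<le> c\<close>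
commutes with \<open>m\<close>. Then \<open>a^(c!)\<close> commutes with \<open>m\<close> for every \<open>a\<close> in \<open>A\<close>, which \<open>power_not_commuting\<close> excludes unless \<open>m\<close> is in \<open>A\<close>.\<close>

lemma FC_char:
  assumes m: "m \<in> M"
  shows "finite ((\<lambda>g. cj g m) ` M) \<longleftrightarrow> m \<in> A"
proof
  assume fin: "finite ((\<lambda>g. cj g m) ` M)"
  have mR: "m \<in> carrier R" "m \<noteq> \<zero>" using m MD by auto
  define c where "c = card ((\<lambda>g. cj g m) ` M)"
  show "m \<in> A"
  proof (rule ccontr)
    assume mA: "m \<notin> A"
    obtain a where a: "a \<in> A" "m \<otimes> a [^] (fact c :: nat) \<noteq> a [^] (fact c :: nat) \<otimes> m"
      using power_not_commuting[OF m mA, of "fact c"] by auto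
    have aR: "a \<in> carrier R" "a \<noteq> \<zero>" using AD a by auto
    define f where "f i = cj (a [^] i) m" for i :: nat
    have "f ` {..c} \<subseteq> (\<lambda>g. cj g m) ` M" unfolding f_def using grp_pow[OF M_grp A_props(1)[OF a(1)]] by blast
    then have "card (f ` {..c}) \<le> c" unfolding c_def by (rule card_mono[OF fin])
    then have "\<not> inj_on f {..c}" using card_image[of f "{..c}"] by auto
    then obtain i j where ij: "i \<le> c" "j \<le> c" "i < j" "f i = f j"
      unfolding inj_on_def by (metis atMost_iff linorder_neqE_nat)
    define d where "d = j - i"
    have d: "0 < d" "d \<le> c" "j = i + d" using ij by (auto simp: d_def)
    have "a [^] j = a [^] i \<otimes> a [^] d" using aR d by (simp add: nat_pow_mult)
    then have "cj (a [^] i) m = cj (a [^] i) (cj (a [^] d) m)" using ij(4) aR mR by (simp add: f_def cj_cj)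
    then have "cj (a [^] d) m = m" using cj_inj[of "a [^] i" m "cj (a [^] d) m"] aR mR by simp
    then have md: "a [^] d \<otimes> m = m \<otimes> a [^] d" using cj_eq_self_iff aR mR by simp
    define C where "C = {c \<in> carrier R. \<forall>s\<in>{m}. c \<otimes> s = s \<otimes> c}"
    have C: "division_subring C" unfolding C_def by (rule dsub_centralizer) (use mR in auto)
    have "a [^] d \<in> C" using md aR by (simp add: C_def)
    then have "(a [^] d) [^] (fact c div d) \<in> C" by (rule dsub_pow[OF C])
    moreover have "d * (fact c div d) = (fact c :: nat)" using d by (simp add: dvd_fact)
    ultimately have "a [^] (fact c :: nat) \<in> C" using aR by (simp add: nat_pow_pow)
    then show False using a(2) by (simp add: C_def)
  qed
next
  assume mA: "m \<in> A"
  obtain x where x: "x \<in> M" "x \<notin> A" using outside by blast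
  have xR: "x \<in> carrier R" "x \<noteq> \<zero>" using x MD by auto
  have mR: "m \<in> carrier R" using MD(1) m by auto
  have "(\<lambda>g. cj g m) ` M \<subseteq> (\<lambda>i. cj (x [^] i) m) ` {..<p}"
  proof
    fix s assume "s \<in> (\<lambda>g. cj g m) ` M"
    then obtain g where g: "g \<in> M" "s = cj g m" by blast
    obtain i b where ib: "i < p" "b \<in> A" "g = b \<otimes> x [^] i" using M_coset'[OF x x(1) g(1)] by blast
    define t where "t = cj (x [^] i) m"
    have t: "t \<in> A" unfolding t_def by (rule A_normal[OF grp_pow[OF M_grp x(1)] mA])
    have "cj b t = t" using cj_eq_self_iff AD[OF ib(2)] AD[OF t] A_props(3)[OF ib(2) t] by simp
    then have "s = t" unfolding g(2) ib(3) t_def using cj_cj[of b "x [^] i" m] AD[OF ib(2)] xR mR by simp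
    then show "s \<in> (\<lambda>i. cj (x [^] i) m) ` {..<p}" using ib(1) by (auto simp: t_def)
  qed
  then show "finite ((\<lambda>g. cj g m) ` M)" by (rule finite_subset) simp
qed

text \<open>Comparing coefficients in \<open>y l = l y\<close>, where \<open>y\<close> in \<open>K\<close> has \<open>p\<close> different conjugates, leaves only the constant coefficient of \<open>l\<close>.\<close>

lemma K_maximal_commuting:
  assumes L: "division_subring L" "\<And>a b. a \<in> L \<Longrightarrow> b \<in> L \<Longrightarrow> a \<otimes> b = b \<otimes> a" "K \<subseteq> L"
  shows "L = K"
proof -
  obtain x where x: "x \<in> M" "x \<notin> A" using outside by blast
  have xR: "x \<in> carrier R" "x \<noteq> \<zero>" using x MD by auto
  obtain y where c: "cyc K x p y" using cyc_ex[OF x] by blast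
  note D = cycD[OF c]
  have "l \<in> K" if l: "l \<in> L" for l
  proof -
    have "l \<in> pow_span x p" using powers_basis'(1)[OF x x(1)] dsub_carrier[OF L(1) l] by simp
    then obtain f where f: "\<And>i. f i \<in> K" "l = (\<Oplus>i\<in>{..<p}. f i \<otimes> x [^] i)" unfolding pow_span_def comb_def by blast
    note fR = KC[OF f(1)]
    have yl: "y \<otimes> l = l \<otimes> y" using L(2,3) l D(6) by blast
    have yR: "y \<in> carrier R" using KC D(6) by simp
    have z: "f i = \<zero>" if i: "0 < i" "i < p" for i
    proof (rule ccontr)
      assume n: "f i \<noteq> \<zero>"
      have xy: "cj (x [^] i) y \<in> carrier R" using xR yR by simp
      have "f i \<otimes> y = f i \<otimes> cj (x [^] i) y" by (rule coefficient_twist'[OF x x(1) f D(6) D(6) yl i(2)])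
      then have "y = cj (x [^] i) y" using mult_left_cancel[OF fR n yR xy] by simp
      then have "cj (x [^] i) y = cj (x [^] (0::nat)) y" using yR by simp
      then show False using inj_onD[OF cyc_inj[OF c], of i 0] i by auto
    qed
    have "l = (\<Oplus>i\<in>{..<p}. if 0 = i then f i \<otimes> x [^] i else \<zero>)"
      unfolding f(2) by (rule finsum_cong') (use fR xR z in auto)
    also have "\<dots> = f 0 \<otimes> x [^] (0::nat)" using finsum_singleton[of 0 "{..<p}" "\<lambda>i. f i \<otimes> x [^] i"] fR xR D(10) by simp
    finally show ?thesis using f(1) fR by simp
  qed
  then show ?thesis using L(3) by blast
qed

lemma K_subfield: "subfield K R" and Fc_subfield: "subfield Fc R"
proof -
  show "subfield K R" by (rule dsub_subfield[OF K_dsub K_comm])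
  show "subfield Fc R" by (rule dsub_subfield[OF Fc_dsub K_comm[OF F_K F_K]])
qed

lemma subfield_dsub: assumes "subfield L R" shows "division_subring L"
proof -
  interpret subfield L R by (rule assms)
  have LR: "L \<subseteq> carrier R" using subfieldE(3)[OF assms] .
  have S: "subring L R" by (rule subfieldE(1)[OF assms])
  show ?thesis unfolding division_subring_def
  proof (intro conjI ballI impI)
    show "inv a \<in> L" if a: "a \<in> L" "a \<noteq> \<zero>" for a
    proof -
      obtain b where "b \<in> L" "a \<otimes> b = \<one>" using subfield_m_inv[OF assms, of a] a by blast
      then show ?thesis using sf_inv_eqI[of a b] LR a by blast
    qed
    show "a \<ominus> b \<in> L" if "a \<in> L" "b \<in> L" for a b unfolding a_minus_def by (rule subringE(7)[OF S that(1) subringE(5)[OF S that(2)]])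
  qed (use LR in auto)
qed

lemma K_maximal_subfield: "maximal_subfield K R"
  unfolding maximal_subfield_def
proof (intro conjI allI impI)
  fix L assume L: "subfield L R \<and> K \<subseteq> L"
  then have sL: "subfield L R" and KL: "K \<subseteq> L" by auto
  show "L = K" by (rule K_maximal_commuting[OF subfield_dsub[OF sL] subfieldE(4)[OF sL] KL])
qed (rule K_subfield)

text \<open>The first \<open>p\<close> powers of a non-fixed element are a basis of \<open>K\<close> over the fixed field.\<close>

lemma dim_K: "dimension p Fc K"
proof -
  obtain x where x: "x \<in> M" "x \<notin> A" using outside by blast
  obtain y where c: "cyc K x p y" using cyc_ex[OF x] by blast
  note D = cycD[OF c] and F = Fc_eq'[OF x x(1)]
  have "comb Fc (\<lambda>i. y [^] i) p = K"
  proof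
    show "comb Fc (\<lambda>i. y [^] i) p \<subseteq> K"
    proof
      fix s assume "s \<in> comb Fc (\<lambda>i. y [^] i) p"
      then obtain f where f: "\<And>i. f i \<in> Fc" "s = (\<Oplus>i\<in>{..<p}. f i \<otimes> y [^] i)" unfolding comb_def by blast
      show "s \<in> K" unfolding f(2) by (rule dsub_finsum[OF K_dsub]) (simp_all add: dsub_mult[OF K_dsub F_K[OF f(1)] dsub_pow[OF K_dsub D(6)]])
    qed
    show "K \<subseteq> comb Fc (\<lambda>i. y [^] i) p" unfolding comb_def F using cyc_span_sum[OF c] by blast
  qed
  moreover have "dimension p Fc (comb Fc (\<lambda>i. y [^] i) p)"
    by (rule comb_dimension[OF Fc_dsub _ _ order_refl]) (use cyc_independent[OF c] KC[OF D(6)] F in auto)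
  ultimately show ?thesis by simp
qed

lemma dim_R: "dimension (p ^ 2) Fc (carrier R)"
proof -
  obtain x where x: "x \<in> M" "x \<notin> A" using outside by blast
  show ?thesis using telescopic_base[OF Fc_subfield K_subfield dim_K powers_basis'(2)[OF x x(1)]] by (simp add: power2_eq_square)
qed

end

section \<open>The groups attached to the division ring\<close>

lemma (in group) generate_min: "subgroup H G \<Longrightarrow> S \<subseteq> H \<Longrightarrow> generate G S \<subseteq> H"
  using generate_subgroup_incl by blast

context skew_field
begin

text \<open>The group structure on a subgroup of the multiplicative group, in the form in which subgroups appear in the theorem.\<close>

abbreviation grp_of :: "'a set \<Rightarrow> 'a monoid" where
  "grp_of H \<equiv> (units_of R)\<lparr>carrier := H\<rparr>"

lemma grp_of_group: assumes H: "mult_subgroup H" shows "group (grp_of H)"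
proof (rule groupI)
  show "\<exists>y\<in>carrier (grp_of H). y \<otimes>\<^bsub>grp_of H\<^esub> x = \<one>\<^bsub>grp_of H\<^esub>" if "x \<in> carrier (grp_of H)" for x
    using that grpD[OF H] by (auto simp: units_of_def intro!: bexI[of _ "inv x"])
qed (auto simp: units_of_def m_assoc grpD[OF H])

lemma grp_of_inv: assumes H: "mult_subgroup H" and a: "a \<in> H" shows "inv\<^bsub>grp_of H\<^esub> a = inv a"
  by (rule group.inv_equality[OF grp_of_group[OF H]]) (use grpD[OF H] a in \<open>auto simp: units_of_def\<close>)

lemma grp_of_pow: "a [^]\<^bsub>grp_of H\<^esub> (n::nat) = a [^] n"
  by (induction n) (simp_all add: nat_pow_def units_of_def)

lemma subgroup_grp_of_iff: assumes H: "mult_subgroup H" shows "subgroup B (grp_of H) \<longleftrightarrow> mult_subgroup B \<and> B \<subseteq> H"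
proof
  assume B: "subgroup B (grp_of H)"
  have BH: "B \<subseteq> H" using subgroup.subset[OF B] by simp
  have inv: "inv a \<in> B" if "a \<in> B" for a using subgroup.m_inv_closed[OF B that] grp_of_inv[OF H, of a] BH that by auto
  have "B \<subseteq> carrier R - {\<zero>}" using BH grpD(1,2)[OF H] by blast
  then show "mult_subgroup B \<and> B \<subseteq> H" unfolding mult_subgroup_def
    using BH inv subgroup.one_closed[OF B] subgroup.m_closed[OF B] by (simp add: units_of_def)
next
  assume B: "mult_subgroup B \<and> B \<subseteq> H"
  then have "inv\<^bsub>grp_of H\<^esub> a \<in> B" if "a \<in> B" for a using that grp_of_inv[OF H, of a] grpD(5)[of B a] by auto
  then show "subgroup B (grp_of H)"
    using B grpD[of B] by (auto simp: subgroup_def units_of_def)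
qed

lemma normal_grp_of_iff:
  assumes H: "mult_subgroup H" shows "B \<lhd> grp_of H \<longleftrightarrow> mult_subgroup B \<and> B \<subseteq> H \<and> (\<forall>h\<in>H. \<forall>b\<in>B. cj h b \<in> B)"
proof -
  have "h \<otimes>\<^bsub>grp_of H\<^esub> b \<otimes>\<^bsub>grp_of H\<^esub> inv\<^bsub>grp_of H\<^esub> h = cj h b" if "h \<in> H" for h b
    using grp_of_inv[OF H that] by (simp add: cj_def units_of_def)
  then show ?thesis
    unfolding group.normal_inv_iff[OF grp_of_group[OF H]] subgroup_grp_of_iff[OF H] by auto
qed

end

context maximal_metabelian_prime
begin

abbreviation "Mg \<equiv> grp_of M"

lemma Mg_group: "group Mg" by (rule grp_of_group[OF M_grp])

lemma A_normal_Mg: "A \<lhd> Mg"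
  unfolding normal_grp_of_iff[OF M_grp] using A_grp A_props(1) A_normal by blast

lemma coset_pow:
  assumes B: "B \<lhd> Mg" and x: "x \<in> M" shows "(B #>\<^bsub>Mg\<^esub> x) [^]\<^bsub>Mg Mod B\<^esub> (n::nat) = B #>\<^bsub>Mg\<^esub> (x [^] n)"
  using normal.FactGroup_pow[OF B, of x n] x by (simp add: grp_of_pow)

lemma coset_one:
  assumes B: "B \<lhd> Mg" and x: "x \<in> M" shows "B #>\<^bsub>Mg\<^esub> x = B \<longleftrightarrow> x \<in> B"
  using group.coset_join1[OF Mg_group, of B x] group.coset_join2[OF Mg_group, of x B] normal_imp_subgroup[OF B] x by auto

lemma quotient_cyclic: "Mg Mod A \<cong> integer_mod_group p"
proof -
  interpret N: normal A Mg by (rule A_normal_Mg)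
  interpret Q: group "Mg Mod A" by (rule N.factorgroup_is_group)
  obtain x where x: "x \<in> M" "x \<notin> A" using outside by blast
  have xR: "x \<in> carrier R" "x \<noteq> \<zero>" using x MD by auto
  obtain y where c: "cyc K x p y" using cyc_ex[OF x] by blast
  note D = cycD[OF c]
  note cp = coset_pow[OF A_normal_Mg] and c1 = coset_one[OF A_normal_Mg]
  have pM: "x [^] i \<in> M" for i :: nat by (rule grp_pow[OF M_grp x(1)])
  show ?thesis
  proof (rule Q.iso_integer_mod_group[of "A #>\<^bsub>Mg\<^esub> x"])
    show "A #>\<^bsub>Mg\<^esub> x \<in> carrier (Mg Mod A)" unfolding carrier_FactGroup using x(1) by simp
    show "(A #>\<^bsub>Mg\<^esub> x) [^]\<^bsub>Mg Mod A\<^esub> p = \<one>\<^bsub>Mg Mod A\<^esub>" using cp[OF x(1)] c1[OF pM] pow_A[OF x(1)] by simp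
    show "(A #>\<^bsub>Mg\<^esub> x) [^]\<^bsub>Mg Mod A\<^esub> d \<noteq> \<one>\<^bsub>Mg Mod A\<^esub>" if d: "0 < d" "d < p" for d :: nat
    proof
      assume "(A #>\<^bsub>Mg\<^esub> x) [^]\<^bsub>Mg Mod A\<^esub> d = \<one>\<^bsub>Mg Mod A\<^esub>"
      then have "x [^] d \<in> A" using cp[OF x(1)] c1[OF pM] by simp
      then have "x [^] d \<otimes> y = y \<otimes> x [^] d" using K_comm[OF A_K D(6)] by blast
      then have "cj (x [^] d) y = cj (x [^] (0::nat)) y" using cj_eq_self_iff[of "x [^] d" y] xR KC[OF D(6)] by simp
      then show False using inj_onD[OF cyc_inj[OF c], of d 0] d by auto
    qed
    show "\<exists>i<p. g = (A #>\<^bsub>Mg\<^esub> x) [^]\<^bsub>Mg Mod A\<^esub> i" if gC: "g \<in> carrier (Mg Mod A)" for g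
    proof -
      obtain m where m: "m \<in> M" "g = A #>\<^bsub>Mg\<^esub> m" using gC unfolding carrier_FactGroup by auto
      obtain i a where ia: "i < p" "a \<in> A" "m = a \<otimes> x [^] i" using M_coset'[OF x x(1) m(1)] by blast
      have "m \<in> A #>\<^bsub>Mg\<^esub> x [^] i" using ia by (auto simp: r_coset_def units_of_def)
      then have "A #>\<^bsub>Mg\<^esub> x [^] i = A #>\<^bsub>Mg\<^esub> m"
        using pM by (intro group.repr_independence[OF Mg_group _ _ N.subgroup_axioms]) simp_all
      then show ?thesis using ia(1) m(2) cp[OF x(1)] by auto
    qed
  qed (rule D(10))
qed

section \<open>The Galois group\<close>

definition act :: "'a \<Rightarrow> 'a \<Rightarrow> 'a" where "act m = restrict (cj m) K"

lemma act_Bij: assumes "m \<in> M" shows "act m \<in> Bij K"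
proof -
  have mR: "m \<in> carrier R" "m \<noteq> \<zero>" using MD assms by auto
  have "cj m ` K = K" using M_normalizes_K[OF assms] by (simp add: normalizes_def)
  moreover have "inj_on (cj m) K" using cj_inj[OF mR] KC by (auto intro: inj_onI)
  ultimately show ?thesis unfolding act_def Bij_def bij_betw_def by (simp add: image_restrict_eq inj_on_restrict_eq)
qed

lemma act_galois: assumes "m \<in> M" shows "act m \<in> carrier (galois_group R K Fc)"
proof -
  have mR: "m \<in> carrier R" "m \<noteq> \<zero>" using MD assms by auto
  have cK: "cj m k \<in> K" if "k \<in> K" for k by (rule normalizes_cj[OF M_normalizes_K[OF assms] that])
  have "act m \<in> ring_hom (R\<lparr>carrier := K\<rparr>) (R\<lparr>carrier := K\<rparr>)"
    by (rule ring_hom_memI) (use cK KC mR dsub_one[OF K_dsub] dsub_add[OF K_dsub] dsub_mult[OF K_dsub] in \<open>auto simp: act_def cj_mult cj_add\<close>)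
  moreover have "act m a = a" if "a \<in> Fc" for a
    using that F_K[OF that] cj_eq_self_iff[OF mR, of a] mR by (auto simp: act_def Fc_def)
  ultimately show ?thesis using act_Bij[OF assms] by (simp add: galois_group_def)
qed

text \<open>The element \<open>y\<close> satisfies a polynomial equation of degree \<open>p\<close> over the center. All images of \<open>y\<close> under
automorphisms are roots of it, and its \<open>p\<close> conjugates under powers of \<open>x\<close> are already \<open>p\<close> different
roots. So \<open>s\<close> agrees with some power of \<open>x\<close> on \<open>y\<close>, and hence on \<open>K\<close>, which \<open>y\<close> generates.\<close>

lemma galois_conj:
  assumes s: "s \<in> carrier (galois_group R K Fc)"
  shows "\<exists>m\<in>M. s = act m"
proof -
  obtain x where x: "x \<in> M" "x \<notin> A" using outside by blast
  have xR: "x \<in> carrier R" "x \<noteq> \<zero>" using x MD by auto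
  obtain y where c: "cyc K x p y" using cyc_ex[OF x] by blast
  note D = cycD[OF c]
  have yR: "y \<in> carrier R" using KC D(6) by blast
  have pM: "x [^] i \<in> M" for i :: nat by (rule grp_pow[OF M_grp x(1)])
  have sum_hom: "h (\<Oplus>i\<in>{..<n}. f i \<otimes> y [^] i) = (\<Oplus>i\<in>{..<n}. f i \<otimes> h y [^] i)"
    if h: "h \<in> carrier (galois_group R K Fc)" and f: "\<And>i. f i \<in> Fc" for h f and n :: nat
  proof -
    have hh: "h \<in> ring_hom (R\<lparr>carrier := K\<rparr>) (R\<lparr>carrier := K\<rparr>)" and hF: "\<And>a. a \<in> Fc \<Longrightarrow> h a = a"
      using h by (auto simp: galois_group_def)
    have hK: "h a \<in> K" if "a \<in> K" for a using ring_hom_closed[OF hh, of a] that by simp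
    have hadd: "h (a \<oplus> b) = h a \<oplus> h b" if "a \<in> K" "b \<in> K" for a b using ring_hom_add[OF hh, of a b] that by simp
    have hmult: "h (a \<otimes> b) = h a \<otimes> h b" if "a \<in> K" "b \<in> K" for a b using ring_hom_mult[OF hh, of a b] that by simp
    have yn: "y [^] i \<in> K" for i :: nat by (rule dsub_pow[OF K_dsub D(6)])
    have hp: "h (y [^] i) = h y [^] i" for i :: nat
    proof (induction i)
      case 0 then show ?case using hF[OF dsub_one[OF Fc_dsub]] by simp
    next
      case (Suc i) then show ?case using hmult[OF yn D(6)] by simp
    qed
    have t: "f i \<otimes> y [^] i \<in> K" for i by (rule dsub_mult[OF K_dsub F_K[OF f] yn])
    have hyR: "h y \<in> carrier R" using KC[OF hK[OF D(6)]] .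
    have fR: "f i \<in> carrier R" for i using KC[OF F_K[OF f]] .
    show ?thesis
    proof (induction n)
      case 0 then show ?case using hF[OF dsub_zero[OF Fc_dsub]] by simp
    next
      case (Suc n)
      have sK: "(\<Oplus>i\<in>{..<n}. f i \<otimes> y [^] i) \<in> K" by (rule dsub_finsum[OF K_dsub]) (use t in auto)
      have e1: "(\<Oplus>i\<in>{..<Suc n}. f i \<otimes> y [^] i) = f n \<otimes> y [^] n \<oplus> (\<Oplus>i\<in>{..<n}. f i \<otimes> y [^] i)"
        by (rule finsum_lessThan_Suc) (use fR yR in simp)
      have e2: "(\<Oplus>i\<in>{..<Suc n}. f i \<otimes> h y [^] i) = f n \<otimes> h y [^] n \<oplus> (\<Oplus>i\<in>{..<n}. f i \<otimes> h y [^] i)"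
        by (rule finsum_lessThan_Suc) (use fR hyR in simp)
      have "h (f n \<otimes> y [^] n) = f n \<otimes> h y [^] n" using hmult[OF F_K[OF f] yn] hF[OF f] hp by simp
      then show ?case unfolding e1 e2 hadd[OF t sK] Suc by simp
    qed
  qed
  have F: "fixed_by K x = Fc" using Fc_eq'[OF x x(1)] by simp
  obtain f where f: "\<And>i. f i \<in> Fc" "y [^] p = (\<Oplus>i\<in>{..<p}. f i \<otimes> y [^] i)"
    using cyc_span_sum[OF c dsub_pow[OF K_dsub D(6), of p]] unfolding F by blast
  have fR: "f i \<in> carrier R" for i using KC[OF F_K[OF f(1)]] .
  \<comment> \<open>coefficients of the polynomial with root \<open>y\<close>\<close>
  define e where "e i = (if i = p then \<ominus> \<one> else f i)" for i
  have eR: "e i \<in> carrier R" for i using fR by (simp add: e_def)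
  have root: "(\<Oplus>i\<in>{..p}. e i \<otimes> h y [^] i) = \<zero>" and hyK: "h y \<in> K"
    if h: "h \<in> carrier (galois_group R K Fc)" for h
  proof -
    have hh: "h \<in> ring_hom (R\<lparr>carrier := K\<rparr>) (R\<lparr>carrier := K\<rparr>)" using h by (auto simp: galois_group_def)
    show hyK: "h y \<in> K" using ring_hom_closed[OF hh, of y] D(6) by simp
    then have hyR: "h y \<in> carrier R" by (rule KC)
    have "h (y [^] n) = h y [^] n" for n :: nat
    proof (induction n)
      case 0 then show ?case using ring_hom_one[OF hh] by simp
    next
      case (Suc n) then show ?case using ring_hom_mult[OF hh, of "y [^] n" y] dsub_pow[OF K_dsub D(6)] D(6) by simp
    qed
    then have "h y [^] p = h (y [^] p)" by (rule sym)
    also have "\<dots> = h (\<Oplus>i\<in>{..<p}. f i \<otimes> y [^] i)" by (rule arg_cong[OF f(2)])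
    also have "\<dots> = (\<Oplus>i\<in>{..<p}. f i \<otimes> h y [^] i)" by (rule sum_hom[OF h f(1)])
    finally have hp: "h y [^] p = (\<Oplus>i\<in>{..<p}. f i \<otimes> h y [^] i)" .
    have "(\<Oplus>i\<in>{..<Suc p}. e i \<otimes> h y [^] i) = e p \<otimes> h y [^] p \<oplus> (\<Oplus>i\<in>{..<p}. e i \<otimes> h y [^] i)"
      by (rule finsum_lessThan_Suc) (use eR hyR in simp)
    also have "(\<Oplus>i\<in>{..<p}. e i \<otimes> h y [^] i) = (\<Oplus>i\<in>{..<p}. f i \<otimes> h y [^] i)"
      by (rule finsum_cong') (use fR hyR in \<open>auto simp: e_def\<close>)
    also have "e p \<otimes> h y [^] p \<oplus> \<dots> = \<zero>" unfolding hp[symmetric] using hyR by (simp add: e_def l_minus l_neg)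
    finally show "(\<Oplus>i\<in>{..p}. e i \<otimes> h y [^] i) = \<zero>" by (simp add: lessThan_Suc_atMost)
  qed
  define Z where "Z = (\<lambda>i. cj (x [^] i) y) ` {..<p}"
  have Z: "finite Z" "card Z = p" unfolding Z_def using card_image[OF cyc_inj[OF c]] by auto
  have actx: "act (x [^] i) y = cj (x [^] i) y" for i :: nat using D(6) by (simp add: act_def)
  have "s y \<in> Z"
  proof (rule ccontr)
    assume n: "s y \<notin> Z"
    have LK: "insert (s y) Z \<subseteq> K" using hyK[OF s] hyK[OF act_galois[OF pM]] unfolding Z_def actx by blast
    have "\<forall>i\<le>p. e i = \<zero>"
    proof (rule sum_roots[of e "insert (s y) Z"])
      show "a \<otimes> b = b \<otimes> a" if "a \<in> insert (s y) Z" "b \<in> insert (s y) Z" for a b using that LK K_comm by blast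
      show "(\<Oplus>i\<in>{..p}. e i \<otimes> lam [^] i) = \<zero>" if "lam \<in> insert (s y) Z" for lam
        using that root[OF s] root[OF act_galois[OF pM]] unfolding Z_def actx by blast
    qed (use Z n eR LK KC in auto)
    then have "\<ominus> \<one> = \<zero>" unfolding e_def by auto
    then show False using one_neq_zero by simp
  qed
  then obtain i :: nat where i: "s y = cj (x [^] i) y" unfolding Z_def by blast
  have "s b = act (x [^] i) b" if b: "b \<in> K" for b
  proof -
    obtain g where g: "\<And>i. g i \<in> Fc" "b = (\<Oplus>i\<in>{..<p}. g i \<otimes> y [^] i)" using cyc_span_sum[OF c b] unfolding F by blast
    show ?thesis unfolding g(2) sum_hom[OF s g(1)] sum_hom[OF act_galois[OF pM] g(1)] actx i ..
  qed
  moreover have "s \<in> extensional K" using s by (auto simp: galois_group_def Bij_def)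
  ultimately have "s = act (x [^] i)" by (intro extensionalityI[of s K]) (auto simp: act_def)
  then show ?thesis using pM by blast
qed

lemma galois_iso: "galois_group R K Fc \<cong> Mg Mod A"
proof -
  let ?\<Gamma> = "galois_group R K Fc"
  have im: "act ` M = carrier ?\<Gamma>" using act_galois galois_conj by blast
  have hom0: "act \<in> hom Mg (BijGroup K)"
  proof (rule homI)
    fix a b assume "a \<in> carrier Mg" "b \<in> carrier Mg"
    then have ab: "a \<in> M" "b \<in> M" by auto
    have R: "a \<in> carrier R" "a \<noteq> \<zero>" "b \<in> carrier R" "b \<noteq> \<zero>" using MD ab by auto
    have "cj b k \<in> K" if "k \<in> K" for k by (rule normalizes_cj[OF M_normalizes_K[OF ab(2)] that])
    then have "act (a \<otimes> b) = compose K (act a) (act b)"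
      using R KC by (intro ext) (auto simp: act_def compose_def cj_cj)
    then show "act (a \<otimes>\<^bsub>Mg\<^esub> b) = act a \<otimes>\<^bsub>BijGroup K\<^esub> act b"
      using act_Bij[OF ab(1)] act_Bij[OF ab(2)] by (simp add: BijGroup_def units_of_def)
  qed (use act_Bij in \<open>simp add: BijGroup_def\<close>)
  interpret B: group_hom Mg "BijGroup K" act
    by (rule group_hom.intro[OF Mg_group group_BijGroup]) (unfold_locales, rule hom0)
  have sub: "subgroup (carrier ?\<Gamma>) (BijGroup K)" using B.img_is_subgroup im by simp
  have \<Gamma>: "?\<Gamma> = (BijGroup K)\<lparr>carrier := carrier ?\<Gamma>\<rparr>" by (simp add: galois_group_def)
  have g: "group ?\<Gamma>" by (subst \<Gamma>) (rule group.subgroup_imp_group[OF group_BijGroup sub])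
  have hom: "act \<in> hom Mg ?\<Gamma>"
  proof (rule homI)
    show "act a \<in> carrier ?\<Gamma>" if "a \<in> carrier Mg" for a using act_galois that by simp
    show "act (a \<otimes>\<^bsub>Mg\<^esub> b) = act a \<otimes>\<^bsub>?\<Gamma>\<^esub> act b" if "a \<in> carrier Mg" "b \<in> carrier Mg" for a b
      using hom_mult[OF hom0 that] by (simp add: galois_group_def)
  qed
  interpret H: group_hom Mg ?\<Gamma> act
    by (rule group_hom.intro[OF Mg_group g]) (unfold_locales, rule hom)
  have "kernel Mg ?\<Gamma> act = A"
  proof -
    have "act m = (\<lambda>k\<in>K. k) \<longleftrightarrow> m \<in> A" if m: "m \<in> M" for m
    proof -
      have mR: "m \<in> carrier R" "m \<noteq> \<zero>" using MD m by auto
      have "act m = (\<lambda>k\<in>K. k) \<longleftrightarrow> (\<forall>k\<in>K. cj m k = k)" unfolding act_def by (auto simp: fun_eq_iff restrict_def)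
      also have "\<dots> \<longleftrightarrow> (\<forall>k\<in>K. m \<otimes> k = k \<otimes> m)" using cj_eq_self_iff[OF mR KC] by auto
      finally show ?thesis using M_commutes_K_iff[OF m] by simp
    qed
    then show ?thesis using A_props(1) by (auto simp: kernel_def galois_group_def BijGroup_def)
  qed
  then have "Mg Mod A \<cong> ?\<Gamma>" using H.FactGroup_iso im by simp
  then show ?thesis by (rule group.iso_sym[OF normal.factorgroup_is_group[OF A_normal_Mg]])
qed

lemma K_galois: "finite_galois_extension R K Fc"
  unfolding finite_galois_extension_def
proof (intro conjI)
  show "finite_dimension Fc K" using finite_dimensionI[OF dim_K] .
  show "{a \<in> K. \<forall>\<sigma>\<in>carrier (galois_group R K Fc). \<sigma> a = a} = Fc"
  proof
    show "Fc \<subseteq> {a \<in> K. \<forall>\<sigma>\<in>carrier (galois_group R K Fc). \<sigma> a = a}"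
      using F_K by (auto simp: galois_group_def)
    show "{a \<in> K. \<forall>\<sigma>\<in>carrier (galois_group R K Fc). \<sigma> a = a} \<subseteq> Fc"
    proof
      fix a assume a: "a \<in> {a \<in> K. \<forall>\<sigma>\<in>carrier (galois_group R K Fc). \<sigma> a = a}"
      obtain x where x: "x \<in> M" "x \<notin> A" using outside by blast
      have xR: "x \<in> carrier R" "x \<noteq> \<zero>" using x MD by auto
      have "cj x a = a" using a act_galois[OF x(1)] by (auto simp: act_def)
      then show "a \<in> Fc" unfolding Fc_eq'[OF x x(1)] fixed_by_def using a cj_eq_self_iff[OF xR KC] by auto
    qed
  qed
qed (use K_subfield Fc_subfield F_K in auto)

end

section \<open>The FC-center and the Fitting subgroup\<close>

context maximal_metabelian_prime
begin

lemma FC_center_eq: "FC_center Mg = A"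
proof -
  have "(\<lambda>g. g \<otimes>\<^bsub>Mg\<^esub> x \<otimes>\<^bsub>Mg\<^esub> inv\<^bsub>Mg\<^esub> g) ` carrier Mg = (\<lambda>g. cj g x) ` M" for x
    by (rule image_cong) (use grp_of_inv[OF M_grp] in \<open>auto simp: cj_def units_of_def\<close>)
  then have "FC_center Mg = {x \<in> M. finite ((\<lambda>g. cj g x) ` M)}"
    unfolding FC_center_def by simp
  then show ?thesis using FC_char A_props(1) by auto
qed

text \<open>The first commutator with \<open>a\<close> in \<open>A\<close> already lies in \<open>B\<close> because \<open>B\<close> is normal; every further one descends in the lower central series of \<open>B\<close>.\<close>

lemma iter_com_lower_central:
  assumes B: "B \<lhd> Mg" and m: "m \<in> B" and a: "a \<in> A"
  shows "iter_com m (Suc n) a \<in> lower_central (grp_of B) n"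
proof (induction n)
  have BM: "B \<subseteq> M" and Bg: "mult_subgroup B" and Bn: "\<And>h b. h \<in> M \<Longrightarrow> b \<in> B \<Longrightarrow> cj h b \<in> B"
    using B unfolding normal_grp_of_iff[OF M_grp] by blast+
  have mM: "m \<in> M" using m BM by blast
  have mR: "m \<in> carrier R" "m \<noteq> \<zero>" using MD mM by auto
  have aR: "a \<in> carrier R" "a \<noteq> \<zero>" using AD a by auto
  have st: "u \<otimes> cj m (inv u) = com u m" if "u \<in> carrier R" "u \<noteq> \<zero>" for u
    using that mR by (simp add: cj_def com_def m_assoc)
  {
    case 0
    have "com a m = cj a m \<otimes> inv m" by (simp add: com_def cj_def)
    then have "com a m \<in> B" using Bn[OF A_props(1)[OF a] m] grpD(4)[OF Bg _ grpD(5)[OF Bg m]] by simp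
    then show ?case using st[OF aR] by simp
  next
    case (Suc n)
    define u where "u = iter_com m (Suc n) a"
    have uR: "u \<in> carrier R" "u \<noteq> \<zero>" using iter_com_closed[OF mR aR, of "Suc n"] by (auto simp only: u_def)
    have u: "u \<in> lower_central (grp_of B) n" unfolding u_def by (rule Suc)
    have "lower_central (grp_of B) n \<subseteq> B"
    proof (induction n)
      case (Suc n)
      interpret Bg: group "grp_of B" by (rule grp_of_group[OF Bg])
      have "(\<Union>x\<in>lower_central (grp_of B) n. \<Union>y\<in>B. {x \<otimes>\<^bsub>grp_of B\<^esub> y \<otimes>\<^bsub>grp_of B\<^esub> inv\<^bsub>grp_of B\<^esub> x \<otimes>\<^bsub>grp_of B\<^esub> inv\<^bsub>grp_of B\<^esub> y}) \<subseteq> carrier (grp_of B)"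
        using Suc Bg.m_closed Bg.inv_closed by auto
      then show ?case using Bg.generate_incl by simp
    qed simp
    then have uB: "u \<in> B" using u by blast
    have "iter_com m (Suc (Suc n)) a = com u m" using st[OF uR] by (simp add: u_def)
    also have "\<dots> = u \<otimes>\<^bsub>grp_of B\<^esub> m \<otimes>\<^bsub>grp_of B\<^esub> inv\<^bsub>grp_of B\<^esub> u \<otimes>\<^bsub>grp_of B\<^esub> inv\<^bsub>grp_of B\<^esub> m"
      unfolding com_def grp_of_inv[OF Bg uB] grp_of_inv[OF Bg m] by (simp add: units_of_def)
    also have "\<dots> \<in> lower_central (grp_of B) (Suc n)"
      unfolding lower_central.simps by (rule generate.incl) (use u m in auto)
    finally show ?case .
  }
qed

text \<open>Nilpotency of \<open>B\<close> makes each of its elements Engel on \<open>A\<close>.\<close>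

lemma nilpotent_normal_sub_A:
  assumes B: "B \<lhd> Mg" and nil: "nilpotent_group (grp_of B)" shows "B \<subseteq> A"
proof
  fix m assume m: "m \<in> B"
  have mM: "m \<in> M" using m B unfolding normal_grp_of_iff[OF M_grp] by blast
  obtain n where n: "lower_central (grp_of B) n = {\<one>\<^bsub>grp_of B\<^esub>}" using nil unfolding nilpotent_group_def by blast
  show "m \<in> A"
  proof (rule ccontr)
    assume "m \<notin> A"
    then obtain a where a: "a \<in> A" "iter_com m (Suc n) a \<noteq> \<one>" using no_engel_A[OF mM] by blast
    then show False using iter_com_lower_central[OF B m a(1), of n] n by (simp add: units_of_def)
  qed
qed

lemma A_nilpotent: "nilpotent_group (grp_of A)"
  unfolding nilpotent_group_def
proof (intro conjI exI)
  interpret Ag: group "grp_of A" by (rule grp_of_group[OF A_grp])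
  show "group (grp_of A)" ..
  have "x \<otimes>\<^bsub>grp_of A\<^esub> y \<otimes>\<^bsub>grp_of A\<^esub> inv\<^bsub>grp_of A\<^esub> x \<otimes>\<^bsub>grp_of A\<^esub> inv\<^bsub>grp_of A\<^esub> y = \<one>\<^bsub>grp_of A\<^esub>" if xy: "x \<in> A" "y \<in> A" for x y
  proof -
    have "x \<otimes> y \<otimes> inv x \<otimes> inv y = y \<otimes> x \<otimes> inv x \<otimes> inv y" using A_props(3)[OF xy] by simp
    also have "\<dots> = \<one>" using AD[OF xy(1)] AD[OF xy(2)] by (simp add: m_assoc)
    finally show ?thesis using grp_of_inv[OF A_grp xy(1)] grp_of_inv[OF A_grp xy(2)] by (simp add: units_of_def)
  qed
  then have "(\<Union>x\<in>carrier (grp_of A). \<Union>y\<in>carrier (grp_of A). {x \<otimes>\<^bsub>grp_of A\<^esub> y \<otimes>\<^bsub>grp_of A\<^esub> inv\<^bsub>grp_of A\<^esub> x \<otimes>\<^bsub>grp_of A\<^esub> inv\<^bsub>grp_of A\<^esub> y}) \<subseteq> {\<one>\<^bsub>grp_of A\<^esub>}"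
    by auto
  then have "lower_central (grp_of A) 1 \<subseteq> {\<one>\<^bsub>grp_of A\<^esub>}"
    using Ag.generate_min[OF Ag.triv_subgroup] by simp
  then show "lower_central (grp_of A) 1 = {\<one>\<^bsub>grp_of A\<^esub>}" using generate.one[of "grp_of A"] by auto
qed

lemma fitting_eq: "fitting_subgroup Mg = A"
proof
  let ?S = "{B. B \<lhd> Mg \<and> nilpotent_group (Mg\<lparr>carrier := B\<rparr>)}"
  have S: "B \<subseteq> A" if "B \<in> ?S" for B using that nilpotent_normal_sub_A by simp
  have "A \<in> ?S" using A_normal_Mg A_nilpotent by simp
  then show "A \<subseteq> fitting_subgroup Mg" unfolding fitting_subgroup_def by (auto intro: generate.incl)
  show "fitting_subgroup Mg \<subseteq> A" unfolding fitting_subgroup_def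
    by (rule group.generate_min[OF Mg_group normal_imp_subgroup[OF A_normal_Mg]]) (use S in blast)
qed

section \<open>The quotient by the derived group and the center\<close>

abbreviation "Md \<equiv> derived Mg M"
abbreviation "MZ \<equiv> Md <#>\<^bsub>Mg\<^esub> center Mg"

lemma center_Mg: "z \<in> center Mg \<longleftrightarrow> z \<in> M \<and> (\<forall>m\<in>M. z \<otimes> m = m \<otimes> z)"
  by (simp add: center_def units_of_def)

lemma Fc_center_Mg: "z \<in> M \<Longrightarrow> z \<in> Fc \<Longrightarrow> z \<in> center Mg"
  unfolding center_Mg using MD(1) by (auto simp: Fc_def)

lemma Md_props: "mult_subgroup Md" "Md \<subseteq> M" "\<And>a b. a \<in> M \<Longrightarrow> b \<in> M \<Longrightarrow> com a b \<in> Md" "Md \<subseteq> A"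
proof -
  have "subgroup Md Mg" using group.derived_is_subgroup[OF Mg_group, of M] by simp
  then show "mult_subgroup Md" "Md \<subseteq> M" unfolding subgroup_grp_of_iff[OF M_grp] by auto
  have com: "com a b = a \<otimes>\<^bsub>Mg\<^esub> b \<otimes>\<^bsub>Mg\<^esub> inv\<^bsub>Mg\<^esub> a \<otimes>\<^bsub>Mg\<^esub> inv\<^bsub>Mg\<^esub> b" if "a \<in> M" "b \<in> M" for a b
    using grp_of_inv[OF M_grp that(1)] grp_of_inv[OF M_grp that(2)] by (simp add: com_def units_of_def)
  show "com a b \<in> Md" if "a \<in> M" "b \<in> M" for a b
    unfolding derived_def com[OF that] by (rule generate.incl) (use that in auto)
  show "Md \<subseteq> A" unfolding derived_def
  proof (rule group.generate_min[OF Mg_group normal_imp_subgroup[OF A_normal_Mg]])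
    show "derived_set Mg M \<subseteq> A" using com A_props(2) by fastforce
  qed
qed

lemma MZ_iff: "s \<in> MZ \<longleftrightarrow> (\<exists>d\<in>Md. \<exists>z\<in>center Mg. s = d \<otimes> z)"
  by (auto simp: set_mult_def units_of_def)

lemma MZ_I: "d \<in> Md \<Longrightarrow> z \<in> center Mg \<Longrightarrow> d \<otimes> z \<in> MZ"
  unfolding MZ_iff by blast

lemma MZ_normal: "MZ \<lhd> Mg"
  unfolding normal_grp_of_iff[OF M_grp]
proof (intro conjI ballI)
  note MdM = subsetD[OF Md_props(2)]
  have ZM: "z \<in> M" and Zc: "\<And>m. m \<in> M \<Longrightarrow> z \<otimes> m = m \<otimes> z" if "z \<in> center Mg" for z using that unfolding center_Mg by auto
  show MZM: "MZ \<subseteq> M"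
  proof
    fix s assume "s \<in> MZ"
    then obtain d z where "d \<in> Md" "z \<in> center Mg" "s = d \<otimes> z" unfolding MZ_iff by blast
    then show "s \<in> M" using MD(4)[OF MdM ZM] by simp
  qed
  show "mult_subgroup MZ" unfolding mult_subgroup_def
  proof (intro conjI ballI)
    show "MZ \<subseteq> carrier R - {\<zero>}" using MZM MD(1,2) by blast
    have "\<one> \<in> center Mg" unfolding center_Mg using MD(1,3) by simp
    then show "\<one> \<in> MZ" using MZ_I[OF grpD(3)[OF Md_props(1)], of \<one>] by simp
    show "s \<otimes> t \<in> MZ" if st: "s \<in> MZ" "t \<in> MZ" for s t
    proof -
      obtain d z where dz: "d \<in> Md" "z \<in> center Mg" "s = d \<otimes> z" using st(1) unfolding MZ_iff by blast
      obtain d' z' where dz': "d' \<in> Md" "z' \<in> center Mg" "t = d' \<otimes> z'" using st(2) unfolding MZ_iff by blast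
      note R = MD(1)[OF MdM[OF dz(1)]] MD(1)[OF MdM[OF dz'(1)]] MD(1)[OF ZM[OF dz(2)]] MD(1)[OF ZM[OF dz'(2)]]
      have "s \<otimes> t = d \<otimes> (z \<otimes> d') \<otimes> z'" unfolding dz(3) dz'(3) using R by (simp add: m_assoc)
      also have "\<dots> = (d \<otimes> d') \<otimes> (z \<otimes> z')" unfolding Zc[OF dz(2) MdM[OF dz'(1)]] using R by (simp add: m_assoc)
      finally have eq: "s \<otimes> t = (d \<otimes> d') \<otimes> (z \<otimes> z')" .
      have "z \<otimes> z' \<in> center Mg" unfolding center_Mg
      proof (intro conjI ballI)
        show "z \<otimes> z' \<in> M" by (rule MD(4)[OF ZM[OF dz(2)] ZM[OF dz'(2)]])
        fix m assume m: "m \<in> M"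
        have mR: "m \<in> carrier R" using MD m by auto
        have "z \<otimes> z' \<otimes> m = z \<otimes> m \<otimes> z'" using R mR Zc[OF dz'(2) m] by (simp add: m_assoc)
        then show "z \<otimes> z' \<otimes> m = m \<otimes> (z \<otimes> z')" using R mR Zc[OF dz(2) m] by (simp add: m_assoc)
      qed
      then show ?thesis unfolding eq by (rule MZ_I[OF grpD(4)[OF Md_props(1) dz(1) dz'(1)]])
    qed
    show "inv s \<in> MZ" if s: "s \<in> MZ" for s
    proof -
      obtain d z where dz: "d \<in> Md" "z \<in> center Mg" "s = d \<otimes> z" using s unfolding MZ_iff by blast
      note D = MD(1,2)[OF MdM[OF dz(1)]] and Z = MD(1,2)[OF ZM[OF dz(2)]]
      have iz: "inv z \<otimes> m = m \<otimes> inv z" if m: "m \<in> M" for m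
      proof -
        have "cj z m = m" using cj_eq_self_iff[OF Z] MD(1)[OF m] Zc[OF dz(2) m] by blast
        then have "cj (inv z) m = m" using cj_inv_cj[OF Z MD(1)[OF m]] by simp
        then show ?thesis using cj_eq_self_iff[of "inv z" m] Z MD(1)[OF m] by simp
      qed
      have izc: "inv z \<in> center Mg" unfolding center_Mg using MD(5)[OF ZM[OF dz(2)]] iz by blast
      have "inv s = inv z \<otimes> inv d" unfolding dz(3) by (rule sf_inv_mult[OF D Z])
      also have "\<dots> = inv d \<otimes> inv z" by (rule iz[OF MD(5)[OF MdM[OF dz(1)]]])
      finally show ?thesis using MZ_I[OF grpD(5)[OF Md_props(1) dz(1)] izc] by simp
    qed
  qed
  show "cj h s \<in> MZ" if h: "h \<in> M" and s: "s \<in> MZ" for h s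
  proof -
    obtain d z where dz: "d \<in> Md" "z \<in> center Mg" "s = d \<otimes> z" using s unfolding MZ_iff by blast
    note D = MD(1,2)[OF MdM[OF dz(1)]] and Z = MD(1,2)[OF ZM[OF dz(2)]] and H = MD(1,2)[OF h]
    have "cj h z = z" using cj_eq_self_iff[OF H Z(1)] Zc[OF dz(2) h] by simp
    then have "cj h s = com h d \<otimes> d \<otimes> z" unfolding dz(3) using cj_mult[OF H D(1) Z(1)] com_cj[OF H D] by simp
    then show ?thesis using MZ_I[OF grpD(4)[OF Md_props(1) Md_props(3)[OF h MdM[OF dz(1)]] dz(1)] dz(2)] by simp
  qed
qed

text \<open>Modulo the derived group, conjugation is trivial, so the norm becomes a power.\<close>

lemma Nr_Md:
  assumes x: "x \<in> M" and a: "a \<in> A" shows "\<exists>d\<in>Md. Nr x a n = d \<otimes> a [^] n"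
proof (induction n)
  case 0 then show ?case using grpD(3)[OF Md_props(1)] by (intro bexI[of _ \<one>]) auto
next
  case (Suc n)
  then obtain d where d: "d \<in> Md" "Nr x a n = d \<otimes> a [^] n" by blast
  define e where "e = com (x [^] n) a"
  have xn: "x [^] n \<in> M" by (rule grp_pow[OF M_grp x])
  have e: "e \<in> Md" unfolding e_def by (rule Md_props(3)[OF xn A_props(1)[OF a]])
  have eA: "e \<in> A" and an: "a [^] n \<in> A" using Md_props(4) e grp_pow[OF A_grp a] by auto
  have R: "d \<in> carrier R" "e \<in> carrier R" "a \<in> carrier R" "a \<noteq> \<zero>" using AD[OF eA] AD[OF a] AD[of d] Md_props(4) d(1) by auto
  have "Nr x a (Suc n) = d \<otimes> a [^] n \<otimes> (e \<otimes> a)"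
    using d(2) com_cj[of "x [^] n" a] MD(1,2)[OF xn] R by (simp add: e_def)
  also have "\<dots> = d \<otimes> (a [^] n \<otimes> e) \<otimes> a" using R by (simp add: m_assoc)
  also have "a [^] n \<otimes> e = e \<otimes> a [^] n" by (rule A_props(3)[OF an eA])
  finally have "Nr x a (Suc n) = (d \<otimes> e) \<otimes> a [^] Suc n" using R by (simp add: m_assoc)
  then show ?case using grpD(4)[OF Md_props(1) d(1) e] by blast
qed

text \<open>For \<open>m\<close> outside \<open>A\<close>, the power \<open>m^p\<close> is central. For \<open>m\<close> in \<open>A\<close> and \<open>x\<close> outside, \<open>(m x)^p\<close> and \<open>x^p\<close> are central, hence so is their quotient, the norm of \<open>m\<close>, which agrees with \<open>m^p\<close> up to an element of the derived group.\<close>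

lemma power_in_MZ: assumes m: "m \<in> M" shows "m [^] p \<in> MZ"
proof (cases "m \<in> A")
  case False
  have mp: "m [^] p \<in> M" by (rule grp_pow[OF M_grp m])
  have "m [^] p \<in> center Mg" by (rule Fc_center_Mg[OF mp power_central'[OF m False m]])
  then show ?thesis using MZ_I[OF grpD(3)[OF Md_props(1)]] MD(1)[OF mp] by fastforce
next
  case True
  obtain x where x: "x \<in> M" "x \<notin> A" using outside by blast
  obtain y where c: "cyc K x p y" using cyc_ex[OF x] by blast
  have mR: "m \<in> carrier R" "m \<noteq> \<zero>" and xR: "x \<in> carrier R" "x \<noteq> \<zero>" using MD m x by auto
  have mx: "m \<otimes> x \<in> M" by (rule MD(4)[OF m x(1)])
  have mxA: "m \<otimes> x \<notin> A"
  proof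
    assume "m \<otimes> x \<in> A"
    then have "inv m \<otimes> (m \<otimes> x) \<in> A" by (rule grpD(4)[OF A_grp grpD(5)[OF A_grp True]])
    then show False using x(2) mR xR by simp
  qed
  have NK: "Nr x m p \<in> K" by (rule Nr_K[OF c A_K[OF True]])
  have "Nr x m p \<otimes> x [^] p = (m \<otimes> x) [^] p" using Nr_pow[OF c A_K[OF True], of p] by simp
  also have "\<dots> \<in> Fc" by (rule power_central'[OF mx mxA mx])
  finally have "Nr x m p \<in> Fc"
    using dsub_cancel_right[OF Fc_dsub power_central'[OF x x(1)] _ KC[OF NK]] xR by simp
  moreover obtain d where d: "d \<in> Md" "Nr x m p = d \<otimes> m [^] p" using Nr_Md[OF x(1) True] by blast
  moreover have dM: "d \<in> M" using d(1) Md_props(2) by blast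
  moreover have mp: "m [^] p \<in> M" by (rule grp_pow[OF M_grp m])
  ultimately have "Nr x m p \<in> center Mg" using Fc_center_Mg MD(4) by simp
  then have "inv d \<otimes> Nr x m p \<in> MZ" by (rule MZ_I[OF grpD(5)[OF Md_props(1) d(1)]])
  then show ?thesis unfolding d(2) using MD(1,2)[OF dM] MD(1)[OF mp] by simp
qed

lemma quotient_elementary: "\<exists>I :: 'a set set. Mg Mod MZ \<cong> sum_group I (\<lambda>_. integer_mod_group p)"
proof -
  interpret N: normal MZ Mg by (rule MZ_normal)
  have Q: "group (Mg Mod MZ)" by (rule N.factorgroup_is_group)
  have com: "MZ #>\<^bsub>Mg\<^esub> (a \<otimes> b) = MZ #>\<^bsub>Mg\<^esub> (b \<otimes> a)" if ab: "a \<in> M" "b \<in> M" for a b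
  proof -
    note aR = MD(1,2)[OF ab(1)] and bR = MD(1,2)[OF ab(2)]
    have "\<one> \<in> center Mg" unfolding center_Mg using MD(1,3) by simp
    then have "com a b \<in> MZ" using MZ_I[OF Md_props(3)[OF ab], of \<one>] MD(1)[OF com_M[OF ab]] by simp
    moreover have "a \<otimes> b = com a b \<otimes> (b \<otimes> a)" using aR bR by (simp add: com_def m_assoc)
    ultimately have "a \<otimes> b \<in> MZ #>\<^bsub>Mg\<^esub> (b \<otimes> a)" by (auto simp: r_coset_def units_of_def)
    then have "MZ #>\<^bsub>Mg\<^esub> (b \<otimes> a) = MZ #>\<^bsub>Mg\<^esub> (a \<otimes> b)"
      using MD(4)[OF ab(2,1)] by (intro group.repr_independence[OF Mg_group _ _ N.subgroup_axioms]) simp_all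
    then show ?thesis ..
  qed
  have "comm_group (Mg Mod MZ)"
  proof (rule group.group_comm_groupI[OF Q])
    fix U V assume XY: "U \<in> carrier (Mg Mod MZ)" "V \<in> carrier (Mg Mod MZ)"
    obtain a where a: "a \<in> M" "U = MZ #>\<^bsub>Mg\<^esub> a" using XY(1) unfolding carrier_FactGroup by auto
    obtain b where b: "b \<in> M" "V = MZ #>\<^bsub>Mg\<^esub> b" using XY(2) unfolding carrier_FactGroup by auto
    have mult: "u \<otimes>\<^bsub>Mg\<^esub> v = u \<otimes> v" for u v by (simp add: units_of_def)
    have "U \<otimes>\<^bsub>Mg Mod MZ\<^esub> V = MZ #>\<^bsub>Mg\<^esub> (a \<otimes> b)" using N.rcos_sum[of a b] a b mult by simp
    moreover have "V \<otimes>\<^bsub>Mg Mod MZ\<^esub> U = MZ #>\<^bsub>Mg\<^esub> (b \<otimes> a)" using N.rcos_sum[of b a] a b mult by simp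
    ultimately show "U \<otimes>\<^bsub>Mg Mod MZ\<^esub> V = V \<otimes>\<^bsub>Mg Mod MZ\<^esub> U" using com[OF a(1) b(1)] by simp
  qed
  then interpret Q: comm_group "Mg Mod MZ" .
  show ?thesis
  proof (rule Q.elementary_abelian_iso_sum_group[OF p])
    fix U assume "U \<in> carrier (Mg Mod MZ)"
    then obtain a where a: "a \<in> M" "U = MZ #>\<^bsub>Mg\<^esub> a" unfolding carrier_FactGroup by auto
    show "U [^]\<^bsub>Mg Mod MZ\<^esub> p = \<one>\<^bsub>Mg Mod MZ\<^esub>"
      unfolding a(2) coset_pow[OF MZ_normal a(1)]
      using coset_one[OF MZ_normal grp_pow[OF M_grp a(1)], of p] power_in_MZ[OF a(1)] by simp
  qed
qed

section \<open>Generation and the direct sum decomposition\<close>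

text \<open>A subring containing the center is finite-dimensional over it and so closed under inverses. Thus it makes no difference whether \<open>F\<close> and \<open>M\<close> generate a ring or a division ring.\<close>

lemma F_M_generate_ring: "carrier R = generate_ring R (Fc \<union> M)"
proof -
  define S where "S = generate_ring R (Fc \<union> M)"
  have sub: "Fc \<union> M \<subseteq> carrier R" using dsub_sub[OF Fc_dsub] MD(1) by blast
  have SR: "S \<subseteq> carrier R" unfolding S_def by (rule generate_ring_incl[OF sub])
  have sr: "subring S R" unfolding S_def by (rule generate_ring_is_subring[OF sub])
  have incl: "Fc \<union> M \<subseteq> S" unfolding S_def by (auto intro: generate_ring.incl)
  have "subalgebra Fc S R"
  proof (intro subalgebra.intro subalgebra_axioms.intro)
    show "subgroup S (add_monoid R)" using subring.axioms(1)[OF sr] .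
    show "k \<otimes> v \<in> S" if "k \<in> Fc" "v \<in> S" for k v using subringE(6)[OF sr] incl that by blast
  qed
  then have "finite_dimension Fc S"
    using subalbegra_incl_imp_finite_dimension[OF Fc_subfield finite_dimensionI[OF dim_R] _ SR] by blast
  then obtain n where n: "dimension n Fc S" by (rule finite_dimensionE')
  have "division_subring S" unfolding division_subring_def
  proof (intro conjI ballI impI)
    show "inv a \<in> S" if "a \<in> S" "a \<noteq> \<zero>" for a
      by (rule finite_dimension_inverse[OF Fc_subfield n subringE(3)[OF sr] subringE(6)[OF sr] that])
    show "a \<ominus> b \<in> S" if "a \<in> S" "b \<in> S" for a b
      unfolding a_minus_def by (rule subringE(7)[OF sr that(1) subringE(5)[OF sr that(2)]])
    show "a \<otimes> b \<in> S" if "a \<in> S" "b \<in> S" for a b by (rule subringE(6)[OF sr that])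
  qed (use SR subringE(3)[OF sr] in auto)
  moreover obtain x where x: "x \<in> M" "x \<notin> A" using outside by blast
  moreover have "Fc \<union> A \<union> {x} \<subseteq> S" using incl A_props(1) x(1) by auto
  ultimately have "carrier R \<subseteq> S" using gen_min[of S "Fc \<union> A \<union> {x}"] generates'[OF x x(1)] by simp
  then show ?thesis using SR by (auto simp: S_def)
qed

text \<open>The exponents run from 1 to \<open>p\<close> instead of from 0 to \<open>p - 1\<close>, which amounts to a right multiplication by \<open>x\<close>.\<close>

lemma direct_sum:
  assumes x: "x \<in> M" "x \<notin> A"
  shows "internal_direct_sum R {1..p} (\<lambda>i. K #> (x [^] i))"
  unfolding internal_direct_sum_def
proof (intro conjI ballI)
  have xR: "x \<in> carrier R" "x \<noteq> \<zero>" using x MD by auto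
  have mem: "s \<in> K #> x [^] i \<longleftrightarrow> (\<exists>k\<in>K. s = k \<otimes> x [^] i)" for s and i :: nat by (auto simp: r_coset_def)
  have carr: "s \<in> carrier R" if "s \<in> K #> x [^] i" for s and i :: nat using that KC xR unfolding mem by auto
  have coef: "s \<otimes> inv (x [^] i) \<in> K" "s \<otimes> inv (x [^] i) \<otimes> x [^] i = s" if "s \<in> K #> x [^] i" for s and i :: nat
    using that KC xR unfolding mem by (auto simp: m_assoc)
  show "additive_subgroup (K #> x [^] i) R" if "i \<in> {1..p}" for i :: nat
  proof (rule additive_subgroupI, rule add.subgroupI)
    show "K #> x [^] i \<subseteq> carrier R" using carr by blast
    show "K #> x [^] i \<noteq> {}" using mem dsub_one[OF K_dsub] by blast
    show "\<ominus> s \<in> K #> x [^] i" if s: "s \<in> K #> x [^] i" for s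
    proof -
      obtain k where k: "k \<in> K" "s = k \<otimes> x [^] i" using s unfolding mem by blast
      have "\<ominus> s = (\<ominus> k) \<otimes> x [^] i" unfolding k(2) using KC[OF k(1)] xR by (simp add: l_minus)
      then show ?thesis unfolding mem using dsub_uminus[OF K_dsub k(1)] by blast
    qed
    show "s \<oplus> t \<in> K #> x [^] i" if st: "s \<in> K #> x [^] i" "t \<in> K #> x [^] i" for s t
    proof -
      obtain k where k: "k \<in> K" "s = k \<otimes> x [^] i" using st(1) unfolding mem by blast
      obtain l where l: "l \<in> K" "t = l \<otimes> x [^] i" using st(2) unfolding mem by blast
      have "s \<oplus> t = (k \<oplus> l) \<otimes> x [^] i" unfolding k(2) l(2) using KC[OF k(1)] KC[OF l(1)] xR by (simp add: l_distr)
      then show ?thesis unfolding mem using dsub_add[OF K_dsub k(1) l(1)] by blast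
    qed
  qed
  have reindex: "finsum R f {1..p} = (\<Oplus>i\<in>{..<p}. f (Suc i))" if "\<And>i. i \<in> {1..p} \<Longrightarrow> f i \<in> carrier R" for f
  proof -
    have "{1..p} = Suc ` {..<p}" by (simp add: lessThan_atLeast0 image_Suc_atLeastLessThan atLeastLessThanSuc_atLeastAtMost)
    then show ?thesis using finsum_reindex[of f Suc "{..<p}"] that by auto
  qed
  let ?\<Phi> = "\<lambda>f. finsum R f {1..p}"
  let ?P = "\<Pi>\<^sub>E i\<in>{1..p}. K #> x [^] i"
  show "bij_betw ?\<Phi> ?P (carrier R)" unfolding bij_betw_def
  proof
    show "inj_on ?\<Phi> ?P"
    proof (rule inj_onI)
      fix f g assume fg: "f \<in> ?P" "g \<in> ?P" "?\<Phi> f = ?\<Phi> g"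
      have fK: "f i \<in> K #> x [^] i" and gK: "g i \<in> K #> x [^] i" if "i \<in> {1..p}" for i using fg that by (auto simp: PiE_iff)
      define h where "h i = (if i < p then f (Suc i) \<otimes> inv (x [^] Suc i) \<ominus> g (Suc i) \<otimes> inv (x [^] Suc i) else \<zero>)" for i
      have S: "Suc i \<in> {1..p}" if "i < p" for i using that by auto
      have hK: "h i \<in> K" for i
        unfolding h_def using dsub_zero[OF K_dsub] dsub_minus[OF K_dsub coef(1)[OF fK[OF S]] coef(1)[OF gK[OF S]]] by simp
      have hx: "h i \<otimes> x [^] Suc i = f (Suc i) \<ominus> g (Suc i)" if i: "i < p" for i
      proof -
        define u v y where "u = f (Suc i) \<otimes> inv (x [^] Suc i)" and "v = g (Suc i) \<otimes> inv (x [^] Suc i)" and "y = x [^] Suc i"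
        have R: "u \<in> carrier R" "v \<in> carrier R" "y \<in> carrier R"
          unfolding u_def v_def y_def using KC[OF coef(1)[OF fK[OF S[OF i]]]] KC[OF coef(1)[OF gK[OF S[OF i]]]] xR by auto
        have "(u \<ominus> v) \<otimes> y = u \<otimes> y \<ominus> v \<otimes> y" using R by (simp add: a_minus_def l_distr l_minus)
        also have "u \<otimes> y = f (Suc i)" unfolding u_def y_def by (rule coef(2)[OF fK[OF S[OF i]]])
        also have "v \<otimes> y = g (Suc i)" unfolding v_def y_def by (rule coef(2)[OF gK[OF S[OF i]]])
        finally show ?thesis using i unfolding h_def u_def v_def y_def by simp
      qed
      have fR: "f (Suc i) \<in> carrier R" and gR: "g (Suc i) \<in> carrier R" if "i < p" for i
        using carr[OF fK[OF S[OF that]]] carr[OF gK[OF S[OF that]]] by auto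
      have hR: "h i \<in> carrier R" for i using KC[OF hK] .
      have "(\<Oplus>i\<in>{..<p}. h i \<otimes> x [^] i) \<otimes> x = (\<Oplus>i\<in>{..<p}. h i \<otimes> x [^] i \<otimes> x)"
        using hR xR by (intro finsum_ldistr) auto
      also have "\<dots> = (\<Oplus>i\<in>{..<p}. f (Suc i) \<oplus> (\<ominus> \<one>) \<otimes> g (Suc i))"
      proof (rule finsum_cong')
        fix i assume "i \<in> {..<p}"
        then have i: "i < p" by simp
        have "h i \<otimes> x [^] i \<otimes> x = h i \<otimes> x [^] Suc i" using hR xR by (simp add: m_assoc)
        then show "h i \<otimes> x [^] i \<otimes> x = f (Suc i) \<oplus> (\<ominus> \<one>) \<otimes> g (Suc i)"
          unfolding hx[OF i] using fR[OF i] gR[OF i] by (simp add: a_minus_def l_minus)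
      qed (use fR gR in auto)
      also have "\<dots> = (\<Oplus>i\<in>{..<p}. f (Suc i)) \<oplus> (\<Oplus>i\<in>{..<p}. (\<ominus> \<one>) \<otimes> g (Suc i))"
        using fR gR by (intro finsum_addf) auto
      also have "(\<Oplus>i\<in>{..<p}. (\<ominus> \<one>) \<otimes> g (Suc i)) = (\<ominus> \<one>) \<otimes> (\<Oplus>i\<in>{..<p}. g (Suc i))"
        using gR by (intro finsum_rdistr[symmetric]) auto
      also have "(\<Oplus>i\<in>{..<p}. f (Suc i)) = (\<Oplus>i\<in>{..<p}. g (Suc i))"
        using fg(3) reindex[of f] reindex[of g] carr[OF fK] carr[OF gK] by simp
      also have "(\<Oplus>i\<in>{..<p}. g (Suc i)) \<oplus> (\<ominus> \<one>) \<otimes> (\<Oplus>i\<in>{..<p}. g (Suc i)) = \<zero>"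
        using gR by (simp add: l_minus r_neg Pi_def)
      finally have "(\<Oplus>i\<in>{..<p}. h i \<otimes> x [^] i) = \<zero>" using xR hR by (simp add: Pi_def)
      then have h0: "\<forall>i<p. h i = \<zero>" by (rule powers_basis'(3)[OF x x(1) hK])
      have "f i = g i" if i: "i \<in> {1..p}" for i
      proof -
        obtain j where j: "i = Suc j" "j < p" using i by (cases i) auto
        have "f (Suc j) \<ominus> g (Suc j) = \<zero>" using hx[OF j(2)] h0 j(2) xR by simp
        then show ?thesis using fR[OF j(2)] gR[OF j(2)] j(1) by simp
      qed
      then show "f = g" using fg(1,2) by (intro PiE_ext) auto
    qed
    show "?\<Phi> ` ?P = carrier R"
    proof
      show "?\<Phi> ` ?P \<subseteq> carrier R" using carr by (auto intro!: finsum_closed simp: PiE_iff)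
      show "carrier R \<subseteq> ?\<Phi> ` ?P"
      proof
        fix s assume s: "s \<in> carrier R"
        have "s \<otimes> inv x \<in> pow_span x p" using powers_basis'(1)[OF x x(1)] s xR by simp
        then obtain c where c: "\<And>i. c i \<in> K" "s \<otimes> inv x = (\<Oplus>i\<in>{..<p}. c i \<otimes> x [^] i)" unfolding pow_span_def comb_def by blast
        note cR = KC[OF c(1)]
        define f where "f = (\<lambda>i\<in>{1..p}. c (i - 1) \<otimes> x [^] i)"
        have f: "f \<in> ?P" unfolding f_def by (auto simp: mem intro!: bexI[OF refl c(1)])
        have "s = (s \<otimes> inv x) \<otimes> x" using s xR by (simp add: m_assoc)
        also have "\<dots> = (\<Oplus>i\<in>{..<p}. c i \<otimes> x [^] i \<otimes> x)" unfolding c(2) using cR xR by (intro finsum_ldistr) auto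
        also have "\<dots> = (\<Oplus>i\<in>{..<p}. f (Suc i))"
          by (rule finsum_cong') (use cR xR in \<open>auto simp: f_def m_assoc\<close>)
        also have "\<dots> = ?\<Phi> f" by (rule reindex[symmetric]) (use cR xR in \<open>auto simp: f_def\<close>)
        finally show "s \<in> ?\<Phi> ` ?P" using f by (rule image_eqI)
      qed
    qed
  qed
qed simp

end

section \<open>The structure theorem\<close>

context skew_field
begin

lemma grp_units: "mult_subgroup (carrier R - {\<zero>})"
  using one_neq_zero by (auto simp: mult_subgroup_def)

lemma grp_of_units: "grp_of (carrier R - {\<zero>}) = units_of R"
  by (simp add: units_of_def units_nonzero)

text \<open>Translates the subgroup notions of the theorem into the elementary conditions on subsets of the division ring.\<close>

lemma maximal_metabelian_intro:
  assumes G: "subnormal_subgroup G (units_of R)" and M: "maximal_subgroup M (grp_of G)"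
    and nonab: "\<not> comm_group (grp_of M)" and met: "metabelian (grp_of M)"
  shows "\<exists>r N. maximal_metabelian R M r N \<and> N 0 = G"
proof -
  obtain r N where N: "N 0 = G" "N r = carrier (units_of R)"
    and Ns: "\<And>i. i \<le> r \<Longrightarrow> subgroup (N i) (units_of R)"
    and Nn: "\<And>i. i < r \<Longrightarrow> N i \<lhd> (units_of R)\<lparr>carrier := N (Suc i)\<rparr>"
    using G unfolding subnormal_subgroup_def by blast
  have Ng: "mult_subgroup (N i)" if "i \<le> r" for i
    using Ns[OF that] subgroup_grp_of_iff[OF grp_units] unfolding grp_of_units by blast
  have Nn': "N i \<subseteq> N (Suc i) \<and> (\<forall>x\<in>N (Suc i). \<forall>y\<in>N i. cj x y \<in> N i)" if "i < r" for i
    using Nn[OF that] normal_grp_of_iff[OF Ng[of "Suc i"]] that by simp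
  have Gg: "mult_subgroup G" using Ng[of 0] N(1) by simp
  have Mg: "mult_subgroup M" "M \<subseteq> G" using M subgroup_grp_of_iff[OF Gg] unfolding maximal_subgroup_def by auto
  have com: "com a b = a \<otimes>\<^bsub>grp_of M\<^esub> b \<otimes>\<^bsub>grp_of M\<^esub> inv\<^bsub>grp_of M\<^esub> a \<otimes>\<^bsub>grp_of M\<^esub> inv\<^bsub>grp_of M\<^esub> b" if "a \<in> M" "b \<in> M" for a b
    using grp_of_inv[OF Mg(1) that(1)] grp_of_inv[OF Mg(1) that(2)] by (simp add: com_def units_of_def)
  have comd: "com a b \<in> derived (grp_of M) M" if "a \<in> M" "b \<in> M" for a b
    unfolding derived_def com[OF that] by (rule generate.incl) (use that in auto)
  have "maximal_metabelian R M r N"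
  proof (unfold_locales)
    show "N r = carrier R - {\<zero>}" using N(2) by (simp add: units_of_def units_nonzero)
    show "mult_subgroup (N i)" if "i \<le> r" for i by (rule Ng[OF that])
    show "N i \<subseteq> N (Suc i)" if "i < r" for i using Nn'[OF that] by blast
    show "cj x y \<in> N i" if "i < r" "x \<in> N (Suc i)" "y \<in> N i" for i x y using Nn'[OF that(1)] that(2,3) by blast
    show "mult_subgroup M" "M \<subseteq> N 0" using Mg N(1) by auto
    show "M \<noteq> N 0" using M N(1) unfolding maximal_subgroup_def by simp
    show "H = M \<or> H = N 0" if "mult_subgroup H" "M \<subseteq> H" "H \<subseteq> N 0" for H
      using M that N(1) subgroup_grp_of_iff[OF Gg, of H] unfolding maximal_subgroup_def by simp
    show "com a b \<otimes> com c d = com c d \<otimes> com a b" if "a \<in> M" "b \<in> M" "c \<in> M" "d \<in> M" for a b c d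
    proof -
      have "comm_group ((grp_of M)\<lparr>carrier := derived (grp_of M) (carrier (grp_of M))\<rparr>)"
        using met unfolding metabelian_def by blast
      then interpret d: comm_group "(grp_of M)\<lparr>carrier := derived (grp_of M) (carrier (grp_of M))\<rparr>" .
      show ?thesis using d.m_comm[of "com a b" "com c d"] comd[OF that(1,2)] comd[OF that(3,4)] by (simp add: units_of_def)
    qed
    show "\<exists>a\<in>M. \<exists>b\<in>M. a \<otimes> b \<noteq> b \<otimes> a"
    proof (rule ccontr)
      assume "\<not> ?thesis"
      then have "comm_group (grp_of M)" by (intro group.group_comm_groupI[OF grp_of_group[OF Mg(1)]]) (auto simp: units_of_def)
      then show False using nonab by blast
    qed
  qed
  then show ?thesis using N(1) by blast
qed

end

theorem theorem3p3:
  fixes D :: "('a, 'b) ring_scheme" (structure)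
    and F G M :: "'a set"
    and Mgrp :: "'a monoid"
  assumes "skew_field D"
    and "F = center D"
    and "subnormal_subgroup G (units_of D)"
    and "maximal_subgroup M ((units_of D)\<lparr>carrier := G\<rparr>)"
    and "Mgrp = (units_of D)\<lparr>carrier := M\<rparr>"
    and "\<not> comm_group Mgrp"
    and "metabelian Mgrp"
  shows "\<exists>(p::nat) K. Factorial_Ring.prime p \<and> maximal_subfield K D \<and>
     (finite_galois_extension D K F \<and>
      ((K - {\<zero>}) \<inter> G) \<lhd> Mgrp \<and>
      galois_group D K F \<cong> Mgrp Mod ((K - {\<zero>}) \<inter> G) \<and>
      Mgrp Mod ((K - {\<zero>}) \<inter> G) \<cong> integer_mod_group p \<and>
      ring.dimension D (p ^ 2) F (carrier D)) \<and>
     ((K - {\<zero>}) \<inter> G = FC_center Mgrp \<and>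
      (K - {\<zero>}) \<inter> G = fitting_subgroup Mgrp \<and>
      (\<exists>I :: 'a set set.
         Mgrp Mod (derived Mgrp M <#>\<^bsub>Mgrp\<^esub> center Mgrp)
           \<cong> sum_group I (\<lambda>_. integer_mod_group p)) \<and>
      (\<forall>x \<in> M - K.
         x [^] p \<in> F \<and>
         carrier D = generate_ring D (F \<union> M) \<and>
         internal_direct_sum D {1..p} (\<lambda>i. K #> (x [^] i))))"
proof -
  interpret skew_field D by (rule assms(1))
  obtain r N where "maximal_metabelian D M r N" and N: "N 0 = G"
    using maximal_metabelian_intro[OF assms(3,4)] assms(6,7) unfolding assms(5) by blast
  then interpret maximal_metabelian D M r N by blast
  obtain x p where xp: "x \<in> M" "x \<notin> A" "Factorial_Ring.prime (p::nat)" "x [^] p \<in> A"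
    using M_mod_A_prime by blast
  interpret maximal_metabelian_prime D M r N p
    by unfold_locales (use xp(3) prime_for_all[OF xp] in auto)
  have F: "F = Fc" unfolding assms(2) by (simp add: center_def Fc_def)
  have Aeq: "(K - {\<zero>}) \<inter> G = A" using A_eq N by simp
  have notA: "x \<notin> A" if "x \<notin> K" for x using that A_K by blast
  show ?thesis
    unfolding F assms(5)
  proof (intro exI[of _ p] exI[of _ K] conjI ballI, unfold Aeq)
    show "\<exists>I :: 'a set set. Mg Mod MZ \<cong> sum_group I (\<lambda>_. integer_mod_group p)" by (rule quotient_elementary)
    fix x assume "x \<in> M - K"
    then have x: "x \<in> M" "x \<notin> A" using notA by auto
    show "x [^] p \<in> Fc" by (rule power_central'[OF x x(1)])
    show "internal_direct_sum D {1..p} (\<lambda>i. K #> x [^] i)" by (rule direct_sum[OF x])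
    show "carrier D = generate_ring D (Fc \<union> M)" by (rule F_M_generate_ring)
  qed (simp_all only: p K_maximal_subfield K_galois A_normal_Mg galois_iso quotient_cyclic dim_R FC_center_eq fitting_eq)
qed

end
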